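(* Consider the elastic–thermoelastic–elastic transmission problem (P) described in the context, with energy $E$ as defined there. There exist constants $M,\omega>0$ such that, for every initial datum $U_0=[u_0,v_0,\theta_0,q_0,u_1,v_1]'$ with finite energy $E_{U_0}$, the corresponding finite energy solution $U=U(t,x)=[u,v,\theta,q,u_t,v_t]'$ of (P) satisfies $$E_{U-W_0}(t)\le M e^{-\omega t}\qquad (t\ge 0),$$ where $W_0$ is a stationary solution of (P) and is uniquely determined by $U_0$.
   Context: Fix real numbers $0<L_1<L_2<L_3$ and $a,b,m,k,\tau>0$. Put $I=(L_1,L_2)$ and $J=(0,L_1)\cup(L_2,L_3)$. Functions are complex valued; $H^s(J)$ consists of functions that are $H^s$ on each of the two components of $J$, and point values of functions on $J$ at $0,L_1,L_2,L_3$ are one-sided traces from within $J$. Problem (P) for the unknowns $u,\theta,q$ (displacement, temperature, heat flux in the middle part) and $v$ (displacement in the outer parts) consists of the equations $u_{tt}-au_{xx}+m\theta_x=0$, $\theta_t+kq_x+mu_{xt}=0$, $\tau q_t+q+k\theta_x=0$ in $[L_1,L_2]\times\mathbb{R}_+$ and $v_{tt}-bv_{xx}=0$ in $([0,L_1]\cup[L_2,L_3])\times\mathbb{R}_+$; the transmission conditions $u(L_i,\cdot)=v(L_i,\cdot)$ and $au_x(L_i,\cdot)-m\theta(L_i,\cdot)=bv_x(L_i,\cdot)$ for $i=1,2$; the boundary conditions $q(L_1,\cdot)=q(L_2,\cdot)=0$ and $v(0,\cdot)=v(L_3,\cdot)=0$; and the initial conditions $u(\cdot,0)=u_0$, $u_t(\cdot,0)=u_1$,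 $\theta(\cdot,0)=\theta_0$, $q(\cdot,0)=q_0$ in $[L_1,L_2]$, $v(\cdot,0)=v_0$, $v_t(\cdot,0)=v_1$ in $[0,L_1]\cup[L_2,L_3]$. The energy of $U=[u,v,\theta,q,u_t,v_t]'$ at time $t$ is $$E_U(t)=\tfrac12\int_J\left(b|v_x|^2+|v_t|^2\right)dx+\tfrac12\int_I\left(a|u_x|^2+|u_t|^2+|\theta|^2+\tau|q|^2\right)dx ,$$ and $E_{U_0}$ denotes the same expression evaluated at the initial datum. The finite energy data form the space $\mathcal{H}$ of all $[u^1,v^1,\theta,q,u^2,v^2]'\in H^1(I)\times H^1(J)\times L^2(I)\times L^2(I)\times L^2(I)\times L^2(J)$ with $v^1(0)=v^1(L_3)=0$ and $u^1(L_i)=v^1(L_i)$ for $i=1,2$; it is a Hilbert space for the inner product whose squared norm is twice the energy. With $u^1=u$, $v^1=v$, $u^2=u_t$, $v^2=v_t$, problem (P) is written as $\frac{d}{dt}U=\mathcal{A}U$, $U(0)=U_0$ in $\mathcal{H}$, where $$\mathcal{A}U=\left[u^2,\ v^2,\ -(kq+mu^2)_x,\ -\tfrac{k}{\tau}\theta_x-\tfrac1\tau q,\ (au^1_x-m\theta)_x,\ bv^1_{xx}\right]'$$ and $D(\mathcal{A})$ is the set of $U\in\mathcal{H}$ with $u^1\in H^2(I)$, $v^1\in H^2(J)$, $\theta,q,u^2\in H^1(I)$, $v^2\in H^1(J)$, $u^2(L_i)=v^2(L_i)$, $v^2(0)=v^2(L_3)=0$, $au^1_x(L_i)-m\theta(L_i)=bv^1_x(L_i)$,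 $q(L_i)=0$ for $i=1,2$. The operator $\mathcal{A}$ generates a strongly continuous contraction semigroup $(T(t))_{t\ge0}$ on $\mathcal{H}$; the finite energy (mild) solution with initial datum $U_0\in\mathcal{H}$ is $U(t)=T(t)U_0$. Stationary solutions are the time-independent ones, i.e. the elements of $\ker(\mathcal{A})$.
   Formalization: The bound M e^{-ωt}, with M chosen before U_0, fails by scaling U_0; it is proved in the form E_{U-W_0}(t) ≤ M E_{U_0} e^{-ωt}, with M and ω independent of U_0. *)

theory Defs
  imports "HOL-Analysis.Analysis"
begin

definition l2_rel :: "(real \<Rightarrow> complex) \<Rightarrow> (real \<Rightarrow> complex) \<Rightarrow> bool" where
  "l2_rel f g \<longleftrightarrow>
     f \<in> borel_measurable lborel \<and> integrable lborel (\<lambda>x. (cmod (f x))\<^sup>2) \<and>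
     g \<in> borel_measurable lborel \<and> integrable lborel (\<lambda>x. (cmod (g x))\<^sup>2) \<and>
     (AE x in lborel. f x = g x)"

lemma l2_rel_add:
  assumes "l2_rel f f'" "l2_rel g g'"
  shows "l2_rel (\<lambda>x. f x + g x) (\<lambda>x. f' x + g' x)"
proof -
  have int: "integrable lborel (\<lambda>x. (cmod (h x + h' x))\<^sup>2)"
    if "h \<in> borel_measurable lborel" "integrable lborel (\<lambda>x. (cmod (h x))\<^sup>2)"
      "h' \<in> borel_measurable lborel" "integrable lborel (\<lambda>x. (cmod (h' x))\<^sup>2)"
    for h h' :: "real \<Rightarrow> complex"
  proof (rule Bochner_Integration.integrable_bound)
    show "integrable lborel (\<lambda>x. 2 * (cmod (h x))\<^sup>2 + 2 * (cmod (h' x))\<^sup>2)"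
      using that by auto
    show "(\<lambda>x. (cmod (h x + h' x))\<^sup>2) \<in> borel_measurable lborel"
      using that by measurable
    have "(cmod (y + z))\<^sup>2 \<le> 2 * (cmod y)\<^sup>2 + 2 * (cmod z)\<^sup>2" for y z
    proof -
      have "(cmod (y + z))\<^sup>2 \<le> (cmod y + cmod z)\<^sup>2"
        by (intro power_mono norm_triangle_ineq) auto
      also have "\<dots> \<le> 2 * (cmod y)\<^sup>2 + 2 * (cmod z)\<^sup>2"
        using zero_le_power2[of "cmod y - cmod z"] by (simp add: power2_eq_square algebra_simps)
      finally show ?thesis .
    qed
    then show "AE x in lborel. norm ((cmod (h x + h' x))\<^sup>2)
        \<le> norm (2 * (cmod (h x))\<^sup>2 + 2 * (cmod (h' x))\<^sup>2)"
      by (intro AE_I2) (auto intro: order_trans)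
  qed
  have "AE x in lborel. f x = f' x" "AE x in lborel. g x = g' x"
    using assms by (auto simp: l2_rel_def)
  then have "AE x in lborel. f x + g x = f' x + g' x"
    by eventually_elim auto
  then show ?thesis
    using assms by (auto simp: l2_rel_def intro!: int)
qed

lemma l2_rel_mult:
  assumes "l2_rel f g"
  shows "l2_rel (\<lambda>x. c * f x) (\<lambda>x. c * g x)"
proof -
  have "AE x in lborel. f x = g x"
    using assms by (auto simp: l2_rel_def)
  then have "AE x in lborel. c * f x = c * g x"
    by eventually_elim auto
  then show ?thesis
    using assms by (auto simp: l2_rel_def norm_mult power_mult_distrib)
qed

lemma l2_rel_zero: "l2_rel (\<lambda>x. 0) (\<lambda>x. 0)"
  by (auto simp: l2_rel_def)

text \<open>Square integrable complex functions on the line, modulo null sets.\<close>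

quotient_type l2 = "real \<Rightarrow> complex" / partial: l2_rel
proof (rule part_equivpI)
  show "\<exists>f. l2_rel f f"
    using l2_rel_zero by blast
  show "symp l2_rel"
    unfolding symp_def l2_rel_def by (auto elim: eventually_mono)
  show "transp l2_rel"
    unfolding transp_def l2_rel_def by (auto elim: eventually_elim2)
qed

text \<open>Complex scalar multiplication; the type class \<open>real_vector\<close> only covers real scalars.\<close>

lift_definition scaleC :: "complex \<Rightarrow> l2 \<Rightarrow> l2" is "\<lambda>c f x. c * f x"
  by (rule l2_rel_mult)

instantiation l2 :: real_vector
begin

lift_definition zero_l2 :: l2 is "\<lambda>x. 0"
  by (rule l2_rel_zero)

lift_definition plus_l2 :: "l2 \<Rightarrow> l2 \<Rightarrow> l2" is "\<lambda>f g x. f x + g x"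
  by (rule l2_rel_add)

definition uminus_l2 :: "l2 \<Rightarrow> l2" where "- f = scaleC (-1) f"

definition minus_l2 :: "l2 \<Rightarrow> l2 \<Rightarrow> l2" where "f - g = f + - g" for f g :: l2

definition scaleR_l2 :: "real \<Rightarrow> l2 \<Rightarrow> l2" where "r *\<^sub>R f = scaleC (of_real r) f"

instance
proof
  fix f g h :: l2 and r s :: real
  show "f + g + h = f + (g + h)"
    by transfer (drule (1) l2_rel_add, drule (1) l2_rel_add, simp add: algebra_simps)
  show "f + g = g + f"
    by transfer (drule (1) l2_rel_add, simp add: algebra_simps)
  show "0 + f = f"
    by transfer (auto simp: l2_rel_def)
  show "- f + f = 0"
    unfolding uminus_l2_def by transfer (auto simp: l2_rel_def)
  show "f - g = f + - g"
    by (rule minus_l2_def)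
  show "r *\<^sub>R (f + g) = r *\<^sub>R f + r *\<^sub>R g"
    unfolding scaleR_l2_def by transfer (drule (1) l2_rel_add, drule l2_rel_mult, simp add: algebra_simps)
  show "(r + s) *\<^sub>R f = r *\<^sub>R f + s *\<^sub>R f"
    unfolding scaleR_l2_def by transfer (frule_tac c = "of_real r" in l2_rel_mult, drule_tac c = "of_real s" in l2_rel_mult,
      drule (1) l2_rel_add, simp add: algebra_simps)
  show "r *\<^sub>R s *\<^sub>R f = (r * s) *\<^sub>R f"
    unfolding scaleR_l2_def
    by transfer (drule_tac c = "of_real (r * s)" in l2_rel_mult, simp add: algebra_simps)
  show "1 *\<^sub>R f = f"
    unfolding scaleR_l2_def by transfer simp
qed

end

text \<open>
  \<open>L2_on S\<close> is the space L2(S), each element being identified with its extension by zero.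
  Everything below that refers to the representative \<open>rep_l2 f\<close> is independent of its choice
  (for open \<open>S\<close>).
\<close>

definition L2_on :: "real set \<Rightarrow> l2 set" where
  "L2_on S = {f. AE x in lborel. x \<notin> S \<longrightarrow> rep_l2 f x = 0}"

definition sq_int :: "real set \<Rightarrow> l2 \<Rightarrow> real" where
  "sq_int S f = (LINT x:S|lborel. (cmod (rep_l2 f x))\<^sup>2)"

text \<open>
  One-dimensional Sobolev spaces via weak derivatives, tested (as in Brezis' textbook) against
  continuously differentiable functions with compact support in the open set \<open>S\<close>.
  If \<open>S\<close> is a union of disjoint intervals, membership means membership on each of them.
\<close>

definition test_fun :: "real set \<Rightarrow> (real \<Rightarrow> complex) \<Rightarrow> (real \<Rightarrow> complex) \<Rightarrow> bool" where
  "test_fun S \<phi> \<phi>' \<longleftrightarrow>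
     (\<forall>x. (\<phi> has_vector_derivative \<phi>' x) (at x)) \<and> continuous_on UNIV \<phi>' \<and>
     (\<exists>K. compact K \<and> K \<subseteq> S \<and> (\<forall>x. x \<notin> K \<longrightarrow> \<phi> x = 0))"

definition weak_deriv :: "real set \<Rightarrow> l2 \<Rightarrow> l2 \<Rightarrow> bool" where
  "weak_deriv S f g \<longleftrightarrow>
     (\<forall>\<phi> \<phi>'. test_fun S \<phi> \<phi>' \<longrightarrow>
        (LINT x:S|lborel. rep_l2 f x * \<phi>' x) = - (LINT x:S|lborel. rep_l2 g x * \<phi> x))"

definition H1 :: "real set \<Rightarrow> l2 set" where
  "H1 S = {f \<in> L2_on S. \<exists>g \<in> L2_on S. weak_deriv S f g}"

definition wD :: "real set \<Rightarrow> l2 \<Rightarrow> l2" where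
  "wD S f = (THE g. g \<in> L2_on S \<and> weak_deriv S f g)"

definition H2 :: "real set \<Rightarrow> l2 set" where
  "H2 S = {f \<in> H1 S. wD S f \<in> H1 S}"

text \<open>
  Value at \<open>x \<in> closure S\<close> of the representative of \<open>f\<close> that is continuous up to the boundary.
  It is one-sided from within \<open>S\<close> when \<open>S\<close> is a union of intervals with disjoint closures.
\<close>

definition bdry_val :: "real set \<Rightarrow> l2 \<Rightarrow> real \<Rightarrow> complex" where
  "bdry_val S f x = (THE c. \<exists>g. continuous_on (closure S) g \<and>
      (AE y in lborel. y \<in> S \<longrightarrow> rep_l2 f y = g y) \<and> c = g x)"

text \<open>
  \<open>X\<close> is a complex vector space with scalar multiplication \<open>sc\<close> and norm \<open>nrm\<close>, carried by a
  subset of an additive group; \<open>T\<close> matters only on nonnegative times and on \<open>X\<close>.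
\<close>

definition contraction_semigroup ::
  "'a::ab_group_add set \<Rightarrow> (complex \<Rightarrow> 'a \<Rightarrow> 'a) \<Rightarrow> ('a \<Rightarrow> real) \<Rightarrow> (real \<Rightarrow> 'a \<Rightarrow> 'a) \<Rightarrow> bool" where
  "contraction_semigroup X sc nrm T \<longleftrightarrow>
     (\<forall>t\<ge>0. \<forall>U\<in>X. T t U \<in> X \<and> nrm (T t U) \<le> nrm U) \<and>
     (\<forall>t\<ge>0. \<forall>U\<in>X. \<forall>V\<in>X. T t (U + V) = T t U + T t V) \<and>
     (\<forall>t\<ge>0. \<forall>c. \<forall>U\<in>X. T t (sc c U) = sc c (T t U)) \<and>
     (\<forall>U\<in>X. T 0 U = U) \<and>
     (\<forall>s\<ge>0. \<forall>t\<ge>0. \<forall>U\<in>X. T (s + t) U = T s (T t U)) \<and>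
     (\<forall>U\<in>X. ((\<lambda>t. nrm (T t U - U)) \<longlongrightarrow> 0) (at_right 0))"

definition has_semigroup_deriv ::
  "(complex \<Rightarrow> 'a::ab_group_add \<Rightarrow> 'a) \<Rightarrow> ('a \<Rightarrow> real) \<Rightarrow> (real \<Rightarrow> 'a \<Rightarrow> 'a) \<Rightarrow> 'a \<Rightarrow> 'a \<Rightarrow> bool" where
  "has_semigroup_deriv sc nrm T U V \<longleftrightarrow>
     ((\<lambda>t. nrm (sc (of_real (1 / t)) (T t U - U) - V)) \<longlongrightarrow> 0) (at_right 0)"

definition generator ::
  "'a::ab_group_add set \<Rightarrow> (complex \<Rightarrow> 'a \<Rightarrow> 'a) \<Rightarrow> ('a \<Rightarrow> real) \<Rightarrow> (real \<Rightarrow> 'a \<Rightarrow> 'a) \<Rightarrow>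
   'a set \<Rightarrow> ('a \<Rightarrow> 'a) \<Rightarrow> bool" where
  "generator X sc nrm T D A \<longleftrightarrow>
     D = {U \<in> X. \<exists>V\<in>X. has_semigroup_deriv sc nrm T U V} \<and>
     (\<forall>U\<in>D. A U \<in> X \<and> has_semigroup_deriv sc nrm T U (A U))"

text \<open>States are tuples (u1, v1, theta, q, u2, v2), where u2 and v2 stand for the velocities.\<close>

type_synonym state = "l2 \<times> l2 \<times> l2 \<times> l2 \<times> l2 \<times> l2"

fun state_scaleC :: "complex \<Rightarrow> state \<Rightarrow> state" where
  "state_scaleC c (u\<^sub>1, v\<^sub>1, \<theta>, q, u\<^sub>2, v\<^sub>2) =
     (scaleC c u\<^sub>1, scaleC c v\<^sub>1, scaleC c \<theta>, scaleC c q, scaleC c u\<^sub>2, scaleC c v\<^sub>2)"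

abbreviation mid :: "real \<Rightarrow> real \<Rightarrow> real set" where
  "mid L\<^sub>1 L\<^sub>2 \<equiv> {L\<^sub>1<..<L\<^sub>2}"

abbreviation outer :: "real \<Rightarrow> real \<Rightarrow> real \<Rightarrow> real set" where
  "outer L\<^sub>1 L\<^sub>2 L\<^sub>3 \<equiv> {0<..<L\<^sub>1} \<union> {L\<^sub>2<..<L\<^sub>3}"

definition energy ::
  "real \<Rightarrow> real \<Rightarrow> real \<Rightarrow> real \<Rightarrow> real \<Rightarrow> real \<Rightarrow> state \<Rightarrow> real" where
  "energy L\<^sub>1 L\<^sub>2 L\<^sub>3 a b \<tau> = (\<lambda>(u\<^sub>1, v\<^sub>1, \<theta>, q, u\<^sub>2, v\<^sub>2).
     let I = mid L\<^sub>1 L\<^sub>2; J = outer L\<^sub>1 L\<^sub>2 L\<^sub>3 in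
     1/2 * (b * sq_int J (wD J v\<^sub>1) + sq_int J v\<^sub>2) +
     1/2 * (a * sq_int I (wD I u\<^sub>1) + sq_int I u\<^sub>2 + sq_int I \<theta> + \<tau> * sq_int I q))"

definition energy_norm ::
  "real \<Rightarrow> real \<Rightarrow> real \<Rightarrow> real \<Rightarrow> real \<Rightarrow> real \<Rightarrow> state \<Rightarrow> real" where
  "energy_norm L\<^sub>1 L\<^sub>2 L\<^sub>3 a b \<tau> U = sqrt (2 * energy L\<^sub>1 L\<^sub>2 L\<^sub>3 a b \<tau> U)"

definition energy_space :: "real \<Rightarrow> real \<Rightarrow> real \<Rightarrow> state set" where
  "energy_space L\<^sub>1 L\<^sub>2 L\<^sub>3 = {(u\<^sub>1, v\<^sub>1, \<theta>, q, u\<^sub>2, v\<^sub>2).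
     let I = mid L\<^sub>1 L\<^sub>2; J = outer L\<^sub>1 L\<^sub>2 L\<^sub>3 in
     u\<^sub>1 \<in> H1 I \<and> v\<^sub>1 \<in> H1 J \<and> \<theta> \<in> L2_on I \<and> q \<in> L2_on I \<and> u\<^sub>2 \<in> L2_on I \<and> v\<^sub>2 \<in> L2_on J \<and>
     bdry_val J v\<^sub>1 0 = 0 \<and> bdry_val J v\<^sub>1 L\<^sub>3 = 0 \<and>
     (\<forall>L\<in>{L\<^sub>1, L\<^sub>2}. bdry_val I u\<^sub>1 L = bdry_val J v\<^sub>1 L)}"

definition domA ::
  "real \<Rightarrow> real \<Rightarrow> real \<Rightarrow> real \<Rightarrow> real \<Rightarrow> real \<Rightarrow> state set" where
  "domA L\<^sub>1 L\<^sub>2 L\<^sub>3 a b m = {(u\<^sub>1, v\<^sub>1, \<theta>, q, u\<^sub>2, v\<^sub>2).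
     let I = mid L\<^sub>1 L\<^sub>2; J = outer L\<^sub>1 L\<^sub>2 L\<^sub>3 in
     (u\<^sub>1, v\<^sub>1, \<theta>, q, u\<^sub>2, v\<^sub>2) \<in> energy_space L\<^sub>1 L\<^sub>2 L\<^sub>3 \<and>
     u\<^sub>1 \<in> H2 I \<and> v\<^sub>1 \<in> H2 J \<and> \<theta> \<in> H1 I \<and> q \<in> H1 I \<and> u\<^sub>2 \<in> H1 I \<and> v\<^sub>2 \<in> H1 J \<and>
     bdry_val J v\<^sub>2 0 = 0 \<and> bdry_val J v\<^sub>2 L\<^sub>3 = 0 \<and>
     (\<forall>L\<in>{L\<^sub>1, L\<^sub>2}.
        bdry_val I u\<^sub>2 L = bdry_val J v\<^sub>2 L \<and>
        of_real a * bdry_val I (wD I u\<^sub>1) L - of_real m * bdry_val I \<theta> L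
          = of_real b * bdry_val J (wD J v\<^sub>1) L \<and>
        bdry_val I q L = 0)}"

definition opA ::
  "real \<Rightarrow> real \<Rightarrow> real \<Rightarrow> real \<Rightarrow> real \<Rightarrow> real \<Rightarrow> real \<Rightarrow> real \<Rightarrow> state \<Rightarrow> state" where
  "opA L\<^sub>1 L\<^sub>2 L\<^sub>3 a b m k \<tau> = (\<lambda>(u\<^sub>1, v\<^sub>1, \<theta>, q, u\<^sub>2, v\<^sub>2).
     let I = mid L\<^sub>1 L\<^sub>2; J = outer L\<^sub>1 L\<^sub>2 L\<^sub>3 in
     (u\<^sub>2,
      v\<^sub>2,
      - wD I (k *\<^sub>R q + m *\<^sub>R u\<^sub>2),
      - ((k / \<tau>) *\<^sub>R wD I \<theta>) - (1 / \<tau>) *\<^sub>R q,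
      wD I (a *\<^sub>R wD I u\<^sub>1 - m *\<^sub>R \<theta>),
      b *\<^sub>R wD J (wD J v\<^sub>1)))"

definition stationary_solutions ::
  "real \<Rightarrow> real \<Rightarrow> real \<Rightarrow> real \<Rightarrow> real \<Rightarrow> real \<Rightarrow> real \<Rightarrow> real \<Rightarrow> state set" where
  "stationary_solutions L\<^sub>1 L\<^sub>2 L\<^sub>3 a b m k \<tau> =
     {W \<in> domA L\<^sub>1 L\<^sub>2 L\<^sub>3 a b m. opA L\<^sub>1 L\<^sub>2 L\<^sub>3 a b m k \<tau> W = 0}"

text \<open>
  \<open>T\<close> is the contraction semigroup generated by \<open>opA\<close>; the finite energy (mild) solution of the
  problem with initial datum \<open>U\<^sub>0\<close> is \<open>\<lambda>t. T t U\<^sub>0\<close>.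
\<close>

definition solution_semigroup ::
  "real \<Rightarrow> real \<Rightarrow> real \<Rightarrow> real \<Rightarrow> real \<Rightarrow> real \<Rightarrow> real \<Rightarrow> real \<Rightarrow>
   (real \<Rightarrow> state \<Rightarrow> state) \<Rightarrow> bool" where
  "solution_semigroup L\<^sub>1 L\<^sub>2 L\<^sub>3 a b m k \<tau> T \<longleftrightarrow>
     contraction_semigroup (energy_space L\<^sub>1 L\<^sub>2 L\<^sub>3) state_scaleC
       (energy_norm L\<^sub>1 L\<^sub>2 L\<^sub>3 a b \<tau>) T \<and>
     generator (energy_space L\<^sub>1 L\<^sub>2 L\<^sub>3) state_scaleC (energy_norm L\<^sub>1 L\<^sub>2 L\<^sub>3 a b \<tau>) T
       (domA L\<^sub>1 L\<^sub>2 L\<^sub>3 a b m) (opA L\<^sub>1 L\<^sub>2 L\<^sub>3 a b m k \<tau>)"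

end

theory Submission
  imports Defs
begin

text \<open>
  Decay follows from a Lyapunov functional, built on the generator's domain by
  multipliers, so neither the resolvent nor a compactness argument is needed. With \<open>w = u\<^sub>x\<close>, \<open>p = u\<^sub>t\<close>
  and \<open>\<sigma> = a w - m \<theta>\<close>, the energy dissipates \<open>|q|\<^sup>2\<close>. This controls \<open>\<theta>\<close> up to its mean, by testing
  the equation of \<open>q\<close> with a primitive of \<open>\<theta>\<close>. The quantity \<open>\<zeta> = m w + \<theta>\<close> obeys \<open>\<zeta>\<^sub>t = - k q\<^sub>x\<close>; its
  integral is conserved, and vanishes after subtracting a stationary solution, so the primitive of
  \<open>\<zeta>\<close> vanishes at both ends and moves slowly, whence \<open>\<zeta>\<close> is controlled by testing the equation of
  \<open>p\<close> with it. Then \<open>\<sigma>\<close> is controlled up to a constant, hence so are the moments of \<open>p\<close> against weights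
  vanishing at the ends, and hence \<open>p\<close> itself in the interior of the middle part. A weighted average
  of \<open>\<theta>\<close> varies slowly for the same reason; shifting \<open>\<theta>\<close>, \<open>\<sigma>\<close> and \<open>b v\<^sub>x\<close> by it, the flux multipliers
  carry the interior bound to the interfaces and through the outer parts, which controls all of the
  kinetic energy. Equipartition finally controls the potential energy.
\<close>


subsection \<open>Square integrable functions as an inner product space\<close>

text \<open>Two obstacles shape the argument. Flux multipliers leave terms at the interfaces that
  contain traces of the velocity, and these are not bounded by the energy. The traces are therefore
  carried along as part of the quantity to be estimated; errors may be absorbed into it with an
  arbitrarily small factor, so a product of an already controlled factor with one that is merely
  bounded by this quantity is harmless. Secondly, dissipation does not see constants: the stationary
  solutions have constant temperature, strain and stress. Before the last step,
  \<open>\<theta>\<close>, \<open>\<sigma>\<close> and \<open>b v_x\<close> are thus only handled up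
  to constants; the mean of \<open>\<theta>\<close> is reached in the equipartition step, where the
  conserved integral, normalised to zero, gives it the favourable sign. All functionals are bounded
  bilinear forms in the embedded state. Their derivatives along orbits then follow from one product
  rule, and the sum of all of them is compared with the energy by boundedness alone.\<close>

definition sq_integrable :: "(real \<Rightarrow> complex) \<Rightarrow> bool" where
  "sq_integrable f \<longleftrightarrow> f \<in> borel_measurable lborel \<and> integrable lborel (\<lambda>x. (cmod (f x))\<^sup>2)"

abbreviation mk_l2 :: "(real \<Rightarrow> complex) \<Rightarrow> l2" where "mk_l2 \<equiv> abs_l2"

lemma sq_integrable_rep [simp]: "sq_integrable (rep_l2 f)"
proof -
  have "l2_rel (rep_l2 f) (rep_l2 f)"
    using Quotient3_rep_reflp[OF Quotient3_l2] .
  then show ?thesis by (simp add: sq_integrable_def l2_rel_def)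
qed

lemma measurable_rep_l2 [measurable]: "rep_l2 f \<in> borel_measurable lborel"
  using sq_integrable_rep[of f] by (simp add: sq_integrable_def)

lemma rep_mk_l2:
  assumes "sq_integrable f" shows "AE x in lborel. rep_l2 (mk_l2 f) x = f x"
proof -
  have "l2_rel f f" using assms by (simp add: sq_integrable_def l2_rel_def)
  then have "l2_rel (rep_l2 (abs_l2 f)) f"
    using Quotient3_l2 rep_abs_rsp_left[OF Quotient3_l2] by metis
  then show ?thesis by (simp add: l2_rel_def)
qed

lemma l2_eqI:
  assumes "AE x in lborel. rep_l2 f x = rep_l2 g x" shows "f = g"
proof -
  have "l2_rel (rep_l2 f) (rep_l2 g)"
    using assms sq_integrable_rep[of f] sq_integrable_rep[of g] by (auto simp: l2_rel_def
        sq_integrable_def)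
  then show ?thesis using Quotient3_rel_rep[OF Quotient3_l2] by metis
qed

lemma rep_l2_plus: "AE x in lborel. rep_l2 (f + g) x = rep_l2 f x + rep_l2 g x"
proof -
  have "l2_rel (rep_l2 f) (rep_l2 f)" "l2_rel (rep_l2 g) (rep_l2 g)"
    using Quotient3_rep_reflp[OF Quotient3_l2] by auto
  from l2_rel_add[OF this] have 1: "sq_integrable (\<lambda>x. rep_l2 f x + rep_l2 g x)"
    by (simp add: l2_rel_def sq_integrable_def)
  have "f + g = mk_l2 (\<lambda>x. rep_l2 f x + rep_l2 g x)"
    by (simp add: plus_l2_def map_fun_def)
  then show ?thesis using rep_mk_l2[OF 1] by simp
qed

lemma rep_l2_scaleC: "AE x in lborel. rep_l2 (scaleC c f) x = c * rep_l2 f x"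
proof -
  have "l2_rel (rep_l2 f) (rep_l2 f)"
    using Quotient3_rep_reflp[OF Quotient3_l2] by auto
  from l2_rel_mult[OF this] have 1: "sq_integrable (\<lambda>x. c * rep_l2 f x)"
    by (simp add: l2_rel_def sq_integrable_def)
  have "scaleC c f = mk_l2 (\<lambda>x. c * rep_l2 f x)"
    by (simp add: scaleC_def map_fun_def)
  then show ?thesis using rep_mk_l2[OF 1] by simp
qed

lemma rep_l2_zero: "AE x in lborel. rep_l2 0 x = 0"
proof -
  have "sq_integrable (\<lambda>x. 0)" by (simp add: sq_integrable_def)
  from rep_mk_l2[OF this] show ?thesis by (simp add: zero_l2_def)
qed

lemma rep_l2_scaleR: "AE x in lborel. rep_l2 (r *\<^sub>R f) x = r *\<^sub>R rep_l2 f x"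
  using rep_l2_scaleC[of "of_real r" f] by (simp add: scaleR_l2_def scaleR_conv_of_real)

lemma rep_l2_minus: "AE x in lborel. rep_l2 (f - g) x = rep_l2 f x - rep_l2 g x"
  using rep_l2_plus[of f "- g"] rep_l2_scaleC[of "-1" g]
  unfolding minus_l2_def uminus_l2_def by eventually_elim simp

lemma integrable_mult_sq:
  assumes "sq_integrable f" "sq_integrable g"
  shows "integrable lborel (\<lambda>x. f x * g x)"
proof (rule Bochner_Integration.integrable_bound)
  show "integrable lborel (\<lambda>x. (cmod (f x))\<^sup>2 + (cmod (g x))\<^sup>2)"
    using assms by (auto simp: sq_integrable_def)
  show "(\<lambda>x. f x * g x) \<in> borel_measurable lborel"
    using assms by (auto simp: sq_integrable_def)
  have "norm (y * z) \<le> norm ((cmod y)\<^sup>2 + (cmod z)\<^sup>2)" for y z :: complex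
  proof -
    have "0 \<le> (cmod y - cmod z)\<^sup>2" "0 \<le> cmod y * cmod z" by auto
    then have "cmod y * cmod z \<le> (cmod y)\<^sup>2 + (cmod z)\<^sup>2"
      unfolding power2_diff by linarith
    then show ?thesis by (simp add: norm_mult)
  qed
  then show "AE x in lborel. norm (f x * g x) \<le> norm ((cmod (f x))\<^sup>2 + (cmod (g x))\<^sup>2)"
    by auto
qed

lemma sq_integrable_cnj: "sq_integrable f \<Longrightarrow> sq_integrable (\<lambda>x. cnj (f x))"
proof -
  have "cnj \<in> borel_measurable borel"
    by (intro borel_measurable_continuous_onI continuous_intros)
  note [measurable] = this
  show "sq_integrable f \<Longrightarrow> ?thesis"
    unfolding sq_integrable_def by (auto intro: measurable_compose[of f lborel borel cnj])
qed

lemma integrable_inner_sq: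
  assumes "sq_integrable f" "sq_integrable g"
  shows "integrable lborel (\<lambda>x. f x \<bullet> g x)"
proof -
  have "integrable lborel (\<lambda>x. Re (f x * cnj (g x)))"
    using integrable_mult_sq[OF assms(1) sq_integrable_cnj[OF assms(2)]] by (rule integrable_Re)
  then show ?thesis by (simp add: inner_complex_def)
qed

text \<open>The inner product is the real part of the Hermitian one. The functionals below are real
  quadratic, and complex scalars enter only through \<open>scaleC\<close>, for which
  \<open>norm_scaleC\<close> supplies homogeneity.\<close>

instantiation l2 :: real_inner
begin

definition inner_l2 :: "l2 \<Rightarrow> l2 \<Rightarrow> real" where
  "inner_l2 f g = (LINT x|lborel. rep_l2 f x \<bullet> rep_l2 g x)"

definition norm_l2 :: "l2 \<Rightarrow> real" where "norm_l2 f = sqrt (f \<bullet> f)"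

definition dist_l2 :: "l2 \<Rightarrow> l2 \<Rightarrow> real" where "dist_l2 f g = norm (f - g)"

definition sgn_l2 :: "l2 \<Rightarrow> l2" where "sgn_l2 f = f /\<^sub>R norm f"

definition uniformity_l2 :: "(l2 \<times> l2) filter" where
  "uniformity_l2 = (INF e\<in>{0<..}. principal {(x, y). dist x y < e})"

definition open_l2 :: "l2 set \<Rightarrow> bool" where
  "open_l2 S = (\<forall>x\<in>S. \<forall>\<^sub>F (x', y) in uniformity. x' = x \<longrightarrow> y \<in> S)"

instance
proof
  fix f g h :: l2 and r :: real
  show "f \<bullet> g = g \<bullet> f" by (simp add: inner_l2_def inner_commute)
  have "(LINT x|lborel. rep_l2 (f + g) x \<bullet> rep_l2 h x)
      = (LINT x|lborel. rep_l2 f x \<bullet> rep_l2 h x + rep_l2 g x \<bullet> rep_l2 h x)"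
    using rep_l2_plus[of f g]
    by (intro integral_cong_AE) (auto simp: inner_add_left elim!: eventually_mono)
  then show "(f + g) \<bullet> h = f \<bullet> h + g \<bullet> h"
    by (simp add: inner_l2_def integrable_inner_sq)
  have "(LINT x|lborel. rep_l2 (r *\<^sub>R f) x \<bullet> rep_l2 h x)
      = (LINT x|lborel. r * (rep_l2 f x \<bullet> rep_l2 h x))"
    using rep_l2_scaleR[of r f]
    by (intro integral_cong_AE) (auto elim!: eventually_mono)
  then show "(r *\<^sub>R f) \<bullet> h = r * (f \<bullet> h)"
    by (simp add: inner_l2_def integrable_inner_sq)
  show "0 \<le> f \<bullet> f" by (simp add: inner_l2_def)
  show "(f \<bullet> f = 0) = (f = 0)"
  proof
    assume "f \<bullet> f = 0"
    then have "AE x in lborel. rep_l2 f x \<bullet> rep_l2 f x = 0"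
      unfolding inner_l2_def
      by (subst (asm) integral_nonneg_eq_0_iff_AE) (auto simp: integrable_inner_sq)
    then have "AE x in lborel. rep_l2 f x = rep_l2 0 x"
      using rep_l2_zero by eventually_elim auto
    then show "f = 0" by (rule l2_eqI)
  next
    assume "f = 0"
    have "AE x in lborel. rep_l2 0 x \<bullet> rep_l2 0 x = 0"
      using rep_l2_zero by eventually_elim simp
    then have "(LINT x|lborel. rep_l2 0 x \<bullet> rep_l2 0 x) = 0"
      by (rule integral_eq_zero_AE)
    then show "f \<bullet> f = 0" using \<open>f = 0\<close> by (simp add: inner_l2_def)
  qed
  show "dist f g = norm (f - g)" by (rule dist_l2_def)
  show "norm f = sqrt (f \<bullet> f)" by (rule norm_l2_def)
  show "sgn f = f /\<^sub>R norm f" by (rule sgn_l2_def)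
qed (rule uniformity_l2_def open_l2_def)+

end

lemma norm_l2_sq: "(norm (f::l2))\<^sup>2 = (LINT x|lborel. (cmod (rep_l2 f x))\<^sup>2)"
  by (simp add: power2_norm_eq_inner inner_l2_def)

lemma norm_scaleC: "norm (scaleC c f) = cmod c * norm f"
proof (rule power2_eq_imp_eq)
  have "(LINT x|lborel. (cmod (rep_l2 (scaleC c f) x))\<^sup>2) = (LINT x|lborel. (cmod c)\<^sup>2 * (cmod
      (rep_l2 f x))\<^sup>2)"
    using rep_l2_scaleC[of c f]
    by (intro integral_cong_AE) (auto simp: norm_mult power_mult_distrib elim!: eventually_mono)
  then show "(norm (scaleC c f))\<^sup>2 = (cmod c * norm f)\<^sup>2"
    by (simp add: norm_l2_sq power_mult_distrib)
qed auto

lemma norm_mk_l2: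
  assumes "sq_integrable f" shows "(norm (mk_l2 f))\<^sup>2 = (LINT x|lborel. (cmod (f x))\<^sup>2)"
  unfolding norm_l2_sq using rep_mk_l2[OF assms] assms
  by (intro integral_cong_AE) (auto simp: sq_integrable_def elim!: eventually_mono)

lemma sq_integrable_add:
  "sq_integrable f \<Longrightarrow> sq_integrable g \<Longrightarrow> sq_integrable (\<lambda>x. f x + g x)"
  using l2_rel_add[of f f g g] by (auto simp: sq_integrable_def l2_rel_def)

lemma sq_integrable_cmult: "sq_integrable f \<Longrightarrow> sq_integrable (\<lambda>x. c * f x)"
  using l2_rel_mult[of f f c] by (auto simp: sq_integrable_def l2_rel_def)

lemma sq_integrable_bound:
  assumes "sq_integrable f" "g \<in> borel_measurable lborel" "AE x in lborel. cmod (g x) \<le> C * cmod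
      (f x)"
  shows "sq_integrable g"
  unfolding sq_integrable_def
proof
  show "integrable lborel (\<lambda>x. (cmod (g x))\<^sup>2)"
  proof (rule Bochner_Integration.integrable_bound)
    show "integrable lborel (\<lambda>x. C\<^sup>2 * (cmod (f x))\<^sup>2)"
      using assms(1) by (simp add: sq_integrable_def)
    show "AE x in lborel. norm ((cmod (g x))\<^sup>2) \<le> norm (C\<^sup>2 * (cmod (f x))\<^sup>2)"
      using assms(3)
      by eventually_elim (use power_mono[where n=2] in \<open>fastforce simp: power_mult_distrib\<close>)
  qed (use assms(2) in auto)
qed (use assms(2) in auto)

lemma sq_integrable_indicator_mult:
  assumes [measurable]: "w \<in> borel_measurable lborel" and "\<And>x. x \<in> {a..b} \<Longrightarrow> cmod (w x) \<le> C"
    "\<And>x. x \<notin> {a..b} \<Longrightarrow> w x = 0"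
  shows "sq_integrable w"
proof (rule sq_integrable_bound[where C = C])
  show "sq_integrable (indicator {a..b})"
    unfolding sq_integrable_def
  proof
    have "(\<lambda>x. (cmod (indicator {a..b} x))\<^sup>2) = (indicator {a..b} :: real \<Rightarrow> real)"
      by (auto simp: indicator_def)
    moreover have "integrable lborel (indicator {a..b} :: real \<Rightarrow> real)"
      by (rule integrable_real_indicator) (auto simp: emeasure_lborel_Icc_eq)
    ultimately show "integrable lborel (\<lambda>x. (cmod (indicator {a..b} x))\<^sup>2)"
      by simp
  qed auto
  show "AE x in lborel. cmod (w x) \<le> C * cmod (indicator {a..b} x)"
    using assms(2,3) by (auto simp: indicator_def)
qed fact

subsection \<open>Primitives of integrable functions\<close>

text \<open>Absolute continuity in integrated form. With this encoding no differentiation almost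
  everywhere is involved, and the product rule becomes a consequence of Fubini.\<close>

definition prim_on :: "real \<Rightarrow> real \<Rightarrow> (real \<Rightarrow> complex) \<Rightarrow> (real \<Rightarrow> complex) \<Rightarrow> bool" where
  "prim_on \<alpha> \<beta> F f \<longleftrightarrow> set_integrable lborel {\<alpha>..\<beta>} f \<and>
     (\<forall>x\<in>{\<alpha>..\<beta>}. F x = F \<alpha> + (LINT t:{\<alpha>..x}|lborel. f t))"

lemma prim_onD: "prim_on \<alpha> \<beta> F f \<Longrightarrow> x \<in> {\<alpha>..\<beta>} \<Longrightarrow> F x = F \<alpha> + (LINT t:{\<alpha>..x}|lborel. f t)"
  unfolding prim_on_def by blast

lemma prim_on_integrable: "prim_on \<alpha> \<beta> F f \<Longrightarrow> set_integrable lborel {\<alpha>..\<beta>} f"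
  unfolding prim_on_def by blast

lemma set_integrable_Icc_mono:
  fixes f :: "real \<Rightarrow> complex"
  assumes "set_integrable lborel {\<alpha>..\<beta>} f" "x \<le> \<beta>"
  shows "set_integrable lborel {\<alpha>..x} f"
  using assms by (auto intro: set_integrable_subset)

lemma prim_on_continuous:
  assumes "prim_on \<alpha> \<beta> F f" shows "continuous_on {\<alpha>..\<beta>} F"
proof -
  have 1: "f absolutely_integrable_on {\<alpha>..\<beta>}"
    using prim_on_integrable[OF assms]
    by (simp add: set_integrable_def integrable_completion borel_measurable_integrable)
  have "continuous_on {\<alpha>..\<beta>} (\<lambda>x. F \<alpha> + integral {\<alpha>..x} f)"
    using set_lebesgue_integral_eq_integral(1)[OF 1]
    by (intro continuous_intros indefinite_integral_continuous_1)
  moreover have "F \<alpha> + integral {\<alpha>..x} f = F x" if x: "x \<in> {\<alpha>..\<beta>}" for x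
  proof -
    have "f absolutely_integrable_on {\<alpha>..x}"
      using 1 x by (auto intro: set_integrable_subset)
    from set_lebesgue_integral_eq_integral(2)[OF this]
    have "integral {\<alpha>..x} f = (LINT t:{\<alpha>..x}|lebesgue. f t)" by simp
    also have "\<dots> = (LINT t:{\<alpha>..x}|lborel. f t)"
      using set_integrable_Icc_mono[of \<alpha> \<beta> f x] prim_on_integrable[OF assms] x
      unfolding set_lebesgue_integral_def
      by (intro integral_completion) (auto simp: set_integrable_def)
    finally show ?thesis using prim_onD[OF assms x] by simp
  qed
  ultimately show ?thesis by (rule continuous_on_eq)
qed

text \<open>Fubini on the plane, cut along the diagonal: the region \<open>t \<le> s\<close> gives
  the first term, the region \<open>s < t\<close> the second. This is the product rule for
  primitives without initial values.\<close>

lemma integral_mult_fubini: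
  fixes f g :: "real \<Rightarrow> complex"
  assumes f: "integrable lborel f" and g: "integrable lborel g"
  shows "(LINT x|lborel. f x) * (LINT x|lborel. g x) =
    (LINT x|lborel. f x * (LINT t:{..x}|lborel. g t)) + (LINT x|lborel. g x * (LINT
        t:{..x}|lborel. f t))"
proof -
  have [measurable]: "f \<in> borel_measurable borel" "g \<in> borel_measurable borel"
    using f g by auto
  have gle: "set_integrable lborel A g" "set_integrable lborel A f" if "A \<in> sets borel" for A
    unfolding set_integrable_def using that f g by (auto intro: integrable_mult_indicator)
  have split: "(LINT x|lborel. g x) = (LINT t:{..s}|lborel. g t) + (LINT t:{s<..}|lborel. g t)"
      for s
  proof -
    have "(LINT t:{..s} \<union> {s<..}|lborel. g t) = (LINT t:{..s}|lborel. g t) + (LINT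
        t:{s<..}|lborel. g t)"
      by (rule set_integral_Un) (auto intro: gle)
    moreover have "{..s} \<union> {s<..} = UNIV" by auto
    ultimately show ?thesis by (simp add: set_lebesgue_integral_def)
  qed
  let ?h = "\<lambda>s t. indicator {s<..} t *\<^sub>R (f s * g t)"
  have bound: "norm (LINT t:A|lborel. k t) \<le> (LINT t|lborel. norm (k t))"
    if "A \<in> sets borel" "integrable lborel k" for A and k :: "real \<Rightarrow> complex"
  proof -
    have "norm (LINT t:A|lborel. k t) \<le> (LINT t|lborel. norm (indicator A t *\<^sub>R k t))"
      unfolding set_lebesgue_integral_def by (rule integral_norm_bound)
    also have "\<dots> \<le> (LINT t|lborel. norm (k t))"
      using that by (intro integral_mono integrable_norm integrable_mult_indicator) (auto simp:
          indicator_def)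
    finally show ?thesis .
  qed
  have prod: "integrable (lborel \<Otimes>\<^sub>M lborel) (case_prod ?h)"
  proof (rule Bochner_Integration.integrable_bound)
    show "integrable (lborel \<Otimes>\<^sub>M lborel) (\<lambda>(s, t). f s * g t)"
    proof (rule lborel_pair.Fubini_integrable)
      show "(\<lambda>(s, t). f s * g t) \<in> borel_measurable (lborel \<Otimes>\<^sub>M lborel)" by measurable
      show "integrable lborel (\<lambda>x. LINT y|lborel. norm (case (x, y) of (s, t) \<Rightarrow> f s * g t))"
        using f g by (simp add: norm_mult)
      show "AE x in lborel. integrable lborel (\<lambda>y. case (x, y) of (s, t) \<Rightarrow> f s * g t)"
        using g by simp
    qed
    have "(\<lambda>p. indicator {p. fst p < snd p} p *\<^sub>R (f (fst p) * g (snd p))) \<in> borel_measurable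
        (lborel \<Otimes>\<^sub>M lborel)"
      by measurable
    moreover have "case_prod ?h = (\<lambda>p. indicator {p. fst p < snd p} p *\<^sub>R (f (fst p) * g (snd p)))"
      by (auto simp: indicator_def fun_eq_iff)
    ultimately show "case_prod ?h \<in> borel_measurable (lborel \<Otimes>\<^sub>M lborel)" by simp
  qed (auto simp: indicator_def)
  have i1: "integrable lborel (\<lambda>s. f s * (LINT t:{..s}|lborel. g t))"
  proof (rule Bochner_Integration.integrable_bound)
    show "integrable lborel (\<lambda>s. f s * of_real (LINT t|lborel. norm (g t)))" using f by simp
    show "(\<lambda>s. f s * (LINT t:{..s}|lborel. g t)) \<in> borel_measurable lborel"
    proof -
      have "(\<lambda>s. LINT t|lborel. indicator {p. snd p \<le> fst p} (s,t) *\<^sub>R g t) \<in> borel_measurable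
          lborel"
        by measurable
      moreover have "(\<lambda>s. LINT t|lborel. indicator {p. snd p \<le> fst p} (s,t) *\<^sub>R g t) = (\<lambda>s. LINT
          t:{..s}|lborel. g t)"
        unfolding set_lebesgue_integral_def by (intro ext Bochner_Integration.integral_cong) (auto
            simp: indicator_def)
      ultimately show ?thesis by simp
    qed
    show "AE s in lborel. norm (f s * (LINT t:{..s}|lborel. g t)) \<le> norm (f s * of_real (LINT
        t|lborel. norm (g t)))"
      using bound[OF _ g] by (auto simp: norm_mult intro!: AE_I2 mult_left_mono order_trans[OF
          bound[OF _ g]])
  qed
  have h1: "(LINT t|lborel. ?h s t) = f s * (LINT t:{s<..}|lborel. g t)" for s
  proof -
    have "(LINT t|lborel. ?h s t) = (LINT t|lborel. f s * (indicator {s<..} t *\<^sub>R g t))"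
      by (intro Bochner_Integration.integral_cong) auto
    also have "\<dots> = f s * (LINT t|lborel. indicator {s<..} t *\<^sub>R g t)"
      by (rule integral_mult_right_zero)
    finally show ?thesis by (simp only: set_lebesgue_integral_def)
  qed
  have h2: "(LINT s|lborel. ?h s t) = g t * (LINT s:{..t}|lborel. f s)" for t
  proof -
    \<comment> \<open>\<open>?h\<close> leaves out the diagonal and the right-hand side contains it;
      for fixed \<open>t\<close> the integrands differ at one point only.\<close>
    have "(LINT s|lborel. ?h s t) = (LINT s|lborel. g t * (indicator {..t} s *\<^sub>R f s))"
      using AE_lborel_singleton[of t] 
      by (intro integral_cong_AE) (auto simp: indicator_def elim!: eventually_mono)
    also have "\<dots> = g t * (LINT s|lborel. indicator {..t} s *\<^sub>R f s)"
      by (rule integral_mult_right_zero)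
    finally show ?thesis by (simp only: set_lebesgue_integral_def)
  qed
  have i2: "integrable lborel (\<lambda>s. f s * (LINT t:{s<..}|lborel. g t))"
    using lborel_pair.integrable_fst[OF prod] unfolding h1 .
  have "(LINT s|lborel. f s * (LINT t:{s<..}|lborel. g t)) = (LINT t|lborel. g t * (LINT
      s:{..t}|lborel. f s))"
    using lborel_pair.Fubini_integral[OF prod] unfolding h1 h2 by simp
  moreover have "(LINT x|lborel. f x) * (LINT x|lborel. g x)
      = (LINT s|lborel. f s * (LINT t:{..s}|lborel. g t) + f s * (LINT t:{s<..}|lborel. g t))"
    unfolding distrib_left[symmetric] split[symmetric] by (rule integral_mult_left_zero[symmetric])
  ultimately show ?thesis using i1 i2 by simp
qed

lemma prim_on_mult_integrable:
  assumes "prim_on \<alpha> \<beta> F f" "prim_on \<alpha> \<beta> G g"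
  shows "set_integrable lborel {\<alpha>..\<beta>} (\<lambda>x. f x * G x)"
proof -
  have c: "continuous_on {\<alpha>..\<beta>} G" by (rule prim_on_continuous[OF assms(2)])
  have "bounded (G ` {\<alpha>..\<beta>})"
    using compact_continuous_image[OF c] compact_imp_bounded by auto
  then obtain B where B: "\<And>x. x \<in> {\<alpha>..\<beta>} \<Longrightarrow> norm (G x) \<le> B" 
    unfolding bounded_iff by blast
  have m: "(\<lambda>x. indicator {\<alpha>..\<beta>} x *\<^sub>R G x) \<in> borel_measurable borel"
    using borel_measurable_continuous_on_indicator[OF _ c] by simp
  have f: "integrable lborel (\<lambda>x. indicator {\<alpha>..\<beta>} x *\<^sub>R f x)"
    using prim_on_integrable[OF assms(1)] by (simp add: set_integrable_def)
  have "integrable lborel (\<lambda>x. (indicator {\<alpha>..\<beta>} x *\<^sub>R f x) * (indicator {\<alpha>..\<beta>} x *\<^sub>R G x))"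
  proof (rule Bochner_Integration.integrable_bound)
    show "integrable lborel (\<lambda>x. (indicator {\<alpha>..\<beta>} x *\<^sub>R f x) * of_real B)"
      using f by (rule integrable_mult_left)
    show "(\<lambda>x. indicator {\<alpha>..\<beta>} x *\<^sub>R f x * indicator {\<alpha>..\<beta>} x *\<^sub>R G x) \<in> borel_measurable lborel"
      using m f by (intro borel_measurable_times) auto
    show "AE x in lborel. norm (indicator {\<alpha>..\<beta>} x *\<^sub>R f x * indicator {\<alpha>..\<beta>} x *\<^sub>R G x)
         \<le> norm (indicator {\<alpha>..\<beta>} x *\<^sub>R f x * of_real B)"
      using B by (auto simp: indicator_def norm_mult intro!: AE_I2 mult_left_mono order_trans[OF B])
  qed
  moreover have "(\<lambda>x. (indicator {\<alpha>..\<beta>} x *\<^sub>R f x) * (indicator {\<alpha>..\<beta>} x *\<^sub>R G x)) = (\<lambda>x.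
      indicator {\<alpha>..\<beta>} x *\<^sub>R (f x * G x))"
    by (auto simp: indicator_def)
  ultimately show ?thesis by (simp add: set_integrable_def)
qed

text \<open>After cutting \<open>f\<close> and \<open>g\<close> to \<open>{\<alpha>..x}\<close>,
  \<open>integral_mult_fubini\<close> yields the product of the increments of \<open>F\<close> and
  \<open>G\<close>; the mixed terms with \<open>F \<alpha>\<close> and \<open>G \<alpha>\<close>
  complete it to the increment of the product.\<close>

lemma prim_on_mult:
  assumes F: "prim_on \<alpha> \<beta> F f" and G: "prim_on \<alpha> \<beta> G g"
  shows "prim_on \<alpha> \<beta> (\<lambda>x. F x * G x) (\<lambda>x. f x * G x + F x * g x)"
proof -
  have i1: "set_integrable lborel {\<alpha>..\<beta>} (\<lambda>x. f x * G x)"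
    by (rule prim_on_mult_integrable[OF F G])
  have i2: "set_integrable lborel {\<alpha>..\<beta>} (\<lambda>x. F x * g x)"
    using prim_on_mult_integrable[OF G F] by (simp add: mult.commute)
  have "F x * G x = F \<alpha> * G \<alpha> + (LINT t:{\<alpha>..x}|lborel. f t * G t + F t * g t)" if x: "x \<in> {\<alpha>..\<beta>}"
      for x
  proof -
    define f0 where "f0 = (\<lambda>t. indicator {\<alpha>..x} t *\<^sub>R f t)"
    define g0 where "g0 = (\<lambda>t. indicator {\<alpha>..x} t *\<^sub>R g t)"
    have int: "integrable lborel f0" "integrable lborel g0"
      using set_integrable_Icc_mono[of \<alpha> \<beta> f x] set_integrable_Icc_mono[of \<alpha> \<beta> g x]
          prim_on_integrable[OF F] prim_on_integrable[OF G] x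
      by (auto simp: f0_def g0_def set_integrable_def)
    have Fx: "F x = F \<alpha> + (LINT t|lborel. f0 t)" "G x = G \<alpha> + (LINT t|lborel. g0 t)"
      using prim_onD[OF F x] prim_onD[OF G x] by (auto simp: f0_def g0_def
          set_lebesgue_integral_def)
    have sub: "(LINT s:{..t}|lborel. f0 s) = F t - F \<alpha>" "(LINT s:{..t}|lborel. g0 s) = G t - G \<alpha>"
        if t: "t \<in> {\<alpha>..x}" for t
    proof -
      have "(LINT s:{..t}|lborel. f0 s) = (LINT s:{\<alpha>..t}|lborel. f s)"
        "(LINT s:{..t}|lborel. g0 s) = (LINT s:{\<alpha>..t}|lborel. g s)"
        using t unfolding f0_def g0_def set_lebesgue_integral_def
        by (intro Bochner_Integration.integral_cong; auto simp: indicator_def)+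
      moreover have "t \<in> {\<alpha>..\<beta>}" using t x by auto
      ultimately show "(LINT s:{..t}|lborel. f0 s) = F t - F \<alpha>" "(LINT s:{..t}|lborel. g0 s) = G t
          - G \<alpha>"
        using prim_onD[OF F, of t] prim_onD[OF G, of t] by auto
    qed
    have j1: "integrable lborel (\<lambda>t. indicator {\<alpha>..x} t *\<^sub>R (f t * G t))"
      and j2: "integrable lborel (\<lambda>t. indicator {\<alpha>..x} t *\<^sub>R (F t * g t))"
      using set_integrable_Icc_mono[OF i1, of x] set_integrable_Icc_mono[OF i2, of x] x by (auto
          simp: set_integrable_def)
    have "(LINT t|lborel. f0 t * (LINT s:{..t}|lborel. g0 s)) = (LINT t|lborel. indicator {\<alpha>..x} t
        *\<^sub>R (f t * G t) - f0 t * G \<alpha>)"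
      by (intro Bochner_Integration.integral_cong) (auto simp: f0_def indicator_def sub
          algebra_simps)
    also have "\<dots> = (LINT t|lborel. indicator {\<alpha>..x} t *\<^sub>R (f t * G t)) - (LINT t|lborel. f0 t) * G
        \<alpha>"
      using j1 int by simp
    finally have e1: "(LINT t|lborel. f0 t * (LINT s:{..t}|lborel. g0 s)) = (LINT t|lborel.
        indicator {\<alpha>..x} t *\<^sub>R (f t * G t)) - (LINT t|lborel. f0 t) * G \<alpha>" .
    have "(LINT t|lborel. g0 t * (LINT s:{..t}|lborel. f0 s)) = (LINT t|lborel. indicator {\<alpha>..x} t
        *\<^sub>R (F t * g t) - g0 t * F \<alpha>)"
      by (intro Bochner_Integration.integral_cong) (auto simp: g0_def indicator_def sub
          algebra_simps)
    also have "\<dots> = (LINT t|lborel. indicator {\<alpha>..x} t *\<^sub>R (F t * g t)) - (LINT t|lborel. g0 t) * F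
        \<alpha>"
      using j2 int by simp
    finally have e2: "(LINT t|lborel. g0 t * (LINT s:{..t}|lborel. f0 s)) = (LINT t|lborel.
        indicator {\<alpha>..x} t *\<^sub>R (F t * g t)) - (LINT t|lborel. g0 t) * F \<alpha>" .
    have "(LINT t:{\<alpha>..x}|lborel. f t * G t + F t * g t)
       = (LINT t|lborel. indicator {\<alpha>..x} t *\<^sub>R (f t * G t)) + (LINT t|lborel. indicator {\<alpha>..x} t
           *\<^sub>R (F t * g t))"
      using j1 j2 by (simp add: set_lebesgue_integral_def scaleR_add_right)
    then show ?thesis
      using integral_mult_fubini[OF int] unfolding e1 e2 Fx by (simp add: algebra_simps)
  qed
  then show ?thesis
    using set_integral_add(1)[OF i1 i2] unfolding prim_on_def by blast
qed

lemma prim_on_C1: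
  assumes "\<And>x. x \<in> {\<alpha>..\<beta>} \<Longrightarrow> (F has_vector_derivative f x) (at x within {\<alpha>..\<beta>})" "continuous_on
      {\<alpha>..\<beta>} f"
  shows "prim_on \<alpha> \<beta> F f"
  unfolding prim_on_def
proof (intro conjI ballI)
  show "set_integrable lborel {\<alpha>..\<beta>} f"
    using borel_integrable_atLeastAtMost'[OF assms(2)] .
  fix x assume x: "x \<in> {\<alpha>..\<beta>}"
  have "(LINT t|lborel. indicator {\<alpha>..x} t *\<^sub>R f t) = F x - F \<alpha>"
    using x assms
    by (intro integral_FTC_Icc) (auto intro: has_vector_derivative_within_subset[of _ _ _
        "{\<alpha>..\<beta>}"] continuous_on_subset)
  then show "F x = F \<alpha> + (LINT t:{\<alpha>..x}|lborel. f t)"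
    by (simp add: set_lebesgue_integral_def)
qed

lemma mk_l2_add:
  assumes "sq_integrable f" "sq_integrable g"
  shows "mk_l2 (\<lambda>x. f x + g x) = mk_l2 f + mk_l2 g"
proof (rule l2_eqI)
  show "AE x in lborel. rep_l2 (mk_l2 (\<lambda>x. f x + g x)) x = rep_l2 (mk_l2 f + mk_l2 g) x"
    using rep_mk_l2[OF sq_integrable_add[OF assms]] rep_mk_l2[OF assms(1)] rep_mk_l2[OF assms(2)]
        rep_l2_plus[of "mk_l2 f" "mk_l2 g"]
    by eventually_elim simp
qed

lemma mk_l2_cmult:
  assumes "sq_integrable f" 
  shows "mk_l2 (\<lambda>x. c * f x) = scaleC c (mk_l2 f)"
proof (rule l2_eqI)
  show "AE x in lborel. rep_l2 (mk_l2 (\<lambda>x. c * f x)) x = rep_l2 (scaleC c (mk_l2 f)) x"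
    using rep_mk_l2[OF sq_integrable_cmult[OF assms, of c]] rep_mk_l2[OF assms] rep_l2_scaleC[of c
        "mk_l2 f"]
    by eventually_elim simp
qed

lemma sq_integrable_diff:
  "sq_integrable f \<Longrightarrow> sq_integrable g \<Longrightarrow> sq_integrable (\<lambda>x. f x - g x)"
  using sq_integrable_add[of f "\<lambda>x. -1 * g x"] sq_integrable_cmult[of g "-1"] by simp

lemma mk_l2_diff:
  assumes "sq_integrable f" "sq_integrable g"
  shows "mk_l2 (\<lambda>x. f x - g x) = mk_l2 f - mk_l2 g"
proof (rule l2_eqI)
  show "AE x in lborel. rep_l2 (mk_l2 (\<lambda>x. f x - g x)) x = rep_l2 (mk_l2 f - mk_l2 g) x"
    using rep_mk_l2[OF sq_integrable_diff[OF assms]] rep_mk_l2[OF assms(1)] rep_mk_l2[OF assms(2)]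
        rep_l2_minus[of "mk_l2 f" "mk_l2 g"]
    by eventually_elim simp
qed

lemma l2_tendsto_dominated:
  assumes s: "\<And>n. sq_integrable (s n)" and f: "sq_integrable f" and w: "sq_integrable w"
    and le: "\<And>n x. cmod (s n x) \<le> cmod (w x)" and lim: "\<And>x. (\<lambda>n. s n x) \<longlonglongrightarrow> f x"
  shows "(\<lambda>n. mk_l2 (s n)) \<longlonglongrightarrow> mk_l2 f"
proof -
  have [measurable]: "\<And>n. s n \<in> borel_measurable borel" "f \<in> borel_measurable borel"
    using s f by (auto simp: sq_integrable_def)
  have fw: "cmod (f x) \<le> cmod (w x)" for x
    using le lim[of x, THEN tendsto_norm] by (intro LIMSEQ_le_const2) auto
  have "(\<lambda>n. LINT x|lborel. (cmod (s n x - f x))\<^sup>2) \<longlonglongrightarrow> (LINT x|(lborel::real measure). (0::real))"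
  proof (rule integral_dominated_convergence[where w = "\<lambda>x. 4 * (cmod (w x))\<^sup>2"])
    show "integrable lborel (\<lambda>x. 4 * (cmod (w x))\<^sup>2)" using w by (simp add: sq_integrable_def)
    show "AE x in lborel. (\<lambda>n. (cmod (s n x - f x))\<^sup>2) \<longlonglongrightarrow> 0"
      using lim by (auto intro!: AE_I2 tendsto_eq_intros)
    have "(cmod (s n x - f x))\<^sup>2 \<le> 4 * (cmod (w x))\<^sup>2" for n x
    proof -
      have "cmod (s n x - f x) \<le> 2 * cmod (w x)"
        using norm_triangle_ineq4[of "s n x" "f x"] le[of n x] fw[of x] by simp
      then have "(cmod (s n x - f x))\<^sup>2 \<le> (2 * cmod (w x))\<^sup>2" by (rule power_mono) simp
      then show ?thesis by (simp add: power_mult_distrib)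
    qed
    then show "\<And>n. AE x in lborel. norm ((cmod (s n x - f x))\<^sup>2) \<le> 4 * (cmod (w x))\<^sup>2" by simp
  qed auto
  then have "(\<lambda>n. (norm (mk_l2 (s n) - mk_l2 f))\<^sup>2) \<longlonglongrightarrow> 0"
    by (simp add: mk_l2_diff[OF s f, symmetric] norm_mk_l2 sq_integrable_diff s f)
  then have "(\<lambda>n. sqrt ((norm (mk_l2 (s n) - mk_l2 f))\<^sup>2)) \<longlonglongrightarrow> sqrt 0"
    by (rule tendsto_real_sqrt)
  then show ?thesis by (simp add: LIM_zero_iff tendsto_norm_zero_iff)
qed

subsection \<open>Density of test functions\<close>

definition test_set :: "real set \<Rightarrow> l2 set" where
  "test_set S = {mk_l2 \<phi> | \<phi>. \<exists>\<phi>'. test_fun S \<phi> \<phi>'}"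

lemma LIMSEQ_in_closure:
  fixes s :: "nat \<Rightarrow> 'a::metric_space"
  assumes "\<And>n. s n \<in> S" "s \<longlonglongrightarrow> l" shows "l \<in> closure S"
  using assms closure_sequential[of l S] by blast

lemma test_fun_continuous: "test_fun S \<phi> \<phi>' \<Longrightarrow> continuous_on A \<phi>"
  unfolding test_fun_def
  by (intro continuous_at_imp_continuous_on) (auto intro: has_vector_derivative_continuous)

lemma test_fun_support:
  assumes "test_fun S \<phi> \<phi>'"
  obtains K where "compact K" "K \<subseteq> S" "\<And>x. x \<notin> K \<Longrightarrow> \<phi> x = 0" "\<And>x. x \<notin> K \<Longrightarrow> \<phi>' x = 0"
proof -
  from assms obtain K where K: "compact K" "K \<subseteq> S" "\<And>x. x \<notin> K \<Longrightarrow> \<phi> x = 0"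
    and d: "\<And>x. (\<phi> has_vector_derivative \<phi>' x) (at x)"
    unfolding test_fun_def by auto
  have "\<phi>' x = 0" if "x \<notin> K" for x
  proof -
    have "open (- K)" using K(1) by (simp add: compact_imp_closed open_Compl)
    have "((\<lambda>_. 0) has_vector_derivative \<phi>' x) (at x)"
      by (rule has_vector_derivative_transform_within_open[OF d \<open>open (- K)\<close>]) (use that K(3) in
          auto)
    moreover have "((\<lambda>_. 0::complex) has_vector_derivative 0) (at x)" by simp
    ultimately show ?thesis by (rule vector_derivative_unique_at)
  qed
  with K show ?thesis by (intro that[of K])
qed

lemma sq_integrable_compact_support:
  assumes "continuous_on UNIV \<phi>" "compact K" "\<And>x. x \<notin> K \<Longrightarrow> \<phi> x = 0"
  shows "sq_integrable \<phi>"
proof -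
  obtain a where a: "\<And>x. x \<in> K \<Longrightarrow> \<bar>x\<bar> \<le> a"
    using compact_imp_bounded[OF assms(2)] unfolding bounded_iff by auto
  have "bounded (\<phi> ` {-a..a})"
    by (intro compact_imp_bounded compact_continuous_image continuous_on_subset[OF assms(1)]) auto
  then obtain C where C: "\<And>x. x \<in> {-a..a} \<Longrightarrow> cmod (\<phi> x) \<le> C"
    unfolding bounded_iff by blast
  show ?thesis
  proof (rule sq_integrable_indicator_mult)
    show "\<phi> \<in> borel_measurable lborel"
      using borel_measurable_continuous_onI[OF assms(1)] by simp
    show "cmod (\<phi> x) \<le> C" if "x \<in> {-a..a}" for x using C that by simp
    show "\<phi> x = 0" if "x \<notin> {-a..a}" for x
    proof -
      have "x \<notin> K" using a[of x] that by (auto simp: abs_le_iff)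
      then show ?thesis by (rule assms(3))
    qed
  qed
qed

lemma test_fun_sq_integrable:
  assumes "test_fun S \<phi> \<phi>'" shows "sq_integrable \<phi>" "sq_integrable \<phi>'"
proof -
  obtain K where K: "compact K" "\<And>x. x \<notin> K \<Longrightarrow> \<phi> x = 0" "\<And>x. x \<notin> K \<Longrightarrow> \<phi>' x = 0"
    using test_fun_support[OF assms] by metis
  show "sq_integrable \<phi>" "sq_integrable \<phi>'"
    using K assms test_fun_continuous[OF assms]
    by (auto simp: test_fun_def intro: sq_integrable_compact_support[where K = K])
qed

lemma test_fun_add:
  assumes "test_fun S \<phi> \<phi>'" "test_fun S \<psi> \<psi>'"
  shows "test_fun S (\<lambda>x. \<phi> x + \<psi> x) (\<lambda>x. \<phi>' x + \<psi>' x)"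
proof -
  from assms obtain K K' where "compact K" "K \<subseteq> S" "\<forall>x. x \<notin> K \<longrightarrow> \<phi> x = 0"
    "compact K'" "K' \<subseteq> S" "\<forall>x. x \<notin> K' \<longrightarrow> \<psi> x = 0"
    unfolding test_fun_def by auto
  then have "\<exists>K. compact K \<and> K \<subseteq> S \<and> (\<forall>x. x \<notin> K \<longrightarrow> \<phi> x + \<psi> x = 0)"
    by (intro exI[of _ "K \<union> K'"]) auto
  then show ?thesis
    using assms unfolding test_fun_def
    by (auto intro!: has_vector_derivative_add continuous_on_add)
qed

lemma test_fun_cmult:
  assumes "test_fun S \<phi> \<phi>'"
  shows "test_fun S (\<lambda>x. c * \<phi> x) (\<lambda>x. c * \<phi>' x)"
proof -
  from assms obtain K where K: "compact K" "K \<subseteq> S" "\<forall>x. x \<notin> K \<longrightarrow> \<phi> x = 0"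
    unfolding test_fun_def by auto
  then have "\<exists>K. compact K \<and> K \<subseteq> S \<and> (\<forall>x. x \<notin> K \<longrightarrow> c * \<phi> x = 0)"
    by (intro exI[of _ K]) auto
  then show ?thesis
    using assms unfolding test_fun_def
    by (auto intro!: has_vector_derivative_mult_right continuous_on_mult continuous_on_const)
qed

lemma test_fun_cnj:
  assumes "test_fun S \<phi> \<phi>'"
  shows "test_fun S (\<lambda>x. cnj (\<phi> x)) (\<lambda>x. cnj (\<phi>' x))"
proof -
  from assms obtain K where K: "compact K" "K \<subseteq> S" "\<forall>x. x \<notin> K \<longrightarrow> \<phi> x = 0"
    unfolding test_fun_def by auto
  then have "\<exists>K. compact K \<and> K \<subseteq> S \<and> (\<forall>x. x \<notin> K \<longrightarrow> cnj (\<phi> x) = 0)"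
    by (intro exI[of _ K]) auto
  then show ?thesis
    using assms unfolding test_fun_def
    by (auto intro!: has_vector_derivative_cnj continuous_on_cnj)
qed

lemma test_fun_mono: "test_fun S \<phi> \<phi>' \<Longrightarrow> S \<subseteq> S' \<Longrightarrow> test_fun S' \<phi> \<phi>'"
  unfolding test_fun_def by blast

lemma test_set_add: "f \<in> test_set S \<Longrightarrow> g \<in> test_set S \<Longrightarrow> f + g \<in> test_set S"
proof -
  assume "f \<in> test_set S" "g \<in> test_set S"
  then obtain \<phi> \<phi>' \<psi> \<psi>' where *: "f = mk_l2 \<phi>" "test_fun S \<phi> \<phi>'" "g = mk_l2 \<psi>" "test_fun S \<psi> \<psi>'"
    unfolding test_set_def by blast
  have "f + g = mk_l2 (\<lambda>x. \<phi> x + \<psi> x)"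
    using * by (simp add: mk_l2_add test_fun_sq_integrable(1))
  then show ?thesis using test_fun_add[OF *(2,4)] unfolding test_set_def by blast
qed

lemma test_set_scaleC: "f \<in> test_set S \<Longrightarrow> scaleC c f \<in> test_set S"
proof -
  assume "f \<in> test_set S"
  then obtain \<phi> \<phi>' where *: "f = mk_l2 \<phi>" "test_fun S \<phi> \<phi>'"
    unfolding test_set_def by blast
  have "scaleC c f = mk_l2 (\<lambda>x. c * \<phi> x)"
    using * by (simp add: mk_l2_cmult test_fun_sq_integrable(1))
  then show ?thesis using test_fun_cmult[OF *(2)] unfolding test_set_def by blast
qed

lemma scaleC_minus: "scaleC c f - scaleC c g = scaleC c (f - g)"
proof (rule l2_eqI)
  show "AE x in lborel. rep_l2 (scaleC c f - scaleC c g) x = rep_l2 (scaleC c (f - g)) x"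
    using rep_l2_minus[of "scaleC c f" "scaleC c g"] rep_l2_minus[of f g] rep_l2_scaleC[of c f]
      rep_l2_scaleC[of c g] rep_l2_scaleC[of c "f - g"]
    by eventually_elim (simp add: right_diff_distrib)
qed

lemma closure_test_add:
  assumes "f \<in> closure (test_set S)" "g \<in> closure (test_set S)"
  shows "f + g \<in> closure (test_set S)"
proof -
  from assms obtain s t where s: "\<And>n. s n \<in> test_set S" "s \<longlonglongrightarrow> f" "\<And>n. t n \<in> test_set S" "t \<longlonglongrightarrow> g"
    unfolding closure_sequential by auto
  then have "\<And>n. s n + t n \<in> test_set S" "(\<lambda>n. s n + t n) \<longlonglongrightarrow> f + g"
    by (auto intro: test_set_add tendsto_add)
  then show ?thesis unfolding closure_sequential by (intro exI[of _ "\<lambda>n. s n + t n"]) auto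
qed

lemma closure_test_scaleC:
  assumes "f \<in> closure (test_set S)"
  shows "scaleC c f \<in> closure (test_set S)"
proof -
  from assms obtain s where s: "\<And>n. s n \<in> test_set S" "s \<longlonglongrightarrow> f" unfolding closure_sequential by auto
  have "(\<lambda>n. norm (scaleC c (s n) - scaleC c f)) \<longlonglongrightarrow> cmod c * 0"
    unfolding scaleC_minus norm_scaleC
    using s(2) by (intro tendsto_intros) (simp add: LIM_zero tendsto_norm_zero)
  then have "(\<lambda>n. scaleC c (s n)) \<longlonglongrightarrow> scaleC c f"
    by (simp add: LIM_zero_iff tendsto_norm_zero_iff)
  then show ?thesis
    by (intro LIMSEQ_in_closure[where s = "\<lambda>n. scaleC c (s n)"] test_set_scaleC s(1))
qed

lemma zero_in_test_set: "0 \<in> test_set S"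
proof -
  have "test_fun S (\<lambda>_. 0) (\<lambda>_. 0)" unfolding test_fun_def by (auto intro!: exI[of _ "{}"])
  moreover have "mk_l2 (\<lambda>_. 0) = 0" by (simp add: zero_l2_def)
  ultimately show ?thesis unfolding test_set_def by (auto intro!: exI[of _ "\<lambda>_. 0"])
qed

lemma closure_test_diff:
  assumes "f \<in> closure (test_set S)" "g \<in> closure (test_set S)"
  shows "f - g \<in> closure (test_set S)"
  using closure_test_add[OF assms(1) closure_test_scaleC[OF assms(2), of "-1"]]
  by (simp add: minus_l2_def uminus_l2_def)

text \<open>Squaring smooths the kink of the positive part just enough: the square is continuously
  differentiable, which is the regularity \<open>test_fun\<close> asks for.\<close>

lemma has_real_derivative_max0_sq:
  "((\<lambda>x. (max 0 x)\<^sup>2) has_real_derivative 2 * max 0 x) (at x)" for x :: real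
proof -
  consider "x < 0" | "x > 0" | "x = 0" by linarith
  then show ?thesis
  proof cases
    case 1
    have "((\<lambda>x. 0) has_real_derivative 2 * max 0 x) (at x)" using 1 by simp
    then show ?thesis
      by (rule has_field_derivative_transform_within_open[where S = "{..<0}"]) (use 1 in auto)
  next
    case 2
    have "((\<lambda>x. x\<^sup>2) has_real_derivative 2 * max 0 x) (at x)" using 2 by (auto intro!:
        derivative_eq_intros)
    then show ?thesis
      by (rule has_field_derivative_transform_within_open[where S = "{0<..}"]) (use 2 in auto)
  next
    case 3
    have "((\<lambda>h. (max 0 h)\<^sup>2 / h) \<longlongrightarrow> 0) (at (0::real))"
    proof (rule Lim_null_comparison)
      show "\<forall>\<^sub>F h in at (0::real). norm ((max 0 h)\<^sup>2 / h) \<le> \<bar>h\<bar>"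
        by (auto simp: max_def power2_eq_square intro!: always_eventually)
      show "((\<lambda>h::real. \<bar>h\<bar>) \<longlongrightarrow> 0) (at 0)" by (auto intro!: tendsto_eq_intros)
    qed
    then show ?thesis using 3 by (simp add: has_field_derivative_iff)
  qed
qed

text \<open>The positive part confines the function to \<open>{c..d}\<close>. As \<open>k\<close>
  grows it tends to 1 at every interior point, so \<open>k\<close> acts as a steepness parameter in
  approximating an indicator.\<close>

lemma test_fun_bump:
  fixes c d :: real
  assumes "c \<le> d" "{c..d} \<subseteq> S"
  shows "\<exists>\<phi>'. test_fun S (\<lambda>x. of_real (1 - exp (- k * (max 0 ((x - c) * (d - x)))\<^sup>2))) \<phi>'"
proof -
  let ?p = "\<lambda>x. (x - c) * (d - x)"
  let ?r' = "\<lambda>x. exp (- k * (max 0 (?p x))\<^sup>2) * (k * (2 * max 0 (?p x) * (c + d - 2 * x)))"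
  have "((\<lambda>x. 1 - exp (- k * (max 0 (?p x))\<^sup>2)) has_real_derivative ?r' x) (at x)" for x
  proof -
    have p: "(?p has_real_derivative (c + d - 2 * x)) (at x)"
      by (auto intro!: derivative_eq_intros simp: algebra_simps)
    have "((\<lambda>x. (max 0 (?p x))\<^sup>2) has_real_derivative 2 * max 0 (?p x) * (c + d - 2 * x)) (at x)"
      using DERIV_chain2[OF has_real_derivative_max0_sq p] .
    from DERIV_diff[OF DERIV_const DERIV_fun_exp[OF DERIV_cmult[OF this, of "-k"]]]
    show ?thesis by simp
  qed
  then have "((\<lambda>x. of_real (1 - exp (- k * (max 0 (?p x))\<^sup>2)) :: complex) has_vector_derivative
      of_real (?r' x)) (at x)" for x
    by (intro has_vector_derivative_of_real) (auto simp:
        has_real_derivative_iff_has_vector_derivative)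
  moreover have "continuous_on UNIV (\<lambda>x. of_real (?r' x) :: complex)"
    by (intro continuous_intros)
  moreover have "max 0 (?p x) = 0" if "x \<notin> {c..d}" for x
    using that assms(1) by (auto simp: max_def zero_le_mult_iff)
  ultimately show ?thesis
    unfolding test_fun_def using assms
    by (intro exI[of _ "\<lambda>x. of_real (?r' x)"] conjI allI exI[of _ "{c..d}"] impI compact_Icc)
        simp_all
qed

lemma sq_integrable_indicator:
  assumes "A \<in> sets borel" "A \<subseteq> {a..b}" shows "sq_integrable (indicator A)"
  by (rule sq_integrable_indicator_mult[where C = 1]) (use assms in \<open>auto simp: indicator_def\<close>)

lemma interval_indicator_in_closure_test:
  assumes "{c<..<d} \<subseteq> {\<alpha><..<\<beta>}"
  shows "mk_l2 (indicator {c<..<d}) \<in> closure (test_set {\<alpha><..<\<beta>})"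
proof (cases "c < d")
  case False
  then have "(indicator {c<..<d} :: real \<Rightarrow> complex) = (\<lambda>_. 0)" by (auto simp: fun_eq_iff)
  then have "mk_l2 (indicator {c<..<d}) = 0" by (simp add: zero_l2_def)
  then show ?thesis using zero_in_test_set closure_subset by fastforce
next
  case True
  \<comment> \<open>Supports have to be compact inside the open interval, so the bump sits on an
    interval shrunk by \<open>e n\<close> while its steepness \<open>n\<close> grows. The factor
    \<open>(d - c) / 2\<close> keeps the shrunk interval nonempty for every
    \<open>n\<close>.\<close>
  define e where "e n = (d - c) / 2 * inverse (real (Suc n))" for n
  have e: "e n > 0" "e n \<le> (d - c) / 2" for n
  proof -
    show "e n > 0" using True by (simp add: e_def)
    have "inverse (real (Suc n)) \<le> 1" by (simp add: inverse_le_1_iff)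
    then have "e n \<le> (d - c) / 2 * 1" unfolding e_def using True by (intro mult_left_mono) auto
    then show "e n \<le> (d - c) / 2" by simp
  qed
  have e0: "e \<longlonglongrightarrow> 0"
    unfolding e_def by (rule tendsto_mult_right_zero[OF LIMSEQ_inverse_real_of_nat])
  define p where "p n x = max 0 ((x - (c + e n)) * ((d - e n) - x))" for n x
  define s where "s n x = (of_real (1 - exp (- real n * (p n x)\<^sup>2)) :: complex)" for n x
  have sub: "{c + e n..d - e n} \<subseteq> {c<..<d}" for n using e(1)[of n] by auto
  have t: "\<exists>\<phi>'. test_fun {\<alpha><..<\<beta>} (s n) \<phi>'" for n
    unfolding s_def p_def using sub[of n] assms e(2)[of n] by (intro test_fun_bump) auto
  have "(\<lambda>n. mk_l2 (s n)) \<longlonglongrightarrow> mk_l2 (indicator {c<..<d})"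
  proof (rule l2_tendsto_dominated)
    show "sq_integrable (s n)" for n using t test_fun_sq_integrable by blast
    show ind: "sq_integrable (indicator {c<..<d})" "sq_integrable (indicator {c<..<d})"
      by (auto intro!: sq_integrable_indicator[of _ c d])
    have p0: "p n x = 0" if "x \<notin> {c<..<d}" for n x
      using that e[of n] by (auto simp: p_def max_def zero_le_mult_iff)
    show "cmod (s n x) \<le> cmod (indicator {c<..<d} x)" for n x
    proof (cases "x \<in> {c<..<d}")
      case True
      have "cmod (s n x) = \<bar>1 - exp (- real n * (p n x)\<^sup>2)\<bar>" unfolding s_def norm_of_real ..
      moreover have "exp (- real n * (p n x)\<^sup>2) \<le> 1" by simp
      ultimately have "cmod (s n x) \<le> 1" using exp_gt_zero[of "- real n * (p n x)\<^sup>2"] by linarith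
      then show ?thesis using True by simp
    qed (simp add: s_def p0)
    show "(\<lambda>n. s n x) \<longlonglongrightarrow> indicator {c<..<d} x" for x
    proof (cases "x \<in> {c<..<d}")
      case False
      then show ?thesis by (simp add: s_def p0)
    next
      case True
      have "(\<lambda>n. p n x) \<longlonglongrightarrow> max 0 ((x - (c + 0)) * ((d - 0) - x))"
        unfolding p_def by (intro tendsto_intros e0)
      moreover have "max 0 ((x - (c + 0)) * ((d - 0) - x)) > 0" using True by simp
      ultimately have "filterlim (\<lambda>n. (p n x)\<^sup>2 * real n) at_top sequentially"
        by (intro filterlim_tendsto_pos_mult_at_top[OF tendsto_power _
            filterlim_real_sequentially]) auto
      then have "filterlim (\<lambda>n. - real n * (p n x)\<^sup>2) at_bot sequentially"
        by (simp add: filterlim_uminus_at_top mult.commute)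
      then have "(\<lambda>n. exp (- real n * (p n x)\<^sup>2)) \<longlonglongrightarrow> 0"
        by (rule filterlim_compose[OF exp_at_bot])
      then have "(\<lambda>n. of_real (1 - exp (- real n * (p n x)\<^sup>2)) :: complex) \<longlonglongrightarrow> of_real (1 - 0)"
        by (intro tendsto_intros)
      then show ?thesis using True by (simp add: s_def)
    qed
  qed
  moreover have "mk_l2 (s n) \<in> test_set {\<alpha><..<\<beta>}" for n
    unfolding test_set_def using t[of n] by blast
  ultimately show ?thesis
    by (intro LIMSEQ_in_closure[of "\<lambda>n. mk_l2 (s n)"])
qed

text \<open>Dynkin's argument: open intervals form an intersection-stable generator of the Borel
  sets, and the sets whose trace on the interval can be approximated are closed under complements
  and countable disjoint unions.\<close>

lemma indicator_in_closure_test: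
  assumes "A \<in> sets borel"
  shows "mk_l2 (indicator (A \<inter> {\<alpha><..<\<beta>})) \<in> closure (test_set {\<alpha><..<\<beta>})" (is "?P A")
proof -
  let ?G = "range (\<lambda>(a::real, b). {a<..<b})"
  have sq: "sq_integrable (indicator (A \<inter> {\<alpha><..<\<beta>}))" if "A \<in> sets borel" for A :: "real set"
    using that by (intro sq_integrable_indicator[of _ \<alpha> \<beta>]) auto
  have G: "sets borel = sigma_sets UNIV ?G"
    using arg_cong[OF borel_eq_box[where 'a = real], of sets] by (simp add: box_real)
  have "A \<in> sigma_sets UNIV ?G" using assms G by simp
  have empty: "?P {}"
  proof -
    have "mk_l2 (indicator {\<alpha><..<\<alpha>}) \<in> closure (test_set {\<alpha><..<\<beta>})"
      by (rule interval_indicator_in_closure_test) simp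
    moreover have "{} \<inter> {\<alpha><..<\<beta>} = {\<alpha><..<\<alpha>}" by simp
    ultimately show ?thesis by (simp only:)
  qed
  show ?thesis
  proof (rule sigma_sets_induct_disjoint[where P = ?P, OF _ _ \<open>A \<in> sigma_sets UNIV ?G\<close>])
    show "Int_stable ?G"
    proof (rule Int_stableI)
      fix A B assume "A \<in> ?G" "B \<in> ?G"
      then obtain a b c d where "A = {a<..<b}" "B = {c<..<d}" by auto
      then have "A \<inter> B = (\<lambda>(a, b). {a<..<b}) (max a c, min b d)" by auto
      then show "A \<inter> B \<in> ?G" by (rule range_eqI)
    qed
    show "?G \<subseteq> Pow UNIV" by simp
  next
    fix B assume "B \<in> ?G"
    then obtain a b where B: "B = {a<..<b}" by auto
    have "B \<inter> {\<alpha><..<\<beta>} = {max a \<alpha><..<min b \<beta>}" unfolding B by auto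
    moreover have "{max a \<alpha><..<min b \<beta>} \<subseteq> {\<alpha><..<\<beta>}" by auto
    ultimately show "?P B" using interval_indicator_in_closure_test[of "max a \<alpha>" "min b \<beta>" \<alpha> \<beta>] by
        simp
  next
    show "?P {}" by (rule empty)
  next
    fix B assume B: "B \<in> sigma_sets UNIV ?G" "?P B"
    have "mk_l2 (\<lambda>x. indicator {\<alpha><..<\<beta>} x - indicator (B \<inter> {\<alpha><..<\<beta>}) x) = mk_l2 (indicator
        {\<alpha><..<\<beta>}) - mk_l2 (indicator (B \<inter> {\<alpha><..<\<beta>}))"
      using B(1)[folded G] by (intro mk_l2_diff sq) (auto intro: sq_integrable_indicator[of _ \<alpha> \<beta>])
    moreover have "(\<lambda>x. indicator {\<alpha><..<\<beta>} x - indicator (B \<inter> {\<alpha><..<\<beta>}) x) = (indicator ((UNIV -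
        B) \<inter> {\<alpha><..<\<beta>}) :: real \<Rightarrow> complex)"
      by (auto simp: indicator_def)
    ultimately show "?P (UNIV - B)"
      using closure_test_diff[OF interval_indicator_in_closure_test[OF subset_refl] B(2)] by simp
  next
    fix B :: "nat \<Rightarrow> real set"
    assume d: "disjoint_family B" and B: "range B \<subseteq> sigma_sets UNIV ?G" and P: "\<And>i. ?P (B i)"
    have Bm: "B i \<in> sets borel" for i using B[folded G] by blast
    define C where "C n = (\<Union>i<n. B i)" for n
    have Cm: "C n \<in> sets borel" for n unfolding C_def using Bm by auto
    have PC: "?P (C n)" for n
    proof (induction n)
      case 0
      have "C 0 = {}" by (simp add: C_def)
      then show ?case using empty by (simp only:)
    next
      case (Suc n)
      have dj: "C n \<inter> B n = {}" 
      proof -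
        have "B i \<inter> B n = {}" if "i < n" for i
          using disjoint_family_onD[OF d, of i n] that by simp
        then show ?thesis unfolding C_def by blast
      qed
      have "mk_l2 (\<lambda>x. indicator (C n \<inter> {\<alpha><..<\<beta>}) x + indicator (B n \<inter> {\<alpha><..<\<beta>}) x) = mk_l2
          (indicator (C n \<inter> {\<alpha><..<\<beta>})) + mk_l2 (indicator (B n \<inter> {\<alpha><..<\<beta>}))"
        by (intro mk_l2_add sq Cm Bm)
      moreover have "(\<lambda>x. indicator (C n \<inter> {\<alpha><..<\<beta>}) x + indicator (B n \<inter> {\<alpha><..<\<beta>}) x) =
          (indicator (C (Suc n) \<inter> {\<alpha><..<\<beta>}) :: real \<Rightarrow> complex)"
      proof
        fix x
        have "C (Suc n) = C n \<union> B n" by (auto simp: C_def lessThan_Suc)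
        then show "indicator (C n \<inter> {\<alpha><..<\<beta>}) x + indicator (B n \<inter> {\<alpha><..<\<beta>}) x = (indicator (C
            (Suc n) \<inter> {\<alpha><..<\<beta>}) x :: complex)"
          using dj by (auto simp: indicator_def)
      qed
      ultimately show ?case using closure_test_add[OF Suc.IH P[of n]] by simp
    qed
    have "(\<lambda>n. mk_l2 (indicator (C n \<inter> {\<alpha><..<\<beta>}))) \<longlonglongrightarrow> mk_l2 (indicator ((\<Union>i. B i) \<inter> {\<alpha><..<\<beta>}))"
    proof (rule l2_tendsto_dominated)
      show "sq_integrable (indicator (C n \<inter> {\<alpha><..<\<beta>}))" for n by (intro sq Cm)
      show "sq_integrable (indicator ((\<Union>i. B i) \<inter> {\<alpha><..<\<beta>}))" using Bm by (intro sq) auto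
      show "sq_integrable (indicator {\<alpha><..<\<beta>})" by (intro sq_integrable_indicator[of _ \<alpha> \<beta>]) auto
      show "cmod (indicator (C n \<inter> {\<alpha><..<\<beta>}) x) \<le> cmod (indicator {\<alpha><..<\<beta>} x)" for n x
        by (auto simp: indicator_def)
      show "(\<lambda>n. indicator (C n \<inter> {\<alpha><..<\<beta>}) x) \<longlonglongrightarrow> (indicator ((\<Union>i. B i) \<inter> {\<alpha><..<\<beta>}) x :: complex)"
          for x
      proof (rule tendsto_eventually)
        have "\<forall>\<^sub>F n in sequentially. x \<in> C n \<longleftrightarrow> x \<in> (\<Union>i. B i)"
        proof (cases "x \<in> (\<Union>i. B i)")
          case True
          then obtain i where "x \<in> B i" by auto
          then show ?thesis using True unfolding C_def
            by (auto intro!: eventually_mono[OF eventually_gt_at_top[of i]])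
        qed (auto simp: C_def)
        then show "\<forall>\<^sub>F n in sequentially. indicator (C n \<inter> {\<alpha><..<\<beta>}) x = (indicator ((\<Union>i. B i) \<inter>
            {\<alpha><..<\<beta>}) x :: complex)"
          by eventually_elim (simp only: indicator_def Int_iff)
      qed
    qed
    then have "mk_l2 (indicator ((\<Union>i. B i) \<inter> {\<alpha><..<\<beta>})) \<in> closure (closure (test_set {\<alpha><..<\<beta>}))"
      by (intro LIMSEQ_in_closure[OF PC])
    then show "?P (\<Union>i. B i)" by simp
  qed
qed

text \<open>Simple functions converge to the representative pointwise and stay below twice its
  modulus, so dominated convergence gives convergence in \<open>l2\<close>. Cut to the interval,
  each of them is a finite combination of indicators.\<close>

theorem test_set_dense:
  assumes "f \<in> L2_on {\<alpha><..<\<beta>}"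
  shows "f \<in> closure (test_set {\<alpha><..<\<beta>})"
proof -
  let ?S = "{\<alpha><..<\<beta>}"
  have "rep_l2 f \<in> borel_measurable borel" using measurable_rep_l2[of f] by simp
  from borel_measurable_implies_sequence_metric[OF this, of 0]
  obtain F where F: "\<And>i. simple_function borel (F i)" "\<And>x. (\<lambda>i. F i x) \<longlonglongrightarrow> rep_l2 f x"
    "\<And>i x. cmod (F i x) \<le> 2 * cmod (rep_l2 f x)"
    by auto
  define s where "s i x = indicator ?S x * F i x" for i x
  have Fm[measurable]: "F i \<in> borel_measurable borel" for i
    using borel_measurable_simple_function[OF F(1)[of i]] .
  have s_sq: "sq_integrable (s i)" for i
  proof (rule sq_integrable_bound[where f = "rep_l2 f" and C = 2])
    show "s i \<in> borel_measurable lborel" unfolding s_def by measurable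
    show "AE x in lborel. cmod (s i x) \<le> 2 * cmod (rep_l2 f x)"
      using F(3)[of i] by (auto simp: s_def indicator_def intro!: AE_I2)
  qed simp
  have fin: "finite B \<Longrightarrow> B \<subseteq> range (F i) \<Longrightarrow>
      sq_integrable (\<lambda>x. \<Sum>y\<in>B. y * indicator ((F i -` {y}) \<inter> ?S) x) \<and>
      mk_l2 (\<lambda>x. \<Sum>y\<in>B. y * indicator ((F i -` {y}) \<inter> ?S) x) \<in> closure (test_set ?S)" for i B
  proof (induction B rule: finite_induct)
    case empty
    have "mk_l2 (\<lambda>_. 0) = 0" by (simp add: zero_l2_def)
    then show ?case using zero_in_test_set closure_subset by (fastforce simp: sq_integrable_def)
  next
    case (insert y B)
    have m: "F i -` {y} \<in> sets borel"
      using simple_functionD(2)[OF F(1)[of i], of "{y}"] by simp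
    have sq: "sq_integrable (indicator ((F i -` {y}) \<inter> ?S))"
      using m by (intro sq_integrable_indicator[of _ \<alpha> \<beta>]) auto
    have 1: "mk_l2 (\<lambda>x. y * indicator ((F i -` {y}) \<inter> ?S) x) \<in> closure (test_set ?S)"
      unfolding mk_l2_cmult[OF sq] by (intro closure_test_scaleC indicator_in_closure_test m)
    have IH: "sq_integrable (\<lambda>x. \<Sum>y\<in>B. y * indicator ((F i -` {y}) \<inter> ?S) x)"
        "mk_l2 (\<lambda>x. \<Sum>y\<in>B. y * indicator ((F i -` {y}) \<inter> ?S) x) \<in> closure (test_set ?S)"
      using insert by blast+
    have 2: "mk_l2 (\<lambda>x. y * indicator ((F i -` {y}) \<inter> ?S) x + (\<Sum>y\<in>B. y * indicator ((F i -` {y}) \<inter>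
        ?S) x)) \<in> closure (test_set ?S)"
      unfolding mk_l2_add[OF sq_integrable_cmult[OF sq] IH(1)] by (rule closure_test_add[OF 1
          IH(2)])
    show ?case
      unfolding sum.insert[OF insert.hyps]
      using 2 sq_integrable_add[OF sq_integrable_cmult[OF sq] IH(1)] by blast
  qed
  have s_eq: "s i = (\<lambda>x. \<Sum>y\<in>range (F i). y * indicator ((F i -` {y}) \<inter> ?S) x)" for i
  proof
    fix x
    have fr: "finite (range (F i))" using simple_functionD(1)[OF F(1)[of i]] by simp
    have "(\<Sum>y\<in>range (F i). y * indicator ((F i -` {y}) \<inter> ?S) x) = (\<Sum>y\<in>range (F i). if y = F i x
        then y * indicator ?S x else 0)"
      by (intro sum.cong) (auto simp: indicator_def)
    then show "s i x = (\<Sum>y\<in>range (F i). y * indicator ((F i -` {y}) \<inter> ?S) x)"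
      using fr by (simp add: s_def sum.delta mult.commute)
  qed
  have s_cl: "mk_l2 (s i) \<in> closure (test_set ?S)" for i
    unfolding s_eq using fin[of "range (F i)" i] simple_functionD(1)[OF F(1)[of i]] by simp
  let ?f = "\<lambda>x. indicator ?S x * rep_l2 f x"
  have fsq: "sq_integrable ?f"
    by (rule sq_integrable_bound[where f = "rep_l2 f" and C = 1]) (auto simp: indicator_def)
  have "(\<lambda>i. mk_l2 (s i)) \<longlonglongrightarrow> mk_l2 ?f"
  proof (rule l2_tendsto_dominated[where w = "\<lambda>x. 2 * rep_l2 f x"])
    show "sq_integrable (\<lambda>x. 2 * rep_l2 f x)" by (intro sq_integrable_cmult) simp
    show "cmod (s n x) \<le> cmod (2 * rep_l2 f x)" for n x
      using F(3)[of n x] by (auto simp: s_def indicator_def norm_mult)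
    show "(\<lambda>n. s n x) \<longlonglongrightarrow> ?f x" for x
      unfolding s_def by (intro tendsto_intros F(2))
  qed (use s_sq fsq in auto)
  then have "mk_l2 ?f \<in> closure (closure (test_set ?S))"
    by (intro LIMSEQ_in_closure[OF s_cl])
  moreover have "mk_l2 ?f = f"
  proof (rule l2_eqI)
    have "AE x in lborel. x \<notin> ?S \<longrightarrow> rep_l2 f x = 0" using assms by (simp add: L2_on_def)
    then show "AE x in lborel. rep_l2 (mk_l2 ?f) x = rep_l2 f x"
      using rep_mk_l2[OF fsq] by eventually_elim (auto simp: indicator_def)
  qed
  ultimately show ?thesis by simp
qed

subsection \<open>Weak derivatives\<close>

text \<open>The hypothesis uses the bilinear pairing and the inner product the Hermitian one;
  conjugating test functions passes between them. Density then makes \<open>h\<close> orthogonal to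
  itself.\<close>

lemma l2_eq_zero_if_orthogonal_tests:
  assumes h: "h \<in> L2_on {\<alpha><..<\<beta>}"
    and orth: "\<And>\<phi> \<phi>'. test_fun {\<alpha><..<\<beta>} \<phi> \<phi>' \<Longrightarrow> (LINT x|lborel. rep_l2 h x * \<phi> x) = 0"
  shows "h = 0"
proof -
  have 0: "h \<bullet> g = 0" if gt: "g \<in> test_set {\<alpha><..<\<beta>}" for g
  proof -
    obtain \<phi> \<phi>' where g: "g = mk_l2 \<phi>" "test_fun {\<alpha><..<\<beta>} \<phi> \<phi>'"
      using gt unfolding test_set_def by blast
    have sq: "sq_integrable \<phi>" by (rule test_fun_sq_integrable(1)[OF g(2)])
    have [measurable]: "\<phi> \<in> borel_measurable borel" using sq by (simp add: sq_integrable_def)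
    have "h \<bullet> g = (LINT x|lborel. rep_l2 h x \<bullet> \<phi> x)"
      unfolding g(1) inner_l2_def using rep_mk_l2[OF sq]
      by (intro integral_cong_AE) (auto elim!: eventually_mono)
    also have "\<dots> = (LINT x|lborel. Re (rep_l2 h x * cnj (\<phi> x)))"
      by (simp add: inner_complex_def)
    also have "\<dots> = Re (LINT x|lborel. rep_l2 h x * cnj (\<phi> x))"
      by (rule integral_Re) (intro integrable_mult_sq sq_integrable_rep sq_integrable_cnj sq)
    finally show ?thesis using orth[OF test_fun_cnj[OF g(2)]] by simp
  qed
  have "h \<bullet> h = 0"
    by (rule continuous_constant_on_closure[of "test_set {\<alpha><..<\<beta>}" "\<lambda>g. h \<bullet> g"])
      (use 0 test_set_dense[OF h] in \<open>auto intro!: continuous_intros\<close>)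
  then show ?thesis by simp
qed

lemma set_integral_mult_support:
  fixes f g :: "real \<Rightarrow> complex"
  assumes "\<And>x. x \<notin> S \<Longrightarrow> g x = 0"
  shows "(LINT x:S|lborel. f x * g x) = (LINT x|lborel. f x * g x)"
  unfolding set_lebesgue_integral_def using assms
  by (intro Bochner_Integration.integral_cong) (auto simp: indicator_def)

lemma weak_deriv_alt:
  "weak_deriv S f g \<longleftrightarrow> (\<forall>\<phi> \<phi>'. test_fun S \<phi> \<phi>' \<longrightarrow>
     (LINT x|lborel. rep_l2 f x * \<phi>' x) = - (LINT x|lborel. rep_l2 g x * \<phi> x))"
proof -
  have "(LINT x:S|lborel. rep_l2 f x * \<phi>' x) = (LINT x|lborel. rep_l2 f x * \<phi>' x)"
    "(LINT x:S|lborel. rep_l2 g x * \<phi> x) = (LINT x|lborel. rep_l2 g x * \<phi> x)"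
    if t: "test_fun S \<phi> \<phi>'" for \<phi> \<phi>'
  proof -
    obtain K where "K \<subseteq> S" "\<And>x. x \<notin> K \<Longrightarrow> \<phi> x = 0" "\<And>x. x \<notin> K \<Longrightarrow> \<phi>' x = 0"
      using test_fun_support[OF t] by metis
    then have "\<And>x. x \<notin> S \<Longrightarrow> \<phi> x = 0" "\<And>x. x \<notin> S \<Longrightarrow> \<phi>' x = 0" by blast+
    then show "(LINT x:S|lborel. rep_l2 f x * \<phi>' x) = (LINT x|lborel. rep_l2 f x * \<phi>' x)"
      "(LINT x:S|lborel. rep_l2 g x * \<phi> x) = (LINT x|lborel. rep_l2 g x * \<phi> x)"
      by (simp_all add: set_integral_mult_support)
  qed
  then show ?thesis unfolding weak_deriv_def by auto
qed

lemma weak_deriv_mono: "weak_deriv S f g \<Longrightarrow> S' \<subseteq> S \<Longrightarrow> weak_deriv S' f g"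
  unfolding weak_deriv_alt using test_fun_mono by blast

definition restr :: "real set \<Rightarrow> l2 \<Rightarrow> l2" where
  "restr A f = mk_l2 (\<lambda>x. indicator A x * rep_l2 f x)"

lemma rep_restr:
  assumes "A \<in> sets borel"
  shows "AE x in lborel. rep_l2 (restr A f) x = indicator A x * rep_l2 f x"
  unfolding restr_def
proof (rule rep_mk_l2, rule sq_integrable_bound[where f = "rep_l2 f" and C = 1])
  show "(\<lambda>x. indicator A x * rep_l2 f x) \<in> borel_measurable lborel"
    using assms by measurable
qed (auto simp: indicator_def)

lemma restr_L2_on:
  assumes "A \<in> sets borel" shows "restr A f \<in> L2_on A"
  using rep_restr[OF assms, of f] unfolding L2_on_def by (auto elim!: eventually_mono)

lemma weak_deriv_unique_AE:
  assumes "weak_deriv {\<alpha><..<\<beta>} f g1" "weak_deriv {\<alpha><..<\<beta>} f g2"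
  shows "AE x in lborel. x \<in> {\<alpha><..<\<beta>} \<longrightarrow> rep_l2 g1 x = rep_l2 g2 x"
proof -
  let ?S = "{\<alpha><..<\<beta>}"
  have r: "AE x in lborel. rep_l2 (restr ?S (g1 - g2)) x = indicator ?S x * (rep_l2 g1 x - rep_l2
      g2 x)"
    using rep_restr[of ?S "g1 - g2"] rep_l2_minus[of g1 g2] by (auto elim: eventually_elim2)
  have "restr ?S (g1 - g2) = 0"
  proof (rule l2_eq_zero_if_orthogonal_tests)
    show "restr ?S (g1 - g2) \<in> L2_on ?S" by (rule restr_L2_on) simp
    fix \<phi> \<phi>' assume t: "test_fun ?S \<phi> \<phi>'"
    have sq: "sq_integrable \<phi>" by (rule test_fun_sq_integrable(1)[OF t])
    have [measurable]: "\<phi> \<in> borel_measurable borel" using sq by (simp add: sq_integrable_def)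
    have z: "\<phi> x = 0" if "x \<notin> ?S" for x using t that unfolding test_fun_def by blast
    have "(LINT x|lborel. rep_l2 (restr ?S (g1 - g2)) x * \<phi> x) = (LINT x|lborel. rep_l2 g1 x * \<phi> x
        - rep_l2 g2 x * \<phi> x)"
    proof (rule integral_cong_AE)
      show "AE x in lborel. rep_l2 (restr ?S (g1 - g2)) x * \<phi> x = rep_l2 g1 x * \<phi> x - rep_l2 g2 x
          * \<phi> x"
        using r
      proof eventually_elim
        case (elim x)
        then show ?case using z[of x] by (cases "x \<in> ?S") (simp_all add: left_diff_distrib)
      qed
    qed auto
    also have "\<dots> = (LINT x|lborel. rep_l2 g1 x * \<phi> x) - (LINT x|lborel. rep_l2 g2 x * \<phi> x)"
      by (intro Bochner_Integration.integral_diff integrable_mult_sq sq sq_integrable_rep)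
    also have "\<dots> = 0"
      using assms t unfolding weak_deriv_alt by (metis (no_types, lifting) eq_iff_diff_eq_0
          neg_equal_iff_equal)
    finally show "(LINT x|lborel. rep_l2 (restr ?S (g1 - g2)) x * \<phi> x) = 0" .
  qed
  then have "AE x in lborel. indicator ?S x * (rep_l2 g1 x - rep_l2 g2 x) = 0"
    using r rep_l2_zero by (auto elim: eventually_elim2)
  then show ?thesis by eventually_elim auto
qed

text \<open>On an interval this is \<open>weak_deriv_unique_AE\<close>. A general open set is
  covered by countably many rational intervals, so the exceptional null sets can be united.\<close>

lemma weak_deriv_unique:
  assumes "open S" "g1 \<in> L2_on S" "g2 \<in> L2_on S" "weak_deriv S f g1" "weak_deriv S f g2"
  shows "g1 = g2"
proof (rule l2_eqI)
  let ?I = "{(p, q). p \<in> \<rat> \<and> q \<in> \<rat> \<and> {p<..<q} \<subseteq> S}"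
  have c: "countable ?I"
    by (rule countable_subset[of _ "\<rat> \<times> \<rat>"]) (auto intro: countable_rat)
  have AE: "AE x in lborel. \<forall>i\<in>?I. x \<in> {fst i<..<snd i} \<longrightarrow> rep_l2 g1 x = rep_l2 g2 x"
  proof (subst AE_ball_countable[OF c], intro ballI)
    fix i assume "i \<in> ?I"
    then have "{fst i<..<snd i} \<subseteq> S" by auto
    then show "AE x in lborel. x \<in> {fst i<..<snd i} \<longrightarrow> rep_l2 g1 x = rep_l2 g2 x"
      using assms weak_deriv_mono by (intro weak_deriv_unique_AE[where f = f]) auto
  qed
  moreover have "\<exists>i\<in>?I. x \<in> {fst i<..<snd i}" if xS: "x \<in> S" for x
  proof -
    obtain e where e: "e > 0" "ball x e \<subseteq> S" using openE[OF assms(1) xS] by metis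
    obtain p where p: "p \<in> \<rat>" "x - e < p" "p < x" using Rats_dense_in_real[of "x - e" x] e by auto
    obtain q where q: "q \<in> \<rat>" "x < q" "q < x + e" using Rats_dense_in_real[of x "x + e"] e by auto
    have "{p<..<q} \<subseteq> ball x e" using p q by (auto simp: dist_real_def)
    then show ?thesis using p q e by (intro bexI[of _ "(p, q)"]) auto
  qed
  note cover = this
  moreover have "AE x in lborel. x \<notin> S \<longrightarrow> rep_l2 g1 x = 0" "AE x in lborel. x \<notin> S \<longrightarrow> rep_l2 g2 x = 0"
    using assms(2,3) by (simp_all add: L2_on_def)
  with AE show "AE x in lborel. rep_l2 g1 x = rep_l2 g2 x"
  proof eventually_elim
    case (elim x)
    show ?case
    proof (cases "x \<in> S")
      case True
      then obtain i where "i \<in> ?I" "x \<in> {fst i<..<snd i}" using cover by blast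
      then show ?thesis using elim(1) by blast
    qed (use elim in simp)
  qed
qed

lemma wD_eqI: "open S \<Longrightarrow> g \<in> L2_on S \<Longrightarrow> weak_deriv S f g \<Longrightarrow> wD S f = g"
  unfolding wD_def using weak_deriv_unique by (intro the_equality) blast+

lemma wD_props:
  assumes "open S" "f \<in> H1 S" shows "wD S f \<in> L2_on S" "weak_deriv S f (wD S f)"
proof -
  obtain g where "g \<in> L2_on S" "weak_deriv S f g" using assms(2) by (auto simp: H1_def)
  then show "wD S f \<in> L2_on S" "weak_deriv S f (wD S f)" using wD_eqI[OF assms(1)] by auto
qed

lemma H1I: "f \<in> L2_on S \<Longrightarrow> g \<in> L2_on S \<Longrightarrow> weak_deriv S f g \<Longrightarrow> f \<in> H1 S"
  by (auto simp: H1_def)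

text \<open>A primitive is constant on each side of the support, and the vanishing integral makes
  the two constants equal; subtracting the common value gives compact support.\<close>

lemma test_fun_antiderivative:
  assumes t: "test_fun {\<alpha><..<\<beta>} \<psi> \<psi>'" and int: "(LINT x|lborel. \<psi> x) = 0" and "\<alpha> < \<beta>"
  shows "\<exists>\<phi>. test_fun {\<alpha><..<\<beta>} \<phi> \<psi>"
proof -
  have cont: "continuous_on UNIV \<psi>" by (rule test_fun_continuous[OF t])
  obtain K where K: "compact K" "K \<subseteq> {\<alpha><..<\<beta>}" "\<And>x. x \<notin> K \<Longrightarrow> \<psi> x = 0"
    using test_fun_support[OF t] by metis
  obtain c d where cd: "\<alpha> < c" "c \<le> d" "d < \<beta>" "K \<subseteq> {c..d}"
  proof (cases "K = {}")
    case True
    obtain z where "\<alpha> < z" "z < \<beta>" using dense[OF \<open>\<alpha> < \<beta>\<close>] by auto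
    then show ?thesis using True by (intro that[of z z]) auto
  next
    case False
    obtain c d where "c \<in> K" "\<forall>t\<in>K. c \<le> t" "d \<in> K" "\<forall>t\<in>K. t \<le> d"
      using compact_attains_inf[OF K(1) False] compact_attains_sup[OF K(1) False] by blast
    then show ?thesis using K(2) by (intro that[of c d]) auto
  qed
  have iso: "isCont \<psi> x" for x using cont by (simp add: continuous_on_eq_continuous_at)
  obtain F where F: "\<And>x. (F has_vector_derivative \<psi> x) (at x)"
    using einterval_antiderivative[of "-\<infinity>" "\<infinity>" \<psi>] iso by auto
  have ftc: "F y - F x = (LINT t|lborel. indicator {x..y} t *\<^sub>R \<psi> t)" if "x \<le> y" for x y
    using that F cont
    by (intro integral_FTC_Icc[symmetric])
      (auto intro: has_vector_derivative_at_within continuous_on_subset)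
  have F0: "F x = F c" if "x \<notin> {c..d}" for x
  proof (cases "x < c")
    case True
    have "AE t in lborel. indicator {x..c} t *\<^sub>R \<psi> t = 0"
      using AE_lborel_singleton[of c]
    proof eventually_elim
      case (elim t)
      have "t \<in> {x..c} \<Longrightarrow> t \<notin> K" using elim cd(4) by auto
      then show ?case using K(3)[of t] by (auto simp: indicator_def)
    qed
    then have "(LINT t|lborel. indicator {x..c} t *\<^sub>R \<psi> t) = 0"
      by (rule integral_eq_zero_AE)
    then show ?thesis using ftc[of x c] True by simp
  next
    case False
    then have x: "x > d" using that by auto
    have "(LINT t|lborel. indicator {c..x} t *\<^sub>R \<psi> t) = (LINT t|lborel. \<psi> t)"
    proof (rule Bochner_Integration.integral_cong)
      fix t
      have "\<psi> t = 0" if "t \<notin> {c..d}" using that K(3) cd(4) by blast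
      then show "indicator {c..x} t *\<^sub>R \<psi> t = \<psi> t" using x by (auto simp: indicator_def)
    qed simp
    then show ?thesis using ftc[of c x] x cd int by simp
  qed
  have "test_fun {\<alpha><..<\<beta>} (\<lambda>x. F x - F c) \<psi>"
    unfolding test_fun_def
  proof (intro conjI allI exI[of _ "{c..d}"] impI)
    show "((\<lambda>x. F x - F c) has_vector_derivative \<psi> x) (at x)" for x
      using has_vector_derivative_diff[OF F has_vector_derivative_const] by simp
  qed (use cont cd F0 in auto)
  then show ?thesis by (intro exI[where x = "\<lambda>x. F x - F c"])
qed

text \<open>Test functions of integral zero are derivatives of test functions, so \<open>h\<close>
  pairs to zero with them. Its pairing with an arbitrary test function is then proportional to the
  integral of that function, as for a constant.\<close>

lemma du_Bois_Reymond:
  assumes h: "h \<in> L2_on {\<alpha><..<\<beta>}" and "\<alpha> < \<beta>"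
    and orth: "\<And>\<phi> \<phi>'. test_fun {\<alpha><..<\<beta>} \<phi> \<phi>' \<Longrightarrow> (LINT x|lborel. rep_l2 h x * \<phi>' x) = 0"
  shows "\<exists>c. AE x in lborel. x \<in> {\<alpha><..<\<beta>} \<longrightarrow> rep_l2 h x = c"
proof -
  let ?S = "{\<alpha><..<\<beta>}"
  let ?N = "\<lambda>\<psi>. LINT x|lborel. rep_l2 h x * \<psi> x"
  have N0: "?N \<psi> = 0" if "test_fun ?S \<psi> \<psi>'" "(LINT x|lborel. \<psi> x) = 0" for \<psi> \<psi>'
    using test_fun_antiderivative[OF that \<open>\<alpha> < \<beta>\<close>] orth by blast
  have ti: "integrable lborel \<psi>" if "test_fun ?S \<psi> \<psi>'" for \<psi> \<psi>'
  proof -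
    have "integrable lborel (\<lambda>x. indicator {\<alpha>..\<beta>} x * \<psi> x)"
      by (rule integrable_mult_sq[OF sq_integrable_indicator[of _ \<alpha> \<beta>]
          test_fun_sq_integrable(1)[OF that]]) auto
    moreover have "(\<lambda>x. indicator {\<alpha>..\<beta>} x * \<psi> x) = \<psi>"
      using that unfolding test_fun_def by (force simp: indicator_def fun_eq_iff)
    ultimately show ?thesis by simp
  qed
  have ni: "integrable lborel (\<lambda>x. rep_l2 h x * \<psi> x)" if "test_fun ?S \<psi> \<psi>'" for \<psi> \<psi>'
    by (intro integrable_mult_sq sq_integrable_rep test_fun_sq_integrable(1)[OF that])
  show ?thesis
  proof (cases "\<forall>\<psi> \<psi>'. test_fun ?S \<psi> \<psi>' \<longrightarrow> (LINT x|lborel. \<psi> x) = 0")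
    \<comment> \<open>Here every test function is a derivative, hence \<open>h = 0\<close>;
      splitting off this case avoids exhibiting a bump of nonzero integral.\<close>
    case True
    then have "h = 0" using N0 by (intro l2_eq_zero_if_orthogonal_tests[OF h]) blast
    then show ?thesis using rep_l2_zero by (intro exI[of _ 0]) (auto elim!: eventually_mono)
  next
    case False
    then obtain \<psi>0 \<psi>0' where t0: "test_fun ?S \<psi>0 \<psi>0'" and m0: "(LINT x|lborel. \<psi>0 x) \<noteq> 0" by blast
    \<comment> \<open>The factor of proportionality, read off from a single test function of nonzero
      integral.\<close>
    define c where "c = ?N \<psi>0 / (LINT x|lborel. \<psi>0 x)"
    let ?c = "mk_l2 (\<lambda>x. c * indicator ?S x)"
    have sqc: "sq_integrable (\<lambda>x. c * indicator ?S x)"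
      by (intro sq_integrable_cmult sq_integrable_indicator[of _ \<alpha> \<beta>]) auto
    have rep: "AE x in lborel. rep_l2 (h - ?c) x = rep_l2 h x - c * indicator ?S x"
      using rep_l2_minus[of h ?c] rep_mk_l2[OF sqc] by (auto elim: eventually_elim2)
    have "h - ?c = 0"
    proof (rule l2_eq_zero_if_orthogonal_tests)
      have "AE x in lborel. x \<notin> ?S \<longrightarrow> rep_l2 h x = 0" using h by (simp add: L2_on_def)
      then show "h - ?c \<in> L2_on ?S" unfolding L2_on_def mem_Collect_eq using rep by
          eventually_elim auto
      fix \<psi> \<psi>' assume t: "test_fun ?S \<psi> \<psi>'"
      have [measurable]: "\<psi> \<in> borel_measurable borel"
        using test_fun_sq_integrable(1)[OF t] by (simp add: sq_integrable_def)
      define r where "r = (LINT x|lborel. \<psi> x) / (LINT x|lborel. \<psi>0 x)"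
      have t2: "test_fun ?S (\<lambda>x. \<psi> x + (- r) * \<psi>0 x) (\<lambda>x. \<psi>' x + (- r) * \<psi>0' x)"
        by (intro test_fun_add test_fun_cmult t t0)
      have "(LINT x|lborel. \<psi> x + (- r) * \<psi>0 x) = 0"
        using ti[OF t] ti[OF t0] m0 by (simp add: r_def)
      from N0[OF t2 this] have "(LINT x|lborel. rep_l2 h x * \<psi> x + (- r) * (rep_l2 h x * \<psi>0 x)) = 0"
        by (simp add: algebra_simps)
      then have 1: "?N \<psi> = r * ?N \<psi>0" using ni[OF t] ni[OF t0] by simp
      have z: "\<psi> x = 0" if "x \<notin> ?S" for x using t that unfolding test_fun_def by blast
      have "(LINT x|lborel. rep_l2 (h - ?c) x * \<psi> x) = (LINT x|lborel. rep_l2 h x * \<psi> x - c * \<psi> x)"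
      proof (rule integral_cong_AE)
        show "AE x in lborel. rep_l2 (h - ?c) x * \<psi> x = rep_l2 h x * \<psi> x - c * \<psi> x"
          using rep
        proof eventually_elim
          case (elim x)
          then show ?case using z[of x] by (cases "x \<in> ?S") (simp_all add: left_diff_distrib)
        qed
      qed auto
      also have "\<dots> = ?N \<psi> - c * (LINT x|lborel. \<psi> x)"
        using ni[OF t] ti[OF t] by simp
      also have "\<dots> = 0" using 1 m0 by (simp add: c_def r_def)
      finally show "(LINT x|lborel. rep_l2 (h - ?c) x * \<psi> x) = 0" .
    qed
    then have "AE x in lborel. rep_l2 h x - c * indicator ?S x = 0"
      using rep rep_l2_zero by (auto elim: eventually_elim2)
    then show ?thesis by (intro exI[of _ c]) (auto elim!: eventually_mono)
  qed
qed

text \<open>\<open>F\<close> is the continuous representative of \<open>f\<close> on the closed interval and \<open>f'\<close> the weak derivative;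
  nothing is said about \<open>f\<close> and \<open>f'\<close> outside the interval.\<close>

definition sobolev :: "real \<Rightarrow> real \<Rightarrow> (real \<Rightarrow> complex) \<Rightarrow> l2 \<Rightarrow> l2 \<Rightarrow> bool" where
  "sobolev \<alpha> \<beta> F f f' \<longleftrightarrow> (AE x in lborel. x \<in> {\<alpha><..<\<beta>} \<longrightarrow> rep_l2 f x = F x) \<and> prim_on \<alpha> \<beta> F (rep_l2
      f')"

lemma set_integrable_rep_l2: "set_integrable lborel {\<alpha>..\<beta>} (rep_l2 g)"
proof -
  have "integrable lborel (\<lambda>x. indicator {\<alpha>..\<beta>} x * rep_l2 g x)"
    by (rule integrable_mult_sq[OF sq_integrable_indicator[of _ \<alpha> \<beta>] sq_integrable_rep]) auto
  moreover have "(\<lambda>x. indicator {\<alpha>..\<beta>} x * rep_l2 g x) = (\<lambda>x. indicat_real {\<alpha>..\<beta>} x *\<^sub>R rep_l2 g x)"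
    by (auto simp: indicator_def)
  ultimately show ?thesis by (simp add: set_integrable_def)
qed

lemma prim_on_integral: "prim_on \<alpha> \<beta> (\<lambda>x. c + (LINT t:{\<alpha>..x}|lborel. rep_l2 g t)) (rep_l2 g)"
proof -
  have "AE t in lborel. indicator {\<alpha>..\<alpha>} t *\<^sub>R rep_l2 g t = 0"
    using AE_lborel_singleton[of \<alpha>] by eventually_elim (simp add: indicator_def)
  then have "(LINT t:{\<alpha>..\<alpha>}|lborel. rep_l2 g t) = 0"
    unfolding set_lebesgue_integral_def by (rule integral_eq_zero_AE)
  then show ?thesis by (simp add: prim_on_def set_integrable_rep_l2)
qed

lemma prim_on_test_fun: "test_fun S \<phi> \<phi>' \<Longrightarrow> prim_on \<alpha> \<beta> \<phi> \<phi>'"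
  unfolding test_fun_def
  by (intro prim_on_C1) (auto intro: has_vector_derivative_at_within continuous_on_subset)

lemma prim_on_weak:
  assumes G: "prim_on \<alpha> \<beta> G (rep_l2 g)" and t: "test_fun {\<alpha><..<\<beta>} \<phi> \<phi>'" and ab: "\<alpha> \<le> \<beta>"
  shows "integrable lborel (\<lambda>x. G x * \<phi>' x)"
    "(LINT x|lborel. G x * \<phi>' x) = - (LINT x|lborel. rep_l2 g x * \<phi> x)"
proof -
  obtain K where K: "K \<subseteq> {\<alpha><..<\<beta>}" "\<And>x. x \<notin> K \<Longrightarrow> \<phi> x = 0" "\<And>x. x \<notin> K \<Longrightarrow> \<phi>' x = 0"
    using test_fun_support[OF t] by metis
  then have z: "\<phi> x = 0 \<and> \<phi>' x = 0" if "x \<notin> {\<alpha><..<\<beta>}" for x using that by blast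
  have \<phi>: "prim_on \<alpha> \<beta> \<phi> \<phi>'" by (rule prim_on_test_fun[OF t])
  have P: "prim_on \<alpha> \<beta> (\<lambda>x. G x * \<phi> x) (\<lambda>x. rep_l2 g x * \<phi> x + G x * \<phi>' x)"
    by (rule prim_on_mult[OF G \<phi>])
  have "set_integrable lborel {\<alpha>..\<beta>} (\<lambda>x. \<phi>' x * G x)"
    by (rule prim_on_mult_integrable[OF \<phi> G])
  moreover have "(\<lambda>x. indicat_real {\<alpha>..\<beta>} x *\<^sub>R (\<phi>' x * G x)) = (\<lambda>x. G x * \<phi>' x)"
    using z by (force simp: indicator_def)
  ultimately show i: "integrable lborel (\<lambda>x. G x * \<phi>' x)" by (simp add: set_integrable_def)
  have j: "integrable lborel (\<lambda>x. rep_l2 g x * \<phi> x)"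
    by (intro integrable_mult_sq sq_integrable_rep test_fun_sq_integrable(1)[OF t])
  have "(LINT x:{\<alpha>..\<beta>}|lborel. rep_l2 g x * \<phi> x + G x * \<phi>' x) = 0"
    using prim_onD[OF P, of \<beta>] z[of \<alpha>] z[of \<beta>] ab by simp
  moreover have "(LINT x:{\<alpha>..\<beta>}|lborel. rep_l2 g x * \<phi> x + G x * \<phi>' x) = (LINT x|lborel. rep_l2 g
      x * \<phi> x + G x * \<phi>' x)"
    unfolding set_lebesgue_integral_def using z by (intro Bochner_Integration.integral_cong)
        (force simp: indicator_def)+
  ultimately show "(LINT x|lborel. G x * \<phi>' x) = - (LINT x|lborel. rep_l2 g x * \<phi> x)"
    using i j by (simp add: eq_neg_iff_add_eq_0 add.commute)
qed

lemma sobolev_weak_int: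
  assumes s: "sobolev \<alpha> \<beta> F f f'" and ab: "\<alpha> \<le> \<beta>" and t: "test_fun {\<alpha><..<\<beta>} \<phi> \<phi>'"
  shows "(LINT x|lborel. rep_l2 f x * \<phi>' x) = (LINT x|lborel. F x * \<phi>' x)"
proof (rule integral_cong_AE)
  obtain K where K: "K \<subseteq> {\<alpha><..<\<beta>}" "\<And>x. x \<notin> K \<Longrightarrow> \<phi> x = 0" "\<And>x. x \<notin> K \<Longrightarrow> \<phi>' x = 0"
    using test_fun_support[OF t] by metis
  then have z: "\<phi>' x = 0" if "x \<notin> {\<alpha><..<\<beta>}" for x using that by blast
  have "AE x in lborel. x \<in> {\<alpha><..<\<beta>} \<longrightarrow> rep_l2 f x = F x" using s by (simp add: sobolev_def)
  then show "AE x in lborel. rep_l2 f x * \<phi>' x = F x * \<phi>' x"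
    by eventually_elim (use z in force)
  show "(\<lambda>x. rep_l2 f x * \<phi>' x) \<in> borel_measurable lborel"
    using integrable_mult_sq[OF sq_integrable_rep[of f] test_fun_sq_integrable(2)[OF t]] by simp
  show "(\<lambda>x. F x * \<phi>' x) \<in> borel_measurable lborel"
    using s by (intro borel_measurable_integrable prim_on_weak(1)[OF _ t ab]) (auto simp:
        sobolev_def)
qed

lemma sobolev_imp_weak_deriv:
  assumes "sobolev \<alpha> \<beta> F f f'" "\<alpha> \<le> \<beta>" shows "weak_deriv {\<alpha><..<\<beta>} f f'"
  unfolding weak_deriv_alt using sobolev_weak_int[OF assms] prim_on_weak(2) assms by (auto simp:
      sobolev_def)

text \<open>The primitive \<open>G\<close> of \<open>g\<close> has the same weak derivative as
  \<open>f\<close>, so \<open>du_Bois_Reymond\<close> makes their difference constant.\<close>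

lemma weak_deriv_imp_sobolev:
  assumes w: "weak_deriv {\<alpha><..<\<beta>} f g" and ab: "\<alpha> < \<beta>"
  shows "\<exists>F. sobolev \<alpha> \<beta> F f g"
proof -
  let ?S = "{\<alpha><..<\<beta>}"
  define G where "G x = (LINT t:{\<alpha>..x}|lborel. rep_l2 g t)" for x
  have G: "prim_on \<alpha> \<beta> G (rep_l2 g)" using prim_on_integral[of \<alpha> \<beta> 0 g] by (simp add:
      G_def[abs_def])
  have "bounded (G ` {\<alpha>..\<beta>})"
    by (intro compact_imp_bounded compact_continuous_image prim_on_continuous[OF G]) auto
  then obtain C where C: "\<And>x. x \<in> {\<alpha>..\<beta>} \<Longrightarrow> cmod (G x) \<le> C" unfolding bounded_iff by blast
  have "(\<lambda>x. indicator {\<alpha>..\<beta>} x *\<^sub>R G x) \<in> borel_measurable borel"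
    using borel_measurable_continuous_on_indicator[OF _ prim_on_continuous[OF G]] by simp
  then have Gsq: "sq_integrable (\<lambda>x. indicator {\<alpha>..\<beta>} x *\<^sub>R G x)"
    using C by (intro sq_integrable_indicator_mult[where C = C]) (auto simp: indicator_def)
  let ?G = "mk_l2 (\<lambda>x. indicator {\<alpha>..\<beta>} x *\<^sub>R G x)"
  define h where "h = restr ?S (f - ?G)"
  have rep: "AE x in lborel. rep_l2 h x = (if x \<in> ?S then rep_l2 f x - G x else 0)"
    using rep_restr[OF borel_open[OF open_greaterThanLessThan], of \<alpha> \<beta> "f - ?G"] rep_l2_minus[of f
        ?G] rep_mk_l2[OF Gsq] unfolding h_def
    by eventually_elim (auto simp: indicator_def)
  have sG: "sobolev \<alpha> \<beta> G ?G g"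
    using rep_mk_l2[OF Gsq] G unfolding sobolev_def by (auto elim!: eventually_mono)
  have "\<exists>c. AE x in lborel. x \<in> ?S \<longrightarrow> rep_l2 h x = c"
  proof (rule du_Bois_Reymond[OF _ ab])
    show "h \<in> L2_on ?S" unfolding h_def by (rule restr_L2_on) simp
    fix \<phi> \<phi>' assume t: "test_fun ?S \<phi> \<phi>'"
    obtain K where K: "K \<subseteq> ?S" "\<And>x. x \<notin> K \<Longrightarrow> \<phi> x = 0" "\<And>x. x \<notin> K \<Longrightarrow> \<phi>' x = 0"
      using test_fun_support[OF t] by metis
    then have z: "\<phi>' x = 0" if "x \<notin> ?S" for x using that by blast
    have sq: "sq_integrable \<phi>'" by (rule test_fun_sq_integrable(2)[OF t])
    have i: "integrable lborel (\<lambda>x. rep_l2 f x * \<phi>' x)" by (intro integrable_mult_sq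
        sq_integrable_rep sq)
    note iG = prim_on_weak[OF G t less_imp_le[OF ab]]
    have "(LINT x|lborel. rep_l2 h x * \<phi>' x) = (LINT x|lborel. rep_l2 f x * \<phi>' x - G x * \<phi>' x)"
    proof (rule integral_cong_AE)
      show "AE x in lborel. rep_l2 h x * \<phi>' x = rep_l2 f x * \<phi>' x - G x * \<phi>' x"
        using rep by eventually_elim (use z in \<open>auto simp: algebra_simps\<close>)
      show "(\<lambda>x. rep_l2 h x * \<phi>' x) \<in> borel_measurable lborel"
        using integrable_mult_sq[OF sq_integrable_rep[of h] sq] by simp
      show "(\<lambda>x. rep_l2 f x * \<phi>' x - G x * \<phi>' x) \<in> borel_measurable lborel"
        using i iG(1) by simp
    qed
    also have "\<dots> = 0" using i iG w t unfolding weak_deriv_alt by simp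
    finally show "(LINT x|lborel. rep_l2 h x * \<phi>' x) = 0" .
  qed
  then obtain c where c: "AE x in lborel. x \<in> ?S \<longrightarrow> rep_l2 h x = c" ..
  have "sobolev \<alpha> \<beta> (\<lambda>x. c + G x) f g"
    unfolding sobolev_def
  proof
    show "AE x in lborel. x \<in> ?S \<longrightarrow> rep_l2 f x = c + G x"
      using c rep by eventually_elim (auto simp: algebra_simps)
    show "prim_on \<alpha> \<beta> (\<lambda>x. c + G x) (rep_l2 g)" unfolding G_def by (rule prim_on_integral)
  qed
  then show ?thesis by (intro exI[where x = "\<lambda>x. c + G x"])
qed

subsection \<open>Multiplication, moments and primitives as bounded operators\<close>

text \<open>Weights are functions on the whole line and are cut to the interval only here, so the
  same weight can serve several intervals and the operators below act on all of
  \<open>l2\<close>.\<close>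

definition cut_weight :: "real \<Rightarrow> real \<Rightarrow> (real \<Rightarrow> real) \<Rightarrow> real \<Rightarrow> complex" where
  "cut_weight \<alpha> \<beta> h x = of_real (indicator {\<alpha><..<\<beta>} x * h x)"

definition wmult :: "real \<Rightarrow> real \<Rightarrow> (real \<Rightarrow> real) \<Rightarrow> l2 \<Rightarrow> l2" where
  "wmult \<alpha> \<beta> h f = mk_l2 (\<lambda>x. cut_weight \<alpha> \<beta> h x * rep_l2 f x)"

definition moment :: "real \<Rightarrow> real \<Rightarrow> (real \<Rightarrow> real) \<Rightarrow> l2 \<Rightarrow> complex" where
  "moment \<alpha> \<beta> h f = (LINT x|lborel. cut_weight \<alpha> \<beta> h x * rep_l2 f x)"

definition const_on :: "real \<Rightarrow> real \<Rightarrow> complex \<Rightarrow> l2" where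
  "const_on \<alpha> \<beta> c = mk_l2 (\<lambda>x. c * indicator {\<alpha><..<\<beta>} x)"

definition prim_op :: "real \<Rightarrow> real \<Rightarrow> l2 \<Rightarrow> l2" where
  "prim_op \<alpha> \<beta> g = mk_l2 (\<lambda>x. indicator {\<alpha><..<\<beta>} x * (LINT t:{\<alpha>..x}|lborel. rep_l2 g t))"

lemma cut_weight_bound:
  assumes "continuous_on UNIV h"
  obtains C where "C \<ge> 0" "\<And>x. cmod (cut_weight \<alpha> \<beta> h x) \<le> C"
proof -
  have "bounded (h ` {\<alpha>..\<beta>})"
    by (intro compact_imp_bounded compact_continuous_image continuous_on_subset[OF assms]) auto
  then obtain C where "\<forall>x\<in>{\<alpha>..\<beta>}. \<bar>h x\<bar> \<le> C" by (auto simp: bounded_iff)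
  then have "cmod (cut_weight \<alpha> \<beta> h x) \<le> \<bar>C\<bar>" for x
  proof (cases "x \<in> {\<alpha><..<\<beta>}")
    case True
    then have "\<bar>h x\<bar> \<le> C" using \<open>\<forall>x\<in>{\<alpha>..\<beta>}. \<bar>h x\<bar> \<le> C\<close> by simp
    then show ?thesis using True unfolding cut_weight_def norm_of_real by simp
  qed (simp add: cut_weight_def)
  then show ?thesis by (intro that[of "\<bar>C\<bar>"]) auto
qed

lemma cut_weight_measurable: "continuous_on UNIV h \<Longrightarrow> cut_weight \<alpha> \<beta> h \<in> borel_measurable borel"
proof -
  assume "continuous_on UNIV h"
  then have [measurable]: "h \<in> borel_measurable borel" by (rule borel_measurable_continuous_onI)
  show ?thesis unfolding cut_weight_def[abs_def] by measurable
qed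

lemma sq_integrable_cut_weight:
  assumes "continuous_on UNIV h" shows "sq_integrable (cut_weight \<alpha> \<beta> h)"
proof -
  obtain C where C: "\<And>x. cmod (cut_weight \<alpha> \<beta> h x) \<le> C" using cut_weight_bound[OF assms] by metis
  show ?thesis
    by (rule sq_integrable_indicator_mult[where C = C and a = \<alpha> and b = \<beta>])
      (use C cut_weight_measurable[OF assms] in \<open>auto simp: cut_weight_def\<close>)
qed

lemma sq_integrable_cut_weight_mult:
  assumes "continuous_on UNIV h" shows "sq_integrable (\<lambda>x. cut_weight \<alpha> \<beta> h x * rep_l2 f x)"
proof -
  obtain C where C: "\<And>x. cmod (cut_weight \<alpha> \<beta> h x) \<le> C" using cut_weight_bound[OF assms] by metis
  show ?thesis
    by (rule sq_integrable_bound[OF sq_integrable_rep[of f], where C = C])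
      (use C cut_weight_measurable[OF assms] in \<open>auto simp: norm_mult intro!: mult_right_mono\<close>)
qed

lemma rep_wmult:
  assumes "continuous_on UNIV h"
  shows "AE x in lborel. rep_l2 (wmult \<alpha> \<beta> h f) x = cut_weight \<alpha> \<beta> h x * rep_l2 f x"
  unfolding wmult_def by (rule rep_mk_l2[OF sq_integrable_cut_weight_mult[OF assms]])

lemma wmult_bounded_linear:
  assumes h: "continuous_on UNIV h" shows "bounded_linear (wmult \<alpha> \<beta> h)"
proof -
  obtain C where C: "C \<ge> 0" "\<And>x. cmod (cut_weight \<alpha> \<beta> h x) \<le> C" using cut_weight_bound[OF h] by
      metis
  show ?thesis
  proof (rule bounded_linear_intro[where K = C])
    fix f g r
    show "wmult \<alpha> \<beta> h (f + g) = wmult \<alpha> \<beta> h f + wmult \<alpha> \<beta> h g"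
    proof (rule l2_eqI)
      show "AE x in lborel. rep_l2 (wmult \<alpha> \<beta> h (f + g)) x = rep_l2 (wmult \<alpha> \<beta> h f + wmult \<alpha> \<beta> h
          g) x"
        using rep_wmult[OF h, of \<alpha> \<beta> "f + g"] rep_wmult[OF h, of \<alpha> \<beta> f] rep_wmult[OF h, of \<alpha> \<beta> g]
          rep_l2_plus[of f g] rep_l2_plus[of "wmult \<alpha> \<beta> h f" "wmult \<alpha> \<beta> h g"]
        by eventually_elim (simp add: distrib_left)
    qed
    show "wmult \<alpha> \<beta> h (r *\<^sub>R f) = r *\<^sub>R wmult \<alpha> \<beta> h f"
    proof (rule l2_eqI)
      show "AE x in lborel. rep_l2 (wmult \<alpha> \<beta> h (r *\<^sub>R f)) x = rep_l2 (r *\<^sub>R wmult \<alpha> \<beta> h f) x"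
        using rep_wmult[OF h, of \<alpha> \<beta> "r *\<^sub>R f"] rep_wmult[OF h, of \<alpha> \<beta> f]
          rep_l2_scaleR[of r f] rep_l2_scaleR[of r "wmult \<alpha> \<beta> h f"]
        by eventually_elim simp
    qed
    show "norm (wmult \<alpha> \<beta> h f) \<le> norm f * C"
    proof (rule power2_le_imp_le)
      have "(norm (wmult \<alpha> \<beta> h f))\<^sup>2 = (LINT x|lborel. (cmod (cut_weight \<alpha> \<beta> h x * rep_l2 f x))\<^sup>2)"
        unfolding wmult_def by (rule norm_mk_l2[OF sq_integrable_cut_weight_mult[OF h]])
      also have "\<dots> \<le> (LINT x|lborel. C\<^sup>2 * (cmod (rep_l2 f x))\<^sup>2)"
      proof (rule integral_mono)
        show "integrable lborel (\<lambda>x. (cmod (cut_weight \<alpha> \<beta> h x * rep_l2 f x))\<^sup>2)"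
          using sq_integrable_cut_weight_mult[OF h] by (simp add: sq_integrable_def)
        show "integrable lborel (\<lambda>x. C\<^sup>2 * (cmod (rep_l2 f x))\<^sup>2)"
          using sq_integrable_rep[of f] by (simp add: sq_integrable_def)
        show "(cmod (cut_weight \<alpha> \<beta> h x * rep_l2 f x))\<^sup>2 \<le> C\<^sup>2 * (cmod (rep_l2 f x))\<^sup>2" for x
          unfolding norm_mult power_mult_distrib by (intro mult_right_mono power_mono C) auto
      qed
      finally show "(norm (wmult \<alpha> \<beta> h f))\<^sup>2 \<le> (norm f * C)\<^sup>2"
        by (simp add: norm_l2_sq power_mult_distrib mult.commute)
    qed (use C in auto)
  qed
qed

lemma wmult_commute:
  assumes h: "continuous_on UNIV h"
  shows "wmult \<alpha> \<beta> h f \<bullet> g = f \<bullet> wmult \<alpha> \<beta> h g"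
  unfolding inner_l2_def
proof (rule integral_cong_AE)
  show "AE x in lborel. rep_l2 (wmult \<alpha> \<beta> h f) x \<bullet> rep_l2 g x = rep_l2 f x \<bullet> rep_l2 (wmult \<alpha> \<beta> h
      g) x"
    using rep_wmult[OF h, of \<alpha> \<beta> f] rep_wmult[OF h, of \<alpha> \<beta> g]
    by eventually_elim (simp add: cut_weight_def scaleR_conv_of_real[symmetric])
qed auto

text \<open>Cauchy-Schwarz for the complex pairing, derived from the real inner product: the second
  factor is multiplied by the value \<open>?z\<close> of the pairing itself, which rotates it so
  that the real part is the full squared modulus.\<close>

lemma norm_pairing_le:
  assumes w: "sq_integrable w"
  shows "cmod (LINT x|lborel. w x * rep_l2 f x) \<le> norm (mk_l2 (\<lambda>x. cnj (w x))) * norm f"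
proof -
  let ?z = "LINT x|lborel. w x * rep_l2 f x"
  have sq: "sq_integrable (\<lambda>x. cnj (w x))" by (rule sq_integrable_cnj[OF w])
  let ?g = "scaleC ?z (mk_l2 (\<lambda>x. cnj (w x)))"
  have [measurable]: "w \<in> borel_measurable borel" "(\<lambda>x. cnj (w x)) \<in> borel_measurable borel"
    using w sq by (simp_all add: sq_integrable_def)
  have "f \<bullet> ?g = (LINT x|lborel. Re (cnj ?z * (w x * rep_l2 f x)))"
    unfolding inner_l2_def
  proof (rule integral_cong_AE)
    show "AE x in lborel. rep_l2 f x \<bullet> rep_l2 ?g x = Re (cnj ?z * (w x * rep_l2 f x))"
      using rep_l2_scaleC[of ?z "mk_l2 (\<lambda>x. cnj (w x))"] rep_mk_l2[OF sq]
    proof eventually_elim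
      case (elim x)
      have "rep_l2 f x \<bullet> (z * cnj (w x)) = Re (cnj z * (w x * rep_l2 f x))" for z
        by (simp add: inner_complex_def algebra_simps)
      then show ?case using elim by simp
    qed
  qed auto
  also have "\<dots> = Re (cnj ?z * ?z)"
    using integrable_mult_sq[OF w sq_integrable_rep[of f]] by (subst integral_Re) auto
  also have "\<dots> = (cmod ?z)\<^sup>2" by (simp only: mult.commute[of "cnj _"] complex_mult_cnj
      cmod_power2) simp
  finally have "(cmod ?z)\<^sup>2 \<le> norm f * norm ?g" using norm_cauchy_schwarz[of f ?g] by simp
  then have "cmod ?z * cmod ?z \<le> cmod ?z * (norm (mk_l2 (\<lambda>x. cnj (w x))) * norm f)"
    by (simp add: norm_scaleC power2_eq_square algebra_simps)
  then show ?thesis by (cases "?z = 0") auto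
qed

lemma moment_bounded_linear:
  assumes h: "continuous_on UNIV h" shows "bounded_linear (moment \<alpha> \<beta> h)"
proof (rule bounded_linear_intro[where K = "norm (mk_l2 (\<lambda>x. cnj (cut_weight \<alpha> \<beta> h x)))"])
  fix f g r
  have [measurable]: "cut_weight \<alpha> \<beta> h \<in> borel_measurable borel" by (rule cut_weight_measurable[OF
      h])
  have i: "integrable lborel (\<lambda>x. cut_weight \<alpha> \<beta> h x * rep_l2 f x)" for f
    by (rule integrable_mult_sq[OF sq_integrable_cut_weight[OF h] sq_integrable_rep])
  have "moment \<alpha> \<beta> h (f + g) = (LINT x|lborel. cut_weight \<alpha> \<beta> h x * rep_l2 f x + cut_weight \<alpha> \<beta> h
      x * rep_l2 g x)"
    unfolding moment_def using rep_l2_plus[of f g]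
    by (intro integral_cong_AE) (auto simp: distrib_left elim!: eventually_mono)
  then show "moment \<alpha> \<beta> h (f + g) = moment \<alpha> \<beta> h f + moment \<alpha> \<beta> h g"
    using i by (simp add: moment_def)
  have "moment \<alpha> \<beta> h (r *\<^sub>R f) = (LINT x|lborel. r *\<^sub>R (cut_weight \<alpha> \<beta> h x * rep_l2 f x))"
    unfolding moment_def using rep_l2_scaleR[of r f]
    by (intro integral_cong_AE) (auto simp: distrib_left elim!: eventually_mono)
  then show "moment \<alpha> \<beta> h (r *\<^sub>R f) = r *\<^sub>R moment \<alpha> \<beta> h f"
    by (simp add: moment_def)
  show "norm (moment \<alpha> \<beta> h f) \<le> norm f * norm (mk_l2 (\<lambda>x. cnj (cut_weight \<alpha> \<beta> h x)))"
    unfolding moment_def using norm_pairing_le[OF sq_integrable_cut_weight[OF h]] by (simp add: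
        mult.commute)
qed

lemma sq_integrable_const_on: "sq_integrable (\<lambda>x. c * indicator {\<alpha><..<\<beta>} x)"
  by (intro sq_integrable_cmult sq_integrable_indicator[of _ \<alpha> \<beta>]) auto

lemma rep_const_on: "AE x in lborel. rep_l2 (const_on \<alpha> \<beta> c) x = c * indicator {\<alpha><..<\<beta>} x"
  unfolding const_on_def by (rule rep_mk_l2[OF sq_integrable_const_on])

lemma const_on_alt: "const_on \<alpha> \<beta> c = scaleC c (const_on \<alpha> \<beta> 1)"
  unfolding const_on_def by (subst mk_l2_cmult[symmetric]) (use sq_integrable_const_on[of 1] in
      auto)

lemma const_on_bounded_linear: "bounded_linear (const_on \<alpha> \<beta>)"
proof (rule bounded_linear_intro[where K = "norm (const_on \<alpha> \<beta> 1)"])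
  fix c d r
  show "const_on \<alpha> \<beta> (c + d) = const_on \<alpha> \<beta> c + const_on \<alpha> \<beta> d"
    unfolding const_on_def by (subst mk_l2_add[symmetric]) (auto simp: sq_integrable_const_on
        distrib_right)
  show "const_on \<alpha> \<beta> (r *\<^sub>R c) = r *\<^sub>R const_on \<alpha> \<beta> c"
    unfolding const_on_def scaleR_l2_def
    by (subst mk_l2_cmult[symmetric]) (auto simp: sq_integrable_const_on scaleR_conv_of_real
        mult.assoc)
  show "norm (const_on \<alpha> \<beta> c) \<le> norm c * norm (const_on \<alpha> \<beta> 1)"
    by (subst const_on_alt) (simp add: norm_scaleC)
qed

text \<open>A constant sees of the other factor only a moment. Pairings with constants that are
  merely bounded therefore become small as soon as the moment is.\<close>

lemma inner_wmult_const_on: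
  assumes h: "continuous_on UNIV h"
  shows "wmult \<alpha> \<beta> h f \<bullet> const_on \<alpha> \<beta> c = moment \<alpha> \<beta> h f \<bullet> c"
proof -
  have [measurable]: "cut_weight \<alpha> \<beta> h \<in> borel_measurable borel" by (rule cut_weight_measurable[OF
      h])
  have i: "integrable lborel (\<lambda>x. cut_weight \<alpha> \<beta> h x * rep_l2 f x)"
    by (rule integrable_mult_sq[OF sq_integrable_cut_weight[OF h] sq_integrable_rep])
  have "wmult \<alpha> \<beta> h f \<bullet> const_on \<alpha> \<beta> c = (LINT x|lborel. (cut_weight \<alpha> \<beta> h x * rep_l2 f x) \<bullet> c)"
    unfolding inner_l2_def
  proof (rule integral_cong_AE)
    show "AE x in lborel. rep_l2 (wmult \<alpha> \<beta> h f) x \<bullet> rep_l2 (const_on \<alpha> \<beta> c) x = (cut_weight \<alpha> \<beta> h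
        x * rep_l2 f x) \<bullet> c"
      using rep_wmult[OF h, of \<alpha> \<beta> f] rep_const_on[of \<alpha> \<beta> c]
      by eventually_elim (auto simp: cut_weight_def indicator_def)
  qed auto
  also have "\<dots> = moment \<alpha> \<beta> h f \<bullet> c"
    unfolding moment_def using i by (rule integral_inner_left)
  finally show ?thesis .
qed

lemma norm_integral_Icc_le:
  assumes "x \<le> \<beta>" "\<alpha> \<le> x"
  shows "cmod (LINT t:{\<alpha>..x}|lborel. rep_l2 g t) \<le> sqrt (\<beta> - \<alpha>) * norm g"
proof -
  have sq: "sq_integrable (indicator {\<alpha>..x})" by (rule sq_integrable_indicator[of _ \<alpha> x]) auto
  have "(LINT t:{\<alpha>..x}|lborel. rep_l2 g t) = (LINT t|lborel. indicator {\<alpha>..x} t * rep_l2 g t)"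
    unfolding set_lebesgue_integral_def by (intro Bochner_Integration.integral_cong) (auto simp:
        indicator_def)
  then have "cmod (LINT t:{\<alpha>..x}|lborel. rep_l2 g t) \<le> norm (mk_l2 (\<lambda>t. cnj (indicator {\<alpha>..x} t)))
      * norm g"
    using norm_pairing_le[OF sq, of g] by simp
  also have "norm (mk_l2 (\<lambda>t. cnj (indicator {\<alpha>..x} t))) \<le> sqrt (\<beta> - \<alpha>)"
  proof (rule real_le_rsqrt)
    have "(norm (mk_l2 (\<lambda>t. cnj (indicator {\<alpha>..x} t))))\<^sup>2 = (LINT t|lborel. indicator {\<alpha>..x} t)"
      unfolding norm_mk_l2[OF sq_integrable_cnj[OF sq]]
      by (intro Bochner_Integration.integral_cong) (auto simp: indicator_def)
    also have "\<dots> = x - \<alpha>" using assms by simp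
    finally show "(norm (mk_l2 (\<lambda>t. cnj (indicator {\<alpha>..x} t))))\<^sup>2 \<le> \<beta> - \<alpha>" using assms by simp
  qed
  finally show ?thesis by (simp add: mult_right_mono)
qed

lemma sq_integrable_prim_op:
  "sq_integrable (\<lambda>x. indicator {\<alpha><..<\<beta>} x * (LINT t:{\<alpha>..x}|lborel. rep_l2 g t))"
proof (rule sq_integrable_indicator_mult[where C = "sqrt (\<beta> - \<alpha>) * norm g" and a = \<alpha> and b = \<beta>])
  have "continuous_on {\<alpha>..\<beta>} (\<lambda>x. LINT t:{\<alpha>..x}|lborel. rep_l2 g t)"
    using prim_on_continuous[OF prim_on_integral[of \<alpha> \<beta> 0 g]] by simp
  then have "continuous_on {\<alpha><..<\<beta>} (\<lambda>x. LINT t:{\<alpha>..x}|lborel. rep_l2 g t)"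
    by (rule continuous_on_subset) auto
  from borel_measurable_continuous_on_indicator[OF _ this]
  have "(\<lambda>x. indicator {\<alpha><..<\<beta>} x *\<^sub>R (LINT t:{\<alpha>..x}|lborel. rep_l2 g t)) \<in> borel_measurable borel"
    by simp
  moreover have "(\<lambda>x. indicat_real {\<alpha><..<\<beta>} x *\<^sub>R (LINT t:{\<alpha>..x}|lborel. rep_l2 g t)) = (\<lambda>x.
      indicator {\<alpha><..<\<beta>} x * (LINT t:{\<alpha>..x}|lborel. rep_l2 g t))"
    by (auto simp: indicator_def)
  ultimately show "(\<lambda>x. indicator {\<alpha><..<\<beta>} x * (LINT t:{\<alpha>..x}|lborel. rep_l2 g t)) \<in>
      borel_measurable lborel"
    by simp
next
  fix x assume x: "x \<in> {\<alpha>..\<beta>}"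
  have "cmod (LINT t:{\<alpha>..x}|lborel. rep_l2 g t) \<le> sqrt (\<beta> - \<alpha>) * norm g"
    using norm_integral_Icc_le x by simp
  moreover have "0 \<le> sqrt (\<beta> - \<alpha>) * norm g" using x by simp
  ultimately show "cmod (indicator {\<alpha><..<\<beta>} x * (LINT t:{\<alpha>..x}|lborel. rep_l2 g t)) \<le> sqrt (\<beta> - \<alpha>)
      * norm g"
    by (cases "x \<in> {\<alpha><..<\<beta>}") (simp_all add: norm_mult)
qed auto

lemma rep_prim_op: "AE x in lborel. rep_l2 (prim_op \<alpha> \<beta> g) x = indicator {\<alpha><..<\<beta>} x * (LINT
    t:{\<alpha>..x}|lborel. rep_l2 g t)"
  unfolding prim_op_def by (rule rep_mk_l2[OF sq_integrable_prim_op])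

lemma set_integral_rep_l2_plus:
  "(LINT t:{\<alpha>..x}|lborel. rep_l2 (f + g) t) = (LINT t:{\<alpha>..x}|lborel. rep_l2 f t) + (LINT
      t:{\<alpha>..x}|lborel. rep_l2 g t)"
proof -
  have "(LINT t:{\<alpha>..x}|lborel. rep_l2 (f + g) t) = (LINT t:{\<alpha>..x}|lborel. rep_l2 f t + rep_l2 g t)"
    unfolding set_lebesgue_integral_def using rep_l2_plus[of f g]
    by (intro integral_cong_AE) (auto elim!: eventually_mono)
  then show ?thesis by (simp add: set_integral_add set_integrable_rep_l2)
qed

lemma set_integral_rep_l2_scaleC:
  "(LINT t:{\<alpha>..x}|lborel. rep_l2 (scaleC c f) t) = c * (LINT t:{\<alpha>..x}|lborel. rep_l2 f t)"
proof -
  have "(LINT t:{\<alpha>..x}|lborel. rep_l2 (scaleC c f) t) = (LINT t:{\<alpha>..x}|lborel. c * rep_l2 f t)"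
    unfolding set_lebesgue_integral_def using rep_l2_scaleC[of c f]
    by (intro integral_cong_AE) (auto elim!: eventually_mono)
  then show ?thesis by simp
qed

lemma prim_on_add:
  assumes F: "prim_on \<alpha> \<beta> F (rep_l2 f)" and G: "prim_on \<alpha> \<beta> G (rep_l2 g)"
  shows "prim_on \<alpha> \<beta> (\<lambda>x. F x + G x) (rep_l2 (f + g))"
  unfolding prim_on_def
proof (intro conjI ballI set_integrable_rep_l2)
  fix x assume x: "x \<in> {\<alpha>..\<beta>}"
  show "F x + G x = F \<alpha> + G \<alpha> + (LINT t:{\<alpha>..x}|lborel. rep_l2 (f + g) t)"
    using prim_onD[OF F x] prim_onD[OF G x] by (simp add: set_integral_rep_l2_plus)
qed

lemma prim_on_scaleC:
  assumes F: "prim_on \<alpha> \<beta> F (rep_l2 f)"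
  shows "prim_on \<alpha> \<beta> (\<lambda>x. c * F x) (rep_l2 (scaleC c f))"
  unfolding prim_on_def
proof (intro conjI ballI set_integrable_rep_l2)
  fix x assume x: "x \<in> {\<alpha>..\<beta>}"
  show "c * F x = c * F \<alpha> + (LINT t:{\<alpha>..x}|lborel. rep_l2 (scaleC c f) t)"
    using prim_onD[OF F x] by (simp add: set_integral_rep_l2_scaleC distrib_left[symmetric])
qed

lemma sobolev_add:
  assumes "sobolev \<alpha> \<beta> F f f'" "sobolev \<alpha> \<beta> G g g'"
  shows "sobolev \<alpha> \<beta> (\<lambda>x. F x + G x) (f + g) (f' + g')"
proof -
  have "AE x in lborel. x \<in> {\<alpha><..<\<beta>} \<longrightarrow> rep_l2 f x = F x" "AE x in lborel. x \<in> {\<alpha><..<\<beta>} \<longrightarrow> rep_l2 g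
      x = G x"
    using assms by (simp_all add: sobolev_def)
  then have "AE x in lborel. x \<in> {\<alpha><..<\<beta>} \<longrightarrow> rep_l2 (f + g) x = F x + G x"
    using rep_l2_plus[of f g] by eventually_elim simp
  then show ?thesis using assms prim_on_add by (simp add: sobolev_def)
qed

lemma sobolev_scaleC:
  assumes "sobolev \<alpha> \<beta> F f f'"
  shows "sobolev \<alpha> \<beta> (\<lambda>x. c * F x) (scaleC c f) (scaleC c f')"
proof -
  have "AE x in lborel. x \<in> {\<alpha><..<\<beta>} \<longrightarrow> rep_l2 f x = F x"
    using assms by (simp_all add: sobolev_def)
  then have "AE x in lborel. x \<in> {\<alpha><..<\<beta>} \<longrightarrow> rep_l2 (scaleC c f) x = c * F x"
    using rep_l2_scaleC[of c f] by eventually_elim simp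
  then show ?thesis using assms prim_on_scaleC by (simp add: sobolev_def)
qed

lemma sobolev_scaleR: "sobolev \<alpha> \<beta> F f f' \<Longrightarrow> sobolev \<alpha> \<beta> (\<lambda>x. r *\<^sub>R F x) (r *\<^sub>R f) (r *\<^sub>R f')"
  using sobolev_scaleC[of \<alpha> \<beta> F f f' "of_real r"] by (simp add: scaleR_l2_def scaleR_conv_of_real)

lemma sobolev_diff:
  "sobolev \<alpha> \<beta> F f f' \<Longrightarrow> sobolev \<alpha> \<beta> G g g' \<Longrightarrow> sobolev \<alpha> \<beta> (\<lambda>x. F x - G x) (f - g) (f' - g')"
  using sobolev_add[OF _ sobolev_scaleR[of \<alpha> \<beta> G g g' "-1"], of F f f'] by simp

lemma sobolev_const_on: "sobolev \<alpha> \<beta> (\<lambda>_. c) (const_on \<alpha> \<beta> c) 0"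
  unfolding sobolev_def
proof
  show "AE x in lborel. x \<in> {\<alpha><..<\<beta>} \<longrightarrow> rep_l2 (const_on \<alpha> \<beta> c) x = c"
    using rep_const_on[of \<alpha> \<beta> c] by eventually_elim simp
  have "(LINT t:{\<alpha>..x}|lborel. rep_l2 0 t) = 0" for x
    using set_integral_rep_l2_scaleC[of \<alpha> x 0 0] scaleR_zero_right[of 0, where 'a = l2] by (simp
        add: scaleR_l2_def)
  then show "prim_on \<alpha> \<beta> (\<lambda>_. c) (rep_l2 0)"
    by (simp add: prim_on_def set_integrable_rep_l2)
qed

lemma sobolev_prim_op: "sobolev \<alpha> \<beta> (\<lambda>x. LINT t:{\<alpha>..x}|lborel. rep_l2 g t) (prim_op \<alpha> \<beta> g) g"
  unfolding sobolev_def
proof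
  show "AE x in lborel. x \<in> {\<alpha><..<\<beta>} \<longrightarrow> rep_l2 (prim_op \<alpha> \<beta> g) x = (LINT t:{\<alpha>..x}|lborel. rep_l2 g
      t)"
    using rep_prim_op[of \<alpha> \<beta> g] by eventually_elim simp
qed (use prim_on_integral[of \<alpha> \<beta> 0 g] in simp)

lemma L2_on_const_on: "const_on \<alpha> \<beta> c \<in> L2_on {\<alpha><..<\<beta>}"
  unfolding L2_on_def mem_Collect_eq using rep_const_on[of \<alpha> \<beta> c] by eventually_elim simp

lemma L2_on_prim_op: "prim_op \<alpha> \<beta> g \<in> L2_on {\<alpha><..<\<beta>}"
  unfolding L2_on_def mem_Collect_eq using rep_prim_op[of \<alpha> \<beta> g] by eventually_elim simp

lemma L2_on_add: "f \<in> L2_on S \<Longrightarrow> g \<in> L2_on S \<Longrightarrow> f + g \<in> L2_on S"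
  unfolding L2_on_def mem_Collect_eq using rep_l2_plus[of f g] by (auto elim: eventually_elim2)

lemma L2_on_scaleC: "f \<in> L2_on S \<Longrightarrow> scaleC c f \<in> L2_on S"
  unfolding L2_on_def mem_Collect_eq using rep_l2_scaleC[of c f] by (auto elim: eventually_elim2)

lemma prim_op_bounded_linear: "bounded_linear (prim_op \<alpha> \<beta>)"
proof (rule bounded_linear_intro[where K = "\<bar>\<beta> - \<alpha>\<bar>"])
  fix f g r
  show "prim_op \<alpha> \<beta> (f + g) = prim_op \<alpha> \<beta> f + prim_op \<alpha> \<beta> g"
    unfolding prim_op_def
    by (subst mk_l2_add[symmetric]) (auto simp: sq_integrable_prim_op set_integral_rep_l2_plus
        distrib_left)
  show "prim_op \<alpha> \<beta> (r *\<^sub>R f) = r *\<^sub>R prim_op \<alpha> \<beta> f"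
    unfolding prim_op_def scaleR_l2_def
    by (subst mk_l2_cmult[symmetric]) (auto simp: sq_integrable_prim_op set_integral_rep_l2_scaleC
        algebra_simps)
  show "norm (prim_op \<alpha> \<beta> g) \<le> norm g * \<bar>\<beta> - \<alpha>\<bar>"
  proof (cases "\<alpha> < \<beta>")
    case False
    then have "prim_op \<alpha> \<beta> g = 0" by (simp add: prim_op_def zero_l2_def)
    then show ?thesis by simp
  next
    case True
    show ?thesis
    proof (rule power2_le_imp_le)
      let ?k = "\<lambda>x. indicator {\<alpha><..<\<beta>} x * (LINT t:{\<alpha>..x}|lborel. rep_l2 g t)"
      have "(norm (prim_op \<alpha> \<beta> g))\<^sup>2 = (LINT x|lborel. (cmod (?k x))\<^sup>2)"
        unfolding prim_op_def by (rule norm_mk_l2[OF sq_integrable_prim_op])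
      also have "\<dots> \<le> (LINT x|lborel. indicator {\<alpha><..<\<beta>} x * ((\<beta> - \<alpha>) * (norm g)\<^sup>2))"
      proof (rule integral_mono)
        show "integrable lborel (\<lambda>x. (cmod (?k x))\<^sup>2)"
          using sq_integrable_prim_op[of \<alpha> \<beta> g] by (simp add: sq_integrable_def)
        show "integrable lborel (\<lambda>x. indicator {\<alpha><..<\<beta>} x * ((\<beta> - \<alpha>) * (norm g)\<^sup>2))"
          by (rule integrable_mult_left) (use True in \<open>auto intro!: integrable_real_indicator
              simp: emeasure_lborel_Ioo\<close>)
        fix x :: real
        show "(cmod (?k x))\<^sup>2 \<le> indicator {\<alpha><..<\<beta>} x * ((\<beta> - \<alpha>) * (norm g)\<^sup>2)"
        proof (cases "x \<in> {\<alpha><..<\<beta>}")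
          case x: True
          have "(cmod (LINT t:{\<alpha>..x}|lborel. rep_l2 g t))\<^sup>2 \<le> (sqrt (\<beta> - \<alpha>) * norm g)\<^sup>2"
            using x by (intro power_mono norm_integral_Icc_le) auto
          then show ?thesis using x True by (simp add: power_mult_distrib)
        qed simp
      qed
      also have "\<dots> = (norm g * \<bar>\<beta> - \<alpha>\<bar>)\<^sup>2"
        using True by (simp add: power2_eq_square algebra_simps)
      finally show "(norm (prim_op \<alpha> \<beta> g))\<^sup>2 \<le> (norm g * \<bar>\<beta> - \<alpha>\<bar>)\<^sup>2" .
    qed simp
  qed
qed

lemma sobolev_unique:
  assumes s: "sobolev \<alpha> \<beta> F f f'" and f: "f \<in> L2_on {\<alpha><..<\<beta>}"
  shows "f = const_on \<alpha> \<beta> (F \<alpha>) + prim_op \<alpha> \<beta> f'"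
proof (rule l2_eqI)
  have 1: "AE x in lborel. x \<in> {\<alpha><..<\<beta>} \<longrightarrow> rep_l2 f x = F x"
    and p: "prim_on \<alpha> \<beta> F (rep_l2 f')" using s by (auto simp: sobolev_def)
  have 2: "AE x in lborel. x \<notin> {\<alpha><..<\<beta>} \<longrightarrow> rep_l2 f x = 0" using f by (simp add: L2_on_def)
  show "AE x in lborel. rep_l2 f x = rep_l2 (const_on \<alpha> \<beta> (F \<alpha>) + prim_op \<alpha> \<beta> f') x"
    using 1 2 rep_l2_plus[of "const_on \<alpha> \<beta> (F \<alpha>)" "prim_op \<alpha> \<beta> f'"] rep_const_on[of \<alpha> \<beta> "F \<alpha>"]
        rep_prim_op[of \<alpha> \<beta> f']
  proof eventually_elim
    case (elim x)
    then show ?case using prim_onD[OF p, of x] by (cases "x \<in> {\<alpha><..<\<beta>}") auto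
  qed
qed

lemma integral_Icc_cut_weight:
  fixes f :: "real \<Rightarrow> complex"
  assumes [measurable]: "(\<lambda>x. indicator {\<alpha>..\<beta>} x *\<^sub>R f x) \<in> borel_measurable borel"
  shows "(LINT x:{\<alpha>..\<beta>}|lborel. f x) = (LINT x|lborel. indicator {\<alpha><..<\<beta>} x *\<^sub>R f x)"
  unfolding set_lebesgue_integral_def
proof (rule integral_cong_AE)
  have "(\<lambda>x. indicator {\<alpha><..<\<beta>} x *\<^sub>R (indicator {\<alpha>..\<beta>} x *\<^sub>R f x)) \<in> borel_measurable borel" by
      measurable
  moreover have "(\<lambda>x. indicator {\<alpha><..<\<beta>} x *\<^sub>R (indicator {\<alpha>..\<beta>} x *\<^sub>R f x)) = (\<lambda>x. indicat_real
      {\<alpha><..<\<beta>} x *\<^sub>R f x)"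
    by (auto simp: indicator_def)
  ultimately show "(\<lambda>x. indicator {\<alpha><..<\<beta>} x *\<^sub>R f x) \<in> borel_measurable lborel" by simp
  show "AE x in lborel. indicat_real {\<alpha>..\<beta>} x *\<^sub>R f x = indicat_real {\<alpha><..<\<beta>} x *\<^sub>R f x"
    using AE_lborel_singleton[of \<alpha>] AE_lborel_singleton[of \<beta>]
    by eventually_elim (auto simp: indicator_def)
qed simp

section \<open>Integration by parts with weights\<close>

definition C1 :: "(real \<Rightarrow> real) \<Rightarrow> (real \<Rightarrow> real) \<Rightarrow> bool" where
  "C1 h h' \<longleftrightarrow> (\<forall>x. (h has_real_derivative h' x) (at x)) \<and> continuous_on UNIV h'"

lemma C1_continuous: "C1 h h' \<Longrightarrow> continuous_on UNIV h" "C1 h h' \<Longrightarrow> continuous_on UNIV h'"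
  unfolding C1_def by (auto intro!: continuous_at_imp_continuous_on DERIV_isCont)

lemma C1_prim_on: "C1 h h' \<Longrightarrow> prim_on \<alpha> \<beta> (\<lambda>x. of_real (h x)) (\<lambda>x. of_real (h' x))"
  unfolding C1_def
  by (intro prim_on_C1 has_vector_derivative_of_real continuous_on_of_real)
    (auto simp: has_real_derivative_iff_has_vector_derivative intro:
        has_vector_derivative_at_within continuous_on_subset)

lemma prim_on_cnj:
  assumes "prim_on \<alpha> \<beta> G g" shows "prim_on \<alpha> \<beta> (\<lambda>x. cnj (G x)) (\<lambda>x. cnj (g x))"
  unfolding prim_on_def
proof (intro conjI ballI)
  have e: "(\<lambda>x. indicat_real A x *\<^sub>R cnj (g x)) = (\<lambda>x. cnj (indicat_real A x *\<^sub>R g x))" for A by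
      auto
  show "set_integrable lborel {\<alpha>..\<beta>} (\<lambda>x. cnj (g x))"
    using prim_on_integrable[OF assms] unfolding set_integrable_def e by (rule integrable_cnj)
  fix x assume "x \<in> {\<alpha>..\<beta>}"
  from prim_onD[OF assms this]
  have "cnj (G x) = cnj (G \<alpha>) + cnj (LINT t:{\<alpha>..x}|lborel. g t)" by (metis complex_cnj_add)
  then show "cnj (G x) = cnj (G \<alpha>) + (LINT t:{\<alpha>..x}|lborel. cnj (g t))"
    unfolding set_lebesgue_integral_def e Bochner_Integration.integral_cnj .
qed

theorem ibp_moment:
  assumes s: "sobolev \<alpha> \<beta> F f f'" and h: "C1 h h'" and ab: "\<alpha> \<le> \<beta>"
  shows "moment \<alpha> \<beta> h f' + moment \<alpha> \<beta> h' f = h \<beta> *\<^sub>R F \<beta> - h \<alpha> *\<^sub>R F \<alpha>"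
proof -
  have p: "prim_on \<alpha> \<beta> F (rep_l2 f')" and r: "AE x in lborel. x \<in> {\<alpha><..<\<beta>} \<longrightarrow> rep_l2 f x = F x"
    using s by (auto simp: sobolev_def)
  have P: "prim_on \<alpha> \<beta> (\<lambda>x. of_real (h x) * F x) (\<lambda>x. of_real (h' x) * F x + of_real (h x) *
      rep_l2 f' x)"
    by (rule prim_on_mult[OF C1_prim_on[OF h] p])
  have i: "integrable lborel (\<lambda>x. cut_weight \<alpha> \<beta> h x * rep_l2 f' x)" "integrable lborel (\<lambda>x.
      cut_weight \<alpha> \<beta> h' x * rep_l2 f x)"
    by (intro integrable_mult_sq sq_integrable_cut_weight sq_integrable_rep C1_continuous[OF h])+
  have m: "(\<lambda>x. indicator {\<alpha>..\<beta>} x *\<^sub>R (of_real (h' x) * F x + of_real (h x) * rep_l2 f' x)) \<in>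
      borel_measurable borel"
    using prim_on_integrable[OF P] unfolding set_integrable_def by (simp add:
        borel_measurable_integrable)
  have "moment \<alpha> \<beta> h f' + moment \<alpha> \<beta> h' f = (LINT x|lborel. cut_weight \<alpha> \<beta> h x * rep_l2 f' x +
      cut_weight \<alpha> \<beta> h' x * rep_l2 f x)"
    unfolding moment_def using i by simp
  also have "\<dots> = (LINT x|lborel. indicator {\<alpha><..<\<beta>} x *\<^sub>R (indicator {\<alpha>..\<beta>} x *\<^sub>R (of_real (h' x)
      * F x + of_real (h x) * rep_l2 f' x)))"
  proof (rule integral_cong_AE)
    show "AE x in lborel. cut_weight \<alpha> \<beta> h x * rep_l2 f' x + cut_weight \<alpha> \<beta> h' x * rep_l2 f x
      = indicator {\<alpha><..<\<beta>} x *\<^sub>R (indicator {\<alpha>..\<beta>} x *\<^sub>R (of_real (h' x) * F x + of_real (h x) *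
          rep_l2 f' x))"
      using r by eventually_elim (auto simp: cut_weight_def indicator_def)
    show "(\<lambda>x. cut_weight \<alpha> \<beta> h x * rep_l2 f' x + cut_weight \<alpha> \<beta> h' x * rep_l2 f x) \<in>
        borel_measurable lborel"
      using i by (intro borel_measurable_add) auto
    show "(\<lambda>x. indicator {\<alpha><..<\<beta>} x *\<^sub>R (indicator {\<alpha>..\<beta>} x *\<^sub>R (of_real (h' x) * F x + of_real (h
        x) * rep_l2 f' x))) \<in> borel_measurable lborel"
      using borel_measurable_scaleR[OF _ m, of "indicator {\<alpha><..<\<beta>}"] by simp
  qed
  also have "\<dots> = (LINT x|lborel. indicator {\<alpha><..<\<beta>} x *\<^sub>R (of_real (h' x) * F x + of_real (h x) *
      rep_l2 f' x))"
    by (intro Bochner_Integration.integral_cong) (auto simp: indicator_def)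
  also have "\<dots> = (LINT x:{\<alpha>..\<beta>}|lborel. of_real (h' x) * F x + of_real (h x) * rep_l2 f' x)"
    by (rule integral_Icc_cut_weight[OF m, symmetric])
  also have "\<dots> = of_real (h \<beta>) * F \<beta> - of_real (h \<alpha>) * F \<alpha>"
    using prim_onD[OF P, of \<beta>] ab by simp
  finally show ?thesis by (simp add: scaleR_conv_of_real)
qed

text \<open>The fundamental theorem for the product of \<open>h\<close>, \<open>F\<close> and the
  conjugate of \<open>G\<close>; its real part consists of real inner products.\<close>

theorem ibp:
  assumes sf: "sobolev \<alpha> \<beta> F f f'" and sg: "sobolev \<alpha> \<beta> G g g'" and h: "C1 h h'" and ab: "\<alpha> \<le> \<beta>"
  shows "wmult \<alpha> \<beta> h f' \<bullet> g + wmult \<alpha> \<beta> h f \<bullet> g' + wmult \<alpha> \<beta> h' f \<bullet> g = h \<beta> * (F \<beta> \<bullet> G \<beta>) - h \<alpha> *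
      (F \<alpha> \<bullet> G \<alpha>)"
proof -
  have pf: "prim_on \<alpha> \<beta> F (rep_l2 f')" and rf: "AE x in lborel. x \<in> {\<alpha><..<\<beta>} \<longrightarrow> rep_l2 f x = F x"
    using sf by (auto simp: sobolev_def)
  have pg: "prim_on \<alpha> \<beta> G (rep_l2 g')" and rg: "AE x in lborel. x \<in> {\<alpha><..<\<beta>} \<longrightarrow> rep_l2 g x = G x"
    using sg by (auto simp: sobolev_def)
  let ?D = "\<lambda>x. (of_real (h' x) * F x + of_real (h x) * rep_l2 f' x) * cnj (G x) + (of_real (h x)
      * F x) * cnj (rep_l2 g' x)"
  have P: "prim_on \<alpha> \<beta> (\<lambda>x. (of_real (h x) * F x) * cnj (G x)) ?D"
    by (intro prim_on_mult prim_on_cnj C1_prim_on h pf pg)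
  have I: "integrable lborel (\<lambda>x. indicator {\<alpha>..\<beta>} x *\<^sub>R ?D x)"
    using prim_on_integrable[OF P] unfolding set_integrable_def by simp
  have m: "(\<lambda>x. indicator {\<alpha>..\<beta>} x *\<^sub>R ?D x) \<in> borel_measurable borel"
    using I by (simp add: borel_measurable_integrable)
  have i: "integrable lborel (\<lambda>x. rep_l2 u x \<bullet> rep_l2 v x)" for u v
    by (intro integrable_inner_sq sq_integrable_rep)
  note c = C1_continuous[OF h]
  have "wmult \<alpha> \<beta> h f' \<bullet> g + wmult \<alpha> \<beta> h f \<bullet> g' + wmult \<alpha> \<beta> h' f \<bullet> g
    = (LINT x|lborel. rep_l2 (wmult \<alpha> \<beta> h f') x \<bullet> rep_l2 g x + rep_l2 (wmult \<alpha> \<beta> h f) x \<bullet> rep_l2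
        g' x + rep_l2 (wmult \<alpha> \<beta> h' f) x \<bullet> rep_l2 g x)"
    unfolding inner_l2_def using i by simp
  also have "\<dots> = (LINT x|lborel. Re (indicator {\<alpha>..\<beta>} x *\<^sub>R ?D x))"
  proof (rule integral_cong_AE)
    show "AE x in lborel. rep_l2 (wmult \<alpha> \<beta> h f') x \<bullet> rep_l2 g x + rep_l2 (wmult \<alpha> \<beta> h f) x \<bullet>
        rep_l2 g' x + rep_l2 (wmult \<alpha> \<beta> h' f) x \<bullet> rep_l2 g x
      = Re (indicator {\<alpha>..\<beta>} x *\<^sub>R ?D x)"
      using rf rg rep_wmult[OF c(1), of \<alpha> \<beta> f'] rep_wmult[OF c(1), of \<alpha> \<beta> f] rep_wmult[OF c(2), of
          \<alpha> \<beta> f]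
        AE_lborel_singleton[of \<alpha>] AE_lborel_singleton[of \<beta>]
    proof eventually_elim
      case (elim x)
      show ?case
      proof (cases "x \<in> {\<alpha><..<\<beta>}")
        case True
        have "(of_real (h x) * rep_l2 f' x) \<bullet> G x + (of_real (h x) * F x) \<bullet> rep_l2 g' x + (of_real
            (h' x) * F x) \<bullet> G x = Re (?D x)"
          by (simp add: inner_complex_def algebra_simps)
        then show ?thesis using True elim by (simp add: cut_weight_def)
      next
        case False
        then show ?thesis using elim by (auto simp: cut_weight_def indicator_def)
      qed
    qed
    show "(\<lambda>x. Re (indicator {\<alpha>..\<beta>} x *\<^sub>R ?D x)) \<in> borel_measurable lborel"
      using m by (intro measurable_compose[OF _ borel_measurable_Re]) simp
  qed auto
  also have "\<dots> = Re (LINT x|lborel. indicator {\<alpha>..\<beta>} x *\<^sub>R ?D x)"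
    by (rule integral_Re[OF I])
  also have "\<dots> = Re (of_real (h \<beta>) * F \<beta> * cnj (G \<beta>) - of_real (h \<alpha>) * F \<alpha> * cnj (G \<alpha>))"
    using prim_onD[OF P, of \<beta>] ab by (simp add: set_lebesgue_integral_def)
  also have "\<dots> = h \<beta> * (F \<beta> \<bullet> G \<beta>) - h \<alpha> * (F \<alpha> \<bullet> G \<alpha>)"
    by (simp add: inner_complex_def algebra_simps)
  finally show ?thesis .
qed

lemma wmult_one:
  assumes "f \<in> L2_on {\<alpha><..<\<beta>}" shows "wmult \<alpha> \<beta> (\<lambda>_. 1) f = f"
proof (rule l2_eqI)
  have "AE x in lborel. x \<notin> {\<alpha><..<\<beta>} \<longrightarrow> rep_l2 f x = 0" using assms by (simp add: L2_on_def)
  moreover have "AE x in lborel. rep_l2 (wmult \<alpha> \<beta> (\<lambda>_. 1) f) x = cut_weight \<alpha> \<beta> (\<lambda>_. 1) x *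
      rep_l2 f x"
    by (rule rep_wmult) simp
  ultimately show "AE x in lborel. rep_l2 (wmult \<alpha> \<beta> (\<lambda>_. 1) f) x = rep_l2 f x"
    by eventually_elim (auto simp: cut_weight_def indicator_def)
qed

subsection \<open>Boundary values\<close>

lemma AE_zero_on_open:
  fixes g :: "real \<Rightarrow> complex"
  assumes S: "open S" and g: "continuous_on S g" and ae: "AE x in lborel. x \<in> S \<longrightarrow> g x = 0" and x:
      "x \<in> S"
  shows "g x = 0"
proof (rule ccontr)
  assume gx: "g x \<noteq> 0"
  have "open (S \<inter> g -` (- {0}))" by (rule continuous_open_preimage[OF g S]) auto
  then obtain e where e: "e > 0" "ball x e \<subseteq> S \<inter> g -` (- {0})"
    using x gx openE[of "S \<inter> g -` (- {0})" x] by blast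
  have "{x - e<..<x + e} = ball x e" by (auto simp: dist_real_def)
  with e(2) have "AE y in lborel. y \<notin> {x - e<..<x + e}"
    using ae by (auto elim!: eventually_mono)
  moreover have "{x - e<..<x + e} \<in> sets lborel" by simp
  moreover have "{y \<in> space lborel. \<not> y \<notin> {x - e<..<x + e}} = {x - e<..<x + e}" by auto
  ultimately have "emeasure lborel {x - e<..<x + e} = 0"
    using AE_iff_measurable[of "{x - e<..<x + e}" lborel "\<lambda>y. y \<notin> {x - e<..<x + e}"] by blast
  then show False using e(1) by simp
qed

text \<open>Two continuous representatives agree almost everywhere on the open set, hence everywhere
  on it, hence on its closure. This justifies the definite description in
  \<open>bdry_val\<close>.\<close>

lemma bdry_valI:
  assumes S: "open S" and g: "continuous_on (closure S) g"
    and ae: "AE y in lborel. y \<in> S \<longrightarrow> rep_l2 f y = g y" and x: "x \<in> closure S"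
  shows "bdry_val S f x = g x"
  unfolding bdry_val_def
proof (rule the_equality)
  show "\<exists>ga. continuous_on (closure S) ga \<and> (AE y in lborel. y \<in> S \<longrightarrow> rep_l2 f y = ga y) \<and> g x = ga
      x"
    using g ae by blast
  fix c assume "\<exists>ga. continuous_on (closure S) ga \<and> (AE y in lborel. y \<in> S \<longrightarrow> rep_l2 f y = ga y) \<and>
      c = ga x"
  then obtain h where h: "continuous_on (closure S) h" "AE y in lborel. y \<in> S \<longrightarrow> rep_l2 f y = h y"
      "c = h x" by blast
  have ae0: "AE y in lborel. y \<in> S \<longrightarrow> h y - g y = 0"
    using ae h(2) by eventually_elim simp
  have hc: "continuous_on (closure S) (\<lambda>y. h y - g y)"
    by (rule continuous_on_diff[OF h(1) g])
  have "h y - g y = 0" if "y \<in> S" for y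
    by (rule AE_zero_on_open[OF S continuous_on_subset[OF hc closure_subset] ae0 that])
  then have "h x - g x = 0"
    by (rule continuous_constant_on_closure[OF hc _ x])
  then show "c = g x" using h(3) by simp
qed

lemma sobolev_cong:
  assumes "sobolev \<alpha> \<beta> F f f'" "\<And>x. x \<in> {\<alpha>..\<beta>} \<Longrightarrow> G x = F x" "\<alpha> \<le> \<beta>"
  shows "sobolev \<alpha> \<beta> G f f'"
  unfolding sobolev_def
proof
  have "AE x in lborel. x \<in> {\<alpha><..<\<beta>} \<longrightarrow> rep_l2 f x = F x" and p: "prim_on \<alpha> \<beta> F (rep_l2 f')"
    using assms(1) by (auto simp: sobolev_def)
  then show "AE x in lborel. x \<in> {\<alpha><..<\<beta>} \<longrightarrow> rep_l2 f x = G x"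
    by eventually_elim (use assms(2) in auto)
  show "prim_on \<alpha> \<beta> G (rep_l2 f')"
    unfolding prim_on_def
  proof (intro conjI ballI set_integrable_rep_l2)
    fix x assume x: "x \<in> {\<alpha>..\<beta>}"
    then show "G x = G \<alpha> + (LINT t:{\<alpha>..x}|lborel. rep_l2 f' t)"
      using prim_onD[OF p x] assms(2)[of x] assms(2)[of \<alpha>] assms(3) by simp
  qed
qed

lemma sobolev_continuous: "sobolev \<alpha> \<beta> F f f' \<Longrightarrow> continuous_on {\<alpha>..\<beta>} F"
  unfolding sobolev_def using prim_on_continuous by blast

lemma bdry_val_sobolev:
  assumes s: "sobolev \<alpha> \<beta> F f f'" and ab: "\<alpha> < \<beta>" and x: "x \<in> {\<alpha>..\<beta>}"
  shows "bdry_val {\<alpha><..<\<beta>} f x = F x"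
proof (rule bdry_valI)
  show "continuous_on (closure {\<alpha><..<\<beta>}) F"
    using sobolev_continuous[OF s] ab by simp
qed (use s ab x in \<open>auto simp: sobolev_def\<close>)

text \<open>\<open>bdry_val\<close> makes sense on the whole closed interval and not only at its
  ends, so it can itself serve as the continuous representative.\<close>

lemma H1_interval_sobolev:
  assumes f: "f \<in> H1 {\<alpha><..<\<beta>}" and ab: "\<alpha> < \<beta>"
  shows "sobolev \<alpha> \<beta> (bdry_val {\<alpha><..<\<beta>} f) f (wD {\<alpha><..<\<beta>} f)"
proof -
  obtain F where F: "sobolev \<alpha> \<beta> F f (wD {\<alpha><..<\<beta>} f)"
    using weak_deriv_imp_sobolev[OF wD_props(2)[OF _ f] ab] by auto
  show ?thesis
    by (rule sobolev_cong[OF F]) (use bdry_val_sobolev[OF F ab] ab in auto)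
qed

lemma closure_two_intervals:
  fixes \<alpha> \<beta> \<gamma> \<delta> :: real
  assumes "\<alpha> < \<beta>" "\<gamma> < \<delta>"
  shows "closure ({\<alpha><..<\<beta>} \<union> {\<gamma><..<\<delta>}) = {\<alpha>..\<beta>} \<union> {\<gamma>..\<delta>}"
  using assms by (simp add: closure_Un)

text \<open>The closed intervals are disjoint, so the two continuous representatives glue to a
  single one on the closure of the union; the traces thereby become one-sided.\<close>

lemma bdry_val_sobolev_two:
  assumes s1: "sobolev \<alpha> \<beta> F f f'" and s2: "sobolev \<gamma> \<delta> G f f'" and o: "\<alpha> < \<beta>" "\<beta> < \<gamma>" "\<gamma> < \<delta>"
  shows "x \<in> {\<alpha>..\<beta>} \<Longrightarrow> bdry_val ({\<alpha><..<\<beta>} \<union> {\<gamma><..<\<delta>}) f x = F x"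
    "x \<in> {\<gamma>..\<delta>} \<Longrightarrow> bdry_val ({\<alpha><..<\<beta>} \<union> {\<gamma><..<\<delta>}) f x = G x"
proof -
  let ?S = "{\<alpha><..<\<beta>} \<union> {\<gamma><..<\<delta>}"
  define H where "H x = (if x \<le> \<beta> then F x else G x)" for x
  have cl: "closure ?S = {\<alpha>..\<beta>} \<union> {\<gamma>..\<delta>}" using o by (intro closure_two_intervals)
  have F: "continuous_on {\<alpha>..\<beta>} F" and G: "continuous_on {\<gamma>..\<delta>} G"
    using sobolev_continuous[OF s1] sobolev_continuous[OF s2] by auto
  have H: "continuous_on (closure ?S) H"
    unfolding cl
  proof (rule continuous_on_closed_Un)
    show "continuous_on {\<alpha>..\<beta>} H" using F by (rule continuous_on_eq) (auto simp: H_def)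
    show "continuous_on {\<gamma>..\<delta>} H" using G by (rule continuous_on_eq) (use o in \<open>auto simp: H_def\<close>)
  qed auto
  have ae: "AE y in lborel. y \<in> ?S \<longrightarrow> rep_l2 f y = H y"
  proof -
    have "AE x in lborel. x \<in> {\<alpha><..<\<beta>} \<longrightarrow> rep_l2 f x = F x" "AE x in lborel. x \<in> {\<gamma><..<\<delta>} \<longrightarrow> rep_l2
        f x = G x"
      using s1 s2 by (simp_all add: sobolev_def)
    then show ?thesis by eventually_elim (use o in \<open>auto simp: H_def\<close>)
  qed
  have *: "bdry_val ?S f x = H x" if "x \<in> {\<alpha>..\<beta>} \<union> {\<gamma>..\<delta>}" for x
    by (rule bdry_valI[OF _ H ae]) (use that cl in auto)
  show "x \<in> {\<alpha>..\<beta>} \<Longrightarrow> bdry_val ?S f x = F x" using *[of x] by (simp add: H_def)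
  show "x \<in> {\<gamma>..\<delta>} \<Longrightarrow> bdry_val ?S f x = G x" using *[of x] o by (simp add: H_def)
qed

lemma H1_two_intervals_sobolev:
  assumes f: "f \<in> H1 ({\<alpha><..<\<beta>} \<union> {\<gamma><..<\<delta>})" and o: "\<alpha> < \<beta>" "\<beta> < \<gamma>" "\<gamma> < \<delta>"
  defines "S \<equiv> {\<alpha><..<\<beta>} \<union> {\<gamma><..<\<delta>}"
  shows "sobolev \<alpha> \<beta> (bdry_val S f) f (wD S f)" "sobolev \<gamma> \<delta> (bdry_val S f) f (wD S f)"
proof -
  have w: "weak_deriv S f (wD S f)" using wD_props(2)[of S f] f by (simp add: S_def open_Un)
  obtain F where F: "sobolev \<alpha> \<beta> F f (wD S f)"
    using weak_deriv_imp_sobolev[OF weak_deriv_mono[OF w] o(1)] by (auto simp: S_def)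
  obtain G where G: "sobolev \<gamma> \<delta> G f (wD S f)"
    using weak_deriv_imp_sobolev[OF weak_deriv_mono[OF w] o(3)] by (auto simp: S_def)
  show "sobolev \<alpha> \<beta> (bdry_val S f) f (wD S f)"
    by (rule sobolev_cong[OF F]) (use bdry_val_sobolev_two[OF F G o] o in \<open>auto simp: S_def\<close>)
  show "sobolev \<gamma> \<delta> (bdry_val S f) f (wD S f)"
    by (rule sobolev_cong[OF G]) (use bdry_val_sobolev_two[OF F G o] o in \<open>auto simp: S_def\<close>)
qed

text \<open>The test function may live on a larger set, as long as it vanishes at the two ends. This
  allows a test function on two intervals to be integrated by parts on each of them.\<close>

lemma sobolev_ibp_test:
  assumes s: "sobolev \<alpha> \<beta> F f f'" and t: "test_fun S \<phi> \<phi>'" and z: "\<phi> \<alpha> = 0" "\<phi> \<beta> = 0" and ab: "\<alpha> \<le>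
      \<beta>"
  shows "(LINT x:{\<alpha><..<\<beta>}|lborel. rep_l2 f x * \<phi>' x) = - (LINT x:{\<alpha><..<\<beta>}|lborel. rep_l2 f' x * \<phi>
      x)"
proof -
  have p: "prim_on \<alpha> \<beta> F (rep_l2 f')" and r: "AE x in lborel. x \<in> {\<alpha><..<\<beta>} \<longrightarrow> rep_l2 f x = F x"
    using s by (auto simp: sobolev_def)
  have P: "prim_on \<alpha> \<beta> (\<lambda>x. F x * \<phi> x) (\<lambda>x. rep_l2 f' x * \<phi> x + F x * \<phi>' x)"
    by (rule prim_on_mult[OF p prim_on_test_fun[OF t]])
  let ?D = "\<lambda>x. rep_l2 f' x * \<phi> x + F x * \<phi>' x"
  have m: "(\<lambda>x. indicator {\<alpha>..\<beta>} x *\<^sub>R ?D x) \<in> borel_measurable borel"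
    using prim_on_integrable[OF P] unfolding set_integrable_def by (simp add:
        borel_measurable_integrable)
  have i: "set_integrable lborel {\<alpha><..<\<beta>} (\<lambda>x. rep_l2 g x * \<psi> x)" if "sq_integrable \<psi>" for g \<psi>
    unfolding set_integrable_def using integrable_mult_sq[OF sq_integrable_rep that]
    by (intro integrable_mult_indicator) auto
  note i1 = i[OF test_fun_sq_integrable(1)[OF t], of f'] and i2 = i[OF
      test_fun_sq_integrable(2)[OF t], of f]
  have "(LINT x:{\<alpha><..<\<beta>}|lborel. rep_l2 f' x * \<phi> x) + (LINT x:{\<alpha><..<\<beta>}|lborel. rep_l2 f x * \<phi>' x)
     = (LINT x:{\<alpha><..<\<beta>}|lborel. rep_l2 f' x * \<phi> x + rep_l2 f x * \<phi>' x)"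
    by (rule set_integral_add(2)[symmetric, OF i1 i2])
  also have "\<dots> = (LINT x|lborel. indicator {\<alpha><..<\<beta>} x *\<^sub>R (indicator {\<alpha>..\<beta>} x *\<^sub>R ?D x))"
    unfolding set_lebesgue_integral_def
  proof (rule integral_cong_AE)
    show "AE x in lborel. indicat_real {\<alpha><..<\<beta>} x *\<^sub>R (rep_l2 f' x * \<phi> x + rep_l2 f x * \<phi>' x)
      = indicat_real {\<alpha><..<\<beta>} x *\<^sub>R (indicat_real {\<alpha>..\<beta>} x *\<^sub>R ?D x)"
      using r by eventually_elim (auto simp: indicator_def)
    show "(\<lambda>x. indicat_real {\<alpha><..<\<beta>} x *\<^sub>R (rep_l2 f' x * \<phi> x + rep_l2 f x * \<phi>' x)) \<in>
        borel_measurable lborel"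
      using set_integral_add(1)[OF i1 i2] unfolding set_integrable_def by (rule
          borel_measurable_integrable)
    show "(\<lambda>x. indicat_real {\<alpha><..<\<beta>} x *\<^sub>R (indicat_real {\<alpha>..\<beta>} x *\<^sub>R ?D x)) \<in> borel_measurable
        lborel"
      using borel_measurable_scaleR[OF _ m, of "indicator {\<alpha><..<\<beta>}"] by simp
  qed
  also have "\<dots> = (LINT x|lborel. indicator {\<alpha><..<\<beta>} x *\<^sub>R ?D x)"
    by (intro Bochner_Integration.integral_cong) (auto simp: indicator_def)
  also have "\<dots> = (LINT x:{\<alpha>..\<beta>}|lborel. ?D x)"
    by (rule integral_Icc_cut_weight[OF m, symmetric])
  also have "\<dots> = 0" using prim_onD[OF P, of \<beta>] z ab by simp
  finally show ?thesis by (simp add: eq_neg_iff_add_eq_0 add.commute)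
qed

lemma H1_intervalI:
  assumes s: "sobolev \<alpha> \<beta> F f f'" and "\<alpha> < \<beta>" and L: "f \<in> L2_on {\<alpha><..<\<beta>}" "f' \<in> L2_on {\<alpha><..<\<beta>}"
  shows "f \<in> H1 {\<alpha><..<\<beta>}" "wD {\<alpha><..<\<beta>} f = f'"
proof -
  have w: "weak_deriv {\<alpha><..<\<beta>} f f'" by (rule sobolev_imp_weak_deriv[OF s]) (use assms in simp)
  show "f \<in> H1 {\<alpha><..<\<beta>}" by (rule H1I[OF L w])
  show "wD {\<alpha><..<\<beta>} f = f'" by (rule wD_eqI[OF _ L(2) w]) simp
qed

lemma H1_two_intervalsI:
  assumes s1: "sobolev \<alpha> \<beta> F f f'" and s2: "sobolev \<gamma> \<delta> G f f'" and o: "\<alpha> < \<beta>" "\<beta> < \<gamma>" "\<gamma> < \<delta>"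
  defines "S \<equiv> {\<alpha><..<\<beta>} \<union> {\<gamma><..<\<delta>}"
  assumes L: "f \<in> L2_on S" "f' \<in> L2_on S"
  shows "f \<in> H1 S" "wD S f = f'"
proof -
  have w: "weak_deriv S f f'"
    unfolding weak_deriv_def
  proof (intro allI impI)
    fix \<phi> \<phi>' assume t: "test_fun S \<phi> \<phi>'"
    then have z: "\<phi> \<alpha> = 0" "\<phi> \<beta> = 0" "\<phi> \<gamma> = 0" "\<phi> \<delta> = 0"
      using o unfolding test_fun_def S_def by fastforce+
    have i: "set_integrable lborel A (\<lambda>x. rep_l2 g x * \<psi> x)" if "sq_integrable \<psi>" "A \<in> sets borel"
        for A g \<psi>
      unfolding set_integrable_def using integrable_mult_sq[OF sq_integrable_rep that(1)] that(2)
      by (intro integrable_mult_indicator) auto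
    have U: "(LINT x:S|lborel. rep_l2 g x * \<psi> x) = (LINT x:{\<alpha><..<\<beta>}|lborel. rep_l2 g x * \<psi> x) +
        (LINT x:{\<gamma><..<\<delta>}|lborel. rep_l2 g x * \<psi> x)"
      if "sq_integrable \<psi>" for g \<psi>
      unfolding S_def using o by (intro set_integral_Un i[OF that]) auto
    show "(LINT x:S|lborel. rep_l2 f x * \<phi>' x) = - (LINT x:S|lborel. rep_l2 f' x * \<phi> x)"
      unfolding U[OF test_fun_sq_integrable(1)[OF t]] U[OF test_fun_sq_integrable(2)[OF t]]
      using sobolev_ibp_test[OF s1 t z(1,2)] sobolev_ibp_test[OF s2 t z(3,4)] o by simp
  qed
  show "f \<in> H1 S" by (rule H1I[OF L w])
  show "wD S f = f'" by (rule wD_eqI[OF _ L(2) w]) (simp add: S_def open_Un)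
qed

lemma pairing_plus:
  assumes "sq_integrable \<phi>"
  shows "(LINT x|lborel. rep_l2 (f + g) x * \<phi> x) = (LINT x|lborel. rep_l2 f x * \<phi> x) + (LINT
      x|lborel. rep_l2 g x * \<phi> x)"
proof -
  have [measurable]: "\<phi> \<in> borel_measurable borel" using assms by (simp add: sq_integrable_def)
  have "(LINT x|lborel. rep_l2 (f + g) x * \<phi> x) = (LINT x|lborel. rep_l2 f x * \<phi> x + rep_l2 g x *
      \<phi> x)"
    using rep_l2_plus[of f g] by (intro integral_cong_AE) (auto simp: distrib_right elim!:
        eventually_mono)
  then show ?thesis using assms by (simp add: integrable_mult_sq)
qed

lemma pairing_scaleC:
  assumes "sq_integrable \<phi>"
  shows "(LINT x|lborel. rep_l2 (scaleC c f) x * \<phi> x) = c * (LINT x|lborel. rep_l2 f x * \<phi> x)"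
proof -
  have [measurable]: "\<phi> \<in> borel_measurable borel" using assms by (simp add: sq_integrable_def)
  have "(LINT x|lborel. rep_l2 (scaleC c f) x * \<phi> x) = (LINT x|lborel. c * (rep_l2 f x * \<phi> x))"
    using rep_l2_scaleC[of c f] by (intro integral_cong_AE) (auto elim!: eventually_mono)
  then show ?thesis by simp
qed

lemma weak_deriv_add:
  "weak_deriv S f f' \<Longrightarrow> weak_deriv S g g' \<Longrightarrow> weak_deriv S (f + g) (f' + g')"
  unfolding weak_deriv_alt by (simp add: pairing_plus test_fun_sq_integrable)

lemma weak_deriv_scaleC:
  "weak_deriv S f f' \<Longrightarrow> weak_deriv S (scaleC c f) (scaleC c f')"
  unfolding weak_deriv_alt by (simp add: pairing_scaleC test_fun_sq_integrable)

lemma H1_add: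
  assumes S: "open S" and "f \<in> H1 S" "g \<in> H1 S"
  shows "f + g \<in> H1 S" "wD S (f + g) = wD S f + wD S g"
proof -
  have w: "weak_deriv S (f + g) (wD S f + wD S g)" and L: "wD S f + wD S g \<in> L2_on S"
    using wD_props[OF S] assms by (auto intro: weak_deriv_add L2_on_add)
  show "wD S (f + g) = wD S f + wD S g" by (rule wD_eqI[OF S L w])
  show "f + g \<in> H1 S" by (rule H1I[OF _ L w]) (use assms in \<open>auto simp: H1_def L2_on_add\<close>)
qed

lemma H1_scaleC:
  assumes S: "open S" and "f \<in> H1 S"
  shows "scaleC c f \<in> H1 S" "wD S (scaleC c f) = scaleC c (wD S f)"
proof -
  have w: "weak_deriv S (scaleC c f) (scaleC c (wD S f))" and L: "scaleC c (wD S f) \<in> L2_on S"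
    using wD_props[OF S] assms by (auto intro: weak_deriv_scaleC L2_on_scaleC)
  show "wD S (scaleC c f) = scaleC c (wD S f)" by (rule wD_eqI[OF S L w])
  show "scaleC c f \<in> H1 S" by (rule H1I[OF _ L w]) (use assms in \<open>auto simp: H1_def L2_on_scaleC\<close>)
qed

lemma H1_scaleR:
  assumes "open S" and "f \<in> H1 S"
  shows "c *\<^sub>R f \<in> H1 S" "wD S (c *\<^sub>R f) = c *\<^sub>R wD S f"
  using H1_scaleC[OF assms] by (simp_all add: scaleR_l2_def)

lemma H1_diff:
  assumes "open S" and "f \<in> H1 S" "g \<in> H1 S"
  shows "f - g \<in> H1 S" "wD S (f - g) = wD S f - wD S g"
  using H1_add[OF assms(1,2) H1_scaleC(1)[OF assms(1,3), of "-1"]] H1_scaleC(2)[OF assms(1,3), of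
      "-1"]
  by (simp_all add: minus_l2_def uminus_l2_def)

lemma H1_imp_L2: "f \<in> H1 S \<Longrightarrow> f \<in> L2_on S" by (simp add: H1_def)

lemma sq_int_eq_norm:
  assumes "f \<in> L2_on S" "S \<in> sets borel" shows "sq_int S f = (norm f)\<^sup>2"
  unfolding sq_int_def norm_l2_sq set_lebesgue_integral_def
proof (rule integral_cong_AE)
  have "AE x in lborel. x \<notin> S \<longrightarrow> rep_l2 f x = 0" using assms(1) by (simp add: L2_on_def)
  then show "AE x in lborel. indicat_real S x *\<^sub>R (cmod (rep_l2 f x))\<^sup>2 = (cmod (rep_l2 f x))\<^sup>2"
    by eventually_elim (auto simp: indicator_def)
  show "(\<lambda>x. indicat_real S x *\<^sub>R (cmod (rep_l2 f x))\<^sup>2) \<in> borel_measurable lborel"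
    using assms(2) by (intro borel_measurable_scaleR borel_measurable_indicator) auto
qed auto

text \<open>\<open>sobolev\<close> ignores what happens off its interval, so functions on the outer
  parts can be assembled from one summand for each component.\<close>

lemma sobolev_add_outside:
  assumes s: "sobolev \<alpha> \<beta> F f f'" and g: "g \<in> L2_on S" "S \<inter> {\<alpha><..<\<beta>} = {}"
  shows "sobolev \<alpha> \<beta> F (f + g) f'"
proof -
  have "AE x in lborel. x \<in> {\<alpha><..<\<beta>} \<longrightarrow> rep_l2 f x = F x" "AE x in lborel. x \<notin> S \<longrightarrow> rep_l2 g x = 0"
    using s g by (simp_all add: sobolev_def L2_on_def)
  then have "AE x in lborel. x \<in> {\<alpha><..<\<beta>} \<longrightarrow> rep_l2 (f + g) x = F x"
    using rep_l2_plus[of f g] by eventually_elim (use g(2) in auto)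
  then show ?thesis using s by (simp add: sobolev_def)
qed

lemma sobolev_deriv_add_outside:
  assumes s: "sobolev \<alpha> \<beta> F f f'" and g: "g \<in> L2_on S" "S \<inter> {\<alpha><..<\<beta>} = {}"
  shows "sobolev \<alpha> \<beta> F f (f' + g)"
proof -
  have g0: "AE x in lborel. x \<notin> S \<longrightarrow> rep_l2 g x = 0" using g by (simp add: L2_on_def)
  have z: "(LINT t:{\<alpha>..x}|lborel. rep_l2 g t) = 0" if "x \<le> \<beta>" for x
    unfolding set_lebesgue_integral_def
  proof (rule integral_eq_zero_AE)
    show "AE t in lborel. indicator {\<alpha>..x} t *\<^sub>R rep_l2 g t = 0"
      using g0 AE_lborel_singleton[of \<alpha>] AE_lborel_singleton[of \<beta>]
      by eventually_elim (use g(2) that in \<open>auto simp: indicator_def\<close>)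
  qed
  have p: "prim_on \<alpha> \<beta> F (rep_l2 f')" using s by (simp add: sobolev_def)
  have "prim_on \<alpha> \<beta> F (rep_l2 (f' + g))"
    unfolding prim_on_def
  proof (intro conjI ballI set_integrable_rep_l2)
    fix x assume x: "x \<in> {\<alpha>..\<beta>}"
    then show "F x = F \<alpha> + (LINT t:{\<alpha>..x}|lborel. rep_l2 (f' + g) t)"
      using prim_onD[OF p x] z[of x] by (simp add: set_integral_rep_l2_plus)
  qed
  then show ?thesis using s by (simp add: sobolev_def)
qed

lemma C1_const: "C1 (\<lambda>_. c) (\<lambda>_. 0)" by (auto simp: C1_def)

lemma cut_weight_zero: "cut_weight \<alpha> \<beta> (\<lambda>_. 0) x = 0" by (simp add: cut_weight_def)

lemma moment_zero_weight: "moment \<alpha> \<beta> (\<lambda>_. 0) f = 0"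
  by (simp add: moment_def cut_weight_zero)

lemma wmult_zero_weight: "wmult \<alpha> \<beta> (\<lambda>_. 0) f = 0"
  by (simp add: wmult_def cut_weight_zero zero_l2_def)

lemma moment_one_deriv:
  assumes "sobolev \<alpha> \<beta> F f f'" "\<alpha> \<le> \<beta>" shows "moment \<alpha> \<beta> (\<lambda>_. 1) f' = F \<beta> - F \<alpha>"
  using ibp_moment[OF assms(1) C1_const[of 1] assms(2)] by (simp add: moment_zero_weight)

lemma integral_eq_moment_one: "\<alpha> \<le> \<beta> \<Longrightarrow> (LINT t:{\<alpha>..\<beta>}|lborel. rep_l2 g t) = moment \<alpha> \<beta> (\<lambda>_. 1) g"
  using moment_one_deriv[OF sobolev_prim_op, of \<alpha> \<beta> g] prim_onD[OF prim_on_integral[of \<alpha> \<beta> 0 g],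
      of \<alpha>] by simp

lemma integral_at_left: "(LINT t:{\<alpha>..\<alpha>}|lborel. rep_l2 g t) = 0"
  using prim_onD[OF prim_on_integral[of \<alpha> \<alpha> 0 g], of \<alpha>] by simp

lemma L2_on_mono: "f \<in> L2_on S \<Longrightarrow> S \<subseteq> S' \<Longrightarrow> f \<in> L2_on S'"
  unfolding L2_on_def by (auto elim!: eventually_mono)

lemma restr_Un:
  assumes "f \<in> L2_on (A \<union> B)" "A \<inter> B = {}" "A \<in> sets borel" "B \<in> sets borel"
  shows "f = restr A f + restr B f"
proof (rule l2_eqI)
  have "AE x in lborel. x \<notin> A \<union> B \<longrightarrow> rep_l2 f x = 0" using assms(1) by (simp add: L2_on_def)
  then show "AE x in lborel. rep_l2 f x = rep_l2 (restr A f + restr B f) x"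
    using rep_l2_plus[of "restr A f" "restr B f"] rep_restr[OF assms(3), of f] rep_restr[OF
        assms(4), of f]
    by eventually_elim (use assms(2) in \<open>auto simp: indicator_def\<close>)
qed

lemma L2_on_diff: "f \<in> L2_on S \<Longrightarrow> g \<in> L2_on S \<Longrightarrow> f - g \<in> L2_on S"
  using L2_on_add[of f S "scaleC (-1) g"] L2_on_scaleC[of g S "-1"] by (simp add: minus_l2_def
      uminus_l2_def)

lemma L2_on_scaleR: "f \<in> L2_on S \<Longrightarrow> c *\<^sub>R f \<in> L2_on S"
  by (simp add: scaleR_l2_def L2_on_scaleC)

lemma L2_on_zero: "0 \<in> L2_on S"
  unfolding L2_on_def using rep_l2_zero by (auto elim!: eventually_mono)

lemma moment_scaleC:
  assumes "continuous_on UNIV h" shows "moment \<alpha> \<beta> h (scaleC c f) = c * moment \<alpha> \<beta> h f"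
  using pairing_scaleC[OF sq_integrable_cut_weight[OF assms], of c f \<alpha> \<beta>] by (simp add: moment_def
      mult.commute)

lemma moment_one_const_on: "\<alpha> \<le> \<beta> \<Longrightarrow> moment \<alpha> \<beta> (\<lambda>_. 1) (const_on \<alpha> \<beta> c) = (\<beta> - \<alpha>) *\<^sub>R c"
  using ibp_moment[OF sobolev_const_on[of \<alpha> \<beta> c], of "\<lambda>x. x" "\<lambda>_. 1"] bounded_linear.linear[OF
      moment_bounded_linear, of "\<lambda>x. x" \<alpha> \<beta>]
  by (simp add: C1_def linear_0 scaleR_diff_left)

lemma const_on_zero: "const_on \<alpha> \<beta> 0 = 0"
  using linear_0[OF bounded_linear.linear[OF const_on_bounded_linear]] .

lemma test_set_sobolev:
  assumes "f \<in> test_set {\<alpha><..<\<beta>}"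
  obtains F f' where "sobolev \<alpha> \<beta> F f f'" "F \<alpha> = 0" "F \<beta> = 0" "f \<in> L2_on {\<alpha><..<\<beta>}" "f' \<in> L2_on
      {\<alpha><..<\<beta>}"
proof -
  obtain \<phi> \<phi>' where f: "f = mk_l2 \<phi>" and t: "test_fun {\<alpha><..<\<beta>} \<phi> \<phi>'"
    using assms unfolding test_set_def by blast
  obtain K where K: "K \<subseteq> {\<alpha><..<\<beta>}" "\<And>x. x \<notin> K \<Longrightarrow> \<phi> x = 0" "\<And>x. x \<notin> K \<Longrightarrow> \<phi>' x = 0"
    using test_fun_support[OF t] by metis
  have z: "\<phi> x = 0" "\<phi>' x = 0" if "x \<notin> {\<alpha><..<\<beta>}" for x using K that by blast+
  note r = rep_mk_l2[OF test_fun_sq_integrable(1)[OF t]] and r' = rep_mk_l2[OF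
      test_fun_sq_integrable(2)[OF t]]
  have [measurable]: "\<phi>' \<in> borel_measurable borel"
    using test_fun_sq_integrable(2)[OF t] by (simp add: sq_integrable_def)
  have p: "prim_on \<alpha> \<beta> \<phi> \<phi>'" by (rule prim_on_test_fun[OF t])
  have e: "(LINT t:{\<alpha>..x}|lborel. rep_l2 (mk_l2 \<phi>') t) = (LINT t:{\<alpha>..x}|lborel. \<phi>' t)" for x
    unfolding set_lebesgue_integral_def
  proof (rule integral_cong_AE)
    show "AE t in lborel. indicator {\<alpha>..x} t *\<^sub>R rep_l2 (mk_l2 \<phi>') t = indicator {\<alpha>..x} t *\<^sub>R \<phi>' t"
      using r' by eventually_elim simp
  qed auto
  have "prim_on \<alpha> \<beta> \<phi> (rep_l2 (mk_l2 \<phi>'))"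
    unfolding prim_on_def
  proof (intro conjI ballI set_integrable_rep_l2)
    fix x assume x: "x \<in> {\<alpha>..\<beta>}"
    show "\<phi> x = \<phi> \<alpha> + (LINT t:{\<alpha>..x}|lborel. rep_l2 (mk_l2 \<phi>') t)"
      unfolding e by (rule prim_onD[OF p x])
  qed
  then have "sobolev \<alpha> \<beta> \<phi> f (mk_l2 \<phi>')"
    unfolding sobolev_def f using r by (auto elim!: eventually_mono)
  moreover have "f \<in> L2_on {\<alpha><..<\<beta>}"
    unfolding f L2_on_def mem_Collect_eq using r by eventually_elim (use z in auto)
  moreover have "mk_l2 \<phi>' \<in> L2_on {\<alpha><..<\<beta>}"
    unfolding L2_on_def mem_Collect_eq using r' by eventually_elim (use z in auto)
  ultimately show ?thesis using z by (intro that[of \<phi> "mk_l2 \<phi>'"]) auto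
qed

type_synonym l2x6 = "l2 \<times> l2 \<times> l2 \<times> l2 \<times> l2 \<times> l2"

subsection \<open>The state space\<close>

locale transmission =
  fixes L\<^sub>1 L\<^sub>2 L\<^sub>3 a b m k \<tau> :: real
  assumes L1: "0 < L\<^sub>1" and L12: "L\<^sub>1 < L\<^sub>2" and L23: "L\<^sub>2 < L\<^sub>3"
    and a0: "0 < a" and b0: "0 < b" and m0: "0 < m" and k0: "0 < k" and tau0: "0 < \<tau>"
begin

abbreviation "I \<equiv> mid L\<^sub>1 L\<^sub>2"
abbreviation "J \<equiv> outer L\<^sub>1 L\<^sub>2 L\<^sub>3"
abbreviation "Hs \<equiv> energy_space L\<^sub>1 L\<^sub>2 L\<^sub>3"
abbreviation "Dom \<equiv> domA L\<^sub>1 L\<^sub>2 L\<^sub>3 a b m"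
abbreviation "Op \<equiv> opA L\<^sub>1 L\<^sub>2 L\<^sub>3 a b m k \<tau>"
abbreviation "En \<equiv> energy L\<^sub>1 L\<^sub>2 L\<^sub>3 a b \<tau>"
abbreviation "Nrm \<equiv> energy_norm L\<^sub>1 L\<^sub>2 L\<^sub>3 a b \<tau>"

text \<open>\<open>X\<close> embeds the energy space into \<open>L2\<close> by replacing the displacements with their derivatives;
  \<open>umap\<close> and \<open>vmap\<close> below recover the displacements.\<close>

definition X :: "state \<Rightarrow> l2x6" where
  "X = (\<lambda>(u, v, \<theta>, q, p, r). (wD I u, wD J v, \<theta>, q, p, r))"

definition energy_form :: "l2x6 \<Rightarrow> real" where
  "energy_form = (\<lambda>(w, y, \<theta>, q, p, r). 1/2 * (b * (norm y)\<^sup>2 + (norm r)\<^sup>2) +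
     1/2 * (a * (norm w)\<^sup>2 + (norm p)\<^sup>2 + (norm \<theta>)\<^sup>2 + \<tau> * (norm q)\<^sup>2))"

lemma open_I: "open I" and open_J: "open J" by (auto simp: open_Un)

lemma sobolev_I: "f \<in> H1 I \<Longrightarrow> sobolev L\<^sub>1 L\<^sub>2 (bdry_val I f) f (wD I f)"
  by (rule H1_interval_sobolev[OF _ L12])

lemma sobolev_J: "f \<in> H1 J \<Longrightarrow> sobolev 0 L\<^sub>1 (bdry_val J f) f (wD J f)" "f \<in> H1 J \<Longrightarrow> sobolev L\<^sub>2 L\<^sub>3
    (bdry_val J f) f (wD J f)"
  by (rule H1_two_intervals_sobolev[OF _ L1 L12 L23]; assumption)+

lemma bdry_I: "sobolev L\<^sub>1 L\<^sub>2 F f f' \<Longrightarrow> x \<in> {L\<^sub>1, L\<^sub>2} \<Longrightarrow> bdry_val I f x = F x"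
  using L12 by (intro bdry_val_sobolev[OF _ L12]) auto

lemma bdry_J: assumes "sobolev 0 L\<^sub>1 F f f'" "sobolev L\<^sub>2 L\<^sub>3 G f f'"
  shows "x \<in> {0, L\<^sub>1} \<Longrightarrow> bdry_val J f x = F x" "x \<in> {L\<^sub>2, L\<^sub>3} \<Longrightarrow> bdry_val J f x = G x"
  using L1 L12 L23 by (auto intro: bdry_val_sobolev_two[OF assms L1 L12 L23])

lemma bdry_I_add:
  assumes "f \<in> H1 I" "g \<in> H1 I" "x \<in> {L\<^sub>1, L\<^sub>2}"
  shows "bdry_val I (f + g) x = bdry_val I f x + bdry_val I g x"
  using bdry_I[OF sobolev_add[OF sobolev_I[OF assms(1)] sobolev_I[OF assms(2)]] assms(3)] .

lemma bdry_I_scaleC: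
  assumes "f \<in> H1 I" "x \<in> {L\<^sub>1, L\<^sub>2}"
  shows "bdry_val I (scaleC c f) x = c * bdry_val I f x"
  using bdry_I[OF sobolev_scaleC[OF sobolev_I[OF assms(1)]] assms(2)] .

lemma bdry_J_add:
  assumes "f \<in> H1 J" "g \<in> H1 J" "x \<in> {0, L\<^sub>1, L\<^sub>2, L\<^sub>3}"
  shows "bdry_val J (f + g) x = bdry_val J f x + bdry_val J g x"
  using bdry_J[OF sobolev_add[OF sobolev_J(1)[OF assms(1)] sobolev_J(1)[OF assms(2)]]
      sobolev_add[OF sobolev_J(2)[OF assms(1)] sobolev_J(2)[OF assms(2)]]] assms(3)
  by auto

lemma bdry_J_scaleC:
  assumes "f \<in> H1 J" "x \<in> {0, L\<^sub>1, L\<^sub>2, L\<^sub>3}"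
  shows "bdry_val J (scaleC c f) x = c * bdry_val J f x"
  using bdry_J[OF sobolev_scaleC[OF sobolev_J(1)[OF assms(1)]] sobolev_scaleC[OF sobolev_J(2)[OF
      assms(1)]]] assms(2)
  by auto

lemma Hs_iff: "(u, v, \<theta>, q, p, r) \<in> Hs \<longleftrightarrow>
     u \<in> H1 I \<and> v \<in> H1 J \<and> \<theta> \<in> L2_on I \<and> q \<in> L2_on I \<and> p \<in> L2_on I \<and> r \<in> L2_on J \<and>
     bdry_val J v 0 = 0 \<and> bdry_val J v L\<^sub>3 = 0 \<and>
     bdry_val I u L\<^sub>1 = bdry_val J v L\<^sub>1 \<and> bdry_val I u L\<^sub>2 = bdry_val J v L\<^sub>2"
  by (simp add: energy_space_def Let_def)

lemma Hs_add:
  assumes "U \<in> Hs" "V \<in> Hs"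
  shows "U + V \<in> Hs" "X (U + V) = X U + X V"
proof -
  obtain u v \<theta> q p r where U: "U = (u, v, \<theta>, q, p, r)" by (cases U) auto
  obtain u' v' \<theta>' q' p' r' where V: "V = (u', v', \<theta>', q', p', r')" by (cases V) auto
  have u: "u \<in> H1 I" "u' \<in> H1 I" and v: "v \<in> H1 J" "v' \<in> H1 J"
    using assms unfolding U V Hs_iff by auto
  show "X (U + V) = X U + X V"
    by (simp add: U V X_def H1_add[OF open_I u] H1_add[OF open_J v])
  show "U + V \<in> Hs"
    using assms H1_add[OF open_I u] H1_add[OF open_J v] L2_on_add
    unfolding U V Hs_iff add_Pair
    by (simp add: Hs_iff bdry_J_add[OF v] bdry_I_add[OF u])
qed

definition cX :: "complex \<Rightarrow> l2x6 \<Rightarrow> l2x6" where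
  "cX c = (\<lambda>(w, y, \<theta>, q, p, r). (scaleC c w, scaleC c y, scaleC c \<theta>, scaleC c q, scaleC c p,
      scaleC c r))"

lemma Hs_scaleC:
  assumes "U \<in> Hs"
  shows "state_scaleC c U \<in> Hs" "X (state_scaleC c U) = cX c (X U)"
proof -
  obtain u v \<theta> q p r where U: "U = (u, v, \<theta>, q, p, r)" by (cases U) auto
  have u: "u \<in> H1 I" and v: "v \<in> H1 J"
    using assms unfolding U Hs_iff by auto
  show "X (state_scaleC c U) = cX c (X U)"
    by (simp add: U X_def cX_def H1_scaleC[OF open_I u] H1_scaleC[OF open_J v])
  show "state_scaleC c U \<in> Hs"
    using assms H1_scaleC[OF open_I u] H1_scaleC[OF open_J v] L2_on_scaleC
    unfolding U
    by (simp add: Hs_iff bdry_J_scaleC[OF v] bdry_I_scaleC[OF u])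
qed

lemma cX_of_real: "cX (of_real c) Y = c *\<^sub>R Y"
  by (cases Y) (simp add: cX_def scaleR_l2_def)

lemma uminus_state: "- U = state_scaleC (-1) U" for U :: state
  by (cases U) (simp add: uminus_l2_def)

lemma Hs_diff:
  assumes "U \<in> Hs" "V \<in> Hs"
  shows "U - V \<in> Hs" "X (U - V) = X U - X V"
proof -
  have e: "U - V = U + state_scaleC (-1) V" by (simp add: uminus_state[symmetric])
  show "U - V \<in> Hs" unfolding e by (intro Hs_add Hs_scaleC assms)
  show "X (U - V) = X U - X V"
    unfolding e using Hs_add(2)[OF assms(1) Hs_scaleC(1)[OF assms(2), of "-1"]] Hs_scaleC(2)[OF
        assms(2), of "-1"]
      cX_of_real[of "-1" "X V"] by simp
qed

lemma energy_eq: "U \<in> Hs \<Longrightarrow> En U = energy_form (X U)"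
proof -
  assume U: "U \<in> Hs"
  obtain u v \<theta> q p r where e: "U = (u, v, \<theta>, q, p, r)" by (cases U) auto
  have "wD I u \<in> L2_on I" "wD J v \<in> L2_on J"
    using U wD_props(1) open_I open_J unfolding e Hs_iff by blast+
  then show ?thesis
    using U unfolding e Hs_iff by (simp add: energy_def energy_form_def X_def Let_def
        sq_int_eq_norm)
qed

definition elo :: real where "elo = min 1 (min a (min b \<tau>)) / 2"
definition ehi :: real where "ehi = max 1 (max a (max b \<tau>)) / 2"

lemma elo_pos: "elo > 0" using a0 b0 tau0 by (simp add: elo_def)
lemma ehi_pos: "ehi > 0" by (simp add: ehi_def)

lemma norm_l2x6: "(norm (w, y, \<theta>, q, p, r))\<^sup>2 = (norm w)\<^sup>2 + (norm y)\<^sup>2 + (norm \<theta>)\<^sup>2 + (norm q)\<^sup>2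
    + (norm p)\<^sup>2 + (norm r)\<^sup>2"
  for w y \<theta> q p r :: l2
  by (simp add: norm_Pair)

lemma energy_form_bounds: "elo * (norm Y)\<^sup>2 \<le> energy_form Y" "energy_form Y \<le> ehi * (norm Y)\<^sup>2"
proof -
  obtain w y \<theta> q p r where Y: "Y = (w, y, \<theta>, q, p, r)" by (cases Y) auto
  have c: "elo \<le> 1/2" "elo \<le> a/2" "elo \<le> b/2" "elo \<le> \<tau>/2" "1/2 \<le> ehi" "a/2 \<le> ehi" "b/2 \<le> ehi" "\<tau>/2
      \<le> ehi"
    by (auto simp: elo_def ehi_def)
  have lo: "elo * (norm f)\<^sup>2 \<le> c * (norm f)\<^sup>2" if "elo \<le> c" for c and f :: l2
    using that by (intro mult_right_mono) auto
  have hi: "c * (norm f)\<^sup>2 \<le> ehi * (norm f)\<^sup>2" if "c \<le> ehi" for c and f :: l2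
    using that by (intro mult_right_mono) auto
  show "elo * (norm Y)\<^sup>2 \<le> energy_form Y"
    using lo[OF c(1), of r] lo[OF c(1), of p] lo[OF c(1), of \<theta>] lo[OF c(2), of w] lo[OF c(3), of
        y] lo[OF c(4), of q]
    unfolding Y norm_l2x6 energy_form_def by (simp add: algebra_simps)
  show "energy_form Y \<le> ehi * (norm Y)\<^sup>2"
    using hi[OF c(5), of r] hi[OF c(5), of p] hi[OF c(5), of \<theta>] hi[OF c(6), of w] hi[OF c(7), of
        y] hi[OF c(8), of q]
    unfolding Y norm_l2x6 energy_form_def by (simp add: algebra_simps)
qed

lemma energy_form_nonneg: "0 \<le> energy_form Y"
  using energy_form_bounds(1)[of Y] elo_pos by (meson less_imp_le mult_nonneg_nonneg order_trans
      zero_le_power2)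

lemma Nrm_eq: "U \<in> Hs \<Longrightarrow> Nrm U = sqrt (2 * energy_form (X U))"
  by (simp add: energy_norm_def energy_eq)

definition nlo :: real where "nlo = sqrt (2 * elo)"
definition nhi :: real where "nhi = sqrt (2 * ehi)"

lemma nlo_pos: "nlo > 0" using elo_pos by (simp add: nlo_def)
lemma Nrm_bounds:
  assumes "U \<in> Hs" shows "nlo * norm (X U) \<le> Nrm U" "Nrm U \<le> nhi * norm (X U)"
proof -
  have "sqrt (2 * elo * (norm (X U))\<^sup>2) \<le> sqrt (2 * energy_form (X U))" "sqrt (2 * energy_form (X
      U)) \<le> sqrt (2 * ehi * (norm (X U))\<^sup>2)"
    using energy_form_bounds[of "X U"] by auto
  then show "nlo * norm (X U) \<le> Nrm U" "Nrm U \<le> nhi * norm (X U)"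
    by (simp_all add: Nrm_eq[OF assms] nlo_def nhi_def real_sqrt_mult)
qed

text \<open>As \<open>v\<close> vanishes at 0 and joins \<open>u\<close> at
  \<open>L\<^sub>1\<close>, the value of \<open>u\<close> there is the integral of
  \<open>v_x\<close> over the left outer part. \<open>vmap\<close> integrates from 0 on the left and
  back from \<open>L\<^sub>3\<close> on the right.\<close>

definition umap :: "l2x6 \<Rightarrow> l2" where
  "umap Y = const_on L\<^sub>1 L\<^sub>2 (moment 0 L\<^sub>1 (\<lambda>_. 1) (fst (snd Y))) + prim_op L\<^sub>1 L\<^sub>2 (fst Y)"

definition vmap :: "l2x6 \<Rightarrow> l2" where
  "vmap Y = prim_op 0 L\<^sub>1 (fst (snd Y)) + (prim_op L\<^sub>2 L\<^sub>3 (fst (snd Y)) - const_on L\<^sub>2 L\<^sub>3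
      (moment L\<^sub>2 L\<^sub>3 (\<lambda>_. 1) (fst (snd Y))))"

lemma umap_bounded_linear: "bounded_linear umap"
  unfolding umap_def
  by (intro bounded_linear_add bounded_linear_compose[OF const_on_bounded_linear]
      bounded_linear_compose[OF prim_op_bounded_linear]
      bounded_linear_compose[OF moment_bounded_linear] bounded_linear_compose[OF
          bounded_linear_fst] bounded_linear_snd bounded_linear_fst)
    simp

lemma vmap_bounded_linear: "bounded_linear vmap"
  unfolding vmap_def
  by (intro bounded_linear_add bounded_linear_sub bounded_linear_compose[OF
      const_on_bounded_linear] bounded_linear_compose[OF prim_op_bounded_linear]
      bounded_linear_compose[OF moment_bounded_linear] bounded_linear_compose[OF
          bounded_linear_fst] bounded_linear_snd bounded_linear_fst)
    simp

lemma umap_eq: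
  assumes u: "u \<in> H1 I" and v: "v \<in> H1 J" and bc: "bdry_val J v 0 = 0" "bdry_val I u L\<^sub>1 =
      bdry_val J v L\<^sub>1"
  shows "umap (wD I u, wD J v, z) = u"
proof -
  have "moment 0 L\<^sub>1 (\<lambda>_. 1) (wD J v) = bdry_val J v L\<^sub>1"
    using moment_one_deriv[OF sobolev_J(1)[OF v]] L1 bc by simp
  then show ?thesis
    using sobolev_unique[OF sobolev_I[OF u] H1_imp_L2[OF u]] bc by (simp add: umap_def)
qed

lemma sobolev_vmap:
  "sobolev 0 L\<^sub>1 (\<lambda>x. LINT t:{0..x}|lborel. rep_l2 (fst (snd Y)) t) (vmap Y) (fst (snd Y))"
  "sobolev L\<^sub>2 L\<^sub>3 (\<lambda>x. (LINT t:{L\<^sub>2..x}|lborel. rep_l2 (fst (snd Y)) t) - moment L\<^sub>2 L\<^sub>3 (\<lambda>_. 1)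
      (fst (snd Y))) (vmap Y) (fst (snd Y))"
proof -
  show "sobolev 0 L\<^sub>1 (\<lambda>x. LINT t:{0..x}|lborel. rep_l2 (fst (snd Y)) t) (vmap Y) (fst (snd Y))"
    unfolding vmap_def using L12
    by (intro sobolev_add_outside[where S = "{L\<^sub>2<..<L\<^sub>3}"] sobolev_prim_op L2_on_diff
        L2_on_prim_op L2_on_const_on) auto
  have "sobolev L\<^sub>2 L\<^sub>3 (\<lambda>x. (LINT t:{L\<^sub>2..x}|lborel. rep_l2 (fst (snd Y)) t) - moment L\<^sub>2 L\<^sub>3
      (\<lambda>_. 1) (fst (snd Y)))
     ((prim_op L\<^sub>2 L\<^sub>3 (fst (snd Y)) - const_on L\<^sub>2 L\<^sub>3 (moment L\<^sub>2 L\<^sub>3 (\<lambda>_. 1) (fst (snd Y)))) +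
         prim_op 0 L\<^sub>1 (fst (snd Y))) (fst (snd Y))"
    using L12 sobolev_diff[OF sobolev_prim_op sobolev_const_on, of L\<^sub>2 L\<^sub>3 "fst (snd Y)"]
    by (intro sobolev_add_outside[where S = "{0<..<L\<^sub>1}"] L2_on_prim_op) auto
  then show "sobolev L\<^sub>2 L\<^sub>3 (\<lambda>x. (LINT t:{L\<^sub>2..x}|lborel. rep_l2 (fst (snd Y)) t) - moment L\<^sub>2
      L\<^sub>3 (\<lambda>_. 1) (fst (snd Y))) (vmap Y) (fst (snd Y))"
    unfolding vmap_def by (simp add: add.commute)
qed

lemma L2_on_vmap: "vmap Y \<in> L2_on J"
  unfolding vmap_def
  by (intro L2_on_add L2_on_diff L2_on_mono[OF L2_on_prim_op] L2_on_mono[OF L2_on_const_on]) auto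

lemma sobolev_umap:
  "sobolev L\<^sub>1 L\<^sub>2 (\<lambda>x. moment 0 L\<^sub>1 (\<lambda>_. 1) (fst (snd Y)) + (LINT t:{L\<^sub>1..x}|lborel. rep_l2 (fst
      Y) t)) (umap Y) (fst Y)"
  unfolding umap_def using sobolev_add[OF sobolev_const_on sobolev_prim_op] by simp

lemma L2_on_umap: "umap Y \<in> L2_on I"
  unfolding umap_def by (intro L2_on_add L2_on_prim_op L2_on_const_on)

lemma vmap_eq:
  assumes v: "v \<in> H1 J" and bc: "bdry_val J v 0 = 0" "bdry_val J v L\<^sub>3 = 0"
  shows "vmap (w, wD J v, z) = v"
proof (rule l2_eqI)
  let ?y = "wD J v" and ?V = "vmap (w, wD J v, z)"
  have p1: "prim_on 0 L\<^sub>1 (bdry_val J v) (rep_l2 ?y)" and r1: "AE x in lborel. x \<in> {0<..<L\<^sub>1} \<longrightarrow>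
      rep_l2 v x = bdry_val J v x"
    using sobolev_J(1)[OF v] by (auto simp: sobolev_def)
  have p2: "prim_on L\<^sub>2 L\<^sub>3 (bdry_val J v) (rep_l2 ?y)" and r2: "AE x in lborel. x \<in> {L\<^sub>2<..<L\<^sub>3}
      \<longrightarrow> rep_l2 v x = bdry_val J v x"
    using sobolev_J(2)[OF v] by (auto simp: sobolev_def)
  have mo: "moment L\<^sub>2 L\<^sub>3 (\<lambda>_. 1) ?y = - bdry_val J v L\<^sub>2"
    using moment_one_deriv[OF sobolev_J(2)[OF v]] L23 bc by simp
  have V1: "AE x in lborel. x \<in> {0<..<L\<^sub>1} \<longrightarrow> rep_l2 ?V x = (LINT t:{0..x}|lborel. rep_l2 ?y t)"
    using sobolev_vmap(1)[of "(w, wD J v, z)"] by (simp add: sobolev_def)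
  have V2: "AE x in lborel. x \<in> {L\<^sub>2<..<L\<^sub>3} \<longrightarrow> rep_l2 ?V x = (LINT t:{L\<^sub>2..x}|lborel. rep_l2 ?y t)
      + bdry_val J v L\<^sub>2"
    using sobolev_vmap(2)[of "(w, wD J v, z)"] mo by (simp add: sobolev_def)
  have z: "AE x in lborel. x \<notin> J \<longrightarrow> rep_l2 v x = 0" "AE x in lborel. x \<notin> J \<longrightarrow> rep_l2 ?V x = 0"
    using H1_imp_L2[OF v] L2_on_vmap[of "(w, wD J v, z)"] by (simp_all add: L2_on_def)
  show "AE x in lborel. rep_l2 ?V x = rep_l2 v x"
    using r1 r2 V1 V2 z
  proof eventually_elim
    case (elim x)
    consider "x \<in> {0<..<L\<^sub>1}" | "x \<in> {L\<^sub>2<..<L\<^sub>3}" | "x \<notin> J" by auto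
    then show ?case
    proof cases
      case 1
      then show ?thesis using elim prim_onD[OF p1, of x] bc by auto
    next
      case 2
      then show ?thesis using elim prim_onD[OF p2, of x] by (auto simp: add.commute)
    qed (use elim in auto)
  qed
qed

lemma umap_X: "(u, v, \<theta>, q, p, r) \<in> Hs \<Longrightarrow> umap (X (u, v, \<theta>, q, p, r)) = u"
  unfolding X_def Hs_iff prod.case by (intro umap_eq) auto

lemma vmap_X: "(u, v, \<theta>, q, p, r) \<in> Hs \<Longrightarrow> vmap (X (u, v, \<theta>, q, p, r)) = v"
  unfolding X_def Hs_iff prod.case by (intro vmap_eq) auto

lemma X_inj:
  assumes "U \<in> Hs" "V \<in> Hs" "X U = X V" shows "U = V"
proof -
  obtain u v \<theta> q p r where U: "U = (u, v, \<theta>, q, p, r)" by (cases U) auto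
  obtain u' v' \<theta>' q' p' r' where V: "V = (u', v', \<theta>', q', p', r')" by (cases V) auto
  have "u = umap (X U)" "v = vmap (X U)" "u' = umap (X V)" "v' = vmap (X V)"
    using assms(1,2) umap_X vmap_X unfolding U V by simp_all
  then have "u = u'" "v = v'" using assms(3) by simp_all
  then show ?thesis using assms(3) by (simp add: U V X_def)
qed

end

lemma has_vector_derivative_within_tendsto:
  fixes f :: "real \<Rightarrow> 'a::real_normed_vector"
  assumes "((\<lambda>s. (f s - f t) /\<^sub>R (s - t)) \<longlongrightarrow> D) (at t within S)"
  shows "(f has_vector_derivative D) (at t within S)"
  unfolding has_vector_derivative_def has_derivative_within'
proof (intro conjI allI impI)
  show "bounded_linear (\<lambda>x. x *\<^sub>R D)" by (rule bounded_linear_scaleR_left)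
  fix e :: real assume "e > 0"
  with assms obtain d where d: "d > 0" "\<And>s. s \<in> S \<Longrightarrow> 0 < dist s t \<Longrightarrow> dist s t < d \<Longrightarrow> dist ((f s - f
      t) /\<^sub>R (s - t)) D < e"
    unfolding Lim_within by metis
  show "\<exists>d>0. \<forall>x'\<in>S. 0 < norm (x' - t) \<and> norm (x' - t) < d \<longrightarrow> norm (f x' - f t - (x' - t) *\<^sub>R D) /
      norm (x' - t) < e"
  proof (intro exI[of _ d] conjI ballI impI d(1))
    fix s assume s: "s \<in> S" "0 < norm (s - t) \<and> norm (s - t) < d"
    have "f s - f t - (s - t) *\<^sub>R D = (s - t) *\<^sub>R ((f s - f t) /\<^sub>R (s - t) - D)"
      using s(2) by (simp add: scaleR_diff_right)
    then have "norm (f s - f t - (s - t) *\<^sub>R D) / norm (s - t) = norm ((f s - f t) /\<^sub>R (s - t) - D)"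
      using s(2) by (simp add: real_norm_def)
    also have "\<dots> < e" using d(2)[OF s(1)] s(2) by (simp add: dist_norm)
    finally show "norm (f s - f t - (s - t) *\<^sub>R D) / norm (s - t) < e" .
  qed
qed

lemma integral_singleton: "(LINT t:{x}|lborel. rep_l2 g t) = 0"
  using integral_at_left[of x g] by simp

section \<open>Image of the embedding and density of the domain\<close>

context transmission
begin

lemma Dom_iff: "(u, v, \<theta>, q, p, r) \<in> Dom \<longleftrightarrow>
     (u, v, \<theta>, q, p, r) \<in> Hs \<and>
     wD I u \<in> H1 I \<and> wD J v \<in> H1 J \<and> \<theta> \<in> H1 I \<and> q \<in> H1 I \<and> p \<in> H1 I \<and> r \<in> H1 J \<and>
     bdry_val J r 0 = 0 \<and> bdry_val J r L\<^sub>3 = 0 \<and>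
     bdry_val I p L\<^sub>1 = bdry_val J r L\<^sub>1 \<and> bdry_val I p L\<^sub>2 = bdry_val J r L\<^sub>2 \<and>
     a *\<^sub>R bdry_val I (wD I u) L\<^sub>1 - m *\<^sub>R bdry_val I \<theta> L\<^sub>1 = b *\<^sub>R bdry_val J (wD J v) L\<^sub>1 \<and>
     a *\<^sub>R bdry_val I (wD I u) L\<^sub>2 - m *\<^sub>R bdry_val I \<theta> L\<^sub>2 = b *\<^sub>R bdry_val J (wD J v) L\<^sub>2 \<and>
     bdry_val I q L\<^sub>1 = 0 \<and> bdry_val I q L\<^sub>2 = 0"
  unfolding domA_def H2_def Let_def by (auto simp: Hs_iff scaleR_conv_of_real)

lemma Dom_Hs: "U \<in> Dom \<Longrightarrow> U \<in> Hs"
  by (cases U) (simp only: Dom_iff)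

lemma Op_eq:
  assumes "(u, v, \<theta>, q, p, r) \<in> Dom"
  shows "Op (u, v, \<theta>, q, p, r) = (p, r, - (k *\<^sub>R wD I q + m *\<^sub>R wD I p),
    - ((k / \<tau>) *\<^sub>R wD I \<theta>) - (1 / \<tau>) *\<^sub>R q, a *\<^sub>R wD I (wD I u) - m *\<^sub>R wD I \<theta>, b *\<^sub>R wD J (wD J
        v))"
proof -
  have h: "wD I u \<in> H1 I" "\<theta> \<in> H1 I" "q \<in> H1 I" "p \<in> H1 I" using assms unfolding Dom_iff by auto
  have "wD I (k *\<^sub>R q + m *\<^sub>R p) = k *\<^sub>R wD I q + m *\<^sub>R wD I p"
    using H1_add(2)[OF open_I H1_scaleR(1)[OF open_I h(3)] H1_scaleR(1)[OF open_I h(4)]]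
    by (simp add: H1_scaleR(2)[OF open_I h(3)] H1_scaleR(2)[OF open_I h(4)])
  moreover have "wD I (a *\<^sub>R wD I u - m *\<^sub>R \<theta>) = a *\<^sub>R wD I (wD I u) - m *\<^sub>R wD I \<theta>"
    using H1_diff(2)[OF open_I H1_scaleR(1)[OF open_I h(1)] H1_scaleR(1)[OF open_I h(2)]]
    by (simp add: H1_scaleR(2)[OF open_I h(1)] H1_scaleR(2)[OF open_I h(2)])
  ultimately show ?thesis by (simp add: opA_def Let_def)
qed

text \<open>On the domain this is the time derivative of the embedded orbit, see
  \<open>XT_deriv\<close>.\<close>

definition dX :: "state \<Rightarrow> l2x6" where "dX U = X (Op U)"

lemma dX_eq:
  assumes "(u, v, \<theta>, q, p, r) \<in> Dom"
  shows "dX (u, v, \<theta>, q, p, r) = (wD I p, wD J r, - (k *\<^sub>R wD I q + m *\<^sub>R wD I p),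
    - ((k / \<tau>) *\<^sub>R wD I \<theta>) - (1 / \<tau>) *\<^sub>R q, a *\<^sub>R wD I (wD I u) - m *\<^sub>R wD I \<theta>, b *\<^sub>R wD J (wD J
        v))"
  unfolding dX_def Op_eq[OF assms] X_def by simp

text \<open>\<open>stretch\<close> vanishes exactly when derivatives in the two parts belong to displacements that vanish
  at \<open>0\<close> and \<open>L\<^sub>3\<close> and are continuous across the interfaces.\<close>

definition stretch :: "l2x6 \<Rightarrow> complex" where
  "stretch Y = moment L\<^sub>1 L\<^sub>2 (\<lambda>_. 1) (fst Y) + (moment 0 L\<^sub>1 (\<lambda>_. 1) (fst (snd Y)) + moment L\<^sub>2
      L\<^sub>3 (\<lambda>_. 1) (fst (snd Y)))"

text \<open>Together with \<open>stretch_X\<close> this describes the image of \<open>X\<close>. The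
  maps \<open>umap\<close> and \<open>vmap\<close> build in all boundary and interface conditions on
  the displacements except continuity at \<open>L\<^sub>2\<close>, and that one amounts to
  \<open>stretch\<close> being zero.\<close>

lemma HsI:
  assumes "w \<in> L2_on I" "y \<in> L2_on J" "\<theta> \<in> L2_on I" "q \<in> L2_on I" "p \<in> L2_on I" "r \<in> L2_on J"
    and L: "stretch (w, y, z) = 0"
  defines "Y \<equiv> (w, y, z)"
  shows "(umap Y, vmap Y, \<theta>, q, p, r) \<in> Hs" "X (umap Y, vmap Y, \<theta>, q, p, r) = (w, y, \<theta>, q, p, r)"
proof -
  have u: "umap Y \<in> H1 I" "wD I (umap Y) = w"
    using H1_intervalI[OF sobolev_umap L12 L2_on_umap, of Y] assms by (auto simp: Y_def)
  have v: "vmap Y \<in> H1 J" "wD J (vmap Y) = y"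
    using H1_two_intervalsI[OF sobolev_vmap L1 L12 L23 L2_on_vmap, of Y] assms by (auto simp: Y_def)
  note bv = bdry_J[OF sobolev_vmap, of _ Y] and bu = bdry_I[OF sobolev_umap, of _ Y]
  have "bdry_val J (vmap Y) 0 = 0" "bdry_val J (vmap Y) L\<^sub>1 = moment 0 L\<^sub>1 (\<lambda>_. 1) y"
    "bdry_val J (vmap Y) L\<^sub>2 = - moment L\<^sub>2 L\<^sub>3 (\<lambda>_. 1) y" "bdry_val J (vmap Y) L\<^sub>3 = 0"
    using bv(1)[of 0] bv(1)[of L\<^sub>1] bv(2)[of L\<^sub>2] bv(2)[of L\<^sub>3] L1 L12 L23
    by (simp_all add: Y_def integral_eq_moment_one integral_singleton)
  moreover have "bdry_val I (umap Y) L\<^sub>1 = moment 0 L\<^sub>1 (\<lambda>_. 1) y"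
    "bdry_val I (umap Y) L\<^sub>2 = moment 0 L\<^sub>1 (\<lambda>_. 1) y + moment L\<^sub>1 L\<^sub>2 (\<lambda>_. 1) w"
    using bu[of L\<^sub>1] bu[of L\<^sub>2] L12 by (simp_all add: Y_def integral_eq_moment_one
        integral_singleton)
  moreover have "moment 0 L\<^sub>1 (\<lambda>_. 1) y + moment L\<^sub>1 L\<^sub>2 (\<lambda>_. 1) w = - moment L\<^sub>2 L\<^sub>3 (\<lambda>_. 1) y"
    using L by (simp add: stretch_def eq_neg_iff_add_eq_0 algebra_simps)
  ultimately show "(umap Y, vmap Y, \<theta>, q, p, r) \<in> Hs"
    using assms(1-6) u v unfolding Hs_iff by simp
  show "X (umap Y, vmap Y, \<theta>, q, p, r) = (w, y, \<theta>, q, p, r)" using u v by (simp add: X_def)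
qed

lemma stretch_X: "U \<in> Hs \<Longrightarrow> stretch (X U) = 0"
proof -
  assume U: "U \<in> Hs"
  obtain u v \<theta> q p r where e: "U = (u, v, \<theta>, q, p, r)" by (cases U) auto
  have h: "u \<in> H1 I" "v \<in> H1 J" using U unfolding e Hs_iff by auto
  show ?thesis
    using U moment_one_deriv[OF sobolev_I[OF h(1)]] moment_one_deriv[OF sobolev_J(1)[OF h(2)]]
        moment_one_deriv[OF sobolev_J(2)[OF h(2)]] L1 L12 L23
    unfolding e Hs_iff by (simp add: stretch_def X_def)
qed

lemma stretch_bounded_linear: "bounded_linear stretch"
  unfolding stretch_def
  by (intro bounded_linear_add bounded_linear_compose[OF moment_bounded_linear]
      bounded_linear_compose[OF bounded_linear_fst] bounded_linear_snd bounded_linear_fst) auto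

definition TI :: "l2 set" where
  "TI = {f \<in> H1 I. bdry_val I f L\<^sub>1 = 0 \<and> bdry_val I f L\<^sub>2 = 0}"

definition TJ :: "l2 set" where
  "TJ = {f \<in> H1 J. bdry_val J f 0 = 0 \<and> bdry_val J f L\<^sub>1 = 0 \<and> bdry_val J f L\<^sub>2 = 0 \<and> bdry_val J f
      L\<^sub>3 = 0}"

lemma TI_dense: assumes "f \<in> L2_on I" shows "f \<in> closure TI"
proof -
  have "test_set I \<subseteq> TI"
  proof
    fix g assume "g \<in> test_set I"
    then obtain G g' where "sobolev L\<^sub>1 L\<^sub>2 G g g'" "G L\<^sub>1 = 0" "G L\<^sub>2 = 0" "g \<in> L2_on I" "g' \<in>
        L2_on I"
      by (rule test_set_sobolev)
    then show "g \<in> TI" using H1_intervalI(1)[of L\<^sub>1 L\<^sub>2 G g g'] bdry_I[of G g g'] L12 by (simp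
        add: TI_def)
  qed
  then show ?thesis using test_set_dense[OF assms] closure_mono by blast
qed

lemma TJ_dense: assumes "f \<in> L2_on J" shows "f \<in> closure TJ"
proof -
  let ?A = "{0<..<L\<^sub>1}" and ?B = "{L\<^sub>2<..<L\<^sub>3}"
  have f: "f = restr ?A f + restr ?B f" using assms L12 by (intro restr_Un) auto
  have "restr ?A f \<in> closure (test_set ?A)" "restr ?B f \<in> closure (test_set ?B)"
    by (intro test_set_dense restr_L2_on; simp)+
  then obtain s t where st: "\<And>n. s n \<in> test_set ?A" "s \<longlonglongrightarrow> restr ?A f" "\<And>n. t n \<in> test_set ?B" "t \<longlonglongrightarrow>
      restr ?B f"
    unfolding closure_sequential by metis
  have "s n + t n \<in> TJ" for n
  proof -
    obtain F f' where F: "sobolev 0 L\<^sub>1 F (s n) f'" "F 0 = 0" "F L\<^sub>1 = 0" "s n \<in> L2_on ?A" "f' \<in>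
        L2_on ?A"
      using test_set_sobolev[OF st(1)[of n]] by metis
    obtain G g' where G: "sobolev L\<^sub>2 L\<^sub>3 G (t n) g'" "G L\<^sub>2 = 0" "G L\<^sub>3 = 0" "t n \<in> L2_on ?B" "g'
        \<in> L2_on ?B"
      using test_set_sobolev[OF st(3)[of n]] by metis
    have d: "?B \<inter> ?A = {}" "?A \<inter> ?B = {}" using L12 by auto
    have s1: "sobolev 0 L\<^sub>1 F (s n + t n) (f' + g')"
      by (rule sobolev_deriv_add_outside[OF sobolev_add_outside[OF F(1) G(4) d(1)] G(5) d(1)])
    have s2: "sobolev L\<^sub>2 L\<^sub>3 G (s n + t n) (f' + g')"
      using sobolev_deriv_add_outside[OF sobolev_add_outside[OF G(1) F(4) d(2)] F(5) d(2)] by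
          (simp add: add.commute)
    have L: "s n + t n \<in> L2_on J" "f' + g' \<in> L2_on J"
      using F G by (auto intro!: L2_on_add intro: L2_on_mono)
    show ?thesis
      using H1_two_intervalsI(1)[OF s1 s2 L1 L12 L23 L] bdry_J[OF s1 s2] F G L1 L12 L23 by (simp
          add: TJ_def)
  qed
  moreover have "(\<lambda>n. s n + t n) \<longlonglongrightarrow> f" using tendsto_add[OF st(2,4)] f by simp
  ultimately show ?thesis by (rule LIMSEQ_in_closure)
qed

lemma TI_scaleC: "f \<in> TI \<Longrightarrow> scaleC c f \<in> TI"
  using H1_scaleC(1)[OF open_I] bdry_I_scaleC by (auto simp: TI_def)

lemma TI_add: "f \<in> TI \<Longrightarrow> g \<in> TI \<Longrightarrow> f + g \<in> TI"
  using H1_add(1)[OF open_I] bdry_I_add by (auto simp: TI_def)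

text \<open>A correction for one scalar constraint that leaves boundary values untouched; it repairs
  \<open>stretch\<close> in \<open>Dom_dense\<close> and \<open>conserved\<close> in
  \<open>D0_dense\<close>. It exists because \<open>TI\<close> approximates the constant 1, whose
  integral is not zero.\<close>

lemma TI_moment_one: "\<exists>\<eta>\<in>TI. moment L\<^sub>1 L\<^sub>2 (\<lambda>_. 1) \<eta> = 1"
proof -
  have "const_on L\<^sub>1 L\<^sub>2 1 \<in> closure TI" by (rule TI_dense[OF L2_on_const_on])
  then obtain s where s: "\<And>n. s n \<in> TI" "s \<longlonglongrightarrow> const_on L\<^sub>1 L\<^sub>2 1" unfolding closure_sequential by
      auto
  have "(\<lambda>n. moment L\<^sub>1 L\<^sub>2 (\<lambda>_. 1) (s n)) \<longlonglongrightarrow> moment L\<^sub>1 L\<^sub>2 (\<lambda>_. 1) (const_on L\<^sub>1 L\<^sub>2 1)"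
    by (rule bounded_linear.tendsto[OF moment_bounded_linear s(2)]) simp
  moreover have "moment L\<^sub>1 L\<^sub>2 (\<lambda>_. 1) (const_on L\<^sub>1 L\<^sub>2 1) \<noteq> 0" using L12 by (simp add:
      moment_one_const_on)
  ultimately have "\<forall>\<^sub>F n in sequentially. moment L\<^sub>1 L\<^sub>2 (\<lambda>_. 1) (s n) \<noteq> 0" by (rule
      tendsto_imp_eventually_ne)
  then obtain n where n: "moment L\<^sub>1 L\<^sub>2 (\<lambda>_. 1) (s n) \<noteq> 0" by (auto simp: eventually_sequentially)
  show ?thesis
    by (rule bexI[of _ "scaleC (1 / moment L\<^sub>1 L\<^sub>2 (\<lambda>_. 1) (s n)) (s n)"]) (use n s in \<open>auto simp:
        moment_scaleC TI_scaleC\<close>)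
qed

text \<open>Averaging orbits would give density from the semigroup alone, but needs completeness of the
  energy space; approximation by test functions avoids this.\<close>

lemma Dom_dense:
  assumes "U \<in> Hs"
  obtains V where "\<And>n. V n \<in> Dom" "(\<lambda>n. X (V n)) \<longlonglongrightarrow> X U"
proof -
  obtain u v \<theta> q p r where U: "U = (u, v, \<theta>, q, p, r)" by (cases U) auto
  have w: "wD I u \<in> L2_on I" and y: "wD J v \<in> L2_on J"
    using assms wD_props(1) open_I open_J unfolding U Hs_iff by blast+
  have h: "\<theta> \<in> L2_on I" "q \<in> L2_on I" "p \<in> L2_on I" "r \<in> L2_on J" using assms unfolding U Hs_iff
      by auto
  obtain sw where sw: "\<And>n. sw n \<in> TI" "sw \<longlonglongrightarrow> wD I u" using TI_dense[OF w] unfolding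
      closure_sequential by auto
  obtain sy where sy: "\<And>n. sy n \<in> TJ" "sy \<longlonglongrightarrow> wD J v" using TJ_dense[OF y] unfolding
      closure_sequential by auto
  obtain st where st: "\<And>n. st n \<in> TI" "st \<longlonglongrightarrow> \<theta>" using TI_dense[OF h(1)] unfolding
      closure_sequential by auto
  obtain sq where sq: "\<And>n. sq n \<in> TI" "sq \<longlonglongrightarrow> q" using TI_dense[OF h(2)] unfolding
      closure_sequential by auto
  obtain sp where sp: "\<And>n. sp n \<in> TI" "sp \<longlonglongrightarrow> p" using TI_dense[OF h(3)] unfolding
      closure_sequential by auto
  obtain sr where sr: "\<And>n. sr n \<in> TJ" "sr \<longlonglongrightarrow> r" using TJ_dense[OF h(4)] unfolding
      closure_sequential by auto
  obtain \<eta> where \<eta>: "\<eta> \<in> TI" "moment L\<^sub>1 L\<^sub>2 (\<lambda>_. 1) \<eta> = 1" using TI_moment_one by blast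
  define z where "z = (\<theta>, q, p, r)"
  define c where "c n = stretch (sw n, sy n, z)" for n
  \<comment> \<open>The approximants may violate the constraint by \<open>c n\<close>, which tends
    to the \<open>stretch\<close> of \<open>X U\<close>, that is to zero. The multiple of
    \<open>\<eta>\<close> removes the defect without disturbing the limit.\<close>
  define w' where "w' n = sw n + scaleC (- c n) \<eta>" for n
  have "c \<longlonglongrightarrow> stretch (wD I u, wD J v, z)"
    unfolding c_def by (intro bounded_linear.tendsto[OF stretch_bounded_linear] tendsto_Pair sw sy
        tendsto_const)
  moreover have "stretch (wD I u, wD J v, z) = 0" using stretch_X[OF assms] by (simp add: U X_def
      z_def)
  ultimately have c0: "c \<longlonglongrightarrow> 0" by simp
  have "(\<lambda>n. cmod (- c n) * norm \<eta>) \<longlonglongrightarrow> 0"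
    using tendsto_mult_left_zero[OF tendsto_norm_zero[OF c0], of "norm \<eta>"] by simp
  then have sc0: "(\<lambda>n. scaleC (- c n) \<eta>) \<longlonglongrightarrow> 0"
    unfolding norm_scaleC[symmetric] by (rule tendsto_norm_zero_cancel)
  have w'lim: "w' \<longlonglongrightarrow> wD I u"
    unfolding w'_def[abs_def] using tendsto_add[OF sw(2) sc0] by simp
  have w'T: "w' n \<in> TI" for n unfolding w'_def by (intro TI_add TI_scaleC sw \<eta>)
  have L0: "stretch (w' n, sy n, z) = 0" for n
  proof -
    have "moment L\<^sub>1 L\<^sub>2 (\<lambda>_. 1) (w' n) = moment L\<^sub>1 L\<^sub>2 (\<lambda>_. 1) (sw n) - c n"
      unfolding w'_def using linear_add[OF bounded_linear.linear[OF moment_bounded_linear]] \<eta>(2)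
          by (simp add: moment_scaleC)
    then show ?thesis by (simp add: stretch_def c_def)
  qed
  have TL: "f \<in> TI \<Longrightarrow> f \<in> L2_on I" "f \<in> TJ \<Longrightarrow> f \<in> L2_on J" for f
    by (auto simp: TI_def TJ_def H1_imp_L2)
  define V where "V n = (umap (w' n, sy n, z), vmap (w' n, sy n, z), st n, sq n, sp n, sr n)" for n
  note H = HsI[OF TL(1)[OF w'T] TL(2)[OF sy(1)] TL(1)[OF st(1)] TL(1)[OF sq(1)] TL(1)[OF sp(1)]
      TL(2)[OF sr(1)] L0]
  have XV: "X (V n) = (w' n, sy n, st n, sq n, sp n, sr n)" for n
    unfolding V_def by (rule H(2))
  show ?thesis
  proof (rule that[of V])
    fix n
    have d: "wD I (umap (w' n, sy n, z)) = w' n" "wD J (vmap (w' n, sy n, z)) = sy n"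
      using XV[of n] by (simp_all add: V_def X_def)
    \<comment> \<open>All approximating components vanish at the end points of their intervals, so
      the conditions on velocity, stress and heat flux read 0 = 0.\<close>
    show "V n \<in> Dom"
      unfolding V_def Dom_iff d using H(1) w'T[of n] sy(1)[of n] st(1)[of n] sq(1)[of n] sp(1)[of
          n] sr(1)[of n]
      by (simp add: TI_def TJ_def)
  next
    show "(\<lambda>n. X (V n)) \<longlonglongrightarrow> X U"
      unfolding XV unfolding U X_def prod.case by (intro tendsto_Pair w'lim sy st sq sp sr)
  qed
qed

end

section \<open>Orbits of the semigroup in the embedded picture\<close>

locale transmission_flow = transmission +
  fixes T :: "real \<Rightarrow> state \<Rightarrow> state"
  assumes sol: "solution_semigroup L\<^sub>1 L\<^sub>2 L\<^sub>3 a b m k \<tau> T"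
begin

lemma
  shows T_Hs: "0 \<le> t \<Longrightarrow> U \<in> Hs \<Longrightarrow> T t U \<in> Hs"
    and T_contr: "0 \<le> t \<Longrightarrow> U \<in> Hs \<Longrightarrow> Nrm (T t U) \<le> Nrm U"
    and T_add: "0 \<le> t \<Longrightarrow> U \<in> Hs \<Longrightarrow> V \<in> Hs \<Longrightarrow> T t (U + V) = T t U + T t V"
    and T_scaleC: "0 \<le> t \<Longrightarrow> U \<in> Hs \<Longrightarrow> T t (state_scaleC c U) = state_scaleC c (T t U)"
    and T_0: "U \<in> Hs \<Longrightarrow> T 0 U = U"
    and T_plus: "0 \<le> s \<Longrightarrow> 0 \<le> t \<Longrightarrow> U \<in> Hs \<Longrightarrow> T (s + t) U = T s (T t U)"
    and T_cont: "U \<in> Hs \<Longrightarrow> ((\<lambda>t. Nrm (T t U - U)) \<longlongrightarrow> 0) (at_right 0)"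
    and Dom_alt: "Dom = {U \<in> Hs. \<exists>V\<in>Hs. has_semigroup_deriv state_scaleC Nrm T U V}"
    and Op_Hs: "U \<in> Dom \<Longrightarrow> Op U \<in> Hs"
    and Op_deriv: "U \<in> Dom \<Longrightarrow> has_semigroup_deriv state_scaleC Nrm T U (Op U)"
  using sol unfolding solution_semigroup_def contraction_semigroup_def generator_def by blast+

lemma T_diff: "0 \<le> t \<Longrightarrow> U \<in> Hs \<Longrightarrow> V \<in> Hs \<Longrightarrow> T t (U - V) = T t U - T t V"
  using T_add[of t U "state_scaleC (-1) V"] T_scaleC[of t V "-1"] Hs_scaleC(1)[of V "-1"]
  by (simp add: uminus_state[symmetric])

definition quot :: "real \<Rightarrow> state \<Rightarrow> state" where
  "quot h U = state_scaleC (of_real (1 / h)) (T h U - U)"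

lemma quot_Hs: "0 \<le> h \<Longrightarrow> U \<in> Hs \<Longrightarrow> quot h U \<in> Hs"
  unfolding quot_def by (intro Hs_scaleC Hs_diff T_Hs)

lemma X_quot: "0 \<le> h \<Longrightarrow> U \<in> Hs \<Longrightarrow> X (quot h U) = (X (T h U) - X U) /\<^sub>R h"
  unfolding quot_def using Hs_scaleC(2)[OF Hs_diff(1)[OF T_Hs[of h U], of U], of "of_real (1 /
      h)"] Hs_diff(2)[OF T_Hs[of h U], of U]
    cX_of_real[of "1 / h"]
  by (simp add: inverse_eq_divide)

lemma T_quot: "0 \<le> t \<Longrightarrow> 0 \<le> h \<Longrightarrow> U \<in> Hs \<Longrightarrow> T t (quot h U) = quot h (T t U)"
  unfolding quot_def using T_scaleC[of t "T h U - U"] T_diff[of t "T h U" U] Hs_diff(1)[OF T_Hs[of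
      h U], of U] T_Hs[of h U]
    T_plus[of t h U] T_plus[of h t U]
  by (simp add: add.commute)

lemma XT_le:
  assumes "0 \<le> t" "U \<in> Hs" shows "norm (X (T t U)) \<le> Nrm U / nlo"
  using Nrm_bounds(1)[OF T_Hs[OF assms]] T_contr[OF assms] nlo_pos
  by (simp add: pos_le_divide_eq mult.commute)

text \<open>Difference quotients commute with \<open>T t\<close>, and \<open>T t\<close> contracts;
  so they converge along the orbit as well, with limit \<open>T t (Op U)\<close>. Since
  \<open>Dom\<close> consists of all states whose quotients converge, it is invariant, and
  uniqueness of limits identifies the derivative.\<close>

lemma
  assumes "U \<in> Dom" "0 \<le> t"
  shows T_Dom: "T t U \<in> Dom" and dX_T: "dX (T t U) = X (T t (Op U))"
proof -
  have UH: "U \<in> Hs" by (rule Dom_Hs[OF assms(1)])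
  have lim: "((\<lambda>h. Nrm (quot h U - Op U)) \<longlongrightarrow> 0) (at_right 0)"
    using Op_deriv[OF assms(1)] by (simp add: has_semigroup_deriv_def quot_def)
  have le: "Nrm (quot h (T t U) - T t (Op U)) \<le> Nrm (quot h U - Op U)" "0 \<le> Nrm (quot h (T t U) -
      T t (Op U))" if "h > 0" for h
  proof -
    have q: "quot h U \<in> Hs" using that UH by (simp add: quot_Hs)
    have e: "quot h (T t U) - T t (Op U) = T t (quot h U - Op U)"
      using T_diff[OF assms(2) q Op_Hs[OF assms(1)]] T_quot[OF assms(2) _ UH, of h] that by simp
    have H: "quot h U - Op U \<in> Hs" by (rule Hs_diff(1)[OF q Op_Hs[OF assms(1)]])
    show "Nrm (quot h (T t U) - T t (Op U)) \<le> Nrm (quot h U - Op U)"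
      unfolding e by (rule T_contr[OF assms(2) H])
    show "0 \<le> Nrm (quot h (T t U) - T t (Op U))"
      unfolding e using energy_form_nonneg by (simp add: Nrm_eq[OF T_Hs[OF assms(2) H]])
  qed
  have lim2: "((\<lambda>h. Nrm (quot h (T t U) - T t (Op U))) \<longlongrightarrow> 0) (at_right 0)"
    by (rule tendsto_sandwich[OF _ _ tendsto_const lim]) (use le in \<open>auto simp:
        eventually_at_right_less intro!: eventually_mono[OF eventually_at_right_less[of 0]]\<close>)
  have TU: "T t U \<in> Hs" and TO: "T t (Op U) \<in> Hs" using T_Hs[OF assms(2)] UH Op_Hs[OF assms(1)] by
      auto
  have D: "has_semigroup_deriv state_scaleC Nrm T (T t U) (T t (Op U))"
    using lim2 by (simp add: has_semigroup_deriv_def quot_def)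
  then show TD: "T t U \<in> Dom" unfolding Dom_alt using TU TO by blast
  have Xlim: "((\<lambda>h. X (quot h (T t U))) \<longlongrightarrow> X V) (at_right 0)"
    if V: "V \<in> Hs" "has_semigroup_deriv state_scaleC Nrm T (T t U) V" for V
  proof -
    have l: "((\<lambda>h. Nrm (quot h (T t U) - V) / nlo) \<longlongrightarrow> 0 / nlo) (at_right 0)"
      using V(2) nlo_pos by (intro tendsto_intros) (auto simp: has_semigroup_deriv_def quot_def)
    have "((\<lambda>h. X (quot h (T t U)) - X V) \<longlongrightarrow> 0) (at_right 0)"
    proof (rule Lim_null_comparison[where g = "\<lambda>h. Nrm (quot h (T t U) - V) / nlo"])
      show "\<forall>\<^sub>F h in at_right 0. norm (X (quot h (T t U)) - X V) \<le> Nrm (quot h (T t U) - V) / nlo"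
        using eventually_at_right_less[of 0]
      proof eventually_elim
        case (elim h)
        have "quot h (T t U) \<in> Hs" using elim TU by (simp add: quot_Hs)
        from Nrm_bounds(1)[OF Hs_diff(1)[OF this V(1)]] Hs_diff(2)[OF this V(1)]
        show ?case using nlo_pos by (simp add: pos_le_divide_eq mult.commute)
      qed
    qed (use l in simp)
    then show ?thesis by (simp add: LIM_zero_iff)
  qed
  show "dX (T t U) = X (T t (Op U))"
    unfolding dX_def
    by (rule tendsto_unique[OF _ Xlim[OF Op_Hs[OF TD] Op_deriv[OF TD]] Xlim[OF TO D]]) simp
qed

text \<open>The generator provides right derivatives only. For \<open>s < t\<close> the quotient is
  pulled back to time \<open>s\<close>, where \<open>T s\<close> contracts, and compared with
  \<open>T (t - s) (Op U)\<close>; strong continuity at zero makes the defect tend to zero.\<close>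

lemma XT_deriv:
  assumes U: "U \<in> Dom" and t: "0 \<le> t"
  shows "((\<lambda>s. X (T s U)) has_vector_derivative dX (T t U)) (at t within {0..})"
proof (rule has_vector_derivative_within_tendsto)
  have UH: "U \<in> Hs" and OH: "Op U \<in> Hs" using Dom_Hs[OF U] Op_Hs[OF U] by auto
  \<comment> \<open>The first summand bounds the error for \<open>s > t\<close>; for
    \<open>s < t\<close> both are used.\<close>
  define \<rho> where "\<rho> h = Nrm (quot h U - Op U) / nlo + Nrm (T h (Op U) - Op U) / nlo" for h
  have lim: "(\<rho> \<longlongrightarrow> 0 / nlo + 0 / nlo) (at_right 0)"
    unfolding \<rho>_def using Op_deriv[OF U] T_cont[OF OH] nlo_pos
    by (intro tendsto_intros) (auto simp: has_semigroup_deriv_def quot_def)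
  have mid: "norm (X (T s (quot h U)) - X (T s (Op U))) \<le> Nrm (quot h U - Op U) / nlo" if "s \<ge> 0"
      "h > 0" for s h
  proof -
    have q: "quot h U \<in> Hs" using that UH by (simp add: quot_Hs)
    have "X (T s (quot h U)) - X (T s (Op U)) = X (T s (quot h U - Op U))"
      using T_diff[OF that(1) q OH] Hs_diff(2)[OF T_Hs[OF that(1) q] T_Hs[OF that(1) OH]] by simp
    then show ?thesis using XT_le[OF that(1) Hs_diff(1)[OF q OH]] by simp
  qed
  have mid2: "norm (X (T s (T h (Op U))) - X (T s (Op U))) \<le> Nrm (T h (Op U) - Op U) / nlo" if "s
      \<ge> 0" "h > 0" for s h
  proof -
    have q: "T h (Op U) \<in> Hs" using that OH by (simp add: T_Hs)
    have "X (T s (T h (Op U))) - X (T s (Op U)) = X (T s (T h (Op U) - Op U))"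
      using T_diff[OF that(1) q OH] Hs_diff(2)[OF T_Hs[OF that(1) q] T_Hs[OF that(1) OH]] by simp
    then show ?thesis using XT_le[OF that(1) Hs_diff(1)[OF q OH]] by simp
  qed
  have nn: "0 \<le> Nrm V / nlo" if "V \<in> Hs" for V using that energy_form_nonneg nlo_pos by (simp add:
      Nrm_eq)
  have quo: "(X (T (s + h) U) - X (T s U)) /\<^sub>R h = X (T s (quot h U))" if "s \<ge> 0" "h > 0" for s h
    using that UH T_quot[of s h U] X_quot[of h "T s U"] T_Hs[of s U] T_plus[of h s U] by (simp
        add: add.commute)
  have key: "norm ((X (T s U) - X (T t U)) /\<^sub>R (s - t) - dX (T t U)) \<le> \<rho> \<bar>s - t\<bar>" if "s \<ge> 0" "s \<noteq>
      t" for s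
  proof (cases "s > t")
    case True
    have "(X (T s U) - X (T t U)) /\<^sub>R (s - t) = X (T t (quot (s - t) U))"
      using quo[of t "s - t"] True t by simp
    then show ?thesis
      using mid[of t "s - t"] True t dX_T[OF U t] nn[OF Hs_diff(1)[OF T_Hs[of "s - t", OF _ OH]
          OH]] by (simp add: \<rho>_def)
  next
    case False
    then have st: "s < t" using that by simp
    have e: "(X (T s U) - X (T t U)) /\<^sub>R (s - t) = (X (T t U) - X (T s U)) /\<^sub>R (t - s)"
    proof -
      have "inverse (s - t) = - inverse (t - s)" using inverse_minus_eq[of "t - s"] by simp
      then show ?thesis by (simp add: scaleR_diff_right)
    qed
    have e2: "X (T t (Op U)) = X (T s (T (t - s) (Op U)))" using T_plus[of s "t - s" "Op U"] st
        that OH by simp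
    have "(X (T s U) - X (T t U)) /\<^sub>R (s - t) - dX (T t U)
      = (X (T s (quot (t - s) U)) - X (T s (Op U))) - (X (T s (T (t - s) (Op U))) - X (T s (Op U)))"
      unfolding e dX_T[OF U t] e2 using quo[of s "t - s"] st that by simp
    then have "norm ((X (T s U) - X (T t U)) /\<^sub>R (s - t) - dX (T t U))
      \<le> norm (X (T s (quot (t - s) U)) - X (T s (Op U))) + norm (X (T s (T (t - s) (Op U))) - X (T
          s (Op U)))"
      by (simp only: norm_triangle_ineq4)
    then show ?thesis using mid[of s "t - s"] mid2[of s "t - s"] st that by (simp add: \<rho>_def abs_if)
  qed
  have "((\<lambda>s. \<bar>s - t\<bar>) \<longlongrightarrow> 0) (at t within {0..})" by (auto intro!: tendsto_eq_intros)
  then have "filterlim (\<lambda>s. \<bar>s - t\<bar>) (at_right 0) (at t within {0..})"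
    by (auto simp: filterlim_at eventually_at_filter)
  from filterlim_compose[OF lim this] have rho0: "((\<lambda>s. \<rho> \<bar>s - t\<bar>) \<longlongrightarrow> 0) (at t within {0..})" by simp
  have "((\<lambda>s. (X (T s U) - X (T t U)) /\<^sub>R (s - t) - dX (T t U)) \<longlongrightarrow> 0) (at t within {0..})"
  proof (rule Lim_null_comparison[OF _ rho0])
    show "\<forall>\<^sub>F s in at t within {0..}. norm ((X (T s U) - X (T t U)) /\<^sub>R (s - t) - dX (T t U)) \<le> \<rho>
        \<bar>s - t\<bar>"
      unfolding eventually_at_filter by (intro always_eventually allI impI key) simp_all
  qed
  then show "((\<lambda>s. (X (T s U) - X (T t U)) /\<^sub>R (s - t)) \<longlongrightarrow> dX (T t U)) (at t within {0..})"
    by (simp add: LIM_zero_iff)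
qed

end

section \<open>Bilinear forms and algebra of weights\<close>

lemma bounded_bilinear_inner_compose:
  fixes M N :: "'a::real_normed_vector \<Rightarrow> 'b::real_inner"
  assumes "bounded_linear M" "bounded_linear N"
  shows "bounded_bilinear (\<lambda>y z. M y \<bullet> N z)"
  using bounded_bilinear.comp[OF bounded_bilinear_inner assms] .

lemma bounded_bilinear_plus:
  fixes A B :: "'a::real_normed_vector \<Rightarrow> 'b::real_normed_vector \<Rightarrow> 'c::real_normed_vector"
  assumes "bounded_bilinear A" "bounded_bilinear B"
  shows "bounded_bilinear (\<lambda>y z. A y z + B y z)"
proof -
  interpret A: bounded_bilinear A by fact
  interpret B: bounded_bilinear B by fact
  obtain K where K: "\<And>y z. norm (A y z) \<le> norm y * norm z * K" using A.bounded by blast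
  obtain L where L: "\<And>y z. norm (B y z) \<le> norm y * norm z * L" using B.bounded by blast
  show ?thesis
  proof
    show "\<exists>K. \<forall>y z. norm (A y z + B y z) \<le> norm y * norm z * K"
    proof (intro exI allI)
      show "norm (A y z + B y z) \<le> norm y * norm z * (K + L)" for y z
        using norm_triangle_le[of "A y z" "B y z" "norm y * norm z * K + norm y * norm z * L"]
            K[of y z] L[of y z]
        by (simp add: distrib_left)
    qed
  qed (simp_all add: A.add_left A.add_right B.add_left B.add_right A.scaleR_left A.scaleR_right
      B.scaleR_left B.scaleR_right scaleR_add_right)
qed

lemma bounded_bilinear_cmult:
  fixes A :: "'a::real_normed_vector \<Rightarrow> 'b::real_normed_vector \<Rightarrow> real"
  assumes "bounded_bilinear A" shows "bounded_bilinear (\<lambda>y z. c * A y z)"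
proof -
  interpret A: bounded_bilinear A by fact
  obtain K where K: "\<And>y z. norm (A y z) \<le> norm y * norm z * K" using A.bounded by blast
  show ?thesis
  proof
    show "\<exists>K. \<forall>y z. norm (c * A y z) \<le> norm y * norm z * K"
      using K mult_left_mono[OF K abs_ge_zero[of c]]
      by (intro exI[of _ "\<bar>c\<bar> * K"]) (simp add: abs_mult algebra_simps)
  qed (simp_all add: A.add_left A.add_right A.scaleR_left A.scaleR_right algebra_simps)
qed

lemma bounded_bilinear_zero: "bounded_bilinear (\<lambda>y z. 0)"
  by standard (auto intro: exI[of _ 0])

lemma wmult_nonneg:
  assumes h: "continuous_on UNIV h" and "\<And>x. x \<in> {\<alpha><..<\<beta>} \<Longrightarrow> 0 \<le> h x"
  shows "0 \<le> wmult \<alpha> \<beta> h f \<bullet> f"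
  unfolding inner_l2_def
proof (rule integral_nonneg_AE)
  show "AE x in lborel. 0 \<le> rep_l2 (wmult \<alpha> \<beta> h f) x \<bullet> rep_l2 f x"
    using rep_wmult[OF h, of \<alpha> \<beta> f]
  proof eventually_elim
    case (elim x)
    have "0 \<le> indicator {\<alpha><..<\<beta>} x * h x" using assms(2)[of x] by (auto simp: indicator_def)
    then show ?case unfolding elim cut_weight_def by (simp add: scaleR_conv_of_real[symmetric]
        del: of_real_mult)
  qed
qed

lemma wmult_wmult:
  assumes "continuous_on UNIV h" "continuous_on UNIV g"
  shows "wmult \<alpha> \<beta> h (wmult \<alpha> \<beta> g f) = wmult \<alpha> \<beta> (\<lambda>x. h x * g x) f"
proof (rule l2_eqI)
  have c: "continuous_on UNIV (\<lambda>x. h x * g x)" using assms by (intro continuous_intros)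
  show "AE x in lborel. rep_l2 (wmult \<alpha> \<beta> h (wmult \<alpha> \<beta> g f)) x = rep_l2 (wmult \<alpha> \<beta> (\<lambda>x. h x * g x)
      f) x"
    using rep_wmult[OF assms(1), of \<alpha> \<beta> "wmult \<alpha> \<beta> g f"] rep_wmult[OF assms(2), of \<alpha> \<beta> f]
        rep_wmult[OF c, of \<alpha> \<beta> f]
    by eventually_elim (auto simp: cut_weight_def indicator_def)
qed

text \<open>Used to split the weight \<open>hh'\<close> into a positive constant and a multiple of
  \<open>chi\<close>.\<close>

lemma wmult_affine_weight:
  assumes h: "continuous_on UNIV h" and f: "f \<in> L2_on {\<alpha><..<\<beta>}"
  shows "wmult \<alpha> \<beta> (\<lambda>x. c + d * h x) f = c *\<^sub>R f + d *\<^sub>R wmult \<alpha> \<beta> h f"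
proof (rule l2_eqI)
  have c: "continuous_on UNIV (\<lambda>x. c + d * h x)" using h by (intro continuous_intros)
  have "AE x in lborel. x \<notin> {\<alpha><..<\<beta>} \<longrightarrow> rep_l2 f x = 0" using f by (simp add: L2_on_def)
  then show "AE x in lborel. rep_l2 (wmult \<alpha> \<beta> (\<lambda>x. c + d * h x) f) x = rep_l2 (c *\<^sub>R f + d *\<^sub>R
      wmult \<alpha> \<beta> h f) x"
    using rep_wmult[OF h, of \<alpha> \<beta> f] rep_wmult[OF c, of \<alpha> \<beta> f] rep_l2_plus[of "c *\<^sub>R f" "d *\<^sub>R
        wmult \<alpha> \<beta> h f"]
      rep_l2_scaleR[of c f] rep_l2_scaleR[of d "wmult \<alpha> \<beta> h f"]
  proof eventually_elim
    case (elim x)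
    then show ?case by (cases "x \<in> {\<alpha><..<\<beta>}") (simp_all add: cut_weight_def scaleR_conv_of_real
        algebra_simps)
  qed
qed

text \<open>Turns the linear part of \<open>interp\<close> into a polynomial weight, so that pairing
  with it produces moments.\<close>

lemma prim_op_const_on: "prim_op \<alpha> \<beta> (const_on \<alpha> \<beta> c) = wmult \<alpha> \<beta> (\<lambda>x. x - \<alpha>) (const_on \<alpha> \<beta> c)"
proof (rule l2_eqI)
  have c: "continuous_on UNIV (\<lambda>x::real. x - \<alpha>)" by (intro continuous_intros)
  have i: "(LINT t:{\<alpha>..x}|lborel. rep_l2 (const_on \<alpha> \<beta> c) t) = of_real (x - \<alpha>) * c" if "x \<in>
      {\<alpha><..<\<beta>}" for x
  proof -
    have "(LINT t:{\<alpha>..x}|lborel. rep_l2 (const_on \<alpha> \<beta> c) t) = (LINT t|lborel. indicator {\<alpha>..x} t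
        *\<^sub>R c)"
      unfolding set_lebesgue_integral_def
    proof (rule integral_cong_AE)
      show "AE t in lborel. indicator {\<alpha>..x} t *\<^sub>R rep_l2 (const_on \<alpha> \<beta> c) t = indicator {\<alpha>..x} t
          *\<^sub>R c"
        using rep_const_on[of \<alpha> \<beta> c] AE_lborel_singleton[of \<alpha>]
        by eventually_elim (use that in \<open>auto simp: indicator_def\<close>)
    qed auto
    also have "\<dots> = of_real (x - \<alpha>) * c" using that by (simp add: scaleR_conv_of_real)
    finally show ?thesis .
  qed
  show "AE x in lborel. rep_l2 (prim_op \<alpha> \<beta> (const_on \<alpha> \<beta> c)) x = rep_l2 (wmult \<alpha> \<beta> (\<lambda>x. x - \<alpha>)
      (const_on \<alpha> \<beta> c)) x"
    using rep_prim_op[of \<alpha> \<beta> "const_on \<alpha> \<beta> c"] rep_wmult[OF c, of \<alpha> \<beta> "const_on \<alpha> \<beta> c"]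
        rep_const_on[of \<alpha> \<beta> c]
  proof eventually_elim
    case (elim x)
    then show ?case using i[of x] by (cases "x \<in> {\<alpha><..<\<beta>}") (simp_all add: cut_weight_def)
  qed
qed

lemma moment_const_on:
  assumes "C1 H h" "\<alpha> \<le> \<beta>" shows "moment \<alpha> \<beta> h (const_on \<alpha> \<beta> c) = (H \<beta> - H \<alpha>) *\<^sub>R c"
  using ibp_moment[OF sobolev_const_on[of \<alpha> \<beta> c] assms] bounded_linear.linear[OF
      moment_bounded_linear[OF C1_continuous(1)[OF assms(1)], of \<alpha> \<beta>]]
  by (simp add: linear_0 scaleR_diff_left)

lemma ibp_one:
  assumes "sobolev \<alpha> \<beta> F f f'" "sobolev \<alpha> \<beta> G g g'" "\<alpha> \<le> \<beta>" "f \<in> L2_on {\<alpha><..<\<beta>}" "f' \<in> L2_on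
      {\<alpha><..<\<beta>}"
  shows "f' \<bullet> g + f \<bullet> g' = F \<beta> \<bullet> G \<beta> - F \<alpha> \<bullet> G \<alpha>"
  using ibp[OF assms(1,2) C1_const[of 1] assms(3)] by (simp add: wmult_one[OF assms(4)]
      wmult_one[OF assms(5)] wmult_zero_weight)

lemma prim_op_deriv:
  assumes "sobolev \<alpha> \<beta> F f f'" "f \<in> L2_on {\<alpha><..<\<beta>}"
  shows "prim_op \<alpha> \<beta> f' = f - const_on \<alpha> \<beta> (F \<alpha>)"
  using sobolev_unique[OF assms] by (simp add: algebra_simps)

lemma const_on_inner: "f \<in> L2_on {\<alpha><..<\<beta>} \<Longrightarrow> f \<bullet> const_on \<alpha> \<beta> c = moment \<alpha> \<beta> (\<lambda>_. 1) f \<bullet> c"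
  using inner_wmult_const_on[of "\<lambda>_. 1" \<alpha> \<beta> f c] by (simp add: wmult_one)

context transmission
begin

definition "cw Y = fst Y" for Y :: l2x6
definition "cy Y = fst (snd Y)" for Y :: l2x6
definition "ct Y = fst (snd (snd Y))" for Y :: l2x6
definition "cq Y = fst (snd (snd (snd Y)))" for Y :: l2x6
definition "cp Y = fst (snd (snd (snd (snd Y))))" for Y :: l2x6
definition "cr Y = snd (snd (snd (snd (snd Y))))" for Y :: l2x6

lemma component_bounded_linear:
  "bounded_linear cw" "bounded_linear cy" "bounded_linear ct" "bounded_linear cq" "bounded_linear
      cp" "bounded_linear cr"
  unfolding cw_def cy_def ct_def cq_def cp_def cr_def
  by (intro bounded_linear_fst bounded_linear_snd bounded_linear_compose[OF bounded_linear_fst]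
      bounded_linear_compose[OF bounded_linear_snd])+

subsection \<open>Controlled functionals\<close>

definition conserved :: "l2x6 \<Rightarrow> complex" where "conserved Y = moment L\<^sub>1 L\<^sub>2 (\<lambda>_. 1) (m *\<^sub>R cw Y +
    ct Y)"

definition D0 :: "state set" where "D0 = {U \<in> Dom. conserved (X U) = 0}"

text \<open>These boundary values are not continuous in the energy norm, yet errors contain them
  through linear interpolants of the velocity. As part of \<open>R\<close> they count as bounded,
  and \<open>controlled_kinetic\<close> finally recovers them.\<close>

definition trace_sq :: "state \<Rightarrow> real" where
  "trace_sq U = (cmod (bdry_val I (cp (X U)) L\<^sub>1))\<^sup>2 + (cmod (bdry_val I (cp (X U)) L\<^sub>2))\<^sup>2"

definition R :: "state \<Rightarrow> real" where "R U = (norm (X U))\<^sup>2 + trace_sq U"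

lemma trace_sq_nonneg: "0 \<le> trace_sq U" by (simp add: trace_sq_def)
lemma R_nonneg: "0 \<le> R U" by (simp add: R_def trace_sq_nonneg)

definition dot :: "(l2x6 \<Rightarrow> l2x6 \<Rightarrow> real) \<Rightarrow> state \<Rightarrow> real" where
  "dot B U = B (X U) (dX U) + B (dX U) (X U)"

text \<open>
  \<open>dot B\<close> is the time derivative of the quadratic functional \<open>B\<close> along the flow. A functional is
  controlled if its time integral is bounded by the energy at the end points plus a small multiple
      of
  the time integral of \<open>R\<close>, the energy together with the traces of the velocity. The estimates are
  closed by showing that \<open>R\<close> is controlled.
\<close>

definition controlled :: "(state \<Rightarrow> real) \<Rightarrow> bool" where
  "controlled f \<longleftrightarrow> (\<forall>\<epsilon>>0. \<exists>B. bounded_bilinear B \<and> (\<forall>U\<in>D0. f U \<le> dot B U + \<epsilon> * R U))"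

definition small :: "(state \<Rightarrow> 'a::real_inner) \<Rightarrow> bool" where
  "small f \<longleftrightarrow> controlled (\<lambda>U. (norm (f U))\<^sup>2)"

text \<open>Measured against \<open>R\<close> and not against the norm of the state, so that traces
  of the velocity qualify.\<close>

definition bnd :: "(state \<Rightarrow> 'a::real_inner) \<Rightarrow> bool" where
  "bnd f \<longleftrightarrow> (\<exists>C\<ge>0. \<forall>U\<in>D0. norm (f U) \<le> C * sqrt (R U))"

text \<open>The modulus makes the notion stable under negative multiples, so that errors can be
  collected without regard to sign.\<close>

definition null :: "(state \<Rightarrow> real) \<Rightarrow> bool" where
  "null e \<longleftrightarrow> controlled (\<lambda>U. \<bar>e U\<bar>)"

lemma controlled_mono: "controlled g \<Longrightarrow> (\<And>U. U \<in> D0 \<Longrightarrow> f U \<le> g U) \<Longrightarrow> controlled f"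
  unfolding controlled_def by (meson order_trans)

lemma controlled_add:
  assumes "controlled f" "controlled g" shows "controlled (\<lambda>U. f U + g U)"
  unfolding controlled_def
proof (intro allI impI)
  fix \<epsilon> :: real assume "\<epsilon> > 0"
  then have e: "\<epsilon> / 2 > 0" by simp
  obtain A where A: "bounded_bilinear A" "\<And>U. U \<in> D0 \<Longrightarrow> f U \<le> dot A U + \<epsilon> / 2 * R U"
    using assms(1) e unfolding controlled_def by metis
  obtain B where B: "bounded_bilinear B" "\<And>U. U \<in> D0 \<Longrightarrow> g U \<le> dot B U + \<epsilon> / 2 * R U"
    using assms(2) e unfolding controlled_def by metis
  show "\<exists>B. bounded_bilinear B \<and> (\<forall>U\<in>D0. f U + g U \<le> dot B U + \<epsilon> * R U)"
    using A(2) B(2) by (intro exI[of _ "\<lambda>y z. A y z + B y z"] conjI bounded_bilinear_plus A(1) B(1))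
      (fastforce simp: dot_def)
qed

lemma controlled_cmult:
  assumes "controlled f" "0 \<le> c" shows "controlled (\<lambda>U. c * f U)"
proof (cases "c = 0")
  case True
  then show ?thesis unfolding controlled_def
    by (auto intro!: exI[of _ "\<lambda>y z. 0"] simp: bounded_bilinear_zero dot_def R_nonneg)
next
  case False
  with assms have c: "c > 0" by simp
  show ?thesis unfolding controlled_def
  proof (intro allI impI)
    fix \<epsilon> :: real assume "\<epsilon> > 0"
    then have e: "\<epsilon> / c > 0" using c by simp
    obtain A where A: "bounded_bilinear A" "\<And>U. U \<in> D0 \<Longrightarrow> f U \<le> dot A U + \<epsilon> / c * R U"
      using assms(1) e unfolding controlled_def by metis
    have "c * f U \<le> dot (\<lambda>y z. c * A y z) U + \<epsilon> * R U" if "U \<in> D0" for U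
      using mult_left_mono[OF A(2)[OF that] assms(2)] c by (simp add: dot_def distrib_left)
    then show "\<exists>B. bounded_bilinear B \<and> (\<forall>U\<in>D0. c * f U \<le> dot B U + \<epsilon> * R U)"
      using bounded_bilinear_cmult[OF A(1)] by blast
  qed
qed

lemma controlled_dot:
  assumes "bounded_bilinear A" "controlled g" "\<And>U. U \<in> D0 \<Longrightarrow> f U \<le> dot A U + g U"
  shows "controlled f"
  unfolding controlled_def
proof (intro allI impI)
  fix \<epsilon> :: real assume "\<epsilon> > 0"
  then obtain B where B: "bounded_bilinear B" "\<And>U. U \<in> D0 \<Longrightarrow> g U \<le> dot B U + \<epsilon> * R U"
    using assms(2) unfolding controlled_def by metis
  show "\<exists>B. bounded_bilinear B \<and> (\<forall>U\<in>D0. f U \<le> dot B U + \<epsilon> * R U)"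
  proof (intro exI[of _ "\<lambda>y z. A y z + B y z"] conjI bounded_bilinear_plus assms(1) B(1) ballI)
    fix U assume "U \<in> D0"
    then show "f U \<le> dot (\<lambda>y z. A y z + B y z) U + \<epsilon> * R U"
      using B(2)[of U] assms(3)[of U] by (simp add: dot_def)
  qed
qed

text \<open>The form in which each multiplier enters: \<open>A\<close> is the functional that is
  differentiated along the flow, and \<open>e\<close> collects what is left over after integration
  by parts.\<close>

lemma controlled_dot_null:
  assumes "bounded_bilinear A" "null e" "\<And>U. U \<in> D0 \<Longrightarrow> f U \<le> dot A U + e U"
  shows "controlled f"
proof (rule controlled_dot[OF assms(1)])
  show "controlled (\<lambda>U. \<bar>e U\<bar>)" using assms(2) by (simp add: null_def)
  show "f U \<le> dot A U + \<bar>e U\<bar>" if "U \<in> D0" for U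
    using assms(3)[OF that] by linarith
qed

lemma controlled_divide: "controlled (\<lambda>U. c * f U) \<Longrightarrow> 0 < c \<Longrightarrow> controlled f"
  using controlled_cmult[of "\<lambda>U. c * f U" "1 / c"] by simp

text \<open>Young's inequality: the bounded factor costs a multiple of \<open>R\<close> that can be
  made as small as desired, while the square of the other factor stays controlled however large its
  coefficient becomes. This is why \<open>controlled\<close> quantifies over all
  \<open>\<epsilon>\<close>.\<close>

lemma small_mult_bnd:
  assumes f: "small f" and g: "bnd g" shows "controlled (\<lambda>U. norm (f U) * norm (g U))"
  unfolding controlled_def
proof (intro allI impI)
  fix \<epsilon> :: real assume e: "\<epsilon> > 0"
  obtain C where C: "C \<ge> 0" "\<And>U. U \<in> D0 \<Longrightarrow> norm (g U) \<le> C * sqrt (R U)" using g by (auto simp: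
      bnd_def)
  \<comment> \<open>Makes \<open>d * C\<^sup>2\<close> at most \<open>\<epsilon> / 2\<close>; the
    added 1 covers \<open>C = 0\<close>.\<close>
  define d where "d = \<epsilon> / (2 * (C\<^sup>2 + 1))"
  have c1: "C\<^sup>2 + 1 > 0" by (rule add_nonneg_pos) auto
  have d: "d > 0" using e c1 by (simp add: d_def)
  have dC: "d * C\<^sup>2 \<le> \<epsilon> / 2"
  proof -
    have "d * C\<^sup>2 \<le> d * (C\<^sup>2 + 1)" using d by simp
    also have "\<dots> = \<epsilon> / 2" using c1 by (simp add: d_def field_simps)
    finally show ?thesis .
  qed
  have "controlled (\<lambda>U. 1 / (4 * d) * (norm (f U))\<^sup>2)"
    using f d by (intro controlled_cmult) (auto simp: small_def)
  then obtain B where B: "bounded_bilinear B" "\<And>U. U \<in> D0 \<Longrightarrow> 1 / (4 * d) * (norm (f U))\<^sup>2 \<le> dot B U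
      + \<epsilon> / 2 * R U"
    using e unfolding controlled_def by (metis half_gt_zero)
  show "\<exists>B. bounded_bilinear B \<and> (\<forall>U\<in>D0. norm (f U) * norm (g U) \<le> dot B U + \<epsilon> * R U)"
  proof (intro exI[of _ B] conjI ballI B(1))
    fix U assume U: "U \<in> D0"
    have "(norm (g U))\<^sup>2 \<le> (C * sqrt (R U))\<^sup>2" by (intro power_mono C(2) U) auto
    then have "d * (norm (g U))\<^sup>2 \<le> d * (C\<^sup>2 * R U)"
      using d R_nonneg[of U] by (simp add: power_mult_distrib)
    also have "\<dots> \<le> \<epsilon> / 2 * R U" using mult_right_mono[OF dC R_nonneg[of U]] by (simp add:
        mult.assoc)
    finally have 1: "d * (norm (g U))\<^sup>2 \<le> \<epsilon> / 2 * R U" .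
    have "0 \<le> (norm (f U) - 2 * d * norm (g U))\<^sup>2 / (4 * d)" using d by simp
    also have "\<dots> = 1 / (4 * d) * (norm (f U))\<^sup>2 + d * (norm (g U))\<^sup>2 - norm (f U) * norm (g U)"
      using d by (simp add: power2_eq_square field_simps)
    finally show "norm (f U) * norm (g U) \<le> dot B U + \<epsilon> * R U" using 1 B(2)[OF U] by simp
  qed
qed

lemma null_inner: "small f \<Longrightarrow> bnd g \<Longrightarrow> null (\<lambda>U. f U \<bullet> g U)" "small f \<Longrightarrow> bnd g \<Longrightarrow> null (\<lambda>U. g U \<bullet> f U)"
  unfolding null_def
  by (rule controlled_mono[OF small_mult_bnd], assumption+, metis Cauchy_Schwarz_ineq2
      mult.commute)+

lemma null_add: "null e \<Longrightarrow> null f \<Longrightarrow> null (\<lambda>U. e U + f U)"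
  unfolding null_def by (rule controlled_mono[OF controlled_add], assumption, assumption, rule
      abs_triangle_ineq)

lemma null_cmult: "null e \<Longrightarrow> null (\<lambda>U. c * e U)"
  unfolding null_def using controlled_cmult[of "\<lambda>U. \<bar>e U\<bar>" "\<bar>c\<bar>"] by (simp add: abs_mult)

lemma null_diff: "null e \<Longrightarrow> null f \<Longrightarrow> null (\<lambda>U. e U - f U)"
  using null_add[of e "\<lambda>U. -1 * f U"] null_cmult[of f "-1"] by simp

lemma null_controlled: "controlled f \<Longrightarrow> (\<And>U. U \<in> D0 \<Longrightarrow> 0 \<le> f U) \<Longrightarrow> null f"
  unfolding null_def by (erule controlled_mono) auto

lemma null_norm: "small f \<Longrightarrow> null (\<lambda>U. (norm (f U))\<^sup>2)"
  unfolding small_def by (erule null_controlled) auto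

lemma small_blin:
  assumes "bounded_linear L" "small f" shows "small (\<lambda>U. L (f U))"
proof -
  obtain K where K: "K > 0" "\<And>x. norm (L x) \<le> norm x * K" using bounded_linear.pos_bounded[OF
      assms(1)] by blast
  have "(norm (L (f U)))\<^sup>2 \<le> K\<^sup>2 * (norm (f U))\<^sup>2" for U
    using power_mono[OF K(2)[of "f U"], of 2] by (simp add: power_mult_distrib mult.commute)
  then show ?thesis using controlled_mono[OF controlled_cmult[OF assms(2)[unfolded small_def], of
      "K\<^sup>2"]]
    unfolding small_def by simp
qed

lemma small_add:
  assumes "small f" "small g" shows "small (\<lambda>U. f U + g U)"
proof -
  have "(norm (x + y))\<^sup>2 \<le> 2 * (norm x)\<^sup>2 + 2 * (norm y)\<^sup>2" for x y :: 'a
  proof -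
    have "0 \<le> (norm (x - y))\<^sup>2" by simp
    then show ?thesis by (simp add: power2_norm_eq_inner inner_simps inner_commute)
  qed
  then show ?thesis
    using controlled_mono[OF controlled_add[OF controlled_cmult[OF assms(1)[unfolded small_def],
        of 2] controlled_cmult[OF assms(2)[unfolded small_def], of 2]]]
    unfolding small_def by simp
qed

lemma small_scaleR: "small f \<Longrightarrow> small (\<lambda>U. c *\<^sub>R f U)"
  by (rule small_blin[OF bounded_linear_scaleR_right])

lemma small_diff: "small f \<Longrightarrow> small g \<Longrightarrow> small (\<lambda>U. f U - g U)"
  using small_add[of f "\<lambda>U. (-1) *\<^sub>R g U"] small_scaleR[of g "-1"] by simp

lemma small_cong: "small f \<Longrightarrow> (\<And>U. U \<in> D0 \<Longrightarrow> g U = f U) \<Longrightarrow> small g"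
  unfolding small_def by (erule controlled_mono) simp

lemma bnd_add: "bnd f \<Longrightarrow> bnd g \<Longrightarrow> bnd (\<lambda>U. f U + g U)"
proof -
  assume "bnd f" "bnd g"
  then obtain C D where "C \<ge> 0" "\<And>U. U \<in> D0 \<Longrightarrow> norm (f U) \<le> C * sqrt (R U)" "D \<ge> 0" "\<And>U. U \<in> D0 \<Longrightarrow>
      norm (g U) \<le> D * sqrt (R U)"
    unfolding bnd_def by metis
  then show ?thesis unfolding bnd_def
    by (intro exI[of _ "C + D"] conjI ballI order_trans[OF norm_triangle_ineq]) (auto simp:
        distrib_right intro: add_mono)
qed

lemma bnd_blin: "bounded_linear L \<Longrightarrow> bnd f \<Longrightarrow> bnd (\<lambda>U. L (f U))"
proof -
  assume L: "bounded_linear L" and "bnd f"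
  then obtain C where C: "C \<ge> 0" "\<And>U. U \<in> D0 \<Longrightarrow> norm (f U) \<le> C * sqrt (R U)" unfolding bnd_def by
      metis
  obtain K where K: "K > 0" "\<And>x. norm (L x) \<le> norm x * K" using bounded_linear.pos_bounded[OF L]
      by blast
  have "norm (L (f U)) \<le> (K * C) * sqrt (R U)" if "U \<in> D0" for U
    using order_trans[OF K(2) mult_right_mono[OF C(2)[OF that]]] K(1) by (simp add: ac_simps)
  then show ?thesis unfolding bnd_def using K(1) C(1) by (intro exI[of _ "K * C"]) simp
qed

lemma bnd_scaleR: "bnd f \<Longrightarrow> bnd (\<lambda>U. c *\<^sub>R f U)"
  by (rule bnd_blin[OF bounded_linear_scaleR_right])

lemma bnd_diff: "bnd f \<Longrightarrow> bnd g \<Longrightarrow> bnd (\<lambda>U. f U - g U)"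
  using bnd_add[of f "\<lambda>U. (-1) *\<^sub>R g U"] bnd_scaleR[of g "-1"] by simp

lemma bnd_X: "bnd X"
  unfolding bnd_def
proof (intro exI[of _ 1] conjI ballI)
  show "norm (X U) \<le> 1 * sqrt (R U)" for U
    by (auto simp: R_def trace_sq_nonneg intro: real_le_rsqrt)
qed simp

lemma bnd_lin_X: "bounded_linear L \<Longrightarrow> bnd (\<lambda>U. L (X U))"
  by (rule bnd_blin[OF _ bnd_X])

lemmas bnd_comp = component_bounded_linear[THEN bnd_lin_X]

lemma bnd_trace: "bnd (\<lambda>U. bdry_val I (cp (X U)) L\<^sub>1)" "bnd (\<lambda>U. bdry_val I (cp (X U)) L\<^sub>2)"
  unfolding bnd_def
  by (intro exI[of _ 1] conjI ballI; auto simp: R_def trace_sq_def intro!: real_le_rsqrt)+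

subsection \<open>Estimates in the middle part\<close>

abbreviation "W \<equiv> wmult L\<^sub>1 L\<^sub>2"
abbreviation "Mm \<equiv> moment L\<^sub>1 L\<^sub>2"
abbreviation "Cc \<equiv> const_on L\<^sub>1 L\<^sub>2"
abbreviation "K \<equiv> prim_op L\<^sub>1 L\<^sub>2"
abbreviation "one \<equiv> \<lambda>_::real. 1::real"
abbreviation "tI \<equiv> bdry_val I"
abbreviation "tJ \<equiv> bdry_val J"

abbreviation "fw U \<equiv> cw (X U)"
abbreviation "fy U \<equiv> cy (X U)"
abbreviation "ft U \<equiv> ct (X U)"
abbreviation "fq U \<equiv> cq (X U)"
abbreviation "fp U \<equiv> cp (X U)"
abbreviation "fr U \<equiv> cr (X U)"
abbreviation "gw U \<equiv> wD I (cw (X U))"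
abbreviation "gy U \<equiv> wD J (cy (X U))"
abbreviation "gt U \<equiv> wD I (ct (X U))"
abbreviation "gq U \<equiv> wD I (cq (X U))"
abbreviation "gp U \<equiv> wD I (cp (X U))"
abbreviation "gr U \<equiv> wD J (cr (X U))"

lemma dom_H1:
  assumes "U \<in> Dom"
  shows "fw U \<in> H1 I" "fy U \<in> H1 J" "ft U \<in> H1 I" "fq U \<in> H1 I" "fp U \<in> H1 I" "fr U \<in> H1 J"
proof -
  obtain u v \<theta> q p r where U: "U = (u, v, \<theta>, q, p, r)" by (cases U) auto
  show "fw U \<in> H1 I" "fy U \<in> H1 J" "ft U \<in> H1 I" "fq U \<in> H1 I" "fp U \<in> H1 I" "fr U \<in> H1 J"
    using assms unfolding U Dom_iff by (simp_all add: X_def cw_def cy_def ct_def cq_def cp_def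
        cr_def)
qed

lemma dom_bc:
  assumes "U \<in> Dom"
  shows "tJ (fr U) 0 = 0" "tJ (fr U) L\<^sub>3 = 0" "tJ (fr U) L\<^sub>1 = tI (fp U) L\<^sub>1" "tJ (fr U) L\<^sub>2 = tI
      (fp U) L\<^sub>2"
    "b *\<^sub>R tJ (fy U) L\<^sub>1 = a *\<^sub>R tI (fw U) L\<^sub>1 - m *\<^sub>R tI (ft U) L\<^sub>1"
    "b *\<^sub>R tJ (fy U) L\<^sub>2 = a *\<^sub>R tI (fw U) L\<^sub>2 - m *\<^sub>R tI (ft U) L\<^sub>2"
    "tI (fq U) L\<^sub>1 = 0" "tI (fq U) L\<^sub>2 = 0"
proof -
  obtain u v \<theta> q p r where U: "U = (u, v, \<theta>, q, p, r)" by (cases U) auto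
  show "tJ (fr U) 0 = 0" "tJ (fr U) L\<^sub>3 = 0" "tJ (fr U) L\<^sub>1 = tI (fp U) L\<^sub>1" "tJ (fr U) L\<^sub>2 = tI
      (fp U) L\<^sub>2"
    "b *\<^sub>R tJ (fy U) L\<^sub>1 = a *\<^sub>R tI (fw U) L\<^sub>1 - m *\<^sub>R tI (ft U) L\<^sub>1"
    "b *\<^sub>R tJ (fy U) L\<^sub>2 = a *\<^sub>R tI (fw U) L\<^sub>2 - m *\<^sub>R tI (ft U) L\<^sub>2"
    "tI (fq U) L\<^sub>1 = 0" "tI (fq U) L\<^sub>2 = 0"
    using assms unfolding U Dom_iff by (simp_all add: X_def cw_def cy_def ct_def cq_def cp_def
        cr_def)
qed

lemma dom_dX:
  assumes "U \<in> Dom"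
  shows "cw (dX U) = gp U" "cy (dX U) = gr U" "ct (dX U) = - (k *\<^sub>R gq U + m *\<^sub>R gp U)"
    "cq (dX U) = - ((k / \<tau>) *\<^sub>R gt U) - (1 / \<tau>) *\<^sub>R fq U" "cp (dX U) = a *\<^sub>R gw U - m *\<^sub>R gt U"
    "cr (dX U) = b *\<^sub>R gy U"
proof -
  obtain u v \<theta> q p r where U: "U = (u, v, \<theta>, q, p, r)" by (cases U) auto
  show "cw (dX U) = gp U" "cy (dX U) = gr U" "ct (dX U) = - (k *\<^sub>R gq U + m *\<^sub>R gp U)"
    "cq (dX U) = - ((k / \<tau>) *\<^sub>R gt U) - (1 / \<tau>) *\<^sub>R fq U" "cp (dX U) = a *\<^sub>R gw U - m *\<^sub>R gt U"
    "cr (dX U) = b *\<^sub>R gy U"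
    using dX_eq[OF assms[unfolded U]] unfolding U by (simp_all add: X_def cw_def cy_def ct_def
        cq_def cp_def cr_def)
qed

lemma dom_L2:
  assumes "U \<in> Dom"
  shows "fw U \<in> L2_on I" "fy U \<in> L2_on J" "ft U \<in> L2_on I" "fq U \<in> L2_on I" "fp U \<in> L2_on I" "fr U
      \<in> L2_on J"
    "gw U \<in> L2_on I" "gy U \<in> L2_on J" "gt U \<in> L2_on I" "gq U \<in> L2_on I" "gp U \<in> L2_on I" "gr U \<in>
        L2_on J"
  using dom_H1[OF assms] H1_imp_L2 wD_props(1) open_I open_J by blast+

lemma dom_sobolev:
  assumes "U \<in> Dom"
  shows "sobolev L\<^sub>1 L\<^sub>2 (tI (fw U)) (fw U) (gw U)" "sobolev L\<^sub>1 L\<^sub>2 (tI (ft U)) (ft U) (gt U)"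
    "sobolev L\<^sub>1 L\<^sub>2 (tI (fq U)) (fq U) (gq U)" "sobolev L\<^sub>1 L\<^sub>2 (tI (fp U)) (fp U) (gp U)"
    "sobolev 0 L\<^sub>1 (tJ (fy U)) (fy U) (gy U)" "sobolev L\<^sub>2 L\<^sub>3 (tJ (fy U)) (fy U) (gy U)"
    "sobolev 0 L\<^sub>1 (tJ (fr U)) (fr U) (gr U)" "sobolev L\<^sub>2 L\<^sub>3 (tJ (fr U)) (fr U) (gr U)"
  using dom_H1[OF assms] sobolev_I sobolev_J by blast+

lemma D0_Dom: "U \<in> D0 \<Longrightarrow> U \<in> Dom" by (simp add: D0_def)

lemma L12': "L\<^sub>1 \<le> L\<^sub>2" using L12 by simp

lemma wmult_J_split:
  assumes "f \<in> L2_on J"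
  shows "f \<bullet> g = wmult 0 L\<^sub>1 one f \<bullet> g + wmult L\<^sub>2 L\<^sub>3 one f \<bullet> g"
proof -
  have "f = wmult 0 L\<^sub>1 one f + wmult L\<^sub>2 L\<^sub>3 one f"
  proof (rule l2_eqI)
    have "AE x in lborel. x \<notin> J \<longrightarrow> rep_l2 f x = 0" using assms by (simp add: L2_on_def)
    moreover have "AE x in lborel. rep_l2 (wmult 0 L\<^sub>1 one f) x = cut_weight 0 L\<^sub>1 one x * rep_l2
        f x"
      "AE x in lborel. rep_l2 (wmult L\<^sub>2 L\<^sub>3 one f) x = cut_weight L\<^sub>2 L\<^sub>3 one x * rep_l2 f x" by
          (rule rep_wmult; simp)+
    ultimately show "AE x in lborel. rep_l2 f x = rep_l2 (wmult 0 L\<^sub>1 one f + wmult L\<^sub>2 L\<^sub>3 one f)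
        x"
      using rep_l2_plus[of "wmult 0 L\<^sub>1 one f" "wmult L\<^sub>2 L\<^sub>3 one f"]
      by eventually_elim (use L12 in \<open>auto simp: cut_weight_def indicator_def\<close>)
  qed
  then show ?thesis by (metis inner_add_left)
qed

lemma ibp_J:
  assumes "sobolev 0 L\<^sub>1 F f f'" "sobolev L\<^sub>2 L\<^sub>3 F f f'" "sobolev 0 L\<^sub>1 G g g'" "sobolev L\<^sub>2 L\<^sub>3
      G g g'" "f \<in> L2_on J" "f' \<in> L2_on J"
  shows "f' \<bullet> g + f \<bullet> g' = F L\<^sub>1 \<bullet> G L\<^sub>1 - F 0 \<bullet> G 0 + (F L\<^sub>3 \<bullet> G L\<^sub>3 - F L\<^sub>2 \<bullet> G L\<^sub>2)"
  unfolding wmult_J_split[OF assms(5)] wmult_J_split[OF assms(6)]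
  using ibp[OF assms(1,3) C1_const[of 1]] ibp[OF assms(2,4) C1_const[of 1]] L1 L23
  by (simp add: wmult_zero_weight)

definition BE :: "l2x6 \<Rightarrow> l2x6 \<Rightarrow> real" where
  "BE y z = 1/2 * (a * (cw y \<bullet> cw z) + b * (cy y \<bullet> cy z) + ct y \<bullet> ct z + \<tau> * (cq y \<bullet> cq z) + cp y
      \<bullet> cp z + cr y \<bullet> cr z)"

lemma BE_bilinear: "bounded_bilinear BE"
  unfolding BE_def
  by (intro bounded_bilinear_cmult bounded_bilinear_plus bounded_bilinear_inner_compose
      component_bounded_linear)

lemma BE_energy_form: "BE y y = energy_form y"
  by (cases y) (simp add: BE_def energy_form_def cw_def cy_def ct_def cq_def cp_def cr_def
      power2_norm_eq_inner algebra_simps add_divide_distrib)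

text \<open>Integration by parts pairs each space derivative with its partner. The terms at the
  interfaces cancel by continuity of velocity and stress, those with \<open>q\<close> vanish with
  \<open>q\<close>, and those at \<open>0\<close> and \<open>L\<^sub>3\<close> with the outer
  velocity. Only the damping of the heat flux remains.\<close>

lemma energy_dissipation:
  assumes U: "U \<in> Dom" shows "dot BE U = - (norm (fq U))\<^sup>2"
proof -
  note s = dom_sobolev[OF U] and L = dom_L2[OF U] and bc = dom_bc[OF U]
  have 1: "gw U \<bullet> fp U + fw U \<bullet> gp U = tI (fw U) L\<^sub>2 \<bullet> tI (fp U) L\<^sub>2 - tI (fw U) L\<^sub>1 \<bullet> tI (fp U)
      L\<^sub>1"
    by (rule ibp_one[OF s(1,4) L12' L(1,7)])
  have 2: "gt U \<bullet> fp U + ft U \<bullet> gp U = tI (ft U) L\<^sub>2 \<bullet> tI (fp U) L\<^sub>2 - tI (ft U) L\<^sub>1 \<bullet> tI (fp U)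
      L\<^sub>1"
    by (rule ibp_one[OF s(2,4) L12' L(3,9)])
  have 3: "gt U \<bullet> fq U + ft U \<bullet> gq U = 0"
    using ibp_one[OF s(2,3) L12' L(3,9)] bc by simp
  have 4: "gy U \<bullet> fr U + fy U \<bullet> gr U = tJ (fy U) L\<^sub>1 \<bullet> tI (fp U) L\<^sub>1 - tJ (fy U) L\<^sub>2 \<bullet> tI (fp U)
      L\<^sub>2"
    using ibp_J[OF s(5,6,7,8) L(2,8)] bc by simp
  have 5: "b * (tJ (fy U) L\<^sub>1 \<bullet> tI (fp U) L\<^sub>1) = a * (tI (fw U) L\<^sub>1 \<bullet> tI (fp U) L\<^sub>1) - m * (tI (ft
      U) L\<^sub>1 \<bullet> tI (fp U) L\<^sub>1)"
    using arg_cong[OF bc(5), of "\<lambda>x. x \<bullet> tI (fp U) L\<^sub>1"] by (simp add: inner_simps)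
  have 6: "b * (tJ (fy U) L\<^sub>2 \<bullet> tI (fp U) L\<^sub>2) = a * (tI (fw U) L\<^sub>2 \<bullet> tI (fp U) L\<^sub>2) - m * (tI (ft
      U) L\<^sub>2 \<bullet> tI (fp U) L\<^sub>2)"
    using arg_cong[OF bc(6), of "\<lambda>x. x \<bullet> tI (fp U) L\<^sub>2"] by (simp add: inner_simps)
  have "dot BE U = a * (gw U \<bullet> fp U + fw U \<bullet> gp U) - m * (gt U \<bullet> fp U + ft U \<bullet> gp U) - k * (gt U \<bullet>
      fq U + ft U \<bullet> gq U)
     + b * (gy U \<bullet> fr U + fy U \<bullet> gr U) - fq U \<bullet> fq U"
    unfolding dot_def BE_def dom_dX[OF U] using tau0
    by (simp add: inner_simps inner_commute field_simps)
  also have "\<dots> = - (fq U \<bullet> fq U)"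
    unfolding 1 2 3 4 using 5 6 by (simp add: algebra_simps)
  finally show ?thesis by (simp add: power2_norm_eq_inner)
qed

lemma small_q: "small fq"
  unfolding small_def
proof (rule controlled_dot_null)
  show "bounded_bilinear (\<lambda>y z. -1 * BE y z)" by (intro bounded_bilinear_cmult BE_bilinear)
  show "null (\<lambda>_. 0)" unfolding null_def controlled_def
    by (auto intro!: exI[of _ "\<lambda>y z. 0"] simp: bounded_bilinear_zero dot_def R_nonneg)
  show "(norm (fq U))\<^sup>2 \<le> dot (\<lambda>y z. -1 * BE y z) U + 0" if "U \<in> D0" for U
    using energy_dissipation[OF D0_Dom[OF that]] by (simp add: dot_def)
qed

definition ell :: real where "ell = L\<^sub>2 - L\<^sub>1"
lemma ell_pos: "ell > 0" using L12 by (simp add: ell_def)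

definition mean :: "l2 \<Rightarrow> complex" where "mean f = (1 / ell) *\<^sub>R Mm one f"
definition osc :: "l2 \<Rightarrow> l2" where "osc f = f - Cc (mean f)"

lemma Mm_one_bl: "bounded_linear (Mm one)" by (rule moment_bounded_linear) simp

lemma mean_bl: "bounded_linear mean"
  unfolding mean_def by (rule bounded_linear_compose[OF bounded_linear_scaleR_right Mm_one_bl])

lemma osc_bl: "bounded_linear osc"
  unfolding osc_def[abs_def] by (intro bounded_linear_sub bounded_linear_ident
      bounded_linear_compose[OF const_on_bounded_linear mean_bl])

lemma Mm_one_const_on: "Mm one (Cc c) = ell *\<^sub>R c"
  using moment_one_const_on[OF L12'] by (simp add: ell_def)

lemma Mm_osc: "Mm one (osc f) = 0"
  unfolding osc_def linear_diff[OF bounded_linear.linear[OF Mm_one_bl]] Mm_one_const_on mean_def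
      using ell_pos by simp

lemma osc_L2: "f \<in> L2_on I \<Longrightarrow> osc f \<in> L2_on I"
  unfolding osc_def by (intro L2_on_diff L2_on_const_on)

lemma const_on_inner_osc: "f \<in> L2_on I \<Longrightarrow> Cc c \<bullet> osc f = 0"
  using const_on_inner[OF osc_L2, of f c] by (simp add: Mm_osc inner_commute)

lemma inner_osc: "f \<in> L2_on I \<Longrightarrow> f \<bullet> osc f = (norm (osc f))\<^sup>2"
proof -
  assume f: "f \<in> L2_on I"
  have "f = osc f + Cc (mean f)" by (simp add: osc_def)
  then have "f \<bullet> osc f = osc f \<bullet> osc f + Cc (mean f) \<bullet> osc f" by (metis inner_add_left)
  then show ?thesis using const_on_inner_osc[OF f] by (simp add: power2_norm_eq_inner)
qed

definition osc_prim :: "l2 \<Rightarrow> l2" where "osc_prim f = K (osc f)"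

lemma osc_prim_bl: "bounded_linear osc_prim"
  unfolding osc_prim_def by (rule bounded_linear_compose[OF prim_op_bounded_linear osc_bl])

lemma K_sobolev_zero:
  assumes "Mm one g = 0"
  obtains F where "sobolev L\<^sub>1 L\<^sub>2 F (K g) g" "F L\<^sub>1 = 0" "F L\<^sub>2 = 0"
  using sobolev_prim_op[of L\<^sub>1 L\<^sub>2 g] assms L12'
  by (intro that[of "\<lambda>x. LINT t:{L\<^sub>1..x}|lborel. rep_l2 g t"]) (simp_all add: integral_singleton
      integral_eq_moment_one)

text \<open>A primitive of a function of integral zero vanishes at both ends, so testing with it
  creates no boundary terms. Both \<open>small_osc_theta\<close> and \<open>small_zeta\<close> rest
  on this.\<close>

lemma ibp_K:
  assumes "sobolev L\<^sub>1 L\<^sub>2 F f f'" "Mm one g = 0" "f \<in> L2_on I" "f' \<in> L2_on I"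
  shows "f' \<bullet> K g = - (f \<bullet> g)"
proof -
  obtain G where G: "sobolev L\<^sub>1 L\<^sub>2 G (K g) g" "G L\<^sub>1 = 0" "G L\<^sub>2 = 0" by (rule K_sobolev_zero[OF
      assms(2)])
  show ?thesis using ibp_one[OF assms(1) G(1) L12' assms(3,4)] G(2,3) by simp
qed

text \<open>The linear function on the middle part with value \<open>c\<close> at
  \<open>L\<^sub>1\<close> and \<open>d\<close> at \<open>L\<^sub>2\<close>.\<close>

definition interp :: "complex \<Rightarrow> complex \<Rightarrow> l2" where
  "interp c d = Cc c + K (Cc ((1 / ell) *\<^sub>R (d - c)))"

text \<open>The mean of \<open>f'\<close> is the slope of the chord through the end values; removing
  it before integrating leaves the deviation of \<open>f\<close> from that chord.\<close>

lemma osc_prim_deriv: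
  assumes "sobolev L\<^sub>1 L\<^sub>2 F f f'" "f \<in> L2_on I"
  shows "osc_prim f' = f - interp (F L\<^sub>1) (F L\<^sub>2)"
proof -
  have "Mm one f' = F L\<^sub>2 - F L\<^sub>1" by (rule moment_one_deriv[OF assms(1) L12'])
  then have "osc_prim f' = K f' - K (Cc ((1 / ell) *\<^sub>R (F L\<^sub>2 - F L\<^sub>1)))"
    unfolding osc_prim_def osc_def mean_def by (simp add: linear_diff[OF bounded_linear.linear[OF
        prim_op_bounded_linear]])
  then show ?thesis unfolding prim_op_deriv[OF assms] interp_def by simp
qed

lemma bnd_interp: "bnd (\<lambda>U. interp (tI (fp U) L\<^sub>1) (tI (fp U) L\<^sub>2))"
  unfolding interp_def
  by (intro bnd_add bnd_blin[OF const_on_bounded_linear] bnd_blin[OF prim_op_bounded_linear]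
      bnd_scaleR bnd_diff bnd_trace)

lemma osc_prim_dtheta:
  assumes U: "U \<in> Dom"
  shows "osc_prim (ct (dX U)) = - k *\<^sub>R fq U - m *\<^sub>R fp U + m *\<^sub>R interp (tI (fp U) L\<^sub>1) (tI (fp
      U) L\<^sub>2)"
proof -
  note l = bounded_linear.linear[OF osc_prim_bl]
  have z: "interp 0 0 = 0"
    unfolding interp_def using linear_0[OF bounded_linear.linear[OF const_on_bounded_linear]]
        linear_0[OF bounded_linear.linear[OF prim_op_bounded_linear]]
    by simp
  show ?thesis
    unfolding dom_dX[OF U] linear_neg[OF l] linear_add[OF l] linear_scale[OF l]
      osc_prim_deriv[OF dom_sobolev(3)[OF U] dom_L2(4)[OF U]] osc_prim_deriv[OF dom_sobolev(4)[OF
          U] dom_L2(5)[OF U]] dom_bc[OF U] z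
    by (simp add: scaleR_diff_right)
qed

text \<open>The functional pairs \<open>q\<close> with \<open>osc_prim\<close> of
  \<open>\<theta>\<close>, which vanishes at both ends; the equation of \<open>q\<close> thus
  produces \<open>k\<close> times the square of the oscillation without boundary terms. The
  derivative falling on \<open>osc_prim\<close> gives \<open>q\<close>, \<open>p\<close> and
  interpolated traces of \<open>p\<close>, which are only bounded but are paired with the small
  \<open>q\<close>.\<close>

lemma small_osc_theta: "small (\<lambda>U. osc (ft U))"
  unfolding small_def
proof (rule controlled_divide[OF _ k0], rule controlled_dot_null)
  let ?e = "\<lambda>U. fq U \<bullet> osc_prim (ft U) - \<tau> * (fq U \<bullet> (- k *\<^sub>R fq U - m *\<^sub>R fp U + m *\<^sub>R interp (tI
      (fp U) L\<^sub>1) (tI (fp U) L\<^sub>2)))"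
  show "bounded_bilinear (\<lambda>y z. \<tau> * (cq y \<bullet> osc_prim (ct z)))"
    by (intro bounded_bilinear_cmult bounded_bilinear_inner_compose component_bounded_linear
        bounded_linear_compose[OF osc_prim_bl])
  show "null ?e"
    by (intro null_diff null_cmult null_inner small_q bnd_lin_X bounded_linear_compose[OF
        osc_prim_bl] component_bounded_linear
        bnd_add bnd_diff bnd_scaleR bnd_interp)
  show "k * (norm (osc (ft U)))\<^sup>2 \<le> dot (\<lambda>y z. \<tau> * (cq y \<bullet> osc_prim (ct z))) U + ?e U" if "U \<in> D0"
      for U
  proof -
    note U = D0_Dom[OF that]
    have "gt U \<bullet> osc_prim (ft U) = - (norm (osc (ft U)))\<^sup>2"
      unfolding osc_prim_def using ibp_K[OF dom_sobolev(2)[OF U] Mm_osc dom_L2(3,9)[OF U]]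
          inner_osc[OF dom_L2(3)[OF U]] by simp
    then have "k * (norm (osc (ft U)))\<^sup>2 = - k * (gt U \<bullet> osc_prim (ft U))" by simp
    moreover have "dot (\<lambda>y z. \<tau> * (cq y \<bullet> osc_prim (ct z))) U = \<tau> * (fq U \<bullet> osc_prim (ct (dX U)))
        + \<tau> * (cq (dX U) \<bullet> osc_prim (ft U))"
      by (simp add: dot_def)
    moreover have "\<tau> * (cq (dX U) \<bullet> osc_prim (ft U)) = - k * (gt U \<bullet> osc_prim (ft U)) - fq U \<bullet>
        osc_prim (ft U)"
      unfolding dom_dX[OF U] using tau0 by (simp add: inner_simps field_simps)
    ultimately show ?thesis unfolding osc_prim_dtheta[OF U] by simp
  qed
qed

text \<open>The coefficient of the temperature left in \<open>sigma\<close> once the strain is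
  eliminated in favour of \<open>zeta\<close>, see \<open>sigma_zeta\<close>.\<close>

definition beta :: real where "beta = a / m + m"
definition zeta :: "l2x6 \<Rightarrow> l2" where "zeta Y = m *\<^sub>R cw Y + ct Y"
definition sigma :: "l2x6 \<Rightarrow> l2" where "sigma Y = a *\<^sub>R cw Y - m *\<^sub>R ct Y"

lemma zeta_bl: "bounded_linear zeta" and sigma_bl: "bounded_linear sigma"
  unfolding zeta_def[abs_def] sigma_def[abs_def]
  by (intro bounded_linear_add bounded_linear_sub bounded_linear_const_scaleR
      component_bounded_linear)+

lemma sigma_zeta: "sigma Y = (a / m) *\<^sub>R zeta Y - beta *\<^sub>R ct Y"
  using m0 by (simp add: sigma_def zeta_def beta_def algebra_simps)

lemma Mm_zeta: "U \<in> D0 \<Longrightarrow> Mm one (zeta (X U)) = 0"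
  by (simp add: D0_def conserved_def zeta_def)

lemma sobolev_sigma:
  assumes "U \<in> Dom"
  shows "sobolev L\<^sub>1 L\<^sub>2 (\<lambda>x. a *\<^sub>R tI (fw U) x - m *\<^sub>R tI (ft U) x) (sigma (X U)) (cp (dX U))"
  unfolding dom_dX[OF assms] sigma_def by (intro sobolev_diff sobolev_scaleR dom_sobolev[OF assms])

lemma sigma_L2: "U \<in> Dom \<Longrightarrow> sigma (X U) \<in> L2_on I" "U \<in> Dom \<Longrightarrow> cp (dX U) \<in> L2_on I"
  and zeta_L2: "U \<in> Dom \<Longrightarrow> zeta (X U) \<in> L2_on I"
  unfolding sigma_def zeta_def by (auto simp: dom_dX intro!: L2_on_diff L2_on_add L2_on_scaleR
      dom_L2)

text \<open>\<open>\<zeta>\<close> has mean zero and \<open>\<zeta>\<^sub>t = - k q\<^sub>x\<close>, so its primitive \<open>K \<zeta>\<close> vanishes at both ends and its time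
  derivative \<open>- k q\<close> is small.\<close>

lemma small_zeta: "small (\<lambda>U. zeta (X U))"
  unfolding small_def
proof (rule controlled_divide[of "a / m"], rule controlled_dot_null)
  let ?e = "\<lambda>U. beta * (osc (ft U) \<bullet> zeta (X U)) - k * (fp U \<bullet> fq U)"
  show "bounded_bilinear (\<lambda>y z. -1 * (cp y \<bullet> K (zeta z)))"
    by (intro bounded_bilinear_cmult bounded_bilinear_inner_compose component_bounded_linear
        bounded_linear_compose[OF prim_op_bounded_linear] zeta_bl)
  show "null ?e"
    by (intro null_diff null_cmult null_inner(1)[OF small_osc_theta] null_inner(2)[OF small_q]
        bnd_lin_X zeta_bl component_bounded_linear)
  show "a / m * (norm (zeta (X U)))\<^sup>2 \<le> dot (\<lambda>y z. -1 * (cp y \<bullet> K (zeta z))) U + ?e U" if U0: "U \<in>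
      D0" for U
  proof -
    note U = D0_Dom[OF U0]
    have 1: "cp (dX U) \<bullet> K (zeta (X U)) = - (sigma (X U) \<bullet> zeta (X U))"
      by (rule ibp_K[OF sobolev_sigma[OF U] Mm_zeta[OF U0] sigma_L2(1)[OF U] sigma_L2(2)[OF U]])
    have "zeta (dX U) = - k *\<^sub>R gq U" unfolding zeta_def dom_dX[OF U] by simp
    then have 2: "K (zeta (dX U)) = - k *\<^sub>R fq U"
      using prim_op_deriv[OF dom_sobolev(3)[OF U] dom_L2(4)[OF U]] dom_bc(7)[OF U]
        linear_0[OF bounded_linear.linear[OF const_on_bounded_linear]]
      by (simp only: linear_scale[OF bounded_linear.linear[OF prim_op_bounded_linear]] diff_zero)
    \<comment> \<open>\<open>zeta\<close> has integral zero and therefore annihilates the mean of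
      the temperature, which is not yet controlled.\<close>
    have 3: "ft U \<bullet> zeta (X U) = osc (ft U) \<bullet> zeta (X U)"
    proof -
      have "zeta (X U) \<bullet> Cc (mean (ft U)) = 0"
        using const_on_inner[OF zeta_L2[OF U], of "mean (ft U)"] Mm_zeta[OF U0] by simp
      then have "Cc (mean (ft U)) \<bullet> zeta (X U) = 0" by (simp only: inner_commute)
      then show ?thesis by (simp add: osc_def inner_diff_left)
    qed
    have "sigma (X U) \<bullet> zeta (X U) = a / m * (norm (zeta (X U)))\<^sup>2 - beta * (osc (ft U) \<bullet> zeta (X
        U))"
      unfolding sigma_zeta using 3 by (simp add: inner_simps power2_norm_eq_inner)
    then show ?thesis unfolding dot_def using 1 2 by (simp add: inner_simps)
  qed
qed (use a0 m0 in simp)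

text \<open>The velocity is the time derivative of the recovered displacement. With this,
  \<open>dot\<close> can differentiate functionals in which displacements occur.\<close>

lemma umap_dX: "U \<in> Dom \<Longrightarrow> umap (dX U) = fp U"
proof -
  assume U: "U \<in> Dom"
  have "umap (wD I (fp U), wD J (fr U), snd (snd (dX U))) = fp U"
    by (rule umap_eq) (use dom_H1[OF U] dom_bc[OF U] in auto)
  moreover have "dX U = (wD I (fp U), wD J (fr U), snd (snd (dX U)))"
    using dom_dX(1,2)[OF U] by (simp add: cw_def cy_def prod_eq_iff)
  ultimately show ?thesis by simp
qed

lemma vmap_dX: "U \<in> Dom \<Longrightarrow> vmap (dX U) = fr U"
proof -
  assume U: "U \<in> Dom"
  have "vmap (wD I (fp U), wD J (fr U), snd (snd (dX U))) = fr U"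
    by (rule vmap_eq) (use dom_H1[OF U] dom_bc[OF U] in auto)
  moreover have "dX U = (wD I (fp U), wD J (fr U), snd (snd (dX U)))"
    using dom_dX(1,2)[OF U] by (simp add: cw_def cy_def prod_eq_iff)
  ultimately show ?thesis by simp
qed

text \<open>The moment is the time derivative of that of \<open>u\<close>, while its own time derivative
  is a moment of \<open>\<sigma>\<close> against \<open>\<psi>'\<close>, which does not see the uncontrolled constant part of \<open>\<sigma>\<close>.\<close>

lemma small_moment:
  assumes \<psi>: "C1 \<psi> \<psi>'" and z: "\<psi> L\<^sub>1 = 0" "\<psi> L\<^sub>2 = 0"
  shows "small (\<lambda>U. Mm \<psi> (fp U))"
  unfolding small_def
proof (rule controlled_dot_null)
  note c = C1_continuous[OF \<psi>]
  note bl = moment_bounded_linear[OF c(1), of L\<^sub>1 L\<^sub>2] moment_bounded_linear[OF c(2), of L\<^sub>1 L\<^sub>2]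
  let ?e = "\<lambda>U. Mm \<psi> (umap (X U)) \<bullet> ((a / m) *\<^sub>R Mm \<psi>' (zeta (X U)) - beta *\<^sub>R Mm \<psi>' (osc (ft U)))"
  show "bounded_bilinear (\<lambda>y z. Mm \<psi> (umap y) \<bullet> Mm \<psi> (cp z))"
    by (intro bounded_bilinear_inner_compose bounded_linear_compose[OF bl(1)] umap_bounded_linear
        component_bounded_linear)
  show "null ?e"
    by (intro null_inner(2) bnd_lin_X bounded_linear_compose[OF bl(1)] umap_bounded_linear
        small_diff small_scaleR
        small_blin[OF bl(2)] small_zeta small_osc_theta)
  show "(norm (Mm \<psi> (fp U)))\<^sup>2 \<le> dot (\<lambda>y z. Mm \<psi> (umap y) \<bullet> Mm \<psi> (cp z)) U + ?e U" if U0: "U \<in> D0"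
      for U
  proof -
    note U = D0_Dom[OF U0] and l = bounded_linear.linear[OF bl(2)]
    have "Mm \<psi> (cp (dX U)) = - Mm \<psi>' (sigma (X U))"
      using ibp_moment[OF sobolev_sigma[OF U] \<psi> L12'] z by (simp add: eq_neg_iff_add_eq_0)
    moreover have "Mm \<psi>' (ft U) = Mm \<psi>' (osc (ft U))"
      unfolding osc_def linear_diff[OF l] moment_const_on[OF \<psi> L12'] using z by simp
    ultimately have "Mm \<psi> (cp (dX U)) = - ((a / m) *\<^sub>R Mm \<psi>' (zeta (X U)) - beta *\<^sub>R Mm \<psi>' (osc
        (ft U)))"
      unfolding sigma_zeta linear_diff[OF l] linear_scale[OF l] by simp
    then show ?thesis unfolding dot_def umap_dX[OF U] by (simp add: power2_norm_eq_inner
        inner_diff_right)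
  qed
qed

end

lemma ibp_square:
  assumes s: "sobolev \<alpha> \<beta> F f f'" and h: "C1 h h'" and ab: "\<alpha> \<le> \<beta>"
  shows "wmult \<alpha> \<beta> h f' \<bullet> f = (h \<beta> * (F \<beta> \<bullet> F \<beta>) - h \<alpha> * (F \<alpha> \<bullet> F \<alpha>)) / 2 - (wmult \<alpha> \<beta> h' f \<bullet> f) /
      2"
proof -
  have "wmult \<alpha> \<beta> h f \<bullet> f' = wmult \<alpha> \<beta> h f' \<bullet> f"
    unfolding wmult_commute[OF C1_continuous(1)[OF h], of \<alpha> \<beta> f f'] by (rule inner_commute)
  moreover have "y = e / 2 - z / 2" if "y + x + z = e" "x = y" for x y z e :: real
    using that by simp
  ultimately show ?thesis using ibp[OF s s h ab] by blast
qed

text \<open>The arithmetic of \<open>dot_BI\<close>, kept apart so that inner products enter as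
  plain real numbers.\<close>

lemma collect_dot_BI:
  fixes d :: real
  assumes "d = w1 + A * w2 + B * w3 + C * w4 + E * w5 + t1 + t2 + t3"
    "w1 = - 1 / 2 * S - z1 / 2" "w2 = - 1 / 2 * trace_sq - w6 / 2" "w6 = 1 / h * n - 3 / h * c"
        "w3 = - x3" "w4 = - z4 / 2"
    "E * w5 \<le> E * (- z5 / 2)" "h > 0"
  shows "d \<le> - 1 / 2 * S - A / 2 * trace_sq - A / (2 * h) * n + 3 * A / (2 * h) * c
    + (- 1 / 2 * z1 - B * x3 - C / 2 * z4 - E / 2 * z5 + t1 + t2 + t3)"
proof -
  have "A * w2 = - A / 2 * trace_sq - A / (2 * h) * n + 3 * A / (2 * h) * c"
    unfolding assms(3,4) using assms(8) by (simp add: field_simps)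
  moreover have "B * w3 = - (B * x3)" "C * w4 = - (C / 2 * z4)" "E * (- z5 / 2) = - (E / 2 * z5)"
    unfolding assms(5,6) by simp_all
  ultimately show ?thesis using assms(1,2,7) by linarith
qed

lemma collect_dot_BJ:
  fixes d :: real
  assumes "A \<le> l / 2 * S" "B = c * (l / 2 * P - w / 2)" "d = A + B + t"
  shows "d \<le> l / 2 * (S + c * P) - c / 2 * w + t"
proof -
  have "B = l / 2 * (c * P) - c / 2 * w" unfolding assms(2) by (simp add: algebra_simps)
  then show ?thesis using assms(1,3) by (simp add: distrib_left)
qed

context transmission
begin

subsection \<open>Propagation to the outer parts\<close>

text \<open>The weights are polynomials in the coordinate \<open>coord\<close>, which maps \<open>(L\<^sub>1, L\<^sub>2)\<close> to \<open>(-1, 1)\<close>. The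
  multiplier weight \<open>hh\<close> has the sign at the ends that makes the boundary terms coercive, and its
  derivative is positive except where \<open>chi\<close> is bounded below.\<close>

definition half_len :: real where "half_len = ell / 2"
lemma half_len_pos: "half_len > 0" using ell_pos by (simp add: half_len_def)

definition coord :: "real \<Rightarrow> real" where "coord x = (x - (L\<^sub>1 + L\<^sub>2) / 2) / half_len"

lemma coord_ends: "coord L\<^sub>1 = -1" "coord L\<^sub>2 = 1"
  using L12 by (simp_all add: coord_def half_len_def ell_def field_simps)

lemma coord_deriv: "(coord has_real_derivative 1 / half_len) (at x)"
  unfolding coord_def[abs_def] using half_len_pos by (auto intro!: derivative_eq_intros)

lemma coord_cont: "continuous_on A coord"
  unfolding coord_def[abs_def] by (intro continuous_intros) (use half_len_pos in auto)

lemma coord_range: "x \<in> {L\<^sub>1<..<L\<^sub>2} \<Longrightarrow> \<bar>coord x\<bar> \<le> 1"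
  using L12 by (auto simp: coord_def half_len_def ell_def field_simps abs_le_iff)

definition chi :: "real \<Rightarrow> real" where "chi x = 1 - (coord x)\<^sup>2"
definition chi' :: "real \<Rightarrow> real" where "chi' x = - 2 * coord x / half_len"
definition hh :: "real \<Rightarrow> real" where "hh x = (coord x) ^ 3 - 2 * coord x"
text \<open>Equal to \<open>(3 * (coord x)\<^sup>2 - 2) / half_len\<close>, arranged as a positive
  constant minus a multiple of \<open>chi\<close>: by \<open>controlled_chi_p\<close> the subtracted
  part is harmless when the weight acts on \<open>p\<close>.\<close>

definition hh' :: "real \<Rightarrow> real" where "hh' x = 1 / half_len + - (3 / half_len) * chi x"
definition kap :: "real \<Rightarrow> real" where "kap x = (1 - (coord x)\<^sup>2)\<^sup>2"
definition kap' :: "real \<Rightarrow> real" where "kap' x = - 4 * coord x * (1 - (coord x)\<^sup>2) / half_len"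
definition kap'' :: "real \<Rightarrow> real" where "kap'' x = (12 * (coord x)\<^sup>2 - 4) / half_len\<^sup>2"
definition Kap :: "real \<Rightarrow> real" where "Kap x = half_len * (coord x - 2 / 3 * (coord x) ^ 3 +
    (coord x) ^ 5 / 5)"

lemma C1_chi: "C1 chi chi'"
  unfolding C1_def chi_def[abs_def] chi'_def[abs_def] using half_len_pos
  by (auto intro!: derivative_eq_intros DERIV_chain2[OF _ coord_deriv] continuous_intros
      coord_cont coord_deriv simp: field_simps)

lemma C1_chi_lin: "C1 (\<lambda>x. chi x * (x - L\<^sub>1)) (\<lambda>x. chi' x * (x - L\<^sub>1) + chi x)"
proof -
  have "(chi has_real_derivative chi' x) (at x)" for x using C1_chi by (simp add: C1_def)
  then show ?thesis using C1_continuous[OF C1_chi]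
    unfolding C1_def by (auto intro!: derivative_eq_intros continuous_intros)
qed

lemma C1_hh: "C1 hh hh'"
  unfolding C1_def hh_def[abs_def] hh'_def[abs_def] chi_def[abs_def] using half_len_pos
  by (auto intro!: derivative_eq_intros continuous_intros coord_cont coord_deriv simp: field_simps
      power2_eq_square power3_eq_cube)

lemma C1_kap: "C1 kap kap'" "C1 kap' kap''"
  unfolding C1_def kap_def[abs_def] kap'_def[abs_def] kap''_def[abs_def] using half_len_pos
  by (auto intro!: derivative_eq_intros continuous_intros coord_cont coord_deriv simp: field_simps
      power2_eq_square)

lemma C1_Kap: "C1 Kap kap"
  unfolding C1_def Kap_def[abs_def] kap_def[abs_def] using half_len_pos
  by (auto intro!: derivative_eq_intros continuous_intros coord_cont coord_deriv simp: field_simps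
      power2_eq_square eval_nat_numeral)

text \<open>The integral of \<open>kap\<close> over the middle part, computed from its
  antiderivative \<open>Kap\<close>; division by it makes \<open>shift\<close> reproduce
  constants.\<close>

definition kap0 :: real where "kap0 = Kap L\<^sub>2 - Kap L\<^sub>1"

lemma kap0_pos: "kap0 > 0" using half_len_pos by (simp add: kap0_def Kap_def coord_ends)

lemma weight_ends: "chi L\<^sub>1 = 0" "chi L\<^sub>2 = 0" "hh L\<^sub>1 = 1" "hh L\<^sub>2 = -1" "kap L\<^sub>1 = 0" "kap L\<^sub>2 =
    0" "kap' L\<^sub>1 = 0" "kap' L\<^sub>2 = 0"
  by (simp_all add: chi_def hh_def kap_def kap'_def coord_ends)

lemma chi_nonneg: "x \<in> {L\<^sub>1<..<L\<^sub>2} \<Longrightarrow> 0 \<le> chi x"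
  using coord_range[of x] by (simp add: chi_def abs_square_le_1)

text \<open>Testing the equation of \<open>p\<close> with the primitive of the oscillation of \<open>\<theta>\<close> leaves the linear interpolant
  of the boundary values of \<open>p\<close>; after weighting with \<open>chi\<close> these enter only through moments of
      \<open>p\<close>.\<close>

lemma controlled_chi_p: "controlled (\<lambda>U. W chi (fp U) \<bullet> fp U)"
proof (rule controlled_divide[OF _ m0], rule controlled_dot_null)
  note c = C1_continuous[OF C1_chi]
  note bl = wmult_bounded_linear[OF c(1), of L\<^sub>1 L\<^sub>2] wmult_bounded_linear[OF c(2), of L\<^sub>1 L\<^sub>2]
  let ?d = "\<lambda>U. (1 / ell) *\<^sub>R (tI (fp U) L\<^sub>2 - tI (fp U) L\<^sub>1)"
  let ?e = "\<lambda>U. - 1 * (W chi (sigma (X U)) \<bullet> osc (ft U) + W chi' (sigma (X U)) \<bullet> osc_prim (ft U))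
      - k * (W chi (fp U) \<bullet> fq U)
    + m * (Mm chi (fp U) \<bullet> tI (fp U) L\<^sub>1 + Mm (\<lambda>x. chi x * (x - L\<^sub>1)) (fp U) \<bullet> ?d U)"
  show "bounded_bilinear (\<lambda>y z. -1 * (W chi (cp y) \<bullet> osc_prim (ct z)))"
    by (intro bounded_bilinear_cmult bounded_bilinear_inner_compose bounded_linear_compose[OF
        bl(1)] bounded_linear_compose[OF osc_prim_bl] component_bounded_linear)
  have sTh: "small (\<lambda>U. osc_prim (ft U))"
    unfolding osc_prim_def by (rule small_blin[OF prim_op_bounded_linear small_osc_theta])
  have n1: "null (\<lambda>U. Mm chi (fp U) \<bullet> tI (fp U) L\<^sub>1)"
    by (rule null_inner(1)[OF small_moment[OF C1_chi weight_ends(1,2)] bnd_trace(1)])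
  have n2: "null (\<lambda>U. Mm (\<lambda>x. chi x * (x - L\<^sub>1)) (fp U) \<bullet> ?d U)"
    by (rule null_inner(1)[OF small_moment[OF C1_chi_lin] bnd_scaleR[OF bnd_diff[OF
        bnd_trace(2,1)]]]) (simp_all add: weight_ends)
  show "null ?e"
    by (intro null_diff null_add null_cmult n1 n2 null_inner(2)[OF small_osc_theta]
        null_inner(2)[OF sTh] null_inner(2)[OF small_q]
      bnd_lin_X bounded_linear_compose[OF bl(1)] bounded_linear_compose[OF bl(2)] sigma_bl
          component_bounded_linear)
  show "m * (W chi (fp U) \<bullet> fp U) \<le> dot (\<lambda>y z. -1 * (W chi (cp y) \<bullet> osc_prim (ct z))) U + ?e U" if
      U0: "U \<in> D0" for U
  proof -
    note U = D0_Dom[OF U0]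
    obtain G where G: "sobolev L\<^sub>1 L\<^sub>2 G (osc_prim (ft U)) (osc (ft U))" "G L\<^sub>1 = 0" "G L\<^sub>2 = 0"
      unfolding osc_prim_def using K_sobolev_zero[OF Mm_osc] by blast
    have 1: "W chi (cp (dX U)) \<bullet> osc_prim (ft U) = - (W chi (sigma (X U)) \<bullet> osc (ft U) + W chi'
        (sigma (X U)) \<bullet> osc_prim (ft U))"
      using ibp[OF sobolev_sigma[OF U] G(1) C1_chi L12'] G(2,3) by simp
    have c1: "continuous_on UNIV (\<lambda>x::real. x - L\<^sub>1)" by (intro continuous_intros)
    have c2: "continuous_on UNIV (\<lambda>x. chi x * (x - L\<^sub>1))" using c by (intro continuous_intros)
    have 2: "W chi (fp U) \<bullet> interp (tI (fp U) L\<^sub>1) (tI (fp U) L\<^sub>2)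
      = Mm chi (fp U) \<bullet> tI (fp U) L\<^sub>1 + Mm (\<lambda>x. chi x * (x - L\<^sub>1)) (fp U) \<bullet> ?d U"
    proof -
      have "W chi (fp U) \<bullet> K (Cc (?d U)) = fp U \<bullet> W chi (W (\<lambda>x. x - L\<^sub>1) (Cc (?d U)))"
        unfolding prim_op_const_on by (rule wmult_commute[OF c(1)])
      also have "\<dots> = W (\<lambda>x. chi x * (x - L\<^sub>1)) (fp U) \<bullet> Cc (?d U)"
        unfolding wmult_wmult[OF c(1) c1] by (rule wmult_commute[OF c2, symmetric])
      finally show ?thesis
        unfolding interp_def inner_add_right inner_wmult_const_on[OF c(1)] by (simp only:
            inner_wmult_const_on[OF c2])
    qed
    have "dot (\<lambda>y z. -1 * (W chi (cp y) \<bullet> osc_prim (ct z))) U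
      = - (W chi (fp U) \<bullet> osc_prim (ct (dX U))) - W chi (cp (dX U)) \<bullet> osc_prim (ft U)"
      by (simp add: dot_def)
    also have "W chi (fp U) \<bullet> osc_prim (ct (dX U)) = - k * (W chi (fp U) \<bullet> fq U) - m * (W chi (fp
        U) \<bullet> fp U)
      + m * (W chi (fp U) \<bullet> interp (tI (fp U) L\<^sub>1) (tI (fp U) L\<^sub>2))"
      unfolding osc_prim_dtheta[OF U] by (simp add: inner_simps)
    finally show ?thesis unfolding 1 2 by (simp add: algebra_simps)
  qed
qed

text \<open>The time derivative of \<open>shift\<close> is small since \<open>kap\<close> and \<open>kap'\<close> vanish at the ends. Adding the multiples
  of \<open>shift\<close> below leaves the space derivatives of \<open>\<theta>\<close>, \<open>\<sigma>\<close> and \<open>b v\<^sub>x\<close> unchanged and makes the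
      first two small.\<close>

definition shift :: "l2x6 \<Rightarrow> complex" where "shift Y = (1 / kap0) *\<^sub>R Mm kap (ct Y)"
definition shift_dot :: "state \<Rightarrow> complex" where "shift_dot U = shift (dX U)"
definition theta_sh :: "l2x6 \<Rightarrow> l2" where "theta_sh Y = ct Y - Cc (shift Y)"
text \<open>The factor \<open>beta\<close> preserves the relation between stress,
  \<open>zeta\<close> and temperature, see \<open>sigma_sh_eq\<close>. Since \<open>ya\<close> and
  \<open>yb\<close> receive the same constant, the stress stays continuous across the
  interfaces.\<close>

definition sigma_sh :: "l2x6 \<Rightarrow> l2" where "sigma_sh Y = sigma Y + Cc (beta *\<^sub>R shift Y)"
definition ya :: "l2x6 \<Rightarrow> l2" where "ya Y = b *\<^sub>R cy Y + const_on 0 L\<^sub>1 (beta *\<^sub>R shift Y)"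
definition yb :: "l2x6 \<Rightarrow> l2" where "yb Y = b *\<^sub>R cy Y + const_on L\<^sub>2 L\<^sub>3 (beta *\<^sub>R shift Y)"

lemma kap_bl: "bounded_linear (Mm kap)" by (rule moment_bounded_linear[OF C1_continuous(1)[OF
    C1_kap(1)]])

lemma shift_bl: "bounded_linear shift"
  unfolding shift_def[abs_def]
  by (intro bounded_linear_compose[OF bounded_linear_scaleR_right] bounded_linear_compose[OF
      kap_bl] component_bounded_linear)

lemma shifted_bl: "bounded_linear theta_sh" "bounded_linear sigma_sh" "bounded_linear ya"
    "bounded_linear yb"
  unfolding theta_sh_def[abs_def] sigma_sh_def[abs_def] ya_def[abs_def] yb_def[abs_def]
  by (intro bounded_linear_add bounded_linear_sub bounded_linear_compose[OF
      const_on_bounded_linear] bounded_linear_const_scaleR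
      shift_bl sigma_bl component_bounded_linear)+

text \<open>A weighted average reproduces constants, so the mean of the temperature cancels against
  that in \<open>shift\<close> and only the oscillation is left.\<close>

lemma small_theta_sh: "small (\<lambda>U. theta_sh (X U))"
proof (rule small_cong)
  show "small (\<lambda>U. osc (ft U) - Cc ((1 / kap0) *\<^sub>R Mm kap (osc (ft U))))"
    by (intro small_diff small_osc_theta small_blin[OF const_on_bounded_linear] small_scaleR
        small_blin[OF kap_bl])
  fix U assume "U \<in> D0"
  have "Mm kap (osc (ft U)) = Mm kap (ft U) - kap0 *\<^sub>R mean (ft U)"
    unfolding osc_def linear_diff[OF bounded_linear.linear[OF kap_bl]] moment_const_on[OF C1_Kap
        L12'] kap0_def ..
  then have "(1 / kap0) *\<^sub>R Mm kap (osc (ft U)) = shift (X U) - mean (ft U)"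
    using kap0_pos by (simp add: shift_def scaleR_diff_right)
  then show "theta_sh (X U) = osc (ft U) - Cc ((1 / kap0) *\<^sub>R Mm kap (osc (ft U)))"
    by (simp add: theta_sh_def osc_def linear_diff[OF bounded_linear.linear[OF
        const_on_bounded_linear]])
qed

lemma sigma_sh_eq: "sigma_sh Y = (a / m) *\<^sub>R zeta Y - beta *\<^sub>R theta_sh Y"
  unfolding sigma_sh_def theta_sh_def sigma_zeta
  by (simp add: scaleR_diff_right linear_scale[OF bounded_linear.linear[OF
      const_on_bounded_linear]])

lemma small_sigma_sh: "small (\<lambda>U. sigma_sh (X U))"
  unfolding sigma_sh_eq by (intro small_diff small_scaleR small_zeta small_theta_sh)

text \<open>The zeros of \<open>kap\<close> at the ends remove the boundary terms of integration by
  parts, and those of \<open>kap'\<close> make \<open>small_moment\<close> applicable to the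
  remaining moment of \<open>p\<close>.\<close>

lemma small_shift_dot: "small shift_dot"
proof (rule small_cong)
  show "small (\<lambda>U. (1 / kap0) *\<^sub>R (k *\<^sub>R Mm kap' (fq U) + m *\<^sub>R Mm kap' (fp U)))"
    by (intro small_scaleR small_add small_moment[OF C1_kap(2)] small_blin[OF _ small_q]
        moment_bounded_linear
        C1_continuous[OF C1_kap(2)] weight_ends)
  fix U assume "U \<in> D0"
  then have U: "U \<in> Dom" by (rule D0_Dom)
  note l = bounded_linear.linear[OF kap_bl]
  have "Mm kap (gq U) = - Mm kap' (fq U)" "Mm kap (gp U) = - Mm kap' (fp U)"
    using ibp_moment[OF dom_sobolev(3)[OF U] C1_kap(1) L12'] ibp_moment[OF dom_sobolev(4)[OF U]
        C1_kap(1) L12']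
    by (simp_all add: weight_ends eq_neg_iff_add_eq_0)
  then show "shift_dot U = (1 / kap0) *\<^sub>R (k *\<^sub>R Mm kap' (fq U) + m *\<^sub>R Mm kap' (fp U))"
    unfolding shift_dot_def shift_def dom_dX[OF U] linear_neg[OF l] linear_add[OF l]
        linear_scale[OF l] by simp
qed

text \<open>Small enough for the interface terms of the outer multipliers to be absorbed by those of \<open>hh\<close>.\<close>

definition del :: real where "del = min 1 ((a + m\<^sup>2) / b) / (2 * L\<^sub>3)"

lemma L3_pos: "0 < L\<^sub>3" using L1 L12 L23 by simp

lemma del_props: "del > 0" "del * L\<^sub>3 \<le> 1 / 2" "del * L\<^sub>3 * b \<le> (a + m\<^sup>2) / 2"
proof -
  have am: "a + m\<^sup>2 > 0" using a0 by (simp add: add_pos_nonneg)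
  show "del > 0" using L3_pos am b0 by (simp add: del_def)
  have e: "del * L\<^sub>3 = min 1 ((a + m\<^sup>2) / b) / 2" using L3_pos by (simp add: del_def)
  show "del * L\<^sub>3 \<le> 1 / 2" unfolding e by simp
  have "min 1 ((a + m\<^sup>2) / b) * b \<le> (a + m\<^sup>2) / b * b" using b0 by (intro mult_right_mono) auto
  then show "del * L\<^sub>3 * b \<le> (a + m\<^sup>2) / 2" unfolding e using b0 by simp
qed

text \<open>The derivative of the first pairing contains \<open>q_x\<close>, which the energy does
  not bound. The second pairing supplies the missing halves, so that \<open>q_x\<close> occurs only
  inside exact derivatives of products, up to the term with \<open>shift_dot\<close>.\<close>

definition BI :: "l2x6 \<Rightarrow> l2x6 \<Rightarrow> real" where
  "BI y z = W hh (cp y) \<bullet> sigma_sh z + - k * (W hh (theta_sh y) \<bullet> cq z)"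
text \<open>The weight vanishes at the clamped end, where the strain is unknown; \<open>BJb\<close>
  does the same from the other side.\<close>

definition BJa :: "l2x6 \<Rightarrow> l2x6 \<Rightarrow> real" where
  "BJa y z = wmult 0 L\<^sub>1 (\<lambda>x. x) (cr y) \<bullet> ya z"
definition BJb :: "l2x6 \<Rightarrow> l2x6 \<Rightarrow> real" where
  "BJb y z = wmult L\<^sub>2 L\<^sub>3 (\<lambda>x. x - L\<^sub>3) (cr y) \<bullet> yb z"

text \<open>The trace of the shifted stress. By the transmission conditions it is also the trace of
  \<open>ya\<close> and \<open>yb\<close> at the interface, which couples the middle estimate to the
  outer ones.\<close>

definition sigma_tr :: "state \<Rightarrow> real \<Rightarrow> complex" where
  "sigma_tr U x = a *\<^sub>R tI (fw U) x - m *\<^sub>R tI (ft U) x + beta *\<^sub>R shift (X U)"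

text \<open>The interface terms of stress and velocity are both negative because \<open>hh\<close>
  equals 1 at the left end and -1 at the right one. Each term of the last group pairs factors at
  least one of which is small.\<close>

lemma dot_BI:
  assumes U: "U \<in> Dom"
  shows "dot BI U \<le> - 1 / 2 * ((cmod (sigma_tr U L\<^sub>1))\<^sup>2 + (cmod (sigma_tr U L\<^sub>2))\<^sup>2) - (a + m\<^sup>2)
      / 2 * trace_sq U
     - (a + m\<^sup>2) / (2 * half_len) * (norm (fp U))\<^sup>2 + 3 * (a + m\<^sup>2) / (2 * half_len) * (W chi (fp
         U) \<bullet> fp U)
     + (- 1 / 2 * (W hh' (sigma_sh (X U)) \<bullet> sigma_sh (X U)) - m * k * (fp U \<bullet> W hh' (fq U)) - k\<^sup>2
         / 2 * (W hh' (fq U) \<bullet> fq U)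
       - k\<^sup>2 / \<tau> / 2 * (W hh' (theta_sh (X U)) \<bullet> theta_sh (X U)) + k / \<tau> * (W hh (theta_sh (X U))
           \<bullet> fq U)
       + W hh (fp U) \<bullet> Cc (beta *\<^sub>R shift_dot U) + k * (W hh (Cc (shift_dot U)) \<bullet> fq U))"
proof -
  note c = C1_continuous[OF C1_hh]
  note l = bounded_linear.linear[OF wmult_bounded_linear[OF c(1), of L\<^sub>1 L\<^sub>2]]
  note lc = bounded_linear.linear[OF const_on_bounded_linear[of L\<^sub>1 L\<^sub>2]]
  note s = dom_sobolev[OF U] and L = dom_L2[OF U] and bc = dom_bc[OF U]
  let ?dg = "shift_dot U"
  have sS: "sobolev L\<^sub>1 L\<^sub>2 (sigma_tr U) (sigma_sh (X U)) (cp (dX U))"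
    using sobolev_add[OF sobolev_sigma[OF U] sobolev_const_on[of L\<^sub>1 L\<^sub>2 "beta *\<^sub>R shift (X U)"]]
        by (simp add: sigma_tr_def[abs_def] sigma_sh_def)
  have sT: "sobolev L\<^sub>1 L\<^sub>2 (\<lambda>x. tI (ft U) x - shift (X U)) (theta_sh (X U)) (gt U)"
    using sobolev_diff[OF s(2) sobolev_const_on[of L\<^sub>1 L\<^sub>2 "shift (X U)"]] by (simp add:
        theta_sh_def)
  have 1: "W hh (cp (dX U)) \<bullet> sigma_sh (X U) = - 1 / 2 * ((cmod (sigma_tr U L\<^sub>1))\<^sup>2 + (cmod
      (sigma_tr U L\<^sub>2))\<^sup>2) - (W hh' (sigma_sh (X U)) \<bullet> sigma_sh (X U)) / 2"
    using ibp_square[OF sS C1_hh L12'] by (simp add: weight_ends power2_norm_eq_inner field_simps)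
  have 2: "W hh (gp U) \<bullet> fp U = - 1 / 2 * trace_sq U - (W hh' (fp U) \<bullet> fp U) / 2"
    using ibp_square[OF s(4) C1_hh L12'] by (simp add: weight_ends power2_norm_eq_inner
        trace_sq_def field_simps)
  have 3: "W hh (gp U) \<bullet> fq U + W hh (fp U) \<bullet> gq U = - (fp U \<bullet> W hh' (fq U))"
    using ibp[OF s(4,3) C1_hh L12'] bc wmult_commute[OF c(2), of L\<^sub>1 L\<^sub>2 "fp U" "fq U"] by simp
  have 4: "W hh (gq U) \<bullet> fq U = - (W hh' (fq U) \<bullet> fq U) / 2"
    using ibp_square[OF s(3) C1_hh L12'] bc by simp
  \<comment> \<open>The end values of the shifted temperature come with a favourable sign and are
    dropped; this is the only inequality among the relations collected here.\<close>
  have 5: "W hh (gt U) \<bullet> theta_sh (X U) \<le> - (W hh' (theta_sh (X U)) \<bullet> theta_sh (X U)) / 2"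
  proof -
    have aux: "e \<le> - D / 2" if "e = (- 1 * A - 1 * B) / 2 - D / 2" "0 \<le> A" "0 \<le> B" for e A B D ::
        real
      using that by simp
    show ?thesis
      by (rule aux[OF ibp_square[OF sT C1_hh L12', unfolded weight_ends] inner_ge_zero
          inner_ge_zero])
  qed
  have 6: "W hh' (fp U) \<bullet> fp U = 1 / half_len * (norm (fp U))\<^sup>2 - 3 / half_len * (W chi (fp U) \<bullet>
      fp U)"
    unfolding hh'_def[abs_def] wmult_affine_weight[OF C1_continuous(1)[OF C1_chi] L(5)]
    by (simp add: inner_simps power2_norm_eq_inner)
  have com: "W hh x \<bullet> y = W hh y \<bullet> x" for x y using wmult_commute[OF c(1), of L\<^sub>1 L\<^sub>2 x y] by
      (simp add: inner_commute)
  have dsg: "sigma_sh (dX U) = (a + m\<^sup>2) *\<^sub>R gp U + (m * k) *\<^sub>R gq U + Cc (beta *\<^sub>R ?dg)"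
    unfolding sigma_sh_def sigma_def dom_dX[OF U] shift_dot_def by (simp add: algebra_simps
        power2_eq_square)
  have dth: "theta_sh (dX U) = - (k *\<^sub>R gq U + m *\<^sub>R gp U) - Cc ?dg"
    unfolding theta_sh_def dom_dX[OF U] shift_dot_def ..
  have "dot BI U = W hh (cp (dX U)) \<bullet> sigma_sh (X U) + W hh (fp U) \<bullet> sigma_sh (dX U) - k * (W hh
      (theta_sh (dX U)) \<bullet> fq U) - k * (W hh (theta_sh (X U)) \<bullet> cq (dX U))"
    by (simp add: dot_def BI_def)
  also have "W hh (fp U) \<bullet> sigma_sh (dX U) = (a + m\<^sup>2) * (W hh (gp U) \<bullet> fp U) + m * k * (W hh (fp
      U) \<bullet> gq U) + W hh (fp U) \<bullet> Cc (beta *\<^sub>R ?dg)"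
    unfolding dsg by (simp add: inner_simps com[of "fp U" "gp U"])
  also have "W hh (theta_sh (dX U)) \<bullet> fq U = - k * (W hh (gq U) \<bullet> fq U) - m * (W hh (gp U) \<bullet> fq U)
      - W hh (Cc ?dg) \<bullet> fq U"
    unfolding dth linear_diff[OF l] linear_neg[OF l] linear_add[OF l] linear_scale[OF l] by (simp
        add: inner_simps)
  also have "W hh (theta_sh (X U)) \<bullet> cq (dX U) = - (k / \<tau>) * (W hh (gt U) \<bullet> theta_sh (X U)) - 1 /
      \<tau> * (W hh (theta_sh (X U)) \<bullet> fq U)"
    unfolding dom_dX[OF U] by (simp add: inner_simps com[of "theta_sh (X U)" "gt U"])
  finally have E: "dot BI U = W hh (cp (dX U)) \<bullet> sigma_sh (X U) + (a + m\<^sup>2) * (W hh (gp U) \<bullet> fp U)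
     + m * k * (W hh (gp U) \<bullet> fq U + W hh (fp U) \<bullet> gq U) + k\<^sup>2 * (W hh (gq U) \<bullet> fq U) + k\<^sup>2 / \<tau> *
         (W hh (gt U) \<bullet> theta_sh (X U))
     + k / \<tau> * (W hh (theta_sh (X U)) \<bullet> fq U) + W hh (fp U) \<bullet> Cc (beta *\<^sub>R ?dg) + k * (W hh (Cc
         ?dg) \<bullet> fq U)"
    by (simp add: algebra_simps power2_eq_square)
  have "k\<^sup>2 / \<tau> * (W hh (gt U) \<bullet> theta_sh (X U)) \<le> k\<^sup>2 / \<tau> * (- (W hh' (theta_sh (X U)) \<bullet> theta_sh
      (X U)) / 2)"
    using 5 tau0 by (intro mult_left_mono) auto
  from collect_dot_BI[OF E 1 2 6 3 4 this half_len_pos] show ?thesis .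
qed

lemma sobolev_y_shift:
  assumes U: "U \<in> Dom"
  shows "sobolev 0 L\<^sub>1 (\<lambda>x. b *\<^sub>R tJ (fy U) x + beta *\<^sub>R shift (X U)) (ya (X U)) (b *\<^sub>R gy U)"
    "sobolev L\<^sub>2 L\<^sub>3 (\<lambda>x. b *\<^sub>R tJ (fy U) x + beta *\<^sub>R shift (X U)) (yb (X U)) (b *\<^sub>R gy U)"
  using sobolev_add[OF sobolev_scaleR[OF dom_sobolev(5)[OF U], of b] sobolev_const_on[of 0 L\<^sub>1
      "beta *\<^sub>R shift (X U)"]]
    sobolev_add[OF sobolev_scaleR[OF dom_sobolev(6)[OF U], of b] sobolev_const_on[of L\<^sub>2 L\<^sub>3 "beta
        *\<^sub>R shift (X U)"]]
  by (simp_all add: ya_def yb_def)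

text \<open>The weights are affine with slope 1, so integration by parts yields the full outer
  kinetic energy with a negative sign. The interface terms are positive, but they involve the same
  two traces that \<open>dot_BI\<close> provides with the opposite sign.\<close>

lemma dot_BJ:
  assumes U: "U \<in> Dom"
  shows "dot BJa U \<le> L\<^sub>1 / 2 * ((cmod (sigma_tr U L\<^sub>1))\<^sup>2 + b * (cmod (tI (fp U) L\<^sub>1))\<^sup>2) - b / 2
      * (wmult 0 L\<^sub>1 one (fr U) \<bullet> fr U)
      + wmult 0 L\<^sub>1 (\<lambda>x. x) (fr U) \<bullet> const_on 0 L\<^sub>1 (beta *\<^sub>R shift_dot U)"
    "dot BJb U \<le> (L\<^sub>3 - L\<^sub>2) / 2 * ((cmod (sigma_tr U L\<^sub>2))\<^sup>2 + b * (cmod (tI (fp U) L\<^sub>2))\<^sup>2) - b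
        / 2 * (wmult L\<^sub>2 L\<^sub>3 one (fr U) \<bullet> fr U)
      + wmult L\<^sub>2 L\<^sub>3 (\<lambda>x. x - L\<^sub>3) (fr U) \<bullet> const_on L\<^sub>2 L\<^sub>3 (beta *\<^sub>R shift_dot U)"
proof -
  note s = dom_sobolev[OF U] and bc = dom_bc[OF U]
  have ca: "C1 (\<lambda>x. x) one" and cb: "C1 (\<lambda>x. x - L\<^sub>3) one"
    unfolding C1_def by (auto intro!: derivative_eq_intros)
  have y: "b *\<^sub>R tJ (fy U) L\<^sub>1 + beta *\<^sub>R shift (X U) = sigma_tr U L\<^sub>1" "b *\<^sub>R tJ (fy U) L\<^sub>2 +
      beta *\<^sub>R shift (X U) = sigma_tr U L\<^sub>2"
    unfolding bc sigma_tr_def by simp_all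
  \<comment> \<open>Serves to drop the squares of \<open>ya\<close> and \<open>yb\<close>, which
    have the favourable sign; only kinetic energy is kept from the outer parts.\<close>
  have nn: "0 \<le> wmult \<alpha> \<beta> one f \<bullet> f" for \<alpha> \<beta> f by (rule wmult_nonneg) auto
  have dy: "ya (dX U) = b *\<^sub>R gr U + const_on 0 L\<^sub>1 (beta *\<^sub>R shift_dot U)" "yb (dX U) = b *\<^sub>R gr
      U + const_on L\<^sub>2 L\<^sub>3 (beta *\<^sub>R shift_dot U)"
    unfolding ya_def yb_def dom_dX[OF U] shift_dot_def by simp_all
  have coma: "wmult \<alpha> \<beta> (\<lambda>x. x) f \<bullet> g = wmult \<alpha> \<beta> (\<lambda>x. x) g \<bullet> f" for \<alpha> \<beta> f g
    using wmult_commute[OF C1_continuous(1)[OF ca], of \<alpha> \<beta> f g] by (simp add: inner_commute)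
  have comb: "wmult \<alpha> \<beta> (\<lambda>x. x - L\<^sub>3) f \<bullet> g = wmult \<alpha> \<beta> (\<lambda>x. x - L\<^sub>3) g \<bullet> f" for \<alpha> \<beta> f g
    using wmult_commute[OF C1_continuous(1)[OF cb], of \<alpha> \<beta> f g] by (simp add: inner_commute)
  have Aa: "wmult 0 L\<^sub>1 (\<lambda>x. x) (cr (dX U)) \<bullet> ya (X U) \<le> L\<^sub>1 / 2 * (cmod (sigma_tr U L\<^sub>1))\<^sup>2"
    unfolding dom_dX[OF U]
    using ibp_square[OF sobolev_y_shift(1)[OF U] ca less_imp_le[OF L1]] nn[of 0 L\<^sub>1 "ya (X U)"]
    by (simp add: y power2_norm_eq_inner)
  have "wmult 0 L\<^sub>1 (\<lambda>x. x) (gr U) \<bullet> fr U = L\<^sub>1 / 2 * (cmod (tI (fp U) L\<^sub>1))\<^sup>2 - (wmult 0 L\<^sub>1 one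
      (fr U) \<bullet> fr U) / 2"
    using ibp_square[OF s(7) ca less_imp_le[OF L1]] by (simp add: bc power2_norm_eq_inner)
  then have Ba: "b * (wmult 0 L\<^sub>1 (\<lambda>x. x) (gr U) \<bullet> fr U) = b * (L\<^sub>1 / 2 * (cmod (tI (fp U) L\<^sub>1))\<^sup>2
      - (wmult 0 L\<^sub>1 one (fr U) \<bullet> fr U) / 2)" by simp
  have Da: "dot BJa U = wmult 0 L\<^sub>1 (\<lambda>x. x) (cr (dX U)) \<bullet> ya (X U) + b * (wmult 0 L\<^sub>1 (\<lambda>x. x) (gr
      U) \<bullet> fr U)
      + wmult 0 L\<^sub>1 (\<lambda>x. x) (fr U) \<bullet> const_on 0 L\<^sub>1 (beta *\<^sub>R shift_dot U)"
    unfolding dot_def BJa_def dy by (simp add: inner_simps coma[of _ _ "fr U" "gr U"])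
  show "dot BJa U \<le> L\<^sub>1 / 2 * ((cmod (sigma_tr U L\<^sub>1))\<^sup>2 + b * (cmod (tI (fp U) L\<^sub>1))\<^sup>2) - b / 2 *
      (wmult 0 L\<^sub>1 one (fr U) \<bullet> fr U)
      + wmult 0 L\<^sub>1 (\<lambda>x. x) (fr U) \<bullet> const_on 0 L\<^sub>1 (beta *\<^sub>R shift_dot U)"
    by (rule collect_dot_BJ[OF Aa Ba Da])
  have Ab: "wmult L\<^sub>2 L\<^sub>3 (\<lambda>x. x - L\<^sub>3) (cr (dX U)) \<bullet> yb (X U) \<le> (L\<^sub>3 - L\<^sub>2) / 2 * (cmod (sigma_tr
      U L\<^sub>2))\<^sup>2"
    unfolding dom_dX[OF U]
  proof -
    have aux: "e \<le> (L\<^sub>3 - L\<^sub>2) / 2 * n" if "e = ((L\<^sub>3 - L\<^sub>3) * n3 - (L\<^sub>2 - L\<^sub>3) * n) / 2 - D / 2"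
        "0 \<le> D" for e n n3 D
      using that by (simp add: field_simps)
    show "wmult L\<^sub>2 L\<^sub>3 (\<lambda>x. x - L\<^sub>3) (b *\<^sub>R gy U) \<bullet> yb (X U) \<le> (L\<^sub>3 - L\<^sub>2) / 2 * (cmod (sigma_tr
        U L\<^sub>2))\<^sup>2"
      unfolding power2_norm_eq_inner
      by (rule aux[OF ibp_square[OF sobolev_y_shift(2)[OF U] cb less_imp_le[OF L23], unfolded y]
          nn])
  qed
  have "wmult L\<^sub>2 L\<^sub>3 (\<lambda>x. x - L\<^sub>3) (gr U) \<bullet> fr U = (L\<^sub>3 - L\<^sub>2) / 2 * (cmod (tI (fp U) L\<^sub>2))\<^sup>2 -
      (wmult L\<^sub>2 L\<^sub>3 one (fr U) \<bullet> fr U) / 2"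
    using ibp_square[OF s(8) cb less_imp_le[OF L23]] by (simp add: bc power2_norm_eq_inner
        algebra_simps)
  then have Bb: "b * (wmult L\<^sub>2 L\<^sub>3 (\<lambda>x. x - L\<^sub>3) (gr U) \<bullet> fr U) = b * ((L\<^sub>3 - L\<^sub>2) / 2 * (cmod
      (tI (fp U) L\<^sub>2))\<^sup>2 - (wmult L\<^sub>2 L\<^sub>3 one (fr U) \<bullet> fr U) / 2)" by simp
  have Db: "dot BJb U = wmult L\<^sub>2 L\<^sub>3 (\<lambda>x. x - L\<^sub>3) (cr (dX U)) \<bullet> yb (X U) + b * (wmult L\<^sub>2 L\<^sub>3
      (\<lambda>x. x - L\<^sub>3) (gr U) \<bullet> fr U)
      + wmult L\<^sub>2 L\<^sub>3 (\<lambda>x. x - L\<^sub>3) (fr U) \<bullet> const_on L\<^sub>2 L\<^sub>3 (beta *\<^sub>R shift_dot U)"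
    unfolding dot_def BJb_def dy by (simp add: inner_simps comb[of _ _ "fr U" "gr U"])
  show "dot BJb U \<le> (L\<^sub>3 - L\<^sub>2) / 2 * ((cmod (sigma_tr U L\<^sub>2))\<^sup>2 + b * (cmod (tI (fp U) L\<^sub>2))\<^sup>2) -
      b / 2 * (wmult L\<^sub>2 L\<^sub>3 one (fr U) \<bullet> fr U)
      + wmult L\<^sub>2 L\<^sub>3 (\<lambda>x. x - L\<^sub>3) (fr U) \<bullet> const_on L\<^sub>2 L\<^sub>3 (beta *\<^sub>R shift_dot U)"
    by (rule collect_dot_BJ[OF Ab Bb Db])
qed

lemma controlled_kinetic:
  "controlled (\<lambda>U. (a + m\<^sup>2) / 4 * trace_sq U + (a + m\<^sup>2) / (2 * half_len) * (norm (fp U))\<^sup>2 + del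
      * b / 2 * (norm (fr U))\<^sup>2)"
proof (rule controlled_dot_null)
  note ch = C1_continuous[OF C1_hh]
  have cx: "continuous_on UNIV (\<lambda>x::real. x)" "continuous_on UNIV (\<lambda>x::real. x - L\<^sub>3)" by (auto
      intro!: continuous_intros)
  note bl = wmult_bounded_linear[OF ch(1), of L\<^sub>1 L\<^sub>2] wmult_bounded_linear[OF ch(2), of L\<^sub>1 L\<^sub>2]
    wmult_bounded_linear[OF cx(1), of 0 L\<^sub>1] wmult_bounded_linear[OF cx(2), of L\<^sub>2 L\<^sub>3]
  note blc = bounded_linear_compose[OF bl(1)] bounded_linear_compose[OF bl(2)]
      bounded_linear_compose[OF bl(3)] bounded_linear_compose[OF bl(4)]
  let ?e1 = "\<lambda>U. - 1 / 2 * (W hh' (sigma_sh (X U)) \<bullet> sigma_sh (X U)) - m * k * (fp U \<bullet> W hh' (fq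
      U)) - k\<^sup>2 / 2 * (W hh' (fq U) \<bullet> fq U)
       - k\<^sup>2 / \<tau> / 2 * (W hh' (theta_sh (X U)) \<bullet> theta_sh (X U)) + k / \<tau> * (W hh (theta_sh (X U))
           \<bullet> fq U)
       + W hh (fp U) \<bullet> Cc (beta *\<^sub>R shift_dot U) + k * (W hh (Cc (shift_dot U)) \<bullet> fq U)"
  let ?e = "\<lambda>U. 3 * (a + m\<^sup>2) / (2 * half_len) * (W chi (fp U) \<bullet> fp U) + ?e1 U
     + del * (wmult 0 L\<^sub>1 (\<lambda>x. x) (fr U) \<bullet> const_on 0 L\<^sub>1 (beta *\<^sub>R shift_dot U) + wmult L\<^sub>2 L\<^sub>3
         (\<lambda>x. x - L\<^sub>3) (fr U) \<bullet> const_on L\<^sub>2 L\<^sub>3 (beta *\<^sub>R shift_dot U))"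
  let ?B = "\<lambda>y z. -1 * (BI y z + del * (BJa y z + BJb y z))"
  show "bounded_bilinear ?B"
    unfolding BI_def BJa_def BJb_def
    by (intro bounded_bilinear_cmult bounded_bilinear_plus bounded_bilinear_inner_compose blc
        shifted_bl component_bounded_linear)
  have coord: "small (\<lambda>U. const_on \<alpha> \<beta> (beta *\<^sub>R shift_dot U))" "small (\<lambda>U. const_on \<alpha> \<beta>
      (shift_dot U))" for \<alpha> \<beta>
    by (intro small_blin[OF const_on_bounded_linear] small_scaleR small_shift_dot)+
  show "null ?e"
    by (intro null_add null_diff null_cmult null_controlled[OF controlled_chi_p] wmult_nonneg
        C1_continuous(1)[OF C1_chi] chi_nonneg
       null_inner(2)[OF small_sigma_sh] null_inner(2)[OF small_theta_sh] null_inner(2)[OF small_q]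
           null_inner(2)[OF coord(1)] null_inner(2)[OF small_blin[OF bl(2) small_q]]
       null_inner(1)[OF small_blin[OF bl(1) coord(2)]] null_inner(1)[OF small_blin[OF bl(1)
           small_theta_sh]] bnd_lin_X blc shifted_bl component_bounded_linear)
  fix U assume "U \<in> D0"
  then have U: "U \<in> Dom" by (rule D0_Dom)
  define S1 S2 P1 P2 where SP: "S1 = (cmod (sigma_tr U L\<^sub>1))\<^sup>2" "S2 = (cmod (sigma_tr U L\<^sub>2))\<^sup>2"
      "P1 = (cmod (tI (fp U) L\<^sub>1))\<^sup>2" "P2 = (cmod (tI (fp U) L\<^sub>2))\<^sup>2"
  have nn: "0 \<le> S1" "0 \<le> S2" "0 \<le> P1" "0 \<le> P2" by (simp_all add: SP)
  have bdP: "trace_sq U = P1 + P2" by (simp add: trace_sq_def SP)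
  have r: "(norm (fr U))\<^sup>2 = wmult 0 L\<^sub>1 one (fr U) \<bullet> fr U + wmult L\<^sub>2 L\<^sub>3 one (fr U) \<bullet> fr U"
    using wmult_J_split[OF dom_L2(6)[OF U], of "fr U"] by (simp add: power2_norm_eq_inner)
  \<comment> \<open>\<open>l\<close> stands for the length of an outer part. The choice of
    \<open>del\<close> lets the outer interface terms use at most half of those in
    \<open>dot_BI\<close>; half of the velocity terms survives as the trace term of the
    claim.\<close>
  have edge: "del * (l / 2 * (S + b * P)) \<le> 1 / 4 * S + (a + m\<^sup>2) / 4 * P" if "0 \<le> l" "l \<le> L\<^sub>3" "0
      \<le> S" "0 \<le> P" for l S P
  proof -
    have "del * l \<le> del * L\<^sub>3" using that del_props(1) by simp
    then have "del * l \<le> 1 / 2" "del * l * b \<le> (a + m\<^sup>2) / 2"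
      using del_props(2,3) mult_right_mono[of "del * l" "del * L\<^sub>3" b] b0 by linarith+
    then have "del * l * S \<le> 1 / 2 * S" "del * l * b * P \<le> (a + m\<^sup>2) / 2 * P"
      using that by (intro mult_right_mono; simp)+
    then have "del * l * S + del * l * b * P \<le> 1 / 2 * S + (a + m\<^sup>2) / 2 * P" by (rule add_mono)
    then have "(del * l * S + del * l * b * P) / 2 \<le> (1 / 2 * S + (a + m\<^sup>2) / 2 * P) / 2" by (rule
        divide_right_mono) simp
    moreover have "del * (l / 2 * (S + b * P)) = (del * l * S + del * l * b * P) / 2" by (simp
        add: algebra_simps)
    moreover have "1 / 4 * S + (a + m\<^sup>2) / 4 * P = (1 / 2 * S + (a + m\<^sup>2) / 2 * P) / 2" by (simp
        add: field_simps)
    ultimately show ?thesis by (simp only:)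
  qed
  have "del * dot BJa U \<le> del * (L\<^sub>1 / 2 * (S1 + b * P1) - b / 2 * (wmult 0 L\<^sub>1 one (fr U) \<bullet> fr U)
      + wmult 0 L\<^sub>1 (\<lambda>x. x) (fr U) \<bullet> const_on 0 L\<^sub>1 (beta *\<^sub>R shift_dot U))"
    "del * dot BJb U \<le> del * ((L\<^sub>3 - L\<^sub>2) / 2 * (S2 + b * P2) - b / 2 * (wmult L\<^sub>2 L\<^sub>3 one (fr U)
        \<bullet> fr U) + wmult L\<^sub>2 L\<^sub>3 (\<lambda>x. x - L\<^sub>3) (fr U) \<bullet> const_on L\<^sub>2 L\<^sub>3 (beta *\<^sub>R shift_dot U))"
    using dot_BJ[OF U] del_props(1) unfolding SP by (intro mult_left_mono; simp)+
  moreover have "del * (L\<^sub>1 / 2 * (S1 + b * P1)) \<le> 1 / 4 * S1 + (a + m\<^sup>2) / 4 * P1" "del * ((L\<^sub>3 -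
      L\<^sub>2) / 2 * (S2 + b * P2)) \<le> 1 / 4 * S2 + (a + m\<^sup>2) / 4 * P2"
    using L1 L12 L23 by (intro edge nn; simp)+
  moreover have "dot ?B U = - dot BI U - del * dot BJa U - del * dot BJb U" by (simp add: dot_def
      algebra_simps)
  moreover have "del * b / 2 * (norm (fr U))\<^sup>2 = del * (b / 2 * (wmult 0 L\<^sub>1 one (fr U) \<bullet> fr U)) +
      del * (b / 2 * (wmult L\<^sub>2 L\<^sub>3 one (fr U) \<bullet> fr U))"
    unfolding r by (simp add: algebra_simps)
  moreover have "(a + m\<^sup>2) / 2 * trace_sq U = (a + m\<^sup>2) / 4 * P1 + (a + m\<^sup>2) / 4 * P2 + (a + m\<^sup>2)
      / 4 * trace_sq U"
    unfolding bdP by (simp add: field_simps)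
  ultimately show "(a + m\<^sup>2) / 4 * trace_sq U + (a + m\<^sup>2) / (2 * half_len) * (norm (fp U))\<^sup>2 + del
      * b / 2 * (norm (fr U))\<^sup>2 \<le> dot ?B U + ?e U"
    using dot_BI[OF U, folded SP] nn(1,2) by (simp only: distrib_left right_diff_distrib)
qed

lemma small_p: "small fp" and small_r: "small fr" and controlled_trace_sq: "controlled trace_sq"
proof -
  have am: "a + m\<^sup>2 > 0" using a0 by (simp add: add_pos_nonneg)
  have c: "0 < (a + m\<^sup>2) / 4" "0 < (a + m\<^sup>2) / (2 * half_len)" "0 < del * b / 2"
    using am half_len_pos del_props(1) b0 by auto
  have n: "0 \<le> (a + m\<^sup>2) / 4 * trace_sq U" "0 \<le> (a + m\<^sup>2) / (2 * half_len) * (norm (fp U))\<^sup>2" "0 \<le>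
      del * b / 2 * (norm (fr U))\<^sup>2" for U
    using c trace_sq_nonneg by (intro mult_nonneg_nonneg; simp)+
  show "small fp" unfolding small_def
    by (rule controlled_divide[OF controlled_mono[OF controlled_kinetic] c(2)]) (use n in \<open>smt
        (verit)\<close>)
  show "small fr" unfolding small_def
    by (rule controlled_divide[OF controlled_mono[OF controlled_kinetic] c(3)]) (use n in \<open>smt
        (verit)\<close>)
  show "controlled trace_sq"
    by (rule controlled_divide[OF controlled_mono[OF controlled_kinetic] c(1)]) (use n in \<open>smt
        (verit)\<close>)
qed

text \<open>With \<open>norm_osc_split\<close> this separates the part of the temperature known from
  the dissipation from its mean, which only equipartition reaches.\<close>

lemma norm_const_on_sq: "(norm (Cc c))\<^sup>2 = ell * (cmod c)\<^sup>2"
  using const_on_inner[OF L2_on_const_on, of L\<^sub>1 L\<^sub>2 c c] by (simp add: power2_norm_eq_inner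
      Mm_one_const_on)

lemma norm_osc_split:
  assumes "f \<in> L2_on I" shows "(norm f)\<^sup>2 = (norm (osc f))\<^sup>2 + ell * (cmod (mean f))\<^sup>2"
proof -
  have f: "f = osc f + Cc (mean f)" by (simp add: osc_def)
  have "f \<bullet> f = (osc f + Cc (mean f)) \<bullet> (osc f + Cc (mean f))" using f by simp
  also have "\<dots> = osc f \<bullet> osc f + Cc (mean f) \<bullet> osc f + (osc f \<bullet> Cc (mean f) + Cc (mean f) \<bullet> Cc
      (mean f))"
    by (simp only: inner_add_left inner_add_right)
  also have "\<dots> = osc f \<bullet> osc f + Cc (mean f) \<bullet> Cc (mean f)"
    using const_on_inner_osc[OF assms, of "mean f"] by (simp only: inner_commute[of "osc f" "Cc _"])
  finally show ?thesis by (simp only: power2_norm_eq_inner[symmetric] norm_const_on_sq)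
qed

subsection \<open>Potential energy and the stationary solutions\<close>

text \<open>Equipartition: the derivative of the pairing of velocity with displacement is the
  kinetic minus the potential part. The interface terms of the middle and outer parts cancel,
  because displacement and stress are continuous there.\<close>

lemma controlled_potential: "controlled (\<lambda>U. a * (norm (fw U))\<^sup>2 + b * (norm (fy U))\<^sup>2 + ell *
    (cmod (mean (ft U)))\<^sup>2)"
proof (rule controlled_dot_null)
  let ?B = "\<lambda>y z. -1 * (cp y \<bullet> umap z + cr y \<bullet> vmap z)"
  let ?e = "\<lambda>U. (norm (fp U))\<^sup>2 + (norm (fr U))\<^sup>2 + m * (osc (ft U) \<bullet> fw U)"
  show "bounded_bilinear ?B"
    by (intro bounded_bilinear_cmult bounded_bilinear_plus bounded_bilinear_inner_compose
        component_bounded_linear umap_bounded_linear vmap_bounded_linear)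
  show "null ?e"
    by (intro null_add null_cmult null_norm small_p small_r null_inner(1)[OF small_osc_theta]
        bnd_comp)
  fix U assume U0: "U \<in> D0"
  then have U: "U \<in> Dom" by (rule D0_Dom)
  obtain u v \<theta> q p r where e: "U = (u, v, \<theta>, q, p, r)" by (cases U) auto
  have H: "(u, v, \<theta>, q, p, r) \<in> Hs" using Dom_Hs[OF U] e by simp
  have uv: "umap (X U) = u" "vmap (X U) = v" using umap_X[OF H] vmap_X[OF H] by (simp_all add: e)
  have h: "u \<in> H1 I" "v \<in> H1 J" and bc: "tJ v 0 = 0" "tJ v L\<^sub>3 = 0" "tI u L\<^sub>1 = tJ v L\<^sub>1" "tI u
      L\<^sub>2 = tJ v L\<^sub>2"
    using H unfolding Hs_iff by auto
  have su: "sobolev L\<^sub>1 L\<^sub>2 (tI u) u (fw U)" and sv: "sobolev 0 L\<^sub>1 (tJ v) v (fy U)" "sobolev L\<^sub>2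
      L\<^sub>3 (tJ v) v (fy U)"
    using sobolev_I[OF h(1)] sobolev_J[OF h(2)] by (simp_all add: e X_def cw_def cy_def)
  have 1: "cp (dX U) \<bullet> u + sigma (X U) \<bullet> fw U = (b *\<^sub>R tJ (fy U) L\<^sub>2) \<bullet> tJ v L\<^sub>2 - (b *\<^sub>R tJ (fy
      U) L\<^sub>1) \<bullet> tJ v L\<^sub>1"
    using ibp_one[OF sobolev_sigma[OF U] su L12' sigma_L2(1)[OF U] sigma_L2(2)[OF U]] unfolding bc
        dom_bc[OF U] .
  have "gy U \<bullet> v + fy U \<bullet> fy U = tJ (fy U) L\<^sub>1 \<bullet> tJ v L\<^sub>1 - tJ (fy U) L\<^sub>2 \<bullet> tJ v L\<^sub>2"
    using ibp_J[OF dom_sobolev(5,6)[OF U] sv dom_L2(2,8)[OF U]] bc by simp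
  then have "b * (gy U \<bullet> v + fy U \<bullet> fy U) = b * (tJ (fy U) L\<^sub>1 \<bullet> tJ v L\<^sub>1 - tJ (fy U) L\<^sub>2 \<bullet> tJ v
      L\<^sub>2)" by (rule arg_cong)
  then have 2: "cr (dX U) \<bullet> v + b * (fy U \<bullet> fy U) = (b *\<^sub>R tJ (fy U) L\<^sub>1) \<bullet> tJ v L\<^sub>1 - (b *\<^sub>R tJ
      (fy U) L\<^sub>2) \<bullet> tJ v L\<^sub>2"
    unfolding dom_dX[OF U] by (simp add: distrib_left right_diff_distrib)
  have "Mm one (zeta (X U)) = m *\<^sub>R Mm one (fw U) + Mm one (ft U)"
    unfolding zeta_def linear_add[OF bounded_linear.linear[OF Mm_one_bl]] linear_scale[OF
        bounded_linear.linear[OF Mm_one_bl]] ..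
  \<comment> \<open>Vanishing of the conserved integral ties the mean strain to the mean temperature
    with the opposite sign. The cross term of the two means then becomes a positive square, which
    controls the mean temperature.\<close>
  then have mw: "m *\<^sub>R Mm one (fw U) = - (ell *\<^sub>R mean (ft U))"
    using Mm_zeta[OF U0] ell_pos by (simp add: mean_def eq_neg_iff_add_eq_0)
  have "m * (Cc (mean (ft U)) \<bullet> fw U) = (m *\<^sub>R Mm one (fw U)) \<bullet> mean (ft U)"
    using const_on_inner[OF dom_L2(1)[OF U], of "mean (ft U)"] by (simp add: inner_commute)
  also have "\<dots> = - (ell * (cmod (mean (ft U)))\<^sup>2)" unfolding mw by (simp add: power2_norm_eq_inner)
  finally have 3: "m * (Cc (mean (ft U)) \<bullet> fw U) = - (ell * (cmod (mean (ft U)))\<^sup>2)" .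
  have "ft U \<bullet> fw U = osc (ft U) \<bullet> fw U + Cc (mean (ft U)) \<bullet> fw U" by (simp add: osc_def
      inner_diff_left)
  then have "sigma (X U) \<bullet> fw U = a * (norm (fw U))\<^sup>2 - m * (osc (ft U) \<bullet> fw U) - m * (Cc (mean
      (ft U)) \<bullet> fw U)"
    by (simp add: sigma_def inner_diff_left power2_norm_eq_inner distrib_left)
  then have 4: "sigma (X U) \<bullet> fw U = a * (norm (fw U))\<^sup>2 - m * (osc (ft U) \<bullet> fw U) + ell * (cmod
      (mean (ft U)))\<^sup>2"
    unfolding 3 by simp
  have "dot ?B U = - ((norm (fp U))\<^sup>2 + cp (dX U) \<bullet> u + (norm (fr U))\<^sup>2 + cr (dX U) \<bullet> v)"
    unfolding dot_def umap_dX[OF U] vmap_dX[OF U] uv by (simp add: power2_norm_eq_inner)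
  then have "a * (norm (fw U))\<^sup>2 + b * (norm (fy U))\<^sup>2 + ell * (cmod (mean (ft U)))\<^sup>2 = dot ?B U +
      ?e U"
    using 1 2 4 by (simp add: power2_norm_eq_inner)
  then show "a * (norm (fw U))\<^sup>2 + b * (norm (fy U))\<^sup>2 + ell * (cmod (mean (ft U)))\<^sup>2 \<le> dot ?B U +
      ?e U" by simp
qed

lemma norm_X: "(norm (X U))\<^sup>2 = (norm (fw U))\<^sup>2 + (norm (fy U))\<^sup>2 + (norm (ft U))\<^sup>2 + (norm (fq
    U))\<^sup>2 + (norm (fp U))\<^sup>2 + (norm (fr U))\<^sup>2"
  using norm_l2x6[of "fw U" "fy U" "ft U" "fq U" "fp U" "fr U"]
  by (simp add: cw_def cy_def ct_def cq_def cp_def cr_def)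

lemma controlled_R: "controlled R"
proof (rule controlled_mono)
  let ?P = "\<lambda>U. a * (norm (fw U))\<^sup>2 + b * (norm (fy U))\<^sup>2 + ell * (cmod (mean (ft U)))\<^sup>2"
  show "controlled (\<lambda>U. 1 / a * ?P U + 1 / b * ?P U + (?P U + (norm (osc (ft U)))\<^sup>2) + (norm (fq
      U))\<^sup>2 + (norm (fp U))\<^sup>2 + (norm (fr U))\<^sup>2 + trace_sq U)"
    using small_q small_p small_r small_osc_theta a0 b0 unfolding small_def
    by (intro controlled_add controlled_cmult controlled_potential controlled_trace_sq) auto
  fix U assume "U \<in> D0"
  then have U: "U \<in> Dom" by (rule D0_Dom)
  have n: "0 \<le> a * (norm (fw U))\<^sup>2" "0 \<le> b * (norm (fy U))\<^sup>2" "0 \<le> ell * (cmod (mean (ft U)))\<^sup>2"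
    using a0 b0 ell_pos by auto
  have "1 / a * (a * (norm (fw U))\<^sup>2) \<le> 1 / a * ?P U" "1 / b * (b * (norm (fy U))\<^sup>2) \<le> 1 / b * ?P U"
    using n a0 b0 by (intro mult_left_mono; simp)+
  then have "(norm (fw U))\<^sup>2 \<le> 1 / a * ?P U" "(norm (fy U))\<^sup>2 \<le> 1 / b * ?P U" using a0 b0 by
      simp_all
  moreover have "ell * (cmod (mean (ft U)))\<^sup>2 \<le> ?P U" using n by simp
  ultimately show "R U \<le> 1 / a * ?P U + 1 / b * ?P U + (?P U + (norm (osc (ft U)))\<^sup>2) + (norm (fq
      U))\<^sup>2 + (norm (fp U))\<^sup>2 + (norm (fr U))\<^sup>2 + trace_sq U"
    unfolding R_def norm_X norm_osc_split[OF dom_L2(3)[OF U]] by linarith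
qed

text \<open>With \<open>\<epsilon> = 1 / 2\<close> the quantity \<open>R\<close> is absorbed into
  itself, which closes the chain of estimates.\<close>

lemma lyapunov_form:
  obtains B where "bounded_bilinear B" "\<And>U. U \<in> D0 \<Longrightarrow> 1 / 2 * (norm (X U))\<^sup>2 \<le> dot B U"
proof -
  obtain B where B: "bounded_bilinear B" "\<And>U. U \<in> D0 \<Longrightarrow> R U \<le> dot B U + 1 / 2 * R U"
    using controlled_R unfolding controlled_def by (metis half_gt_zero zero_less_one)
  show ?thesis
  proof (rule that[OF B(1)])
    fix U assume "U \<in> D0"
    then have "1 / 2 * R U \<le> dot B U" using B(2)[of U] by simp
    moreover have "1 / 2 * (norm (X U))\<^sup>2 \<le> 1 / 2 * R U" using trace_sq_nonneg[of U] by (simp add: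
        R_def)
    ultimately show "1 / 2 * (norm (X U))\<^sup>2 \<le> dot B U" by (rule order_trans[rotated])
  qed
qed

lemma conserved_bl: "bounded_linear conserved"
  unfolding conserved_def[abs_def] by (rule bounded_linear_compose[OF Mm_one_bl zeta_bl[unfolded
      zeta_def[abs_def]]])

lemma conserved_dX: assumes U: "U \<in> Dom" shows "conserved (dX U) = 0"
proof -
  note l = bounded_linear.linear[OF Mm_one_bl]
  have "Mm one (gq U) = 0" using moment_one_deriv[OF dom_sobolev(3)[OF U] L12'] dom_bc[OF U] by simp
  moreover have "m *\<^sub>R cw (dX U) + ct (dX U) = - k *\<^sub>R gq U" unfolding dom_dX[OF U] by simp
  ultimately show ?thesis unfolding conserved_def by (simp only: linear_scale[OF l]
      scaleR_zero_right)
qed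

text \<open>The conserved integral is corrected through the temperature alone. The correction
  vanishes at the ends, so every boundary condition of \<open>Dom\<close> persists, and the
  displacements are not touched.\<close>

lemma D0_dense:
  assumes U: "U \<in> Hs" and Z: "conserved (X U) = 0"
  obtains V where "\<And>n. V n \<in> D0" "(\<lambda>n. X (V n)) \<longlonglongrightarrow> X U"
proof -
  obtain V where V: "\<And>n. V n \<in> Dom" "(\<lambda>n. X (V n)) \<longlonglongrightarrow> X U" by (rule Dom_dense[OF U]) blast
  obtain \<eta> where \<eta>: "\<eta> \<in> TI" "Mm one \<eta> = 1" using TI_moment_one by blast
  define c where "c n = - conserved (X (V n))" for n
  define N where "N f = ((0, 0, f, 0, 0, 0) :: l2x6)" for f
  define V' where "V' n = V n + N (scaleC (c n) \<eta>)" for n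
  have "c \<longlonglongrightarrow> - conserved (X U)" unfolding c_def by (intro tendsto_minus bounded_linear.tendsto[OF
      conserved_bl V(2)])
  then have c0: "c \<longlonglongrightarrow> 0" using Z by simp
  have XV': "X (V' n) = X (V n) + N (scaleC (c n) \<eta>)" for n
    by (cases "V n") (simp add: V'_def N_def X_def)
  have "(\<lambda>n. cmod (c n) * norm \<eta>) \<longlonglongrightarrow> 0"
    using tendsto_mult_left_zero[OF tendsto_norm_zero[OF c0], of "norm \<eta>"] .
  then have "(\<lambda>n. scaleC (c n) \<eta>) \<longlonglongrightarrow> 0"
    unfolding norm_scaleC[symmetric] by (rule tendsto_norm_zero_cancel)
  then have "(\<lambda>n. N (scaleC (c n) \<eta>)) \<longlonglongrightarrow> (0, 0, 0, 0, 0, 0)"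
    unfolding N_def by (intro tendsto_Pair tendsto_const)
  then have lim: "(\<lambda>n. X (V' n)) \<longlonglongrightarrow> X U"
    unfolding XV' using tendsto_add[OF V(2)] by (fastforce simp: zero_prod_def[symmetric])
  have "V' n \<in> D0" for n
  proof -
    obtain u v \<theta> q p r where e: "V n = (u, v, \<theta>, q, p, r)" by (cases "V n") auto
    have t: "scaleC (c n) \<eta> \<in> TI" by (rule TI_scaleC[OF \<eta>(1)])
    then have t': "scaleC (c n) \<eta> \<in> H1 I" "tI (scaleC (c n) \<eta>) L\<^sub>1 = 0" "tI (scaleC (c n) \<eta>) L\<^sub>2 =
        0" by (auto simp: TI_def)
    have D: "(u, v, \<theta>, q, p, r) \<in> Dom" using V(1)[of n] e by simp
    then have th: "\<theta> \<in> H1 I" unfolding Dom_iff by simp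
    have "V' n = (u, v, \<theta> + scaleC (c n) \<eta>, q, p, r)" by (simp add: V'_def N_def e)
    moreover have "(u, v, \<theta> + scaleC (c n) \<eta>, q, p, r) \<in> Dom"
      using D H1_add(1)[OF open_I th t'(1)] bdry_I_add[OF th t'(1)] t'(2,3) H1_imp_L2[OF
          H1_add(1)[OF open_I th t'(1)]]
      unfolding Dom_iff Hs_iff by simp
    moreover have "conserved (X (V' n)) = conserved (X (V n)) + c n"
    proof -
      have "conserved (N (scaleC (c n) \<eta>)) = c n"
        unfolding conserved_def N_def cw_def ct_def using \<eta>(2) by (simp add: moment_scaleC)
      then show ?thesis unfolding XV' linear_add[OF bounded_linear.linear[OF conserved_bl]] by simp
    qed
    ultimately show ?thesis by (simp add: D0_def c_def)
  qed
  then show ?thesis using lim by (rule that)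
qed

text \<open>The stationary solution with temperature \<open>c\<close> has slope \<open>mid_slope * c\<close> in the middle part and
  \<open>outer_slope * c\<close> in the outer parts.\<close>

definition mid_slope :: real where "mid_slope = m / (a + b * ell / (L\<^sub>1 + (L\<^sub>3 - L\<^sub>2)))"
definition outer_slope :: real where "outer_slope = - mid_slope * ell / (L\<^sub>1 + (L\<^sub>3 - L\<^sub>2))"

text \<open>The two equations express continuity of the stress at unit temperature and zero total
  elongation; they are the linear system that both slopes solve.\<close>

lemma mid_slope_props: "mid_slope > 0" "a * mid_slope - m = b * outer_slope" "mid_slope * ell +
    outer_slope * (L\<^sub>1 + (L\<^sub>3 - L\<^sub>2)) = 0"
proof -
  have l: "L\<^sub>1 + (L\<^sub>3 - L\<^sub>2) > 0" using L1 L23 by simp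
  have p: "a + b * ell / (L\<^sub>1 + (L\<^sub>3 - L\<^sub>2)) > 0"
    using a0 b0 ell_pos l by (intro add_pos_nonneg) auto
  show "mid_slope > 0" unfolding mid_slope_def using m0 p by simp
  have "mid_slope * (a + b * ell / (L\<^sub>1 + (L\<^sub>3 - L\<^sub>2))) = m" unfolding mid_slope_def using p by simp
  then show "a * mid_slope - m = b * outer_slope" unfolding outer_slope_def by (simp add:
      algebra_simps)
  show "mid_slope * ell + outer_slope * (L\<^sub>1 + (L\<^sub>3 - L\<^sub>2)) = 0" unfolding outer_slope_def using l
      by simp
qed

definition Xst :: "complex \<Rightarrow> l2x6" where
  "Xst c = (Cc (mid_slope *\<^sub>R c), const_on 0 L\<^sub>1 (outer_slope *\<^sub>R c) + const_on L\<^sub>2 L\<^sub>3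
      (outer_slope *\<^sub>R c), Cc c, 0, 0, 0)"

definition Wst :: "complex \<Rightarrow> state" where
  "Wst c = (umap (Xst c), vmap (Xst c), Cc c, 0, 0, 0)"

lemma Xst_bl: "bounded_linear Xst"
  unfolding Xst_def[abs_def]
  by (intro bounded_linear_Pair bounded_linear_add bounded_linear_compose[OF
      const_on_bounded_linear] bounded_linear_zero
      bounded_linear_scaleR_right bounded_linear_ident)

lemma const_on_H1: "Cc c \<in> H1 I" "wD I (Cc c) = 0" "tI (Cc c) L\<^sub>1 = c" "tI (Cc c) L\<^sub>2 = c"
proof -
  show "Cc c \<in> H1 I" "wD I (Cc c) = 0"
    using H1_intervalI[OF sobolev_const_on L12 L2_on_const_on L2_on_zero] by blast+
  show "tI (Cc c) L\<^sub>1 = c" "tI (Cc c) L\<^sub>2 = c" using bdry_I[OF sobolev_const_on, of _ c] by simp_all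
qed

lemma const_on_J_H1:
  fixes c :: complex
  defines "f \<equiv> const_on 0 L\<^sub>1 c + const_on L\<^sub>2 L\<^sub>3 c"
  shows "f \<in> H1 J" "wD J f = 0" "x \<in> {0, L\<^sub>1, L\<^sub>2, L\<^sub>3} \<Longrightarrow> tJ f x = c"
proof -
  have s1: "sobolev 0 L\<^sub>1 (\<lambda>_. c) f 0" unfolding f_def
    by (rule sobolev_add_outside[OF sobolev_const_on L2_on_const_on]) (use L12 in auto)
  have s2: "sobolev L\<^sub>2 L\<^sub>3 (\<lambda>_. c) f 0" unfolding f_def
    by (subst add.commute, rule sobolev_add_outside[OF sobolev_const_on L2_on_const_on]) (use L12
        in auto)
  have L: "f \<in> L2_on J" "0 \<in> L2_on J"
    unfolding f_def by (auto intro!: L2_on_add L2_on_mono[OF L2_on_const_on] L2_on_zero)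
  show "f \<in> H1 J" "wD J f = 0" using H1_two_intervalsI[OF s1 s2 L1 L12 L23 L] by auto
  show "x \<in> {0, L\<^sub>1, L\<^sub>2, L\<^sub>3} \<Longrightarrow> tJ f x = c" using bdry_J[OF s1 s2] by auto
qed

lemma zero_H1: "0 \<in> H1 I" "wD I 0 = 0" "tI 0 L\<^sub>1 = 0" "tI 0 L\<^sub>2 = 0"
  "0 \<in> H1 J" "wD J 0 = 0" "tJ 0 0 = 0" "tJ 0 L\<^sub>1 = 0" "tJ 0 L\<^sub>2 = 0" "tJ 0 L\<^sub>3 = 0"
proof -
  have t: "tJ 0 x = 0" if "x \<in> {0, L\<^sub>1, L\<^sub>2, L\<^sub>3}" for x
    using const_on_J_H1(3)[OF that, of 0] by (simp add: const_on_zero)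
  show "tJ 0 0 = 0" "tJ 0 L\<^sub>1 = 0" "tJ 0 L\<^sub>2 = 0" "tJ 0 L\<^sub>3 = 0" by (rule t; simp)+
qed (use const_on_H1[of 0] const_on_J_H1(1,2)[of 0] in \<open>simp_all add: const_on_zero\<close>)

lemma Wst_stationary:
  shows "Wst c \<in> stationary_solutions L\<^sub>1 L\<^sub>2 L\<^sub>3 a b m k \<tau>" "X (Wst c) = Xst c"
proof -
  let ?y = "const_on 0 L\<^sub>1 (outer_slope *\<^sub>R c) + const_on L\<^sub>2 L\<^sub>3 (outer_slope *\<^sub>R c)" and ?w =
      "Cc (mid_slope *\<^sub>R c)"
  have m1: "moment 0 L\<^sub>1 one ?y = (L\<^sub>1 * outer_slope) *\<^sub>R c" "moment L\<^sub>2 L\<^sub>3 one ?y = ((L\<^sub>3 - L\<^sub>2)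
      * outer_slope) *\<^sub>R c"
  proof -
    have C: "C1 (\<lambda>x. x) one" by (auto simp: C1_def)
    have s: "sobolev 0 L\<^sub>1 (\<lambda>_. outer_slope *\<^sub>R c) ?y 0" "sobolev L\<^sub>2 L\<^sub>3 (\<lambda>_. outer_slope *\<^sub>R c)
        ?y 0"
    proof -
      show "sobolev 0 L\<^sub>1 (\<lambda>_. outer_slope *\<^sub>R c) ?y 0"
        by (rule sobolev_add_outside[OF sobolev_const_on L2_on_const_on]) (use L12 in auto)
      show "sobolev L\<^sub>2 L\<^sub>3 (\<lambda>_. outer_slope *\<^sub>R c) ?y 0"
        by (subst add.commute, rule sobolev_add_outside[OF sobolev_const_on L2_on_const_on]) (use
            L12 in auto)
    qed
    have z: "moment \<alpha> \<beta> (\<lambda>x. x) 0 = 0" for \<alpha> \<beta>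
      by (rule linear_0[OF bounded_linear.linear[OF moment_bounded_linear]]) (intro
          continuous_intros)
    show "moment 0 L\<^sub>1 one ?y = (L\<^sub>1 * outer_slope) *\<^sub>R c" using ibp_moment[OF s(1) C] L1 z by simp
    show "moment L\<^sub>2 L\<^sub>3 one ?y = ((L\<^sub>3 - L\<^sub>2) * outer_slope) *\<^sub>R c"
      using ibp_moment[OF s(2) C] L23 z by (simp add: left_diff_distrib scaleR_diff_left)
  qed
  have "stretch (Xst c) = (mid_slope * ell + outer_slope * (L\<^sub>1 + (L\<^sub>3 - L\<^sub>2))) *\<^sub>R c"
    unfolding stretch_def Xst_def fst_conv snd_conv m1 Mm_one_const_on by (simp add: algebra_simps)
  then have L0: "stretch (?w, ?y, Cc c, 0, 0, 0) = 0" using mid_slope_props(3) by (simp add: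
      Xst_def)
  have L: "?w \<in> L2_on I" "?y \<in> L2_on J" "Cc c \<in> L2_on I" "0 \<in> L2_on I" "0 \<in> L2_on J"
    using L2_on_const_on H1_imp_L2 const_on_J_H1(1) zero_H1 by blast+
  note H = HsI[OF L(1,2,3,4,4,5) L0]
  show X: "X (Wst c) = Xst c" using H(2) by (simp add: Wst_def Xst_def)
  have d: "wD I (umap (Xst c)) = ?w" "wD J (vmap (Xst c)) = ?y"
    using X by (simp_all add: Wst_def X_def Xst_def)
  have D: "Wst c \<in> Dom"
  proof -
    have "a *\<^sub>R (mid_slope *\<^sub>R c) - m *\<^sub>R c = b *\<^sub>R (outer_slope *\<^sub>R c)"
      using mid_slope_props(2) by (metis scaleR_diff_left scaleR_scaleR)
    then show ?thesis
      unfolding Wst_def Dom_iff d using H(1) const_on_H1 const_on_J_H1 zero_H1 by (simp add: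
          Xst_def)
  qed
  have "Op (Wst c) = 0"
    unfolding Wst_def Op_eq[OF D[unfolded Wst_def]] d by (simp add: const_on_H1 const_on_J_H1
        zero_H1 zero_prod_def)
  with D show "Wst c \<in> stationary_solutions L\<^sub>1 L\<^sub>2 L\<^sub>3 a b m k \<tau>" by (simp add:
      stationary_solutions_def)
qed

text \<open>The conserved integral of the stationary state of unit temperature. As it is nonzero,
  the integral is a coordinate on the family \<open>Wst\<close>.\<close>

definition conserved_unit :: real where "conserved_unit = ell * (m * mid_slope + 1)"

lemma conserved_unit_pos: "conserved_unit > 0" using ell_pos m0 mid_slope_props(1) by (simp add:
    conserved_unit_def add_pos_pos)

lemma conserved_Xst: "conserved (Xst c) = conserved_unit *\<^sub>R c"
proof -
  note l = bounded_linear.linear[OF Mm_one_bl]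
  show ?thesis unfolding conserved_def Xst_def cw_def ct_def fst_conv snd_conv linear_add[OF l]
      linear_scale[OF l] Mm_one_const_on conserved_unit_def
    by (simp add: algebra_simps)
qed

text \<open>The projection onto the kernel of \<open>conserved\<close> along the stationary states
  \<open>Xst\<close>.\<close>

definition Pst :: "l2x6 \<Rightarrow> l2x6" where "Pst Y = Y - Xst ((1 / conserved_unit) *\<^sub>R conserved Y)"

lemma Pst_bl: "bounded_linear Pst"
  unfolding Pst_def[abs_def]
  by (intro bounded_linear_sub bounded_linear_ident bounded_linear_compose[OF Xst_bl]
      bounded_linear_compose[OF bounded_linear_scaleR_right conserved_bl])

lemma conserved_Pst: "conserved (Pst Y) = 0"
  unfolding Pst_def linear_diff[OF bounded_linear.linear[OF conserved_bl]] conserved_Xst using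
      conserved_unit_pos by simp

end

section \<open>Exponential decay of orbits\<close>

context transmission_flow
begin

lemma X_zero: "X 0 = 0"
  using zero_H1 by (simp add: X_def zero_prod_def)

lemma T_D0:
  assumes U: "U \<in> D0" and t: "0 \<le> t" shows "T t U \<in> D0"
proof -
  have UD: "U \<in> Dom" by (rule D0_Dom[OF U])
  have "((\<lambda>s. conserved (X (T s U))) has_vector_derivative 0) (at s within {0..})" if "s \<in> {0..}"
      for s
    using bounded_linear.has_vector_derivative[OF conserved_bl XT_deriv[OF UD, of s]]
        conserved_dX[OF T_Dom[OF UD, of s]] that by simp
  then obtain c where c: "\<And>s. s \<in> {0..} \<Longrightarrow> conserved (X (T s U)) = c"
    using has_vector_derivative_zero_constant[of "{0..}" "\<lambda>s. conserved (X (T s U))"] by auto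
  have "conserved (X (T t U)) = conserved (X (T 0 U))" using c[of t] c[of 0] t by simp
  then show ?thesis using U T_0[OF Dom_Hs[OF UD]] T_Dom[OF UD t] by (simp add: D0_def)
qed

text \<open>The derivative of the embedded orbit is the image of the zero state under the semigroup,
  hence zero by linearity.\<close>

lemma T_stationary:
  assumes V: "V \<in> Dom" "Op V = 0" and t: "0 \<le> t" shows "T t V = V"
proof -
  have z: "T s 0 = 0" if "0 \<le> s" for s
  proof -
    have H: "0 \<in> Hs" using Op_Hs[OF V(1)] V(2) by simp
    have "T s 0 = T s (0 - 0)" by simp
    also have "\<dots> = T s 0 - T s 0" by (rule T_diff[OF that H H])
    finally show ?thesis by simp
  qed
  have D: "((\<lambda>s. X (T s V)) has_vector_derivative 0) (at s within {0..})" if "s \<in> {0..}" for s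
    using XT_deriv[OF V(1), of s] dX_T[OF V(1), of s] V(2) z[of s] that X_zero by simp
  have cv: "convex {0::real..}" by simp
  obtain c where c: "\<And>s. s \<in> {0..} \<Longrightarrow> X (T s V) = c"
    by (rule has_vector_derivative_zero_constant[OF cv D]) blast+
  have VH: "V \<in> Hs" by (rule Dom_Hs[OF V(1)])
  have "X (T t V) = X V" using c[of t] c[of 0] t T_0[OF VH] by simp
  then show ?thesis by (rule X_inj[OF T_Hs[OF t VH] VH])
qed

text \<open>The form \<open>B\<close> may fail to be definite. A large multiple of the energy, which
  does not increase along orbits, makes the combination comparable to the energy without spoiling
  the differential inequality.\<close>

lemma decay_D0:
  obtains C \<omega> where "C > 0" "\<omega> > 0" "\<And>U t. U \<in> D0 \<Longrightarrow> 0 \<le> t \<Longrightarrow> energy_form (X (T t U)) \<le> C *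
      energy_form (X U) * exp (- \<omega> * t)"
proof -
  obtain B where B: "bounded_bilinear B" "\<And>U. U \<in> D0 \<Longrightarrow> 1 / 2 * (norm (X U))\<^sup>2 \<le> dot B U"
    by (rule lyapunov_form) blast
  obtain K where K: "K > 0" "\<And>y z. norm (B y z) \<le> norm y * norm z * K"
    using bounded_bilinear.pos_bounded[OF B(1)] by blast
  define \<kappa> where "\<kappa> = K / elo"
  have kp: "\<kappa> > 0" using K elo_pos by (simp add: \<kappa>_def)
  have Be: "\<bar>B y y\<bar> \<le> \<kappa> * energy_form y" for y
  proof -
    have "\<bar>B y y\<bar> \<le> K * (norm y)\<^sup>2" using K(2)[of y y] by (simp add: power2_eq_square ac_simps)
    also have "\<dots> = \<kappa> * (elo * (norm y)\<^sup>2)" using elo_pos by (simp add: \<kappa>_def)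
    also have "\<dots> \<le> \<kappa> * energy_form y" using energy_form_bounds(1)[of y] kp by (intro
        mult_left_mono) auto
    finally show ?thesis .
  qed
  \<comment> \<open>\<open>B\<close> is bounded by \<open>\<kappa>\<close> times the energy, so the
    factor 2 places \<open>F\<close> between \<open>\<kappa>\<close> and \<open>3 * \<kappa>\<close>
    times the energy. The sign of \<open>B\<close> turns its growth into decay of
    \<open>F\<close>.\<close>
  define F where "F y z = 2 * \<kappa> * BE y z + -1 * B y z" for y z
  have F: "bounded_bilinear F" unfolding F_def by (intro bounded_bilinear_plus
      bounded_bilinear_cmult BE_bilinear B(1))
  have Flo: "\<kappa> * energy_form y \<le> F y y" and Fhi: "F y y \<le> 3 * \<kappa> * energy_form y" for y
    using Be[of y] unfolding F_def BE_energy_form by (auto simp: abs_le_iff)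
  \<comment> \<open>The largest rate this gives: \<open>F\<close> is at most
    \<open>3 * \<kappa> * ehi\<close> times the squared norm, and \<open>dot F\<close> is at most
    minus half the squared norm.\<close>
  define \<omega> where "\<omega> = 1 / (2 * ehi * (3 * \<kappa>))"
  have w: "\<omega> > 0" using ehi_pos kp by (simp add: \<omega>_def)
  have Fd: "dot F U \<le> - \<omega> * F (X U) (X U)" if "U \<in> D0" for U
  proof -
    have "dot F U = 2 * \<kappa> * dot BE U - dot B U" by (simp add: dot_def F_def algebra_simps)
    also have "\<dots> \<le> - (1 / 2 * (norm (X U))\<^sup>2)"
    proof -
      have "2 * \<kappa> * dot BE U \<le> 0"
        unfolding energy_dissipation[OF D0_Dom[OF that]] using kp by (simp add: mult_nonneg_nonneg)
      then show ?thesis using B(2)[OF that] by linarith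
    qed
    also have "\<dots> \<le> - (\<omega> * F (X U) (X U))"
    proof -
      have "\<omega> * F (X U) (X U) \<le> \<omega> * (3 * \<kappa> * (ehi * (norm (X U))\<^sup>2))"
        using Fhi[of "X U"] energy_form_bounds(2)[of "X U"] w kp
        by (intro mult_left_mono order_trans[OF Fhi]) auto
      also have "\<dots> = 1 / 2 * (norm (X U))\<^sup>2" using ehi_pos kp by (simp add: \<omega>_def)
      finally show ?thesis by simp
    qed
    finally show ?thesis by simp
  qed
  show ?thesis
  \<comment> \<open>3 is the quotient of the upper and lower comparison constants of
    \<open>F\<close>.\<close>
  proof (rule that[of 3 \<omega>])
    show "3 > (0::real)" "\<omega> > 0" using w by auto
    fix U t assume U: "U \<in> D0" and t: "0 \<le> (t::real)"
    have UD: "U \<in> Dom" by (rule D0_Dom[OF U])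
    define g where "g s = exp (\<omega> * s) * F (X (T s U)) (X (T s U))" for s
    have der: "(g has_real_derivative exp (\<omega> * s) * (\<omega> * F (X (T s U)) (X (T s U)) + dot F (T s
        U))) (at s within {0..})" if "0 \<le> s" for s
    proof -
      have "((\<lambda>s. F (X (T s U)) (X (T s U))) has_real_derivative dot F (T s U)) (at s within {0..})"
        using bounded_bilinear.has_vector_derivative[OF F XT_deriv[OF UD that] XT_deriv[OF UD that]]
        by (simp add: dot_def has_real_derivative_iff_has_vector_derivative)
      then show ?thesis unfolding g_def[abs_def]
        by (auto intro!: derivative_eq_intros simp: algebra_simps)
    qed
    have "g t \<le> g 0"
    proof (cases "t = 0")
      case False
      show ?thesis
      proof (rule DERIV_nonpos_imp_decreasing_open[OF t])
        fix s assume s: "0 < s" "s < t"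
        have "at s within {0..} = at s"
          using s by (intro at_within_open_subset[of s "{0<..}"]) auto
        then have "(g has_real_derivative exp (\<omega> * s) * (\<omega> * F (X (T s U)) (X (T s U)) + dot F (T
            s U))) (at s)"
          using der[of s] s by simp
        moreover have "exp (\<omega> * s) * (\<omega> * F (X (T s U)) (X (T s U)) + dot F (T s U)) \<le> 0"
          using Fd[OF T_D0[OF U, of s]] s by (intro mult_nonneg_nonpos) auto
        ultimately show "\<exists>y. (g has_real_derivative y) (at s) \<and> y \<le> 0" by blast
      next
        have "continuous_on {0..} g"
          unfolding continuous_on_eq_continuous_within using der DERIV_continuous by fastforce
        then show "continuous_on {0..t} g" by (rule continuous_on_subset) auto
      qed
    qed simp
    then have "exp (\<omega> * t) * F (X (T t U)) (X (T t U)) \<le> F (X U) (X U)"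
      using T_0[OF Dom_Hs[OF UD]] by (simp add: g_def)
    then have "exp (\<omega> * t) * (\<kappa> * energy_form (X (T t U))) \<le> 3 * \<kappa> * energy_form (X U)"
      by (intro order_trans[OF mult_left_mono[OF Flo]] order_trans[OF _ Fhi]) simp_all
    then have "\<kappa> * (exp (\<omega> * t) * energy_form (X (T t U))) \<le> \<kappa> * (3 * energy_form (X U))" by (simp
        add: algebra_simps)
    then have "exp (\<omega> * t) * energy_form (X (T t U)) \<le> 3 * energy_form (X U)" using kp by simp
    then have "exp (- \<omega> * t) * (exp (\<omega> * t) * energy_form (X (T t U))) \<le> exp (- \<omega> * t) * (3 *
        energy_form (X U))"
      by (rule mult_left_mono) simp
    then show "energy_form (X (T t U)) \<le> 3 * energy_form (X U) * exp (- \<omega> * t)"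
      by (simp add: mult.assoc[symmetric] exp_add[symmetric] mult.commute)
  qed
qed

text \<open>Differentiation along orbits is available on \<open>D0\<close> only. Both sides of the
  inequality depend continuously on the embedded datum, since \<open>T t\<close> is bounded in the
  norm of \<open>X\<close>, so density extends it.\<close>

lemma decay_conserved:
  obtains C \<omega> where "C > 0" "\<omega> > 0"
    "\<And>U t. U \<in> Hs \<Longrightarrow> conserved (X U) = 0 \<Longrightarrow> 0 \<le> t \<Longrightarrow> energy_form (X (T t U)) \<le> C * energy_form (X U)
        * exp (- \<omega> * t)"
proof -
  obtain C \<omega> where C: "C > 0" "\<omega> > 0" "\<And>U t. U \<in> D0 \<Longrightarrow> 0 \<le> t \<Longrightarrow> energy_form (X (T t U)) \<le> C *
      energy_form (X U) * exp (- \<omega> * t)"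
    by (rule decay_D0) blast
  have eYlim: "(\<lambda>n. energy_form (s n)) \<longlonglongrightarrow> energy_form l" if "s \<longlonglongrightarrow> l" for s l
    using bounded_bilinear.tendsto[OF BE_bilinear that that] by (simp add: BE_energy_form)
  show ?thesis
  proof (rule that[OF C(1,2)])
    fix U t assume U: "U \<in> Hs" "conserved (X U) = 0" and t: "0 \<le> (t::real)"
    obtain V where V: "\<And>n. V n \<in> D0" "(\<lambda>n. X (V n)) \<longlonglongrightarrow> X U" by (rule D0_dense[OF U]) blast
    have VH: "V n \<in> Hs" for n using Dom_Hs[OF D0_Dom[OF V(1)]] .
    have "(\<lambda>n. X (T t (V n)) - X (T t U)) \<longlonglongrightarrow> 0"
    proof (rule Lim_null_comparison)
      show "\<forall>\<^sub>F n in sequentially. norm (X (T t (V n)) - X (T t U)) \<le> nhi / nlo * norm (X (V n) -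
          X U)"
      proof (rule always_eventually, rule allI)
        fix n
        have H: "V n - U \<in> Hs" by (rule Hs_diff(1)[OF VH U(1)])
        have "norm (X (T t (V n)) - X (T t U)) = norm (X (T t (V n - U)))"
          using T_diff[OF t VH U(1)] Hs_diff(2)[OF T_Hs[OF t VH] T_Hs[OF t U(1)]] by simp
        also have "\<dots> \<le> Nrm (V n - U) / nlo" by (rule XT_le[OF t H])
        also have "\<dots> \<le> nhi * norm (X (V n - U)) / nlo"
          using Nrm_bounds(2)[OF H] nlo_pos by (intro divide_right_mono) auto
        finally show "norm (X (T t (V n)) - X (T t U)) \<le> nhi / nlo * norm (X (V n) - X U)"
          using Hs_diff(2)[OF VH U(1)] by simp
      qed
      show "(\<lambda>n. nhi / nlo * norm (X (V n) - X U)) \<longlonglongrightarrow> 0"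
        using V(2) by (intro tendsto_mult_right_zero tendsto_norm_zero) (simp add: LIM_zero)
    qed
    then have "(\<lambda>n. X (T t (V n))) \<longlonglongrightarrow> X (T t U)" by (simp add: LIM_zero_iff)
    from eYlim[OF this] show "energy_form (X (T t U)) \<le> C * energy_form (X U) * exp (- \<omega> * t)"
    proof (rule LIMSEQ_le)
      show "(\<lambda>n. C * energy_form (X (V n)) * exp (- \<omega> * t)) \<longlonglongrightarrow> C * energy_form (X U) * exp (- \<omega> * t)"
        by (intro tendsto_intros eYlim V(2))
      show "\<exists>N. \<forall>n\<ge>N. energy_form (X (T t (V n))) \<le> C * energy_form (X (V n)) * exp (- \<omega> * t)"
        using C(3)[OF V(1) t] by blast
    qed
  qed
qed

text \<open>The stationary state with the same conserved integral as the datum is a fixed point of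
  the semigroup, and subtracting it puts the datum into the kernel of \<open>conserved\<close>.
  Uniqueness holds because every stationary state obeying the bound is the limit of the embedded
  orbit, and \<open>X\<close> is injective.\<close>

lemma exponential_decay:
  "\<exists>M>0. \<exists>\<omega>>0. \<forall>U\<in>Hs. \<exists>!W. W \<in> stationary_solutions L\<^sub>1 L\<^sub>2 L\<^sub>3 a b m k \<tau> \<and>
     (\<forall>t\<ge>0. En (T t U - W) \<le> M * En U * exp (- \<omega> * t))"
proof -
  obtain C \<omega> where C: "C > 0" "\<omega> > 0"
    "\<And>U t. U \<in> Hs \<Longrightarrow> conserved (X U) = 0 \<Longrightarrow> 0 \<le> t \<Longrightarrow> energy_form (X (T t U)) \<le> C * energy_form (X U)
        * exp (- \<omega> * t)"
    by (rule decay_conserved) blast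
  obtain K where K: "K > 0" "\<And>Y. norm (Pst Y) \<le> norm Y * K" using bounded_linear.pos_bounded[OF
      Pst_bl] by blast
  \<comment> \<open>The second factor bounds the growth of the energy under the projection
    \<open>Pst\<close>.\<close>
  define M where "M = C * (ehi * K\<^sup>2 / elo)"
  have M: "M > 0" using C(1) ehi_pos K(1) elo_pos by (simp add: M_def)
  have eP: "energy_form (Pst Y) \<le> ehi * K\<^sup>2 / elo * energy_form Y" for Y
  proof -
    have "energy_form (Pst Y) \<le> ehi * (norm (Pst Y))\<^sup>2" by (rule energy_form_bounds)
    also have "\<dots> \<le> ehi * (norm Y * K)\<^sup>2" using ehi_pos by (intro mult_left_mono power_mono K(2))
        auto
    also have "\<dots> = ehi * K\<^sup>2 / elo * (elo * (norm Y)\<^sup>2)" using elo_pos by (simp add: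
        power_mult_distrib)
    also have "\<dots> \<le> ehi * K\<^sup>2 / elo * energy_form Y" using energy_form_bounds(1) ehi_pos elo_pos by
        (intro mult_left_mono) auto
    finally show ?thesis .
  qed
  have st: "W \<in> Dom" "Op W = 0" "W \<in> Hs" if "W \<in> stationary_solutions L\<^sub>1 L\<^sub>2 L\<^sub>3 a b m k \<tau>" for W
    using that Dom_Hs by (auto simp: stationary_solutions_def)
  show ?thesis
  proof (rule exI[of _ M], rule conjI, rule M, rule exI[of _ \<omega>], rule conjI, rule C(2), rule ballI)
    fix U assume U: "U \<in> Hs"
    let ?P = "\<lambda>W. W \<in> stationary_solutions L\<^sub>1 L\<^sub>2 L\<^sub>3 a b m k \<tau> \<and> (\<forall>t\<ge>0. En (T t U - W) \<le> M * En
        U * exp (- \<omega> * t))"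
    have enT: "En (T t U - W) = energy_form (X (T t U) - X W)" if "W \<in> Hs" "0 \<le> t" for W t
      using energy_eq[OF Hs_diff(1)[OF T_Hs[OF that(2) U] that(1)]] Hs_diff(2)[OF T_Hs[OF that(2)
          U] that(1)] by simp
    show "\<exists>!W. ?P W"
    proof (rule ex_ex1I)
      define W where "W = Wst ((1 / conserved_unit) *\<^sub>R conserved (X U))"
      have W: "W \<in> stationary_solutions L\<^sub>1 L\<^sub>2 L\<^sub>3 a b m k \<tau>" "X W = Xst ((1 / conserved_unit)
          *\<^sub>R conserved (X U))"
        unfolding W_def by (rule Wst_stationary)+
      have UW: "U - W \<in> Hs" by (rule Hs_diff(1)[OF U st(3)[OF W(1)]])
      have XUW: "X (U - W) = Pst (X U)"
        using Hs_diff(2)[OF U st(3)[OF W(1)]] W(2) by (simp add: Pst_def)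
      have "En (T t U - W) \<le> M * En U * exp (- \<omega> * t)" if t: "0 \<le> t" for t
      proof -
        have "T t (U - W) = T t U - W"
          using T_diff[OF t U st(3)[OF W(1)]] T_stationary[OF st(1,2)[OF W(1)] t] by simp
        then have "En (T t U - W) = energy_form (X (T t (U - W)))"
          using energy_eq[OF T_Hs[OF t UW]] by simp
        also have "\<dots> \<le> C * energy_form (X (U - W)) * exp (- \<omega> * t)"
          using C(3)[OF UW _ t] conserved_Pst XUW by simp
        also have "\<dots> \<le> C * (ehi * K\<^sup>2 / elo * energy_form (X U)) * exp (- \<omega> * t)"
          unfolding XUW using eP[of "X U"] C(1) by (intro mult_right_mono mult_left_mono) auto
        also have "\<dots> = M * En U * exp (- \<omega> * t)" by (simp add: M_def energy_eq[OF U])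
        finally show ?thesis .
      qed
      with W(1) show "\<exists>W. ?P W" by blast
    next
      fix W W' assume P: "?P W" "?P W'"
      then have H: "W \<in> Hs" "W' \<in> Hs" using st(3) by auto
      define e where "e t = sqrt (M * En U * exp (- \<omega> * t) / elo)" for t
      have nb: "norm (X (T t U) - X V) \<le> e t" if "?P V" "0 \<le> t" for V t
      proof -
        have V: "V \<in> Hs" using st(3) that(1) by auto
        have "elo * (norm (X (T t U) - X V))\<^sup>2 \<le> M * En U * exp (- \<omega> * t)"
          using that enT[OF V that(2)] energy_form_bounds(1)[of "X (T t U) - X V"] by auto
        then have "(norm (X (T t U) - X V))\<^sup>2 \<le> M * En U * exp (- \<omega> * t) / elo"
          using elo_pos by (simp add: pos_le_divide_eq mult.commute)
        then show ?thesis unfolding e_def by (rule real_le_rsqrt)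
      qed
      have "((\<lambda>t. exp (- \<omega> * t)) \<longlongrightarrow> 0) at_top"
        using C(2) by (intro filterlim_compose[OF exp_at_bot] filterlim_tendsto_neg_mult_at_bot[OF
            tendsto_const _ filterlim_ident]) auto
      then have "((\<lambda>t. sqrt (M * En U * exp (- \<omega> * t) / elo)) \<longlongrightarrow> sqrt (M * En U * 0 / elo)) at_top"
        using elo_pos by (intro tendsto_real_sqrt tendsto_divide tendsto_mult tendsto_const) auto
      then have "(e \<longlongrightarrow> 0) at_top" by (simp add: e_def[abs_def])
      then have lim: "((\<lambda>t. e t + e t) \<longlongrightarrow> 0 + 0) at_top" by (intro tendsto_add)
      have "norm (X W - X W') \<le> e t + e t" if "0 \<le> t" for t
        using norm_triangle_ineq4[of "X (T t U) - X W'" "X (T t U) - X W"] nb[OF P(1) that] nb[OF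
            P(2) that] by simp
      then have "norm (X W - X W') \<le> 0 + 0"
        by (intro tendsto_lowerbound[OF lim]) (auto intro: eventually_mono[OF
            eventually_ge_at_top[of 0]])
      then have "X W = X W'" by simp
      then show "W = W'" by (rule X_inj[OF H])
    qed
  qed
qed

end

text \<open>The energy of the datum is a factor of the bound because the constants are chosen before
  the datum, while both sides scale with the square of the datum.\<close>

theorem theorem1p1:
  fixes L\<^sub>1 L\<^sub>2 L\<^sub>3 a b m k \<tau> :: real
    and T :: "real \<Rightarrow> state \<Rightarrow> state"
  assumes "0 < L\<^sub>1" and "L\<^sub>1 < L\<^sub>2" and "L\<^sub>2 < L\<^sub>3"
    and "0 < a" and "0 < b" and "0 < m" and "0 < k" and "0 < \<tau>"
    and "solution_semigroup L\<^sub>1 L\<^sub>2 L\<^sub>3 a b m k \<tau> T"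
  shows "\<exists>M>0. \<exists>\<omega>>0. \<forall>U\<^sub>0 \<in> energy_space L\<^sub>1 L\<^sub>2 L\<^sub>3.
    \<exists>!W\<^sub>0. W\<^sub>0 \<in> stationary_solutions L\<^sub>1 L\<^sub>2 L\<^sub>3 a b m k \<tau> \<and>
      (\<forall>t\<ge>0. energy L\<^sub>1 L\<^sub>2 L\<^sub>3 a b \<tau> (T t U\<^sub>0 - W\<^sub>0)
                \<le> M * energy L\<^sub>1 L\<^sub>2 L\<^sub>3 a b \<tau> U\<^sub>0 * exp (- \<omega> * t))"
proof -
  interpret transmission_flow L\<^sub>1 L\<^sub>2 L\<^sub>3 a b m k \<tau> T
    using assms by unfold_locales
  show ?thesis by (rule exponential_decay)
qed

end
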